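(* Let $p$ be an odd prime. Any two clusters $\mathcal{L},\mathcal{L}'$ in $\mathcal{C}_\pi^{\mathbb{Z}/p}$ are equivalent in the sense that there is a strictly triangulated automorphism of $\mathcal{C}_\pi^{\mathbb{Z}/p}$, induced by a homeomorphism of the circle, which takes $\mathcal{L}$ to $\mathcal{L}'$.
   Context: **The category.** $p$ is an odd prime, $\theta=2\pi/p$. $R$ is a discrete valuation ring with uniformizer $u$ and residue field $K=R/(u)$ of characteristic $\neq p$, containing all $p$-th roots of unity. Let $\tilde{\mathcal{X}}_\pi=\{(x,y,\epsilon)\in\mathbb{R}\times\mathbb{R}\times\{+,-\}: |x-y|\le \pi\}$, with $(x,y,\epsilon)\le(x',y',\epsilon')$ iff $x\le x'$ and $y\le y'$, and automorphism $\sigma(x,y,\epsilon)=(y+\pi,x+\pi,-\epsilon)$. Let $\mathcal{X}_\pi$ be the set of $\sigma$-orbits, $M(x,y)$ the orbit of $(x,y,+)$ (the orbit of $(x,y,-)$ is $M(y+\pi,x+\pi)$), and $E(x,y)=M(x,y-\pi)$ for $x\le y\le x+2\pi$; $E(x,y)\cong E(y,x+2\pi)$. For $X,Y,Z\in\mathcal{X}_\pi$ with representatives $\tilde X,\tilde Y,\tilde Z$ put $c(X,Y,Z)=i+j-k$ where $i,j,k$ are the minimal integers with $\tilde X\le\sigma^i\tilde Y$, $\tilde Y\le\sigma^j\tilde Z$, $\tilde X\le\sigma^k\tilde Z$. Let $\mathcal{F}_\pi$ be the additive $R$-category of finite direct sums of elements of $\mathcal{X}_\pi$, where $\mathrm{Hom}(X,Y)=Rf_{XY}$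 is free of rank one for $X,Y\in\mathcal{X}_\pi$ ($f_{XY}$ basic morphism), $f_{XX}=\mathrm{id}$, $f_{YZ}f_{XY}=u^{c(X,Y,Z)}f_{XZ}$. It has a unique exact structure making it a Frobenius category with indecomposable projective-injectives the $M(x,y)$ with $|x-y|=\pi$. The generator $\gamma$ of $G=\mathbb{Z}/p$ acts $R$-linearly by rotation: $\gamma M(x,y)=M(x+\theta,y+\theta)$, $\gamma f_{XY}=f_{\gamma X,\gamma Y}$. $\mathcal{F}_\pi^{\mathbb{Z}/p}$ has objects $(X,\xi)$ with isomorphisms $\xi_g:gX\to X$ ($g\in G$), $\xi_{gh}=\xi_g\circ g\xi_h$; morphisms $f:X\to Y$ with $f\xi^X_g=\xi^Y_g\,gf$; exact sequences those exact in $\mathcal{F}_\pi$. It is a Frobenius category and $\mathcal{C}_\pi^{\mathbb{Z}/p}$ is its stable category, triangulated with shift $[1]$, chosen so that $E(x,y)[1]=E(y,x+2\pi)$ and $(SX)[1]=S(X[1])$, where $SX=(\bigoplus_{g\in G}gX,\xi)$ with $\xi_h$ permuting summands by identity maps $h(gX)\to(hg)X$. All indecomposables are isomorphic to objects $SX$, $X\in\mathcal{X}_\pi$; write $SE(x,y)=S(E(x,y))$. **Clusters.** An indecomposable object of $\mathcal{C}_\pi^{\mathbb{Z}/p}$ is rigid if its endomorphism ring is $K$; equivalently, it is isomorphic to $SE(x,y)$ with $x<y<x+\theta$. It is almost rigid if it is a limit of a sequence of rigid objects; equivalently, it is isomorphic to $SE(x,y)$ with $x<y\le x+\theta$. Convergence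 $Y_n\to Y$ means convergence of endpoints: $Y_n\cong SE(x_n,y_n)$, $Y\cong SE(x,y)$ with $x_n\to x$, $y_n\to y$. Almost rigid objects $X,Y$ are compatible if there is a sequence $Y_n\to Y$ with $\mathcal{C}_\pi^{\mathbb{Z}/p}(X,Y_n)=0$ for all $n$. A cluster is a discrete maximal set of pairwise compatible (nonisomorphic) almost rigid objects, where discreteness refers to the topology on isomorphism classes of almost rigid objects given by $\{(x,y): x<y\le x+\theta\}$ modulo $(x,y)\sim(x+\theta,y+\theta)$. A strictly triangulated automorphism is an additive automorphism commuting strictly with $[1]$ and taking distinguished triangles to distinguished triangles. It is induced by a homeomorphism $g$ of the circle (lifted to $\mathbb{R}$, commuting with the $\mathbb{Z}/p$-rotations) if it is given by $E(x,y)\mapsto E(g(x),g(y))$ and basic morphisms $\mapsto$ basic morphisms. Taking $\mathcal{L}$ to $\mathcal{L}'$ is meant up to isomorphism of objects. *)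

theory Defs
  imports "HOL-Analysis.Analysis" "HOL-Computational_Algebra.Computational_Algebra"
begin

section \<open>Preadditive categories and exact structures\<close>

record ('o, 'm) addcat =
  obs :: "'o set"
  mors :: "'m set"
  src :: "'m \<Rightarrow> 'o"
  tgt :: "'m \<Rightarrow> 'o"
  idn :: "'o \<Rightarrow> 'm"
  cmp :: "'m \<Rightarrow> 'm \<Rightarrow> 'm"
  pls :: "'m \<Rightarrow> 'm \<Rightarrow> 'm"
  zro :: "'o \<Rightarrow> 'o \<Rightarrow> 'm"

definition hom :: "('o, 'm) addcat \<Rightarrow> 'o \<Rightarrow> 'o \<Rightarrow> 'm set" where
  "hom C A B = {f \<in> mors C. src C f = A \<and> tgt C f = B}"

definition is_iso :: "('o, 'm) addcat \<Rightarrow> 'm \<Rightarrow> bool" where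
  "is_iso C f \<longleftrightarrow> f \<in> mors C \<and>
     (\<exists>g\<in>hom C (tgt C f) (src C f).
        cmp C g f = idn C (src C f) \<and> cmp C f g = idn C (tgt C f))"

definition isomorphic :: "('o, 'm) addcat \<Rightarrow> 'o \<Rightarrow> 'o \<Rightarrow> bool" where
  "isomorphic C A B \<longleftrightarrow> (\<exists>f\<in>hom C A B. is_iso C f)"

definition iso_class :: "('o, 'm) addcat \<Rightarrow> 'o \<Rightarrow> 'o set" where
  "iso_class C A = {B \<in> obs C. isomorphic C A B}"

definition zero_object :: "('o, 'm) addcat \<Rightarrow> 'o \<Rightarrow> bool" where
  "zero_object C A \<longleftrightarrow> A \<in> obs C \<and> idn C A = zro C A A"

definition direct_sum :: "('o, 'm) addcat \<Rightarrow> 'o \<Rightarrow> 'o \<Rightarrow> 'o \<Rightarrow> bool" where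
  "direct_sum C A B S \<longleftrightarrow> A \<in> obs C \<and> B \<in> obs C \<and> S \<in> obs C \<and>
     (\<exists>i\<in>hom C A S. \<exists>j\<in>hom C B S. \<exists>r\<in>hom C S A. \<exists>s\<in>hom C S B.
        cmp C r i = idn C A \<and> cmp C s j = idn C B \<and>
        cmp C r j = zro C B A \<and> cmp C s i = zro C A B \<and>
        pls C (cmp C i r) (cmp C j s) = idn C S)"

definition indecomposable :: "('o, 'm) addcat \<Rightarrow> 'o \<Rightarrow> bool" where
  "indecomposable C A \<longleftrightarrow> A \<in> obs C \<and> \<not> zero_object C A \<and>
     (\<forall>B D. direct_sum C B D A \<longrightarrow> zero_object C B \<or> zero_object C D)"

definition is_kernel :: "('o, 'm) addcat \<Rightarrow> 'm \<Rightarrow> 'm \<Rightarrow> bool" where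
  "is_kernel C i q \<longleftrightarrow> i \<in> mors C \<and> q \<in> mors C \<and> tgt C i = src C q \<and>
     cmp C q i = zro C (src C i) (tgt C q) \<and>
     (\<forall>f\<in>mors C. tgt C f = src C q \<and> cmp C q f = zro C (src C f) (tgt C q) \<longrightarrow>
        (\<exists>!h. h \<in> hom C (src C f) (src C i) \<and> cmp C i h = f))"

definition is_cokernel :: "('o, 'm) addcat \<Rightarrow> 'm \<Rightarrow> 'm \<Rightarrow> bool" where
  "is_cokernel C i q \<longleftrightarrow> i \<in> mors C \<and> q \<in> mors C \<and> tgt C i = src C q \<and>
     cmp C q i = zro C (src C i) (tgt C q) \<and>
     (\<forall>f\<in>mors C. src C f = tgt C i \<and> cmp C f i = zro C (src C i) (tgt C f) \<longrightarrow>
        (\<exists>!h. h \<in> hom C (tgt C q) (tgt C f) \<and> cmp C h q = f))"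

definition is_pushout :: "('o, 'm) addcat \<Rightarrow> 'm \<Rightarrow> 'm \<Rightarrow> 'm \<Rightarrow> 'm \<Rightarrow> bool" where
  "is_pushout C i f f' i' \<longleftrightarrow>
     i \<in> mors C \<and> f \<in> mors C \<and> f' \<in> mors C \<and> i' \<in> mors C \<and>
     src C i = src C f \<and> src C f' = tgt C i \<and> src C i' = tgt C f \<and> tgt C f' = tgt C i' \<and>
     cmp C f' i = cmp C i' f \<and>
     (\<forall>a\<in>mors C. \<forall>b\<in>mors C.
        src C a = tgt C i \<and> src C b = tgt C f \<and> tgt C a = tgt C b \<and> cmp C a i = cmp C b f \<longrightarrow>
        (\<exists>!h. h \<in> hom C (tgt C i') (tgt C a) \<and> cmp C h f' = a \<and> cmp C h i' = b))"

definition is_pullback :: "('o, 'm) addcat \<Rightarrow> 'm \<Rightarrow> 'm \<Rightarrow> 'm \<Rightarrow> 'm \<Rightarrow> bool" where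
  "is_pullback C q f f' q' \<longleftrightarrow>
     q \<in> mors C \<and> f \<in> mors C \<and> f' \<in> mors C \<and> q' \<in> mors C \<and>
     tgt C q = tgt C f \<and> tgt C f' = src C q \<and> tgt C q' = src C f \<and> src C f' = src C q' \<and>
     cmp C q f' = cmp C f q' \<and>
     (\<forall>a\<in>mors C. \<forall>b\<in>mors C.
        tgt C a = src C q \<and> tgt C b = src C f \<and> src C a = src C b \<and> cmp C q a = cmp C f b \<longrightarrow>
        (\<exists>!h. h \<in> hom C (src C a) (src C q') \<and> cmp C f' h = a \<and> cmp C q' h = b))"

text \<open>An exact structure is given by its class of conflations (i, q).\<close>

definition adm_mono :: "('m \<times> 'm) set \<Rightarrow> 'm \<Rightarrow> bool" where
  "adm_mono CF i \<longleftrightarrow> (\<exists>q. (i, q) \<in> CF)"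

definition adm_epi :: "('m \<times> 'm) set \<Rightarrow> 'm \<Rightarrow> bool" where
  "adm_epi CF q \<longleftrightarrow> (\<exists>i. (i, q) \<in> CF)"

definition exact_structure :: "('o, 'm) addcat \<Rightarrow> ('m \<times> 'm) set \<Rightarrow> bool" where
  "exact_structure C CF \<longleftrightarrow>
     (\<forall>(i, q)\<in>CF. is_kernel C i q \<and> is_cokernel C i q) \<and>
     (\<forall>(i, q)\<in>CF. \<forall>i'\<in>mors C. \<forall>q'\<in>mors C. \<forall>a b c.
        is_iso C a \<and> is_iso C b \<and> is_iso C c \<and> tgt C i' = src C q' \<and>
        a \<in> hom C (src C i) (src C i') \<and> b \<in> hom C (tgt C i) (tgt C i') \<and>
        c \<in> hom C (tgt C q) (tgt C q') \<and>
        cmp C i' a = cmp C b i \<and> cmp C q' b = cmp C c q \<longrightarrow> (i', q') \<in> CF) \<and>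
     (\<forall>A\<in>obs C. adm_mono CF (idn C A) \<and> adm_epi CF (idn C A)) \<and>
     (\<forall>i j. adm_mono CF i \<and> adm_mono CF j \<and> tgt C i = src C j \<longrightarrow> adm_mono CF (cmp C j i)) \<and>
     (\<forall>q r. adm_epi CF q \<and> adm_epi CF r \<and> tgt C q = src C r \<longrightarrow> adm_epi CF (cmp C r q)) \<and>
     (\<forall>i. \<forall>f\<in>mors C. adm_mono CF i \<and> src C f = src C i \<longrightarrow>
        (\<exists>f' i'. is_pushout C i f f' i' \<and> adm_mono CF i')) \<and>
     (\<forall>q. \<forall>f\<in>mors C. adm_epi CF q \<and> tgt C f = tgt C q \<longrightarrow>
        (\<exists>f' q'. is_pullback C q f f' q' \<and> adm_epi CF q'))"

definition projective :: "('o, 'm) addcat \<Rightarrow> ('m \<times> 'm) set \<Rightarrow> 'o \<Rightarrow> bool" where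
  "projective C CF P \<longleftrightarrow> P \<in> obs C \<and>
     (\<forall>(i, q)\<in>CF. \<forall>f\<in>hom C P (tgt C q). \<exists>h\<in>hom C P (src C q). cmp C q h = f)"

definition injective :: "('o, 'm) addcat \<Rightarrow> ('m \<times> 'm) set \<Rightarrow> 'o \<Rightarrow> bool" where
  "injective C CF I \<longleftrightarrow> I \<in> obs C \<and>
     (\<forall>(i, q)\<in>CF. \<forall>f\<in>hom C (src C i) I. \<exists>h\<in>hom C (tgt C i) I. cmp C h i = f)"

definition projinj :: "('o, 'm) addcat \<Rightarrow> ('m \<times> 'm) set \<Rightarrow> 'o \<Rightarrow> bool" where
  "projinj C CF P \<longleftrightarrow> projective C CF P \<and> injective C CF P"

definition frobenius :: "('o, 'm) addcat \<Rightarrow> ('m \<times> 'm) set \<Rightarrow> bool" where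
  "frobenius C CF \<longleftrightarrow> exact_structure C CF \<and>
     (\<forall>A\<in>obs C. \<exists>(i, q)\<in>CF. tgt C q = A \<and> projective C CF (src C q)) \<and>
     (\<forall>A\<in>obs C. \<exists>(i, q)\<in>CF. src C i = A \<and> injective C CF (tgt C i)) \<and>
     (\<forall>A\<in>obs C. projective C CF A \<longleftrightarrow> injective C CF A)"


section \<open>Stable categories and their triangulation\<close>

datatype ('o, 'c) arr = Arr (asrc: 'o) (atgt: 'o) (coef: 'c)

definition stably_zero :: "('o, 'm) addcat \<Rightarrow> ('m \<times> 'm) set \<Rightarrow> 'm \<Rightarrow> bool" where
  "stably_zero C CF f \<longleftrightarrow> f \<in> mors C \<and>
     (\<exists>P. projinj C CF P \<and> (\<exists>a\<in>hom C (src C f) P. \<exists>b\<in>hom C P (tgt C f). f = cmp C b a))"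

definition stab_cls :: "('o, 'm) addcat \<Rightarrow> ('m \<times> 'm) set \<Rightarrow> 'm \<Rightarrow> ('o, 'm set) arr" where
  "stab_cls C CF f = Arr (src C f) (tgt C f)
     {f' \<in> hom C (src C f) (tgt C f).
        \<exists>h\<in>hom C (src C f) (tgt C f). stably_zero C CF h \<and> f' = pls C f h}"

definition stable_cat ::
    "('o, 'm) addcat \<Rightarrow> ('m \<times> 'm) set \<Rightarrow> ('o, ('o, 'm set) arr) addcat" where
  "stable_cat C CF = \<lparr>
     obs = obs C,
     mors = stab_cls C CF ` mors C,
     src = asrc,
     tgt = atgt,
     idn = (\<lambda>A. stab_cls C CF (idn C A)),
     cmp = (\<lambda>\<psi> \<phi>. Arr (asrc \<phi>) (atgt \<psi>)
              (\<Union>g\<in>coef \<psi>. \<Union>f\<in>coef \<phi>. coef (stab_cls C CF (cmp C g f)))),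
     pls = (\<lambda>\<psi> \<phi>. Arr (asrc \<phi>) (atgt \<phi>)
              (\<Union>g\<in>coef \<psi>. \<Union>f\<in>coef \<phi>. coef (stab_cls C CF (pls C g f)))),
     zro = (\<lambda>A B. stab_cls C CF (zro C A B))\<rparr>"

text \<open>
  A suspension chooses for every object A a conflation A \<rightarrow> I(A) \<rightarrow> A[1] with
  I(A) injective.  The shift functor depends on this choice, and commuting strictly with the
  shift is a condition relative to it.
\<close>

record ('o, 'm) susp =
  inj_hull :: "'o \<Rightarrow> 'o"
  sus :: "'o \<Rightarrow> 'o"
  inc :: "'o \<Rightarrow> 'm"
  prj :: "'o \<Rightarrow> 'm"

definition suspension ::
    "('o, 'm) addcat \<Rightarrow> ('m \<times> 'm) set \<Rightarrow> ('o, 'm) susp \<Rightarrow> bool" where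
  "suspension C CF T \<longleftrightarrow> (\<forall>A\<in>obs C.
     injective C CF (inj_hull T A) \<and> sus T A \<in> obs C \<and>
     inc T A \<in> hom C A (inj_hull T A) \<and> prj T A \<in> hom C (inj_hull T A) (sus T A) \<and>
     (inc T A, prj T A) \<in> CF)"

text \<open>
  The class of f[1] consists of all maps h that complete f to a map of the chosen conflations.
\<close>

definition shift_mor ::
    "('o, 'm) addcat \<Rightarrow> ('m \<times> 'm) set \<Rightarrow> ('o, 'm) susp \<Rightarrow> ('o, 'm set) arr \<Rightarrow> ('o, 'm set) arr"
  where
  "shift_mor C CF T \<phi> = (let A = asrc \<phi>; B = atgt \<phi> in Arr (sus T A) (sus T B)
     (\<Union>h \<in> {h \<in> hom C (sus T A) (sus T B).
        \<exists>f\<in>coef \<phi>. \<exists>k\<in>hom C (inj_hull T A) (inj_hull T B).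
          cmp C k (inc T A) = cmp C (inc T B) f \<and> cmp C h (prj T A) = cmp C (prj T B) k}.
        coef (stab_cls C CF h)))"

text \<open>
  Happel's standard triangles.  In the conditions below Y \<rightarrow> Z \<rightarrow> X[1] is a
  conflation and (u, k, id) is a map to it from the chosen conflation of X, so that
  Z is the pushout of X \<rightarrow> I(X) along u.
\<close>

definition standard_triangle ::
    "('o, 'm) addcat \<Rightarrow> ('m \<times> 'm) set \<Rightarrow> ('o, 'm) susp \<Rightarrow>
     ('o, 'm set) arr \<times> ('o, 'm set) arr \<times> ('o, 'm set) arr \<Rightarrow> bool" where
  "standard_triangle C CF T \<Delta> \<longleftrightarrow>
     (\<exists>X\<in>obs C. \<exists>Y\<in>obs C. \<exists>Z\<in>obs C. \<exists>u\<in>hom C X Y. \<exists>v\<in>hom C Y Z.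
      \<exists>w\<in>hom C Z (sus T X). \<exists>k\<in>hom C (inj_hull T X) Z.
        (v, w) \<in> CF \<and> cmp C v u = cmp C k (inc T X) \<and> cmp C w k = prj T X \<and>
        \<Delta> = (stab_cls C CF u, stab_cls C CF v, stab_cls C CF w))"

definition distinguished ::
    "('o, 'm) addcat \<Rightarrow> ('m \<times> 'm) set \<Rightarrow> ('o, 'm) susp \<Rightarrow>
     ('o, 'm set) arr \<times> ('o, 'm set) arr \<times> ('o, 'm set) arr \<Rightarrow> bool" where
  "distinguished C CF T \<Delta> \<longleftrightarrow> (let D = stable_cat C CF; (\<phi>, \<psi>, \<omega>) = \<Delta> in
     \<phi> \<in> mors D \<and> \<psi> \<in> hom D (atgt \<phi>) (atgt \<psi>) \<and> \<omega> \<in> hom D (atgt \<psi>) (sus T (asrc \<phi>)) \<and>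
     (\<exists>\<phi>' \<psi>' \<omega>'. standard_triangle C CF T (\<phi>', \<psi>', \<omega>') \<and>
        (\<exists>a\<in>hom D (asrc \<phi>) (asrc \<phi>'). \<exists>b\<in>hom D (atgt \<phi>) (atgt \<phi>'). \<exists>c\<in>hom D (atgt \<psi>) (atgt \<psi>').
           is_iso D a \<and> is_iso D b \<and> is_iso D c \<and>
           cmp D b \<phi> = cmp D \<phi>' a \<and> cmp D c \<psi> = cmp D \<psi>' b \<and>
           cmp D (shift_mor C CF T a) \<omega> = cmp D \<omega>' c)))"

definition additive_automorphism ::
    "('o, 'm) addcat \<Rightarrow> ('o \<Rightarrow> 'o) \<Rightarrow> ('m \<Rightarrow> 'm) \<Rightarrow> bool" where
  "additive_automorphism D F0 F1 \<longleftrightarrow>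
     bij_betw F0 (obs D) (obs D) \<and> bij_betw F1 (mors D) (mors D) \<and>
     (\<forall>\<phi>\<in>mors D. src D (F1 \<phi>) = F0 (src D \<phi>) \<and> tgt D (F1 \<phi>) = F0 (tgt D \<phi>)) \<and>
     (\<forall>A\<in>obs D. F1 (idn D A) = idn D (F0 A)) \<and>
     (\<forall>\<phi>\<in>mors D. \<forall>\<psi>\<in>mors D. tgt D \<phi> = src D \<psi> \<longrightarrow> F1 (cmp D \<psi> \<phi>) = cmp D (F1 \<psi>) (F1 \<phi>)) \<and>
     (\<forall>\<phi>\<in>mors D. \<forall>\<psi>\<in>mors D. src D \<phi> = src D \<psi> \<and> tgt D \<phi> = tgt D \<psi> \<longrightarrow>
        F1 (pls D \<psi> \<phi>) = pls D (F1 \<psi>) (F1 \<phi>))"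

definition strictly_triangulated_automorphism ::
    "('o, 'm) addcat \<Rightarrow> ('m \<times> 'm) set \<Rightarrow> ('o, 'm) susp \<Rightarrow>
     ('o \<Rightarrow> 'o) \<Rightarrow> (('o, 'm set) arr \<Rightarrow> ('o, 'm set) arr) \<Rightarrow> bool" where
  "strictly_triangulated_automorphism C CF T F0 F1 \<longleftrightarrow>
     additive_automorphism (stable_cat C CF) F0 F1 \<and>
     (\<forall>A\<in>obs C. F0 (sus T A) = sus T (F0 A)) \<and>
     (\<forall>\<phi>\<in>mors (stable_cat C CF). F1 (shift_mor C CF T \<phi>) = shift_mor C CF T (F1 \<phi>)) \<and>
     (\<forall>\<phi> \<psi> \<omega>. distinguished C CF T (\<phi>, \<psi>, \<omega>) \<longrightarrow> distinguished C CF T (F1 \<phi>, F1 \<psi>, F1 \<omega>))"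


section \<open>The coefficient ring\<close>

definition is_ideal :: "'r::comm_ring_1 set \<Rightarrow> bool" where
  "is_ideal I \<longleftrightarrow> 0 \<in> I \<and> (\<forall>a\<in>I. \<forall>b\<in>I. a + b \<in> I) \<and> (\<forall>a\<in>I. \<forall>r. r * a \<in> I)"

text \<open>
  A domain is a discrete valuation ring with uniformizer u iff it is a principal ideal
  domain whose set of nonunits is the nonzero ideal (u).
\<close>

definition dvr_uniformizer :: "'r::idom \<Rightarrow> bool" where
  "dvr_uniformizer u \<longleftrightarrow>
     (\<forall>I :: 'r set. is_ideal I \<longrightarrow> (\<exists>a. I = {x. a dvd x})) \<and>
     u \<noteq> 0 \<and> {x. \<not> x dvd 1} = {x. u dvd x}"

definition residue_map :: "'r::idom \<Rightarrow> ('r \<Rightarrow> 'k::field) \<Rightarrow> bool" where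
  "residue_map u res \<longleftrightarrow> surj res \<and> res 1 = 1 \<and>
     (\<forall>a b. res (a + b) = res a + res b \<and> res (a * b) = res a * res b) \<and>
     (\<forall>a. res a = 0 \<longleftrightarrow> u dvd a)"


section \<open>The continuous Frobenius category\<close>

type_synonym pt = "real \<times> real \<times> bool"

text \<open>The sign + is True.\<close>

definition strip :: "pt set" where
  "strip = {(x, y, e). \<bar>x - y\<bar> \<le> pi}"

definition pt_le :: "pt \<Rightarrow> pt \<Rightarrow> bool" where
  "pt_le s t \<longleftrightarrow> fst s \<le> fst t \<and> fst (snd s) \<le> fst (snd t)"

definition sigma :: "pt \<Rightarrow> pt" where
  "sigma t = (case t of (x, y, e) \<Rightarrow> (y + pi, x + pi, \<not> e))"

definition sigma_pow :: "int \<Rightarrow> pt \<Rightarrow> pt" where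
  "sigma_pow i = (if 0 \<le> i then sigma ^^ nat i else inv sigma ^^ nat (- i))"

definition sigma_orbit :: "pt \<Rightarrow> pt set" where
  "sigma_orbit t = range (\<lambda>i. sigma_pow i t)"

definition Xpi :: "pt set set" where
  "Xpi = sigma_orbit ` strip"

definition Mpt :: "real \<Rightarrow> real \<Rightarrow> pt set" where
  "Mpt x y = sigma_orbit (x, y, True)"

definition Ept :: "real \<Rightarrow> real \<Rightarrow> pt set" where
  "Ept x y = Mpt x (y - pi)"

definition rep :: "pt set \<Rightarrow> pt" where
  "rep X = (SOME t. t \<in> X)"

definition min_deg :: "pt set \<Rightarrow> pt set \<Rightarrow> int" where
  "min_deg X Y = (LEAST i. pt_le (rep X) (sigma_pow i (rep Y)))"

definition cocyc :: "pt set \<Rightarrow> pt set \<Rightarrow> pt set \<Rightarrow> int" where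
  "cocyc X Y Z = min_deg X Y + min_deg Y Z - min_deg X Z"

text \<open>
  A list of points stands for their direct sum.  The coefficient m i j of a morphism
  from X to Y is that of the basic morphism from X ! j to Y ! i; coefficients with indices out
  of range are 0.
\<close>

type_synonym 'r fmor = "(pt set list, nat \<Rightarrow> nat \<Rightarrow> 'r) arr"

definition Fpi :: "'r::idom \<Rightarrow> (pt set list, 'r fmor) addcat" where
  "Fpi u = \<lparr>
     obs = {X. set X \<subseteq> Xpi},
     mors = {Arr X Y m | X Y m. set X \<subseteq> Xpi \<and> set Y \<subseteq> Xpi \<and>
               (\<forall>i j. \<not> (i < length Y \<and> j < length X) \<longrightarrow> m i j = 0)},
     src = asrc,
     tgt = atgt,
     idn = (\<lambda>X. Arr X X (\<lambda>i j. if i = j \<and> i < length X then 1 else 0)),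
     cmp = (\<lambda>g f. Arr (asrc f) (atgt g)
              (\<lambda>i k. if i < length (atgt g) \<and> k < length (asrc f)
                then \<Sum>j<length (atgt f). coef g i j * coef f j k *
                   u ^ nat (cocyc (asrc f ! k) (atgt f ! j) (atgt g ! i))
                else 0)),
     pls = (\<lambda>g f. Arr (asrc f) (atgt f) (\<lambda>i j. coef g i j + coef f i j)),
     zro = (\<lambda>X Y. Arr X Y (\<lambda>i j. 0))\<rparr>"

text \<open>
  The category has exactly one exact structure with the following property, so that fixing
  a class CF with this property fixes the exact structure.
\<close>

definition Fpi_frobenius :: "'r::idom \<Rightarrow> ('r fmor \<times> 'r fmor) set \<Rightarrow> bool" where
  "Fpi_frobenius u CF \<longleftrightarrow> frobenius (Fpi u) CF \<and>
     (\<forall>P\<in>obs (Fpi u). indecomposable (Fpi u) P \<and> projinj (Fpi u) CF P \<longleftrightarrow>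
        (\<exists>x y. \<bar>x - y\<bar> = pi \<and> isomorphic (Fpi u) P [Mpt x y]))"

text \<open>
  The action on morphisms of a map of points that takes basic morphisms to basic morphisms.
\<close>

definition push_mor :: "(pt set \<Rightarrow> pt set) \<Rightarrow> 'r fmor \<Rightarrow> 'r fmor" where
  "push_mor h f = Arr (map h (asrc f)) (map h (atgt f)) (coef f)"


section \<open>Equivariant objects\<close>

definition theta :: "nat \<Rightarrow> real" where
  "theta p = 2 * pi / real p"

definition rot :: "nat \<Rightarrow> nat \<Rightarrow> pt set \<Rightarrow> pt set" where
  "rot p k X = (\<lambda>(x, y, e). (x + real k * theta p, y + real k * theta p, e)) ` X"

text \<open>
  Elements of the cyclic group are represented by the exponents 0, \<dots>, p - 1 of its generator.
\<close>

type_synonym 'r gob = "pt set list \<times> (nat \<Rightarrow> 'r fmor)"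
type_synonym 'r gmor = "('r gob, nat \<Rightarrow> nat \<Rightarrow> 'r) arr"

definition gobs :: "'r::idom \<Rightarrow> nat \<Rightarrow> 'r gob set" where
  "gobs u p = {(X, \<xi>). X \<in> obs (Fpi u) \<and> \<xi> \<in> extensional {..<p} \<and>
     (\<forall>g<p. \<xi> g \<in> hom (Fpi u) (map (rot p g) X) X \<and> is_iso (Fpi u) (\<xi> g)) \<and>
     (\<forall>g<p. \<forall>h<p. \<xi> ((g + h) mod p) = cmp (Fpi u) (\<xi> g) (push_mor (rot p g) (\<xi> h)))}"

definition und :: "'r gmor \<Rightarrow> 'r fmor" where
  "und f = Arr (fst (asrc f)) (fst (atgt f)) (coef f)"

definition lift_mor :: "'r gob \<Rightarrow> 'r gob \<Rightarrow> 'r fmor \<Rightarrow> 'r gmor" where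
  "lift_mor A B f = Arr A B (coef f)"

definition FpiG :: "'r::idom \<Rightarrow> nat \<Rightarrow> ('r gob, 'r gmor) addcat" where
  "FpiG u p = \<lparr>
     obs = gobs u p,
     mors = {f. asrc f \<in> gobs u p \<and> atgt f \<in> gobs u p \<and> und f \<in> mors (Fpi u) \<and>
               (\<forall>g<p. cmp (Fpi u) (und f) (snd (asrc f) g) =
                       cmp (Fpi u) (snd (atgt f) g) (push_mor (rot p g) (und f)))},
     src = asrc,
     tgt = atgt,
     idn = (\<lambda>A. lift_mor A A (idn (Fpi u) (fst A))),
     cmp = (\<lambda>g f. lift_mor (asrc f) (atgt g) (cmp (Fpi u) (und g) (und f))),
     pls = (\<lambda>g f. lift_mor (asrc f) (atgt f) (pls (Fpi u) (und g) (und f))),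
     zro = (\<lambda>A B. lift_mor A B (zro (Fpi u) (fst A) (fst B)))\<rparr>"

definition conflG :: "'r::idom \<Rightarrow> nat \<Rightarrow> ('r fmor \<times> 'r fmor) set \<Rightarrow> ('r gmor \<times> 'r gmor) set" where
  "conflG u p CF = {(i, q). i \<in> mors (FpiG u p) \<and> q \<in> mors (FpiG u p) \<and>
     atgt i = asrc q \<and> (und i, und q) \<in> CF}"

definition CpiG ::
    "'r::idom \<Rightarrow> nat \<Rightarrow> ('r fmor \<times> 'r fmor) set \<Rightarrow> ('r gob, ('r gob, 'r gmor set) arr) addcat" where
  "CpiG u p CF = stable_cat (FpiG u p) (conflG u p CF)"

text \<open>
  With n = length X, the index g * n + a of the list underlying S X belongs to the summand a
  of the rotation of X by the g-th power of the generator.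
\<close>

definition Sob :: "nat \<Rightarrow> pt set list \<Rightarrow> 'r::idom gob" where
  "Sob p X = (let n = length X; GX = concat (map (\<lambda>g. map (rot p g) X) [0..<p]) in
     (GX, \<lambda>h\<in>{..<p}. Arr (map (rot p h) GX) GX
        (\<lambda>i j. if j < p * n \<and> i = ((h + j div n) mod p) * n + j mod n then 1 else 0)))"

definition SE :: "nat \<Rightarrow> real \<Rightarrow> real \<Rightarrow> 'r::idom gob" where
  "SE p x y = Sob p [Ept x y]"

text \<open>(S X)[1] = S (X[1]) for X a direct sum of objects E(x,y), where E(x,y)[1] = E(y,x+2 pi).\<close>

definition normalized :: "nat \<Rightarrow> ('r::idom gob, 'r gmor) susp \<Rightarrow> bool" where
  "normalized p T \<longleftrightarrow> (\<forall>zs. (\<forall>(x, y)\<in>set zs. x \<le> y \<and> y \<le> x + 2 * pi) \<longrightarrow>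
     sus T (Sob p (map (\<lambda>(x, y). Ept x y) zs)) = Sob p (map (\<lambda>(x, y). Ept y (x + 2 * pi)) zs))"


section \<open>Clusters\<close>

definition rigid ::
    "'k::field itself \<Rightarrow> 'r::idom \<Rightarrow> nat \<Rightarrow> ('r fmor \<times> 'r fmor) set \<Rightarrow> 'r gob \<Rightarrow> bool" where
  "rigid K u p CF A \<longleftrightarrow> (let D = CpiG u p CF in indecomposable D A \<and>
     (\<exists>\<Phi> :: 'k \<Rightarrow> _. bij_betw \<Phi> UNIV (hom D A A) \<and> \<Phi> 1 = idn D A \<and>
        (\<forall>a b. \<Phi> (a + b) = pls D (\<Phi> a) (\<Phi> b) \<and> \<Phi> (a * b) = cmp D (\<Phi> a) (\<Phi> b))))"

definition converges ::
    "'r::idom \<Rightarrow> nat \<Rightarrow> ('r fmor \<times> 'r fmor) set \<Rightarrow> (nat \<Rightarrow> 'r gob) \<Rightarrow> 'r gob \<Rightarrow> bool" where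
  "converges u p CF Ys Y \<longleftrightarrow> (\<exists>xs ys x y.
     (\<forall>n. xs n \<le> ys n \<and> ys n \<le> xs n + 2 * pi \<and> isomorphic (CpiG u p CF) (Ys n) (SE p (xs n) (ys n))) \<and>
     x \<le> y \<and> y \<le> x + 2 * pi \<and> isomorphic (CpiG u p CF) Y (SE p x y) \<and>
     xs \<longlonglongrightarrow> x \<and> ys \<longlonglongrightarrow> y)"

definition almost_rigid ::
    "'k::field itself \<Rightarrow> 'r::idom \<Rightarrow> nat \<Rightarrow> ('r fmor \<times> 'r fmor) set \<Rightarrow> 'r gob \<Rightarrow> bool" where
  "almost_rigid K u p CF A \<longleftrightarrow> indecomposable (CpiG u p CF) A \<and>
     (\<exists>Ys. (\<forall>n. rigid K u p CF (Ys n)) \<and> converges u p CF Ys A)"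

definition compatible ::
    "'r::idom \<Rightarrow> nat \<Rightarrow> ('r fmor \<times> 'r fmor) set \<Rightarrow> 'r gob \<Rightarrow> 'r gob \<Rightarrow> bool" where
  "compatible u p CF X Y \<longleftrightarrow> (\<exists>Ys. converges u p CF Ys Y \<and>
     (\<forall>n. hom (CpiG u p CF) X (Ys n) = {zro (CpiG u p CF) X (Ys n)}))"

definition ar_domain :: "nat \<Rightarrow> (real \<times> real) set" where
  "ar_domain p = {(x, y). x < y \<and> y \<le> x + theta p}"

definition ar_class ::
    "'r::idom \<Rightarrow> nat \<Rightarrow> ('r fmor \<times> 'r fmor) set \<Rightarrow> real \<times> real \<Rightarrow> 'r gob set" where
  "ar_class u p CF d = iso_class (CpiG u p CF) (SE p (fst d) (snd d))"

text \<open>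
  Two points of the domain have the same class iff they differ by a multiple of
  (theta, theta), so this is the quotient topology.
\<close>

definition ar_topology ::
    "'r::idom \<Rightarrow> nat \<Rightarrow> ('r fmor \<times> 'r fmor) set \<Rightarrow> 'r gob set topology" where
  "ar_topology u p CF = topology (\<lambda>U. U \<subseteq> ar_class u p CF ` ar_domain p \<and>
     openin (top_of_set (ar_domain p)) {d \<in> ar_domain p. ar_class u p CF d \<in> U})"

definition compatible_family ::
    "'k::field itself \<Rightarrow> 'r::idom \<Rightarrow> nat \<Rightarrow> ('r fmor \<times> 'r fmor) set \<Rightarrow> 'r gob set \<Rightarrow> bool" where
  "compatible_family K u p CF L \<longleftrightarrow> (\<forall>A\<in>L. almost_rigid K u p CF A) \<and>
     pairwise (\<lambda>A B. compatible u p CF A B \<and> \<not> isomorphic (CpiG u p CF) A B) L"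

definition cluster ::
    "'k::field itself \<Rightarrow> 'r::idom \<Rightarrow> nat \<Rightarrow> ('r fmor \<times> 'r fmor) set \<Rightarrow> 'r gob set \<Rightarrow> bool" where
  "cluster K u p CF L \<longleftrightarrow> compatible_family K u p CF L \<and>
     (\<forall>M. compatible_family K u p CF M \<and> L \<subseteq> M \<longrightarrow> M = L) \<and>
     subtopology (ar_topology u p CF) (iso_class (CpiG u p CF) ` L) =
       discrete_topology (iso_class (CpiG u p CF) ` L)"


section \<open>Automorphisms induced by homeomorphisms of the circle\<close>

text \<open>
  Commuting with the translation by theta forces a homeomorphism of the line to be increasing
  and to commute with the translation by 2 pi.
\<close>

definition circle_homeo_lift :: "nat \<Rightarrow> (real \<Rightarrow> real) \<Rightarrow> bool" where
  "circle_homeo_lift p g \<longleftrightarrow> (\<exists>g'. homeomorphism UNIV UNIV g g') \<and>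
     (\<forall>x. g (x + theta p) = g x + theta p)"

definition induced_by ::
    "'r::idom \<Rightarrow> nat \<Rightarrow> ('r fmor \<times> 'r fmor) set \<Rightarrow> (real \<Rightarrow> real) \<Rightarrow>
     ('r gob \<Rightarrow> 'r gob) \<Rightarrow> (('r gob, 'r gmor set) arr \<Rightarrow> ('r gob, 'r gmor set) arr) \<Rightarrow> bool" where
  "induced_by u p CF g F0 F1 \<longleftrightarrow> (\<exists>h.
     (\<forall>x y. x \<le> y \<and> y \<le> x + 2 * pi \<longrightarrow> h (Ept x y) = Ept (g x) (g y)) \<and>
     (\<forall>(X, \<xi>)\<in>gobs u p. F0 (X, \<xi>) = (map h X, \<lambda>k\<in>{..<p}. push_mor h (\<xi> k))) \<and>
     (\<forall>f\<in>mors (FpiG u p). F1 (stab_cls (FpiG u p) (conflG u p CF) f) =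
        stab_cls (FpiG u p) (conflG u p CF)
          (lift_mor (F0 (asrc f)) (F0 (atgt f)) (push_mor h (und f)))))"

end

theory Submission
  imports Defs
begin

text \<open>
  Up to rotation by theta a cluster is a maximal set of pairwise noncrossing arcs of a circle of
  circumference theta: nonzero stable maps SE(x,y) \<rightarrow> SE(a,b) correspond to interleavings of the
  endpoints, so that compatibility (a condition on limits) means that no translates cross strictly.
  Such a set, being discrete, contains a loop, and every arc of it is cut by a unique point into two
  arcs of the set; it is thus a binary tree of arcs whose endpoints are dense.  The tree isomorphism
  between two clusters is an order isomorphism of dense sets of endpoints and extends to a
  homeomorphism of the circle.  Such a homeomorphism acts strictly on everything once the
  suspension is built from canonical hulls.
\<close>

section \<open>Preadditive and exact categories\<close>

text \<open>The automorphism has to commute with the shift on the nose, on every equivariant object,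
  for a suspension chosen before the clusters. So hulls, their maps and the structure maps of
  cokernels are formulas in the points and in exponents of u; a homeomorphism preserves the order of
  endpoints, hence the exponents, hence the formulas. The exact structure is known only through
  axioms, so conflations have to be recognized: the explicit hull sequence is compared with some
  embedding into an injective, and every conflation is a pullback of a hull sequence, which shows
  that homeomorphisms preserve exactness. Equivariance is reached by averaging over the group,
  possible since p is invertible in R. Oddness of p keeps E(x,y) from being isomorphic to a
  nontrivial rotation of itself through the flip E(x,y) \<cong> E(y,x+2 pi). Since 3 theta \<le> 2
  pi, the flip of an arc of length at most theta is longer than theta, so such an arc is determined
  by its object up to translation.\<close>

locale preadditive =
  fixes C :: "('o, 'm) addcat"
  assumes hom_obs: "f \<in> hom C A B \<Longrightarrow> A \<in> obs C \<and> B \<in> obs C"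
    and id_hom [intro, simp]: "A \<in> obs C \<Longrightarrow> idn C A \<in> hom C A A"
    and comp_hom [intro]: "f \<in> hom C A B \<Longrightarrow> g \<in> hom C B D \<Longrightarrow> cmp C g f \<in> hom C A D"
    and comp_assoc: "f \<in> hom C A B \<Longrightarrow> g \<in> hom C B D \<Longrightarrow> h \<in> hom C D E \<Longrightarrow>
      cmp C h (cmp C g f) = cmp C (cmp C h g) f"
    and id_left: "f \<in> hom C A B \<Longrightarrow> cmp C (idn C B) f = f"
    and id_right: "f \<in> hom C A B \<Longrightarrow> cmp C f (idn C A) = f"
    and plus_hom [intro]: "f \<in> hom C A B \<Longrightarrow> g \<in> hom C A B \<Longrightarrow> pls C f g \<in> hom C A B"
    and plus_assoc: "f \<in> hom C A B \<Longrightarrow> g \<in> hom C A B \<Longrightarrow> h \<in> hom C A B \<Longrightarrow>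
      pls C (pls C f g) h = pls C f (pls C g h)"
    and plus_comm: "f \<in> hom C A B \<Longrightarrow> g \<in> hom C A B \<Longrightarrow> pls C f g = pls C g f"
    and zero_hom [intro]: "A \<in> obs C \<Longrightarrow> B \<in> obs C \<Longrightarrow> zro C A B \<in> hom C A B"
    and plus_zero: "f \<in> hom C A B \<Longrightarrow> pls C f (zro C A B) = f"
    and neg_ex: "f \<in> hom C A B \<Longrightarrow> \<exists>g\<in>hom C A B. pls C f g = zro C A B"
    and distl: "f \<in> hom C A B \<Longrightarrow> f' \<in> hom C A B \<Longrightarrow> g \<in> hom C B D \<Longrightarrow>
      cmp C g (pls C f f') = pls C (cmp C g f) (cmp C g f')"
    and distr: "f \<in> hom C A B \<Longrightarrow> g \<in> hom C B D \<Longrightarrow> g' \<in> hom C B D \<Longrightarrow>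
      cmp C (pls C g g') f = pls C (cmp C g f) (cmp C g' f)"
begin

abbreviation comp_syntax (infixl "\<cdot>" 70) where "g \<cdot> f \<equiv> cmp C g f"
abbreviation plus_syntax (infixl "\<oplus>" 65) where "g \<oplus> f \<equiv> pls C g f"
abbreviation "\<I> \<equiv> idn C"
abbreviation "\<O> \<equiv> zro C"

definition neg :: "'m \<Rightarrow> 'm" where
  "neg f = (SOME g. g \<in> hom C (src C f) (tgt C f) \<and> f \<oplus> g = \<O> (src C f) (tgt C f))"

lemma homD: "f \<in> hom C A B \<Longrightarrow> f \<in> mors C \<and> src C f = A \<and> tgt C f = B"
  by (simp add: hom_def)

lemma mors_hom: "f \<in> mors C \<Longrightarrow> f \<in> hom C (src C f) (tgt C f)"
  by (simp add: hom_def)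

lemma hom_obs1: "f \<in> hom C A B \<Longrightarrow> A \<in> obs C" and hom_obs2: "f \<in> hom C A B \<Longrightarrow> B \<in> obs C"
  using hom_obs by blast+

lemma neg: assumes "f \<in> hom C A B"
  shows neg_hom [intro]: "neg f \<in> hom C A B" and plus_neg: "f \<oplus> neg f = \<O> A B"
proof -
  have "\<exists>g. g \<in> hom C (src C f) (tgt C f) \<and> f \<oplus> g = \<O> (src C f) (tgt C f)"
    using neg_ex[OF assms] homD[OF assms] by auto
  from someI_ex[OF this] show "neg f \<in> hom C A B" "f \<oplus> neg f = \<O> A B"
    unfolding neg_def using homD[OF assms] by auto
qed

lemma plus_cancel:
  assumes "f \<in> hom C A B" "g \<in> hom C A B" "h \<in> hom C A B" "f \<oplus> g = f \<oplus> h"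
  shows "g = h"
proof -
  have "g = \<O> A B \<oplus> g"
    using plus_zero plus_comm assms(2) zero_hom hom_obs by metis
  also have "\<dots> = (neg f \<oplus> f) \<oplus> g" using plus_neg[OF assms(1)] plus_comm neg_hom assms(1) by metis
  also have "\<dots> = neg f \<oplus> (f \<oplus> h)" using plus_assoc neg_hom assms by metis
  also have "\<dots> = (neg f \<oplus> f) \<oplus> h" using plus_assoc neg_hom assms by metis
  also have "\<dots> = \<O> A B \<oplus> h" using plus_neg[OF assms(1)] plus_comm neg_hom assms(1) by metis
  also have "\<dots> = h" using plus_zero plus_comm assms(3) zero_hom hom_obs by metis
  finally show ?thesis .
qed

lemma plus_cancel_zero:
  assumes "f \<in> hom C A B" "g \<in> hom C A B" "f \<oplus> g = f"
  shows "g = \<O> A B"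
  using plus_cancel[OF assms(1,2) zero_hom] assms plus_zero hom_obs by metis

lemma zero_plus: "f \<in> hom C A B \<Longrightarrow> \<O> A B \<oplus> f = f"
  using plus_zero plus_comm zero_hom hom_obs by metis

lemma eq_if_diff_zero:
  assumes "f \<in> hom C A B" "g \<in> hom C A B" "f \<oplus> neg g = \<O> A B"
  shows "f = g"
  using plus_cancel[of "neg g" A B f g] assms plus_neg plus_comm neg_hom by metis

lemma comp_zero: assumes "f \<in> hom C A B" "D \<in> obs C" shows "\<O> B D \<cdot> f = \<O> A D"
proof -
  have z: "\<O> B D \<in> hom C B D" using assms hom_obs by blast
  have "\<O> B D \<cdot> f \<oplus> \<O> B D \<cdot> f = \<O> B D \<cdot> f"
    using distr[OF assms(1) z z] plus_zero[OF z] by simp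
  then show ?thesis using plus_cancel_zero comp_hom[OF assms(1) z] by blast
qed

lemma zero_comp: assumes "f \<in> hom C A B" "D \<in> obs C" shows "f \<cdot> \<O> D A = \<O> D B"
proof -
  have z: "\<O> D A \<in> hom C D A" using assms hom_obs by blast
  have "f \<cdot> \<O> D A \<oplus> f \<cdot> \<O> D A = f \<cdot> \<O> D A"
    using distl[OF z z assms(1)] plus_zero[OF z] by simp
  then show ?thesis using plus_cancel_zero comp_hom[OF z assms(1)] by blast
qed

lemma comp_neg: assumes "f \<in> hom C A B" "g \<in> hom C B D" shows "g \<cdot> neg f = neg (g \<cdot> f)"
proof -
  have "g \<cdot> f \<oplus> g \<cdot> neg f = \<O> A D"
    using distl[OF assms(1) neg_hom[OF assms(1)] assms(2)] plus_neg[OF assms(1)] zero_comp assms hom_obs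
    by metis
  moreover have "g \<cdot> f \<oplus> neg (g \<cdot> f) = \<O> A D" using plus_neg comp_hom assms by blast
  ultimately show ?thesis using plus_cancel[of "g \<cdot> f" A D] comp_hom neg_hom assms by metis
qed

lemma neg_comp: assumes "f \<in> hom C A B" "g \<in> hom C B D" shows "neg g \<cdot> f = neg (g \<cdot> f)"
proof -
  have "g \<cdot> f \<oplus> neg g \<cdot> f = \<O> A D"
    using distr[OF assms neg_hom[OF assms(2)]] plus_neg[OF assms(2)] comp_zero assms hom_obs
    by metis
  moreover have "g \<cdot> f \<oplus> neg (g \<cdot> f) = \<O> A D" using plus_neg comp_hom assms by blast
  ultimately show ?thesis using plus_cancel[of "g \<cdot> f" A D] comp_hom neg_hom assms by metis
qed

lemma diff_plus: assumes "f \<in> hom C A B" "g \<in> hom C A B" shows "g \<oplus> (f \<oplus> neg g) = f"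
proof -
  have n: "neg g \<in> hom C A B" using assms by blast
  have "g \<oplus> (f \<oplus> neg g) = g \<oplus> (neg g \<oplus> f)" using plus_comm[OF assms(1) n] by simp
  also have "\<dots> = (g \<oplus> neg g) \<oplus> f" using plus_assoc[OF assms(2) n assms(1)] by simp
  also have "\<dots> = f" using plus_neg[OF assms(2)] zero_plus assms by simp
  finally show ?thesis .
qed

lemma comp_middle:
  assumes "d \<in> hom C X A" "c \<in> hom C A B" "b \<in> hom C B D" "a \<in> hom C D E"
  shows "(a \<cdot> b) \<cdot> (c \<cdot> d) = a \<cdot> ((b \<cdot> c) \<cdot> d)"
  using comp_assoc[OF comp_hom[OF assms(1,2)] assms(3,4)] comp_assoc[OF assms(1-3)] by simp

lemma is_isoI:
  assumes "f \<in> hom C A B" "g \<in> hom C B A" "g \<cdot> f = \<I> A" "f \<cdot> g = \<I> B"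
  shows "is_iso C f"
  using assms unfolding is_iso_def hom_def by auto

lemma is_isoE:
  assumes "is_iso C f" "f \<in> hom C A B"
  obtains g where "g \<in> hom C B A" "g \<cdot> f = \<I> A" "f \<cdot> g = \<I> B" "is_iso C g"
proof -
  obtain g where g: "g \<in> hom C B A" "g \<cdot> f = \<I> A" "f \<cdot> g = \<I> B"
    using assms unfolding is_iso_def hom_def by auto
  moreover have "is_iso C g" using is_isoI g assms by blast
  ultimately show ?thesis using that by blast
qed

lemma is_iso_idn: "A \<in> obs C \<Longrightarrow> is_iso C (\<I> A)"
  by (rule is_isoI[where g = "\<I> A"]) (auto intro: id_left)

lemma comp_is_iso:
  assumes "is_iso C f" "is_iso C g" "f \<in> hom C A B" "g \<in> hom C B D"
  shows "is_iso C (g \<cdot> f)"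
proof -
  obtain f' where f': "f' \<in> hom C B A" "f' \<cdot> f = \<I> A" "f \<cdot> f' = \<I> B" using assms is_isoE by metis
  obtain g' where g': "g' \<in> hom C D B" "g' \<cdot> g = \<I> B" "g \<cdot> g' = \<I> D" using assms is_isoE by metis
  show ?thesis
  proof (rule is_isoI)
    show "g \<cdot> f \<in> hom C A D" "f' \<cdot> g' \<in> hom C D A" using assms f' g' by blast+
    have "(f' \<cdot> g') \<cdot> (g \<cdot> f) = f' \<cdot> ((g' \<cdot> g) \<cdot> f)"
      by (rule comp_middle[OF assms(3,4) g'(1) f'(1)])
    then show "(f' \<cdot> g') \<cdot> (g \<cdot> f) = \<I> A" using g' f' assms id_left by metis
    have "(g \<cdot> f) \<cdot> (f' \<cdot> g') = g \<cdot> ((f \<cdot> f') \<cdot> g')"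
      by (rule comp_middle[OF g'(1) f'(1) assms(3,4)])
    then show "(g \<cdot> f) \<cdot> (f' \<cdot> g') = \<I> D" using g' f' assms id_left by metis
  qed
qed

lemma isomorphicI:
  assumes "f \<in> hom C A B" "g \<in> hom C B A" "g \<cdot> f = \<I> A" "f \<cdot> g = \<I> B"
  shows "isomorphic C A B"
  using is_isoI[OF assms] assms unfolding isomorphic_def by blast

lemma isomorphicE:
  assumes "isomorphic C A B"
  obtains f g where "f \<in> hom C A B" "g \<in> hom C B A" "g \<cdot> f = \<I> A" "f \<cdot> g = \<I> B"
  using assms is_isoE unfolding isomorphic_def by metis

lemma isomorphic_refl: "A \<in> obs C \<Longrightarrow> isomorphic C A A"
  using is_iso_idn id_hom isomorphic_def by metis

lemma isomorphic_sym: "isomorphic C A B \<Longrightarrow> isomorphic C B A"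
  by (meson isomorphicE isomorphicI)

lemma isomorphic_trans: "isomorphic C A B \<Longrightarrow> isomorphic C B D \<Longrightarrow> isomorphic C A D"
  unfolding isomorphic_def using comp_is_iso comp_hom by metis

lemma isomorphic_obs: "isomorphic C A B \<Longrightarrow> A \<in> obs C \<and> B \<in> obs C"
  unfolding isomorphic_def using hom_obs by blast

lemma iso_class_eq_iff:
  assumes "A \<in> obs C" "B \<in> obs C"
  shows "iso_class C A = iso_class C B \<longleftrightarrow> isomorphic C A B"
  using assms isomorphic_refl isomorphic_sym isomorphic_trans unfolding iso_class_def by blast

lemma hom_trivial_iso:
  assumes "isomorphic C A A'" "isomorphic C B B'" "hom C A B = {\<O> A B}"
  shows "hom C A' B' = {\<O> A' B'}"
proof -
  obtain a a' where a: "a \<in> hom C A A'" "a' \<in> hom C A' A" "a' \<cdot> a = \<I> A" "a \<cdot> a' = \<I> A'"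
    using assms isomorphicE by metis
  obtain b b' where b: "b \<in> hom C B B'" "b' \<in> hom C B' B" "b' \<cdot> b = \<I> B" "b \<cdot> b' = \<I> B'"
    using assms isomorphicE by metis
  have "f = \<O> A' B'" if f: "f \<in> hom C A' B'" for f
  proof -
    have "b' \<cdot> (f \<cdot> a) = \<O> A B" using assms(3) a b f comp_hom by blast
    moreover have "b \<cdot> (b' \<cdot> (f \<cdot> a)) \<cdot> a' = f"
      using comp_assoc[of "f \<cdot> a" A B' b' B b B'] comp_assoc[of a' A' A a A' f B'] a b f comp_hom
        id_left id_right by metis
    moreover have "b \<cdot> \<O> A B \<cdot> a' = \<O> A' B'"
      using zero_comp comp_zero a b hom_obs1 hom_obs2 by metis
    ultimately show ?thesis by simp
  qed
  moreover have "\<O> A' B' \<in> hom C A' B'" using a b hom_obs by blast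
  ultimately show ?thesis by blast
qed

lemma zero_object_if_factor:
  assumes "i \<in> hom C B A" "r \<in> hom C A B" "r \<cdot> i = \<I> B" "i \<cdot> r = \<O> A A"
  shows "zero_object C B"
proof -
  have o: "A \<in> obs C" "B \<in> obs C" using assms hom_obs by blast+
  have "\<I> B = r \<cdot> i \<cdot> (r \<cdot> i)" using assms id_left id_hom o by metis
  also have "\<dots> = r \<cdot> ((i \<cdot> r) \<cdot> i)" by (rule comp_middle[OF assms(1,2,1,2)])
  also have "\<dots> = \<O> B B" using assms comp_zero zero_comp o by metis
  finally show ?thesis using o unfolding zero_object_def by simp
qed

text \<open>A decomposition yields the complementary idempotents i r and j s, and by
  \<open>zero_object_if_factor\<close> a summand whose idempotent vanishes is a zero object.\<close>

lemma indecomposableI: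
  assumes "A \<in> obs C" "\<not> zero_object C A"
    and idem: "\<And>e e'. e \<in> hom C A A \<Longrightarrow> e' \<in> hom C A A \<Longrightarrow> e \<cdot> e = e \<Longrightarrow> e' \<cdot> e' = e' \<Longrightarrow>
      e \<oplus> e' = \<I> A \<Longrightarrow> e = \<O> A A \<or> e' = \<O> A A"
  shows "indecomposable C A"
  unfolding indecomposable_def
proof (intro conjI allI impI)
  fix B D assume "direct_sum C B D A"
  then obtain i j r s where *: "i \<in> hom C B A" "j \<in> hom C D A" "r \<in> hom C A B" "s \<in> hom C A D"
    "r \<cdot> i = \<I> B" "s \<cdot> j = \<I> D" "i \<cdot> r \<oplus> j \<cdot> s = \<I> A"
    unfolding direct_sum_def by blast
  have "(i \<cdot> r) \<cdot> (i \<cdot> r) = i \<cdot> ((r \<cdot> i) \<cdot> r)" by (rule comp_middle[OF *(3,1,3,1)])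
  then have 1: "(i \<cdot> r) \<cdot> (i \<cdot> r) = i \<cdot> r" using * id_left by metis
  have "(j \<cdot> s) \<cdot> (j \<cdot> s) = j \<cdot> ((s \<cdot> j) \<cdot> s)" by (rule comp_middle[OF *(4,2,4,2)])
  then have 2: "(j \<cdot> s) \<cdot> (j \<cdot> s) = j \<cdot> s" using * id_left by metis
  have "i \<cdot> r = \<O> A A \<or> j \<cdot> s = \<O> A A"
    using idem[OF _ _ 1 2] * comp_hom by blast
  then show "zero_object C B \<or> zero_object C D"
    using zero_object_if_factor * by blast
qed (use assms in auto)

lemma zero_object_iso:
  assumes "isomorphic C A B" "zero_object C A" shows "zero_object C B"
proof -
  obtain a a' where a: "a \<in> hom C A B" "a' \<in> hom C B A" "a' \<cdot> a = \<I> A" "a \<cdot> a' = \<I> B"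
    using assms isomorphicE by metis
  have o: "A \<in> obs C" "B \<in> obs C" using a hom_obs by blast+
  have "\<I> B = a \<cdot> (\<I> A \<cdot> a')" using a id_left by metis
  also have "\<dots> = \<O> B B" using assms(2) a o comp_zero zero_comp unfolding zero_object_def by metis
  finally show ?thesis using o unfolding zero_object_def by simp
qed

lemma is_kernelI:
  assumes "i \<in> hom C A B" "q \<in> hom C B D" "q \<cdot> i = \<O> A D"
    and "\<And>E f. f \<in> hom C E B \<Longrightarrow> q \<cdot> f = \<O> E D \<Longrightarrow> \<exists>h\<in>hom C E A. i \<cdot> h = f"
    and "\<And>E h h'. h \<in> hom C E A \<Longrightarrow> h' \<in> hom C E A \<Longrightarrow> i \<cdot> h = i \<cdot> h' \<Longrightarrow> h = h'"
  shows "is_kernel C i q"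
  unfolding is_kernel_def
proof (intro conjI ballI impI)
  fix f assume "f \<in> mors C" "tgt C f = src C q \<and> q \<cdot> f = \<O> (src C f) (tgt C q)"
  then have "f \<in> hom C (src C f) B" "q \<cdot> f = \<O> (src C f) D"
    using homD[OF assms(2)] mors_hom by auto
  with assms(4)[OF this] assms(5) show "\<exists>!h. h \<in> hom C (src C f) (src C i) \<and> i \<cdot> h = f"
    using homD[OF assms(1)] by blast
qed (use homD[OF assms(1)] homD[OF assms(2)] assms(3) in auto)

lemma is_kernelD:
  assumes "is_kernel C i q" "i \<in> hom C A B" "q \<in> hom C B D"
  shows "q \<cdot> i = \<O> A D"
    and "f \<in> hom C E B \<Longrightarrow> q \<cdot> f = \<O> E D \<Longrightarrow> \<exists>h\<in>hom C E A. i \<cdot> h = f"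
    and "h \<in> hom C E A \<Longrightarrow> h' \<in> hom C E A \<Longrightarrow> i \<cdot> h = i \<cdot> h' \<Longrightarrow> h = h'"
proof -
  have all: "\<forall>f\<in>mors C. tgt C f = src C q \<and> q \<cdot> f = \<O> (src C f) (tgt C q) \<longrightarrow>
      (\<exists>!h. h \<in> hom C (src C f) (src C i) \<and> i \<cdot> h = f)" and "q \<cdot> i = \<O> (src C i) (tgt C q)"
    using assms(1) by (simp_all add: is_kernel_def)
  then show z: "q \<cdot> i = \<O> A D" using homD[OF assms(2)] homD[OF assms(3)] by simp
  have ex1: "\<exists>!h. h \<in> hom C E A \<and> i \<cdot> h = f" if "f \<in> hom C E B" "q \<cdot> f = \<O> E D" for E f
    using bspec[OF all, of f] that(2) homD[OF that(1)] homD[OF assms(2)] homD[OF assms(3)] by simp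
  then show "f \<in> hom C E B \<Longrightarrow> q \<cdot> f = \<O> E D \<Longrightarrow> \<exists>h\<in>hom C E A. i \<cdot> h = f"
    by blast
  assume h: "h \<in> hom C E A" "h' \<in> hom C E A" "i \<cdot> h = i \<cdot> h'"
  have "q \<cdot> (i \<cdot> h) = \<O> E D"
    using comp_assoc[OF h(1) assms(2,3)] z comp_zero[OF h(1)] assms(3) hom_obs by metis
  from ex1[OF comp_hom[OF h(1) assms(2)] this] show "h = h'" using h by auto
qed

lemma is_cokernelI:
  assumes "i \<in> hom C A B" "q \<in> hom C B D" "q \<cdot> i = \<O> A D"
    and "\<And>E f. f \<in> hom C B E \<Longrightarrow> f \<cdot> i = \<O> A E \<Longrightarrow> \<exists>h\<in>hom C D E. h \<cdot> q = f"
    and "\<And>E h h'. h \<in> hom C D E \<Longrightarrow> h' \<in> hom C D E \<Longrightarrow> h \<cdot> q = h' \<cdot> q \<Longrightarrow> h = h'"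
  shows "is_cokernel C i q"
  unfolding is_cokernel_def
proof (intro conjI ballI impI)
  fix f assume "f \<in> mors C" "src C f = tgt C i \<and> f \<cdot> i = \<O> (src C i) (tgt C f)"
  then have "f \<in> hom C B (tgt C f)" "f \<cdot> i = \<O> A (tgt C f)"
    using homD[OF assms(1)] mors_hom by auto
  with assms(4)[OF this] assms(5) show "\<exists>!h. h \<in> hom C (tgt C q) (tgt C f) \<and> h \<cdot> q = f"
    using homD[OF assms(2)] by blast
qed (use homD[OF assms(1)] homD[OF assms(2)] assms(3) in auto)

lemma is_cokernelD:
  assumes "is_cokernel C i q" "i \<in> hom C A B" "q \<in> hom C B D"
  shows "q \<cdot> i = \<O> A D"
    and "f \<in> hom C B E \<Longrightarrow> f \<cdot> i = \<O> A E \<Longrightarrow> \<exists>h\<in>hom C D E. h \<cdot> q = f"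
    and "h \<in> hom C D E \<Longrightarrow> h' \<in> hom C D E \<Longrightarrow> h \<cdot> q = h' \<cdot> q \<Longrightarrow> h = h'"
proof -
  have all: "\<forall>f\<in>mors C. src C f = tgt C i \<and> f \<cdot> i = \<O> (src C i) (tgt C f) \<longrightarrow>
      (\<exists>!h. h \<in> hom C (tgt C q) (tgt C f) \<and> h \<cdot> q = f)" and "q \<cdot> i = \<O> (src C i) (tgt C q)"
    using assms(1) by (simp_all add: is_cokernel_def)
  then show z: "q \<cdot> i = \<O> A D" using homD[OF assms(2)] homD[OF assms(3)] by simp
  have ex1: "\<exists>!h. h \<in> hom C D E \<and> h \<cdot> q = f" if "f \<in> hom C B E" "f \<cdot> i = \<O> A E" for E f
    using bspec[OF all, of f] that(2) homD[OF that(1)] homD[OF assms(2)] homD[OF assms(3)] by simp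
  then show "f \<in> hom C B E \<Longrightarrow> f \<cdot> i = \<O> A E \<Longrightarrow> \<exists>h\<in>hom C D E. h \<cdot> q = f"
    by blast
  assume h: "h \<in> hom C D E" "h' \<in> hom C D E" "h \<cdot> q = h' \<cdot> q"
  have "(h \<cdot> q) \<cdot> i = \<O> A E"
    using comp_assoc[OF assms(2,3) h(1)] z zero_comp[OF h(1)] assms(2) hom_obs by metis
  from ex1[OF comp_hom[OF assms(3) h(1)] this] show "h = h'" using h by auto
qed

lemma is_pullbackI:
  assumes "q \<in> hom C B D" "f \<in> hom C E D" "f' \<in> hom C T B" "q' \<in> hom C T E" "q \<cdot> f' = f \<cdot> q'"
    and "\<And>X a b. a \<in> hom C X B \<Longrightarrow> b \<in> hom C X E \<Longrightarrow> q \<cdot> a = f \<cdot> b \<Longrightarrow>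
      \<exists>h\<in>hom C X T. f' \<cdot> h = a \<and> q' \<cdot> h = b"
    and "\<And>X h h'. h \<in> hom C X T \<Longrightarrow> h' \<in> hom C X T \<Longrightarrow> f' \<cdot> h = f' \<cdot> h' \<Longrightarrow> q' \<cdot> h = q' \<cdot> h' \<Longrightarrow> h = h'"
  shows "is_pullback C q f f' q'"
  unfolding is_pullback_def
proof (intro conjI ballI impI)
  fix a b assume "a \<in> mors C" "b \<in> mors C"
    "tgt C a = src C q \<and> tgt C b = src C f \<and> src C a = src C b \<and> q \<cdot> a = f \<cdot> b"
  then have "a \<in> hom C (src C a) B" "b \<in> hom C (src C a) E" "q \<cdot> a = f \<cdot> b"
    using homD[OF assms(1)] homD[OF assms(2)] mors_hom by (auto simp: hom_def)
  from assms(6)[OF this] obtain h where h: "h \<in> hom C (src C a) T" "f' \<cdot> h = a" "q' \<cdot> h = b" by blast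
  have "src C q' = T" using homD[OF assms(4)] by simp
  then show "\<exists>!h. h \<in> hom C (src C a) (src C q') \<and> f' \<cdot> h = a \<and> q' \<cdot> h = b"
  proof (intro ex1I[of _ h] conjI)
    fix h' assume "h' \<in> hom C (src C a) (src C q') \<and> f' \<cdot> h' = a \<and> q' \<cdot> h' = b"
    with h \<open>src C q' = T\<close> show "h' = h" by (intro assms(7)[of h' "src C a" h]) simp_all
  qed (use h \<open>src C q' = T\<close> in simp_all)
qed (use homD[OF assms(1)] homD[OF assms(2)] homD[OF assms(3)] homD[OF assms(4)] assms(5) in auto)

lemma is_pullbackE:
  assumes "is_pullback C q f f' q'" "q \<in> hom C B D" "f \<in> hom C E D"
  obtains T where "f' \<in> hom C T B" "q' \<in> hom C T E" "q \<cdot> f' = f \<cdot> q'"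
    and "\<And>X a b. a \<in> hom C X B \<Longrightarrow> b \<in> hom C X E \<Longrightarrow> q \<cdot> a = f \<cdot> b \<Longrightarrow>
      \<exists>h\<in>hom C X T. f' \<cdot> h = a \<and> q' \<cdot> h = b"
    and "\<And>X h h'. h \<in> hom C X T \<Longrightarrow> h' \<in> hom C X T \<Longrightarrow> f' \<cdot> h = f' \<cdot> h' \<Longrightarrow> q' \<cdot> h = q' \<cdot> h' \<Longrightarrow> h = h'"
proof
  let ?T = "src C q'"
  have pb: "f' \<in> mors C" "q' \<in> mors C" "tgt C f' = src C q" "tgt C q' = src C f" "src C f' = src C q'"
    "q \<cdot> f' = f \<cdot> q'"
    using assms(1) by (simp_all only: is_pullback_def)
  show f': "f' \<in> hom C ?T B" and q': "q' \<in> hom C ?T E" and c: "q \<cdot> f' = f \<cdot> q'"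
    using pb homD[OF assms(2)] homD[OF assms(3)] unfolding hom_def by simp_all
  have ex1: "\<exists>!h. h \<in> hom C X ?T \<and> f' \<cdot> h = a \<and> q' \<cdot> h = b"
    if "a \<in> hom C X B" "b \<in> hom C X E" "q \<cdot> a = f \<cdot> b" for X a b
  proof -
    have "a \<in> mors C" "b \<in> mors C" "tgt C a = src C q" "tgt C b = src C f" "src C a = X" "src C b = X"
      using that(1,2) assms(2,3) unfolding hom_def by simp_all
    moreover have "\<forall>a\<in>mors C. \<forall>b\<in>mors C.
        tgt C a = src C q \<and> tgt C b = src C f \<and> src C a = src C b \<and> q \<cdot> a = f \<cdot> b \<longrightarrow>
        (\<exists>!h. h \<in> hom C (src C a) ?T \<and> f' \<cdot> h = a \<and> q' \<cdot> h = b)"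
      using assms(1) unfolding is_pullback_def by (elim conjE)
    ultimately show ?thesis using that(3) by (metis (no_types, lifting))
  qed
  then show "\<exists>h\<in>hom C X ?T. f' \<cdot> h = a \<and> q' \<cdot> h = b"
    if "a \<in> hom C X B" "b \<in> hom C X E" "q \<cdot> a = f \<cdot> b" for X a b
    using that by blast
  show "h = h'" if "h \<in> hom C X ?T" "h' \<in> hom C X ?T" "f' \<cdot> h = f' \<cdot> h'" "q' \<cdot> h = q' \<cdot> h'" for X h h'
  proof -
    have "q \<cdot> (f' \<cdot> h) = f \<cdot> (q' \<cdot> h)"
      using comp_assoc[OF that(1) f' assms(2)] comp_assoc[OF that(1) q' assms(3)] c by simp
    then show ?thesis using ex1[OF comp_hom[OF that(1) f'] comp_hom[OF that(1) q']] that by auto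
  qed
qed

lemma section_of_mono_is_inverse:
  assumes t: "t \<in> hom C B T" and b: "b \<in> hom C T B" and tb: "t \<cdot> b = \<I> T"
    and mono: "\<And>x y. x \<in> hom C B B \<Longrightarrow> y \<in> hom C B B \<Longrightarrow> t \<cdot> x = t \<cdot> y \<Longrightarrow> x = y"
  shows "b \<cdot> t = \<I> B"
proof -
  have o: "B \<in> obs C" using t hom_obs by blast
  have "t \<cdot> (b \<cdot> t) = t \<cdot> \<I> B" using comp_assoc[OF t b t] tb id_left[OF t] id_right[OF t] by simp
  then show ?thesis using mono comp_hom[OF t b] id_hom[OF o] by blast
qed

end

section \<open>Recognizing conflations\<close>

locale exact_category = preadditive C for C :: "('o, 'm) addcat" +
  fixes CF :: "('m \<times> 'm) set"
  assumes exact: "exact_structure C CF"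
begin

lemma conflation_kernel: "(i, q) \<in> CF \<Longrightarrow> is_kernel C i q"
  and conflation_cokernel: "(i, q) \<in> CF \<Longrightarrow> is_cokernel C i q"
  using exact unfolding exact_structure_def by blast+

lemma conflationE:
  assumes "(i, q) \<in> CF"
  obtains A B D where "i \<in> hom C A B" "q \<in> hom C B D"
  using conflation_kernel[OF assms] unfolding is_kernel_def hom_def by blast

lemma conflation_iso:
  assumes "(i, q) \<in> CF" "i \<in> hom C A B" "q \<in> hom C B D" "i' \<in> hom C A' B'" "q' \<in> hom C B' D'"
    and "a \<in> hom C A A'" "b \<in> hom C B B'" "c \<in> hom C D D'" "is_iso C a" "is_iso C b" "is_iso C c"
    and "i' \<cdot> a = b \<cdot> i" "q' \<cdot> b = c \<cdot> q"
  shows "(i', q') \<in> CF"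
proof -
  have all: "\<forall>(i, q)\<in>CF. \<forall>i'\<in>mors C. \<forall>q'\<in>mors C. \<forall>a b c.
        is_iso C a \<and> is_iso C b \<and> is_iso C c \<and> tgt C i' = src C q' \<and>
        a \<in> hom C (src C i) (src C i') \<and> b \<in> hom C (tgt C i) (tgt C i') \<and>
        c \<in> hom C (tgt C q) (tgt C q') \<and>
        cmp C i' a = cmp C b i \<and> cmp C q' b = cmp C c q \<longrightarrow> (i', q') \<in> CF"
    using exact unfolding exact_structure_def by (elim conjE) assumption
  have h: "i' \<in> mors C" "q' \<in> mors C" "tgt C i' = src C q'" "src C i = A" "src C i' = A'" "tgt C i = B"
    "tgt C i' = B'" "tgt C q = D" "tgt C q' = D'"
    using assms(2-5) by (simp_all add: hom_def)
  note a1 = bspec[OF bspec[OF bspec[OF all assms(1), unfolded prod.case] h(1)] h(2)]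
  show ?thesis using a1 h assms(6-) by blast
qed

lemma pullback_ex:
  assumes "(j, k) \<in> CF" "k \<in> hom C I Z" "w \<in> hom C D Z"
  obtains f' q' i' where "is_pullback C k w f' q'" "(i', q') \<in> CF"
proof -
  have all: "\<forall>q. \<forall>f\<in>mors C. adm_epi CF q \<and> tgt C f = tgt C q \<longrightarrow>
        (\<exists>f' q'. is_pullback C q f f' q' \<and> adm_epi CF q')"
    using exact unfolding exact_structure_def by (elim conjE) assumption
  have "w \<in> mors C" "adm_epi CF k" "tgt C w = tgt C k"
    using assms unfolding adm_epi_def hom_def by auto
  with all have "\<exists>f' q'. is_pullback C k w f' q' \<and> adm_epi CF q'" by blast
  then show ?thesis using that unfolding adm_epi_def by blast
qed

text \<open>The isomorphism t of the middle terms over D induces an isomorphism of the kernels, and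
  an exact structure is closed under isomorphism of pairs.\<close>

lemma conflation_if_iso_deflation:
  assumes K: "is_kernel C i q" and i: "i \<in> hom C A B" and q: "q \<in> hom C B D"
    and CF: "(i', q') \<in> CF" and q': "q' \<in> hom C T D"
    and t: "t \<in> hom C B T" and b: "b \<in> hom C T B" and tb: "t \<cdot> b = \<I> T" and bt: "b \<cdot> t = \<I> B"
    and qt: "q' \<cdot> t = q"
  shows "(i, q) \<in> CF"
proof -
  have K': "is_kernel C i' q'" using conflation_kernel CF .
  obtain A' where i': "i' \<in> hom C A' T" using K' q' unfolding is_kernel_def hom_def by auto
  have o: "A \<in> obs C" "B \<in> obs C" "D \<in> obs C" "T \<in> obs C" "A' \<in> obs C" using i q q' i' hom_obs by blast+
  have qb: "q \<cdot> b = q'"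
    using comp_assoc[OF b t q'] qt tb id_right[OF q'] by simp
  have "q \<cdot> (b \<cdot> i') = \<O> A' D"
    using comp_assoc[OF i' b q] qb is_kernelD(1)[OF K' i' q'] by simp
  then obtain a where a: "a \<in> hom C A' A" "i \<cdot> a = b \<cdot> i'"
    using is_kernelD(2)[OF K i q comp_hom[OF i' b]] by blast
  have "q' \<cdot> (t \<cdot> i) = \<O> A D"
    using comp_assoc[OF i t q'] qt is_kernelD(1)[OF K i q] by simp
  then obtain a' where a': "a' \<in> hom C A A'" "i' \<cdot> a' = t \<cdot> i"
    using is_kernelD(2)[OF K' i' q' comp_hom[OF i t]] by blast
  have "i \<cdot> (a \<cdot> a') = (b \<cdot> i') \<cdot> a'" using comp_assoc[OF a'(1) a(1) i] a by simp
  also have "\<dots> = b \<cdot> (t \<cdot> i)" using comp_assoc[OF a'(1) i' b] a' by simp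
  also have "\<dots> = i \<cdot> \<I> A" using comp_assoc[OF i t b] bt id_left[OF i] id_right[OF i] by simp
  finally have 1: "a \<cdot> a' = \<I> A"
    using is_kernelD(3)[OF K i q comp_hom[OF a'(1) a(1)] id_hom[OF o(1)]] by blast
  have "i' \<cdot> (a' \<cdot> a) = (t \<cdot> i) \<cdot> a" using comp_assoc[OF a(1) a'(1) i'] a' by simp
  also have "\<dots> = t \<cdot> (b \<cdot> i')" using comp_assoc[OF a(1) i t] a by simp
  also have "\<dots> = i' \<cdot> \<I> A'" using comp_assoc[OF i' b t] tb id_left[OF i'] id_right[OF i'] by simp
  finally have 2: "a' \<cdot> a = \<I> A'"
    using is_kernelD(3)[OF K' i' q' comp_hom[OF a(1) a'(1)] id_hom[OF o(5)]] by blast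
  show ?thesis
    using conflation_iso[OF CF i' q' i q a(1) b id_hom[OF o(3)] is_isoI[OF a(1) a'(1) 2 1]
        is_isoI[OF b t tb bt] is_iso_idn[OF o(3)] a(2)] qb id_left[OF q'] by simp
qed

text \<open>
  A kernel-cokernel pair (i, q) whose inflation part factors through an inflation j, and through
  which j factors, is a conflation: the pullback of the deflation of j along the induced map of
  cokernels is isomorphic to q.
\<close>

lemma conflation_if_mutual_factor:
  assumes CF: "(j, k) \<in> CF" and j: "j \<in> hom C A I" and k: "k \<in> hom C I Z"
    and K: "is_kernel C i q" and CK: "is_cokernel C i q" and i: "i \<in> hom C A B" and q: "q \<in> hom C B D"
    and n: "n \<in> hom C I B" and nj: "n \<cdot> j = i" and m: "m \<in> hom C B I" and mi: "m \<cdot> i = j"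
  shows "(i, q) \<in> CF"
proof -
  note Kj = conflation_kernel[OF CF] and Cj = conflation_cokernel[OF CF]
  have o: "A \<in> obs C" "B \<in> obs C" "D \<in> obs C" "I \<in> obs C" "Z \<in> obs C" using i q j k hom_obs by blast+
  have "(k \<cdot> m) \<cdot> i = \<O> A Z" using comp_assoc[OF i m k] mi is_kernelD(1)[OF Kj j k] by simp
  then obtain z where z: "z \<in> hom C D Z" "z \<cdot> q = k \<cdot> m"
    using is_cokernelD(2)[OF CK i q comp_hom[OF m k]] by blast
  have "(q \<cdot> n) \<cdot> j = \<O> A D" using comp_assoc[OF j n q] nj is_kernelD(1)[OF K i q] by simp
  then obtain y where y: "y \<in> hom C Z D" "y \<cdot> k = q \<cdot> n"
    using is_cokernelD(2)[OF Cj j k comp_hom[OF n q]] by blast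
  have nm: "n \<cdot> m \<in> hom C B B" using comp_hom[OF m n] .
  \<comment> \<open>Since n m i = i, the difference of the identity and n m kills i and factors as s
    q. The identity of B is thus n m + s q, from which an inverse of t is built below.\<close>
  let ?d = "\<I> B \<oplus> neg (n \<cdot> m)"
  have d: "?d \<in> hom C B B" using nm o by blast
  have nmi: "(n \<cdot> m) \<cdot> i = i" using comp_assoc[OF i m n] mi nj by simp
  have "?d \<cdot> i = \<O> A B"
    using distr[OF i id_hom[OF o(2)] neg_hom[OF nm]] id_left[OF i] neg_comp[OF i nm] nmi plus_neg[OF i] by simp
  then obtain s where s: "s \<in> hom C D B" "s \<cdot> q = ?d" using is_cokernelD(2)[OF CK i q d] by blast
  have nmsq: "n \<cdot> m \<oplus> s \<cdot> q = \<I> B" using diff_plus[OF id_hom[OF o(2)] nm] s by simp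
  obtain f' q' i' where pb: "is_pullback C k z f' q'" and CF': "(i', q') \<in> CF"
    using pullback_ex[OF CF k z(1)] .
  obtain T where f': "f' \<in> hom C T I" and q': "q' \<in> hom C T D" and sq: "k \<cdot> f' = z \<cdot> q'"
    and pbe: "\<And>X a b. a \<in> hom C X I \<Longrightarrow> b \<in> hom C X D \<Longrightarrow> k \<cdot> a = z \<cdot> b \<Longrightarrow>
      \<exists>h\<in>hom C X T. f' \<cdot> h = a \<and> q' \<cdot> h = b"
    and pbu: "\<And>X h h'. h \<in> hom C X T \<Longrightarrow> h' \<in> hom C X T \<Longrightarrow> f' \<cdot> h = f' \<cdot> h' \<Longrightarrow> q' \<cdot> h = q' \<cdot> h' \<Longrightarrow> h = h'"
    using is_pullbackE[OF pb k z(1)] by metis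
  have o': "T \<in> obs C" using f' hom_obs by blast
  obtain t where t: "t \<in> hom C B T" "f' \<cdot> t = m" "q' \<cdot> t = q" using pbe[OF m q] z(2) by auto
  \<comment> \<open>A first candidate for the inverse of t, read off from n m + s q by replacing m
    and q with the projections f' and q' of the pullback. By \<open>yzqs\<close> its component over
    D is correct.\<close>
  define b0 where "b0 = n \<cdot> f' \<oplus> s \<cdot> q'"
  have nf: "n \<cdot> f' \<in> hom C T B" and sq': "s \<cdot> q' \<in> hom C T B" using f' n s q' by blast+
  have b0: "b0 \<in> hom C T B" unfolding b0_def using nf sq' by blast
  have yz: "y \<cdot> z \<in> hom C D D" and qs: "q \<cdot> s \<in> hom C D D" using y z q s by blast+
  have "(y \<cdot> z \<oplus> q \<cdot> s) \<cdot> q = (y \<cdot> z) \<cdot> q \<oplus> (q \<cdot> s) \<cdot> q" using distr[OF q yz qs] .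
  also have "(y \<cdot> z) \<cdot> q = q \<cdot> (n \<cdot> m)"
    using comp_assoc[OF q z(1) y(1)] comp_assoc[OF m k y(1)] comp_assoc[OF m n q] y(2) z(2) by simp
  also have "(q \<cdot> s) \<cdot> q = q \<cdot> (s \<cdot> q)" using comp_assoc[OF q s(1) q] by simp
  also have "q \<cdot> (n \<cdot> m) \<oplus> q \<cdot> (s \<cdot> q) = q \<cdot> \<I> B"
    using distl[OF nm comp_hom[OF q s(1)] q] nmsq by simp
  also have "\<dots> = \<I> D \<cdot> q" using id_left[OF q] id_right[OF q] by simp
  finally have yzqs: "y \<cdot> z \<oplus> q \<cdot> s = \<I> D"
    using is_cokernelD(3)[OF CK i q plus_hom[OF yz qs] id_hom[OF o(3)]] by blast
  have "q \<cdot> b0 = q \<cdot> (n \<cdot> f') \<oplus> q \<cdot> (s \<cdot> q')" unfolding b0_def using distl[OF nf sq' q] .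
  also have "q \<cdot> (n \<cdot> f') = (y \<cdot> z) \<cdot> q'"
    using comp_assoc[OF f' n q] comp_assoc[OF f' k y(1)] comp_assoc[OF q' z(1) y(1)] y(2) sq by simp
  also have "q \<cdot> (s \<cdot> q') = (q \<cdot> s) \<cdot> q'" using comp_assoc[OF q' s(1) q] .
  also have "(y \<cdot> z) \<cdot> q' \<oplus> (q \<cdot> s) \<cdot> q' = q'" using distr[OF q' yz qs] yzqs id_left[OF q'] by simp
  finally have qb0: "q \<cdot> b0 = q'" .
  \<comment> \<open>The component of \<open>b0\<close> in I may be wrong. The error f' - m b0 is
    killed by k, so it equals j l, and adding i l to \<open>b0\<close> corrects it because m i =
    j.\<close>
  have mb0: "m \<cdot> b0 \<in> hom C T I" using b0 m by blast
  let ?e = "f' \<oplus> neg (m \<cdot> b0)"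
  have e: "?e \<in> hom C T I" using f' mb0 by blast
  have "k \<cdot> (m \<cdot> b0) = z \<cdot> q'" using comp_assoc[OF b0 m k] comp_assoc[OF b0 q z(1)] z(2) qb0 by simp
  then have "k \<cdot> ?e = \<O> T Z"
    using distl[OF f' neg_hom[OF mb0] k] comp_neg[OF mb0 k] sq plus_neg[OF comp_hom[OF q' z(1)]] by simp
  then obtain l where l: "l \<in> hom C T A" "j \<cdot> l = ?e" using is_kernelD(2)[OF Kj j k e] by blast
  define b where "b = b0 \<oplus> i \<cdot> l"
  have il: "i \<cdot> l \<in> hom C T B" using i l by blast
  have b: "b \<in> hom C T B" unfolding b_def using b0 il by blast
  have "q \<cdot> (i \<cdot> l) = \<O> T D"
    using comp_assoc[OF l(1) i q] is_kernelD(1)[OF K i q] comp_zero[OF l(1) o(3)] by simp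
  then have qb: "q \<cdot> b = q'" unfolding b_def using distl[OF b0 il q] qb0 plus_zero[OF q'] by simp
  have "m \<cdot> (i \<cdot> l) = ?e" using comp_assoc[OF l(1) i m] mi l by simp
  then have mb: "m \<cdot> b = f'" unfolding b_def using distl[OF b0 il m] diff_plus[OF f' mb0] by simp
  have tb: "t \<cdot> b = \<I> T"
    by (rule pbu[OF comp_hom[OF b t(1)] id_hom[OF o']])
      (use comp_assoc[OF b t(1) f'] comp_assoc[OF b t(1) q'] t mb qb id_right[OF f'] id_right[OF q'] in simp_all)
  have bt: "b \<cdot> t = \<I> B"
  proof (rule section_of_mono_is_inverse[OF t(1) b tb])
    fix x x' assume x: "x \<in> hom C B B" "x' \<in> hom C B B" and eq: "t \<cdot> x = t \<cdot> x'"
    let ?x = "x \<oplus> neg x'"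
    have xx: "?x \<in> hom C B B" using x by blast
    have tx: "t \<cdot> ?x = \<O> B T"
      using distl[OF x(1) neg_hom[OF x(2)] t(1)] comp_neg[OF x(2) t(1)] eq plus_neg[OF comp_hom[OF x(2) t(1)]] by simp
    have "q \<cdot> ?x = \<O> B D"
      using comp_assoc[OF xx t(1) q'] t(3) tx zero_comp[OF q' o(2)] by simp
    then obtain v where v: "v \<in> hom C B A" "i \<cdot> v = ?x" using is_kernelD(2)[OF K i q xx] by blast
    have "j \<cdot> v = m \<cdot> ?x" using comp_assoc[OF v(1) i m] mi v by simp
    also have "\<dots> = \<O> B I" using comp_assoc[OF xx t(1) f'] t(2) tx zero_comp[OF f' o(2)] by simp
    also have "\<dots> = j \<cdot> \<O> B A" using zero_comp[OF j o(2)] by simp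
    finally have "v = \<O> B A"
      using is_kernelD(3)[OF Kj j k v(1) zero_hom[OF o(2,1)]] by blast
    then have "?x = \<O> B B" using v(2) zero_comp[OF i o(2)] by simp
    then show "x = x'" using eq_if_diff_zero x by blast
  qed
  show ?thesis using conflation_if_iso_deflation[OF K i q CF' q' t(1) b tb bt t(3)] .
qed

text \<open>Both rows have the kernel A. The comparison map t from B to an actual pullback T is
  monic, because its kernel lies in A and is killed by j. It has a right inverse because deflations
  are cokernels: the pullback P of q and q' covers T, and a map P \<rightarrow> B over T descends to
  T.\<close>

lemma conflation_square_pullback:
  assumes CF: "(j, k) \<in> CF" and j: "j \<in> hom C A I" and k: "k \<in> hom C I Z"
    and CF1: "(i, q) \<in> CF" and i: "i \<in> hom C A B" and q: "q \<in> hom C B D"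
    and m: "m \<in> hom C B I" and mi: "m \<cdot> i = j" and z: "z \<in> hom C D Z" and zq: "z \<cdot> q = k \<cdot> m"
  shows "is_pullback C k z m q"
proof -
  note Kj = conflation_kernel[OF CF] and K = conflation_kernel[OF CF1]
  have o: "A \<in> obs C" "B \<in> obs C" "D \<in> obs C" "I \<in> obs C" "Z \<in> obs C" using i q j k hom_obs by blast+
  obtain f' q' i' where pb: "is_pullback C k z f' q'" and CF': "(i', q') \<in> CF"
    using pullback_ex[OF CF k z] .
  obtain T where f': "f' \<in> hom C T I" and q': "q' \<in> hom C T D" and sq: "k \<cdot> f' = z \<cdot> q'"
    and pbe: "\<And>X a b. a \<in> hom C X I \<Longrightarrow> b \<in> hom C X D \<Longrightarrow> k \<cdot> a = z \<cdot> b \<Longrightarrow>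
      \<exists>h\<in>hom C X T. f' \<cdot> h = a \<and> q' \<cdot> h = b"
    and pbu: "\<And>X h h'. h \<in> hom C X T \<Longrightarrow> h' \<in> hom C X T \<Longrightarrow> f' \<cdot> h = f' \<cdot> h' \<Longrightarrow> q' \<cdot> h = q' \<cdot> h' \<Longrightarrow> h = h'"
    using is_pullbackE[OF pb k z] by metis
  have o': "T \<in> obs C" using f' hom_obs by blast
  obtain t where t: "t \<in> hom C B T" "f' \<cdot> t = m" "q' \<cdot> t = q" using pbe[OF m q] zq by auto
  have mono: "x = x'" if x: "x \<in> hom C X B" "x' \<in> hom C X B" and eq: "t \<cdot> x = t \<cdot> x'" for X x x'
  proof -
    have oX: "X \<in> obs C" using x hom_obs by blast
    let ?x = "x \<oplus> neg x'"
    have xx: "?x \<in> hom C X B" using x by blast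
    have tx: "t \<cdot> ?x = \<O> X T"
      using distl[OF x(1) neg_hom[OF x(2)] t(1)] comp_neg[OF x(2) t(1)] eq plus_neg[OF comp_hom[OF x(2) t(1)]] by simp
    have "q \<cdot> ?x = \<O> X D"
      using comp_assoc[OF xx t(1) q'] t(3) tx zero_comp[OF q' oX] by simp
    then obtain v where v: "v \<in> hom C X A" "i \<cdot> v = ?x" using is_kernelD(2)[OF K i q xx] by blast
    have "j \<cdot> v = m \<cdot> ?x" using comp_assoc[OF v(1) i m] mi v by simp
    also have "\<dots> = \<O> X I" using comp_assoc[OF xx t(1) f'] t(2) tx zero_comp[OF f' oX] by simp
    also have "\<dots> = j \<cdot> \<O> X A" using zero_comp[OF j oX] by simp
    finally have "v = \<O> X A"
      using is_kernelD(3)[OF Kj j k v(1) zero_hom[OF oX o(1)]] by blast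
    then have "?x = \<O> X B" using v(2) zero_comp[OF i oX] by simp
    then show "x = x'" using eq_if_diff_zero x by blast
  qed
  obtain p2 p1 i2 where pb2: "is_pullback C q q' p1 p2" and CF2: "(i2, p2) \<in> CF"
    using pullback_ex[OF CF1 q q'] .
  obtain P where p1: "p1 \<in> hom C P B" and p2: "p2 \<in> hom C P T" and qp: "q \<cdot> p1 = q' \<cdot> p2"
    using is_pullbackE[OF pb2 q q'] by metis
  note K2 = conflation_kernel[OF CF2] and C2 = conflation_cokernel[OF CF2]
  obtain N where i2: "i2 \<in> hom C N P" using K2 p2 unfolding is_kernel_def hom_def by auto
  have oP: "P \<in> obs C" "N \<in> obs C" using i2 hom_obs by blast+
  have tp1: "t \<cdot> p1 \<in> hom C P T" using p1 t by blast
  \<comment> \<open>The two maps from P to T agree over D, so their difference comes from a map v to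
    A; subtracting i v from p1 removes it.\<close>
  let ?d = "t \<cdot> p1 \<oplus> neg p2"
  have d: "?d \<in> hom C P T" using tp1 p2 by blast
  have qd: "q' \<cdot> ?d = \<O> P D"
    using distl[OF tp1 neg_hom[OF p2] q'] comp_neg[OF p2 q'] comp_assoc[OF p1 t(1) q'] t(3) qp
      plus_neg[OF comp_hom[OF p2 q']] by simp
  then have "k \<cdot> (f' \<cdot> ?d) = \<O> P Z"
    using comp_assoc[OF d f' k] comp_assoc[OF d q' z] sq zero_comp[OF z oP(1)] by simp
  then obtain v where v: "v \<in> hom C P A" "j \<cdot> v = f' \<cdot> ?d"
    using is_kernelD(2)[OF Kj j k comp_hom[OF d f']] by blast
  have iv: "i \<cdot> v \<in> hom C P B" using i v by blast
  have "t \<cdot> (i \<cdot> v) = ?d"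
  proof (rule pbu[OF comp_hom[OF iv t(1)] d])
    show "f' \<cdot> (t \<cdot> (i \<cdot> v)) = f' \<cdot> ?d"
      using comp_assoc[OF iv t(1) f'] t(2) comp_assoc[OF v(1) i m] mi v(2) by simp
    show "q' \<cdot> (t \<cdot> (i \<cdot> v)) = q' \<cdot> ?d"
      using comp_assoc[OF iv t(1) q'] t(3) comp_assoc[OF v(1) i q] is_kernelD(1)[OF K i q]
        comp_zero[OF v(1) o(3)] qd by simp
  qed
  then have ptiv: "p2 \<oplus> t \<cdot> (i \<cdot> v) = t \<cdot> p1" using diff_plus[OF tp1 p2] by simp
  let ?e = "p1 \<oplus> neg (i \<cdot> v)"
  have e: "?e \<in> hom C P B" using p1 iv by blast
  have "t \<cdot> ?e = t \<cdot> p1 \<oplus> neg (t \<cdot> (i \<cdot> v))"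
    using distl[OF p1 neg_hom[OF iv] t(1)] comp_neg[OF iv t(1)] by simp
  also have "\<dots> = p2"
    using ptiv plus_cancel[of "t \<cdot> (i \<cdot> v)" P T "t \<cdot> p1 \<oplus> neg (t \<cdot> (i \<cdot> v))" p2]
      diff_plus[OF tp1 comp_hom[OF iv t(1)]] plus_comm[OF p2 comp_hom[OF iv t(1)]] p2 tp1 iv t(1) by (metis comp_hom neg_hom plus_hom)
  finally have te: "t \<cdot> ?e = p2" .
  have "t \<cdot> (?e \<cdot> i2) = t \<cdot> \<O> N B"
    using comp_assoc[OF i2 e t(1)] te is_kernelD(1)[OF K2 i2 p2] zero_comp[OF t(1) oP(2)] by simp
  then have "?e \<cdot> i2 = \<O> N B" using mono[OF comp_hom[OF i2 e] zero_hom[OF oP(2) o(2)]] by simp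
  then obtain b where b: "b \<in> hom C T B" "b \<cdot> p2 = ?e" using is_cokernelD(2)[OF C2 i2 p2 e] by blast
  have "(t \<cdot> b) \<cdot> p2 = \<I> T \<cdot> p2" using comp_assoc[OF p2 b(1) t(1)] b te id_left[OF p2] by simp
  then have tb: "t \<cdot> b = \<I> T"
    using is_cokernelD(3)[OF C2 i2 p2 comp_hom[OF b(1) t(1)] id_hom[OF o']] by blast
  show ?thesis
  proof (rule is_pullbackI[OF k z m q])
    fix X a c assume a: "a \<in> hom C X I" "c \<in> hom C X D" "k \<cdot> a = z \<cdot> c"
    then obtain h where h: "h \<in> hom C X T" "f' \<cdot> h = a" "q' \<cdot> h = c" using pbe by blast
    have bh: "b \<cdot> h \<in> hom C X B" using h b by blast
    have "t \<cdot> (b \<cdot> h) = h" using comp_assoc[OF h(1) b(1) t(1)] tb id_left[OF h(1)] by simp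
    then have "m \<cdot> (b \<cdot> h) = a \<and> q \<cdot> (b \<cdot> h) = c"
      using comp_assoc[OF bh t(1) f'] comp_assoc[OF bh t(1) q'] t h by simp
    then show "\<exists>h\<in>hom C X B. m \<cdot> h = a \<and> q \<cdot> h = c" using bh by blast
  next
    fix X h h' assume h: "h \<in> hom C X B" "h' \<in> hom C X B" "m \<cdot> h = m \<cdot> h'" "q \<cdot> h = q \<cdot> h'"
    have "t \<cdot> h = t \<cdot> h'"
      by (rule pbu[OF comp_hom[OF h(1) t(1)] comp_hom[OF h(2) t(1)]])
        (use comp_assoc[OF h(1) t(1) f'] comp_assoc[OF h(2) t(1) f'] comp_assoc[OF h(1) t(1) q']
          comp_assoc[OF h(2) t(1) q'] t h in simp_all)
    then show "h = h'" using mono h by blast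
  qed (use zq in simp)
qed

text \<open>The axioms provide some pullback of k along z whose map to D is a deflation; any other
  pullback is isomorphic to it over D.\<close>

lemma conflation_if_pullback:
  assumes CF: "(j, k) \<in> CF" and k: "k \<in> hom C I Z"
    and K: "is_kernel C i q" and i: "i \<in> hom C A B" and q: "q \<in> hom C B D"
    and m: "m \<in> hom C B I" and z: "z \<in> hom C D Z" and pb: "is_pullback C k z m q"
  shows "(i, q) \<in> CF"
proof -
  obtain f' q' i' where pb': "is_pullback C k z f' q'" and CF': "(i', q') \<in> CF"
    using pullback_ex[OF CF k z] .
  obtain T where f': "f' \<in> hom C T I" and q': "q' \<in> hom C T D" and sq': "k \<cdot> f' = z \<cdot> q'"
    and pbe': "\<And>X a b. a \<in> hom C X I \<Longrightarrow> b \<in> hom C X D \<Longrightarrow> k \<cdot> a = z \<cdot> b \<Longrightarrow>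
      \<exists>h\<in>hom C X T. f' \<cdot> h = a \<and> q' \<cdot> h = b"
    and pbu': "\<And>X h h'. h \<in> hom C X T \<Longrightarrow> h' \<in> hom C X T \<Longrightarrow> f' \<cdot> h = f' \<cdot> h' \<Longrightarrow> q' \<cdot> h = q' \<cdot> h' \<Longrightarrow> h = h'"
    using is_pullbackE[OF pb' k z] by metis
  obtain B' where m': "m \<in> hom C B' I" and q1: "q \<in> hom C B' D" and sq: "k \<cdot> m = z \<cdot> q"
    and pbe: "\<And>X a b. a \<in> hom C X I \<Longrightarrow> b \<in> hom C X D \<Longrightarrow> k \<cdot> a = z \<cdot> b \<Longrightarrow>
      \<exists>h\<in>hom C X B'. m \<cdot> h = a \<and> q \<cdot> h = b"
    and pbu: "\<And>X h h'. h \<in> hom C X B' \<Longrightarrow> h' \<in> hom C X B' \<Longrightarrow> m \<cdot> h = m \<cdot> h' \<Longrightarrow> q \<cdot> h = q \<cdot> h' \<Longrightarrow> h = h'"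
    using is_pullbackE[OF pb k z] by metis
  have B': "B' = B" using m m' by (simp add: hom_def)
  obtain t where t: "t \<in> hom C B T" "f' \<cdot> t = m" "q' \<cdot> t = q" using pbe'[OF m q sq] by blast
  obtain b where b: "b \<in> hom C T B" "m \<cdot> b = f'" "q \<cdot> b = q'" using pbe[OF f' q' sq'] B' by blast
  have o: "T \<in> obs C" "B \<in> obs C" using t hom_obs by blast+
  have tb: "t \<cdot> b = \<I> T"
    by (rule pbu'[OF comp_hom[OF b(1) t(1)] id_hom[OF o(1)]])
      (use comp_assoc[OF b(1) t(1) f'] comp_assoc[OF b(1) t(1) q'] t b id_right[OF f'] id_right[OF q'] in simp_all)
  have bt: "b \<cdot> t = \<I> B"
    by (rule pbu[unfolded B', OF comp_hom[OF t(1) b(1)] id_hom[OF o(2)]])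
      (use comp_assoc[OF t(1) b(1) m] comp_assoc[OF t(1) b(1) q] t b id_right[OF m] id_right[OF q] in simp_all)
  show ?thesis using conflation_if_iso_deflation[OF K i q CF' q' t(1) b(1) tb bt t(3)] .
qed

end

section \<open>Stable categories\<close>

text \<open>Closure under addition is an assumption because it calls for sums of
  projective-injectives. \<open>G_stable_setup\<close> obtains it from the divisibility criterion
  for stably zero maps.\<close>

locale stable_setup = preadditive C for C :: "('o, 'm) addcat" +
  fixes CF :: "('m \<times> 'm) set"
  assumes stably_zero_plus: "stably_zero C CF f \<Longrightarrow> stably_zero C CF g \<Longrightarrow>
      f \<in> hom C A B \<Longrightarrow> g \<in> hom C A B \<Longrightarrow> stably_zero C CF (pls C f g)"
    and stably_zero_zero: "A \<in> obs C \<Longrightarrow> B \<in> obs C \<Longrightarrow> stably_zero C CF (zro C A B)"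
begin

abbreviation "sz \<equiv> stably_zero C CF"
abbreviation cls ("\<lbrakk>_\<rbrakk>") where "\<lbrakk>f\<rbrakk> \<equiv> stab_cls C CF f"
abbreviation "D \<equiv> stable_cat C CF"

lemma stably_zeroE:
  assumes "sz f" "f \<in> hom C A B"
  obtains P a b where "projinj C CF P" "a \<in> hom C A P" "b \<in> hom C P B" "f = b \<cdot> a"
  using assms unfolding stably_zero_def hom_def by auto

lemma stably_zeroI:
  assumes "projinj C CF P" "a \<in> hom C A P" "b \<in> hom C P B" "f = b \<cdot> a"
  shows "sz f"
  using assms homD[OF comp_hom[OF assms(2,3)]] unfolding stably_zero_def by auto

lemma stably_zero_post:
  assumes "sz f" "f \<in> hom C A B" "g \<in> hom C B E" shows "sz (g \<cdot> f)"
proof -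
  obtain P a b where *: "projinj C CF P" "a \<in> hom C A P" "b \<in> hom C P B" "f = b \<cdot> a"
    using stably_zeroE[OF assms(1,2)] .
  show ?thesis
    using stably_zeroI[OF *(1,2) comp_hom[OF *(3) assms(3)]] comp_assoc[OF *(2,3) assms(3)] *(4) by simp
qed

lemma stably_zero_pre:
  assumes "sz f" "f \<in> hom C A B" "g \<in> hom C E A" shows "sz (f \<cdot> g)"
proof -
  obtain P a b where *: "projinj C CF P" "a \<in> hom C A P" "b \<in> hom C P B" "f = b \<cdot> a"
    using stably_zeroE[OF assms(1,2)] .
  show ?thesis
    using stably_zeroI[OF *(1) comp_hom[OF assms(3) *(2)] *(3)] comp_assoc[OF assms(3) *(2,3)] *(4) by simp
qed

lemma stably_zero_neg:
  assumes "sz f" "f \<in> hom C A B" shows "sz (neg f)"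
proof -
  obtain P a b where *: "projinj C CF P" "a \<in> hom C A P" "b \<in> hom C P B" "f = b \<cdot> a"
    using stably_zeroE[OF assms(1,2)] .
  show ?thesis
    using stably_zeroI[OF *(1,2) neg_hom[OF *(3)]] neg_comp[OF *(2,3)] *(4) by simp
qed

lemma coef_cls: "f \<in> hom C A B \<Longrightarrow> coef \<lbrakk>f\<rbrakk> = {f \<oplus> h | h. h \<in> hom C A B \<and> sz h}"
  unfolding stab_cls_def using homD by auto

lemma cls_coef_hom: "f \<in> hom C A B \<Longrightarrow> f' \<in> coef \<lbrakk>f\<rbrakk> \<Longrightarrow> f' \<in> hom C A B"
  unfolding coef_cls by auto

lemma asrc_cls [simp]: "asrc \<lbrakk>f\<rbrakk> = src C f" and atgt_cls [simp]: "atgt \<lbrakk>f\<rbrakk> = tgt C f"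
  by (simp_all add: stab_cls_def)

lemma cls_self: assumes "f \<in> hom C A B" shows "f \<in> coef \<lbrakk>f\<rbrakk>"
proof -
  have "A \<in> obs C" "B \<in> obs C" using assms hom_obs by blast+
  then have "f = f \<oplus> \<O> A B" "\<O> A B \<in> hom C A B" "sz (\<O> A B)"
    using stably_zero_zero zero_hom plus_zero[OF assms] by simp_all
  then show ?thesis using coef_cls[OF assms] by blast
qed

lemma cls_plus: assumes "f \<in> hom C A B" "h \<in> hom C A B" "sz h" shows "\<lbrakk>f \<oplus> h\<rbrakk> = \<lbrakk>f\<rbrakk>"
proof -
  have fh: "f \<oplus> h \<in> hom C A B" using assms by blast
  have "coef \<lbrakk>f \<oplus> h\<rbrakk> = coef \<lbrakk>f\<rbrakk>"
  proof
    show "coef \<lbrakk>f \<oplus> h\<rbrakk> \<subseteq> coef \<lbrakk>f\<rbrakk>"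
    proof
      fix x assume "x \<in> coef \<lbrakk>f \<oplus> h\<rbrakk>"
      then obtain k where k: "k \<in> hom C A B" "sz k" "x = (f \<oplus> h) \<oplus> k" using coef_cls[OF fh] by auto
      have "x = f \<oplus> (h \<oplus> k)" using k plus_assoc[OF assms(1,2) k(1)] by simp
      moreover have "h \<oplus> k \<in> hom C A B" "sz (h \<oplus> k)"
        using k assms stably_zero_plus by blast+
      ultimately show "x \<in> coef \<lbrakk>f\<rbrakk>" using coef_cls[OF assms(1)] by blast
    qed
    show "coef \<lbrakk>f\<rbrakk> \<subseteq> coef \<lbrakk>f \<oplus> h\<rbrakk>"
    proof
      fix x assume "x \<in> coef \<lbrakk>f\<rbrakk>"
      then obtain k where k: "k \<in> hom C A B" "sz k" "x = f \<oplus> k" using coef_cls[OF assms(1)] by auto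
      have kn: "k \<oplus> neg h \<in> hom C A B" "sz (k \<oplus> neg h)"
        using k assms stably_zero_plus[OF k(2) stably_zero_neg[OF assms(3,2)]] by blast+
      have "x = (f \<oplus> h) \<oplus> (k \<oplus> neg h)"
        using k plus_assoc[OF assms(1,2) kn(1)] diff_plus[OF k(1) assms(2)] by simp
      then show "x \<in> coef \<lbrakk>f \<oplus> h\<rbrakk>" using coef_cls[OF fh] kn by blast
    qed
  qed
  then show ?thesis using homD[OF assms(1)] homD[OF fh] by (intro arr.expand) simp
qed

lemma cls_eq_iff:
  assumes "f \<in> hom C A B" "g \<in> hom C A B"
  shows "\<lbrakk>f\<rbrakk> = \<lbrakk>g\<rbrakk> \<longleftrightarrow> sz (f \<oplus> neg g)"
proof
  assume "\<lbrakk>f\<rbrakk> = \<lbrakk>g\<rbrakk>"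
  then obtain h where h: "h \<in> hom C A B" "sz h" "f = g \<oplus> h"
    using cls_self[OF assms(1)] coef_cls[OF assms(2)] by auto
  have "f \<oplus> neg g = h"
    using plus_cancel[of g A B "f \<oplus> neg g" h] diff_plus[OF assms] h assms by blast
  then show "sz (f \<oplus> neg g)" using h by simp
next
  assume "sz (f \<oplus> neg g)"
  then have "\<lbrakk>g \<oplus> (f \<oplus> neg g)\<rbrakk> = \<lbrakk>g\<rbrakk>" using cls_plus assms by blast
  then show "\<lbrakk>f\<rbrakk> = \<lbrakk>g\<rbrakk>" using diff_plus[OF assms] by simp
qed

lemma cls_zero_iff: assumes "f \<in> hom C A B" shows "\<lbrakk>f\<rbrakk> = \<lbrakk>\<O> A B\<rbrakk> \<longleftrightarrow> sz f"
proof -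
  have o: "A \<in> obs C" "B \<in> obs C" using assms hom_obs by blast+
  have z: "\<O> A B \<in> hom C A B" using o by blast
  have "neg (\<O> A B) = \<O> A B" using zero_plus[OF neg_hom[OF z]] plus_neg[OF z] by simp
  then show ?thesis using cls_eq_iff[OF assms z] plus_zero[OF assms] by simp
qed

lemma stable_obs [simp]: "obs D = obs C"
  by (simp add: stable_cat_def)

lemma stable_idn: "idn D A = \<lbrakk>\<I> A\<rbrakk>" and stable_zro: "zro D A B = \<lbrakk>\<O> A B\<rbrakk>"
  by (simp_all add: stable_cat_def)

lemma stable_hom: "hom D A B = stab_cls C CF ` hom C A B"
  unfolding hom_def stable_cat_def by auto

lemma stable_homE:
  assumes "k \<in> hom D A B"
  obtains f where "f \<in> hom C A B" "k = \<lbrakk>f\<rbrakk>"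
  using assms stable_hom by auto

lemma cls_hom [intro]: "f \<in> hom C A B \<Longrightarrow> \<lbrakk>f\<rbrakk> \<in> hom D A B"
  using stable_hom by auto

text \<open>Composition in \<open>stable_cat\<close> is a union over all representatives. The united
  classes are equal, since stably zero maps form an ideal.\<close>

lemma stable_cmp:
  assumes "f \<in> hom C A B" "g \<in> hom C B E"
  shows "cmp D \<lbrakk>g\<rbrakk> \<lbrakk>f\<rbrakk> = \<lbrakk>g \<cdot> f\<rbrakk>"
proof -
  have "\<lbrakk>g' \<cdot> f'\<rbrakk> = \<lbrakk>g \<cdot> f\<rbrakk>" if mem: "g' \<in> coef \<lbrakk>g\<rbrakk>" "f' \<in> coef \<lbrakk>f\<rbrakk>" for g' f'
  proof -
    obtain h k where h: "h \<in> hom C A B" "sz h" "f' = f \<oplus> h" and k: "k \<in> hom C B E" "sz k" "g' = g \<oplus> k"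
      using mem unfolding coef_cls[OF assms(1)] coef_cls[OF assms(2)] by blast
    have f': "f' \<in> hom C A B" and g': "g' \<in> hom C B E" using h k assms by blast+
    have "g' \<cdot> f' = g \<cdot> f' \<oplus> k \<cdot> f'" using distr[OF f' assms(2) k(1)] k by simp
    then have "\<lbrakk>g' \<cdot> f'\<rbrakk> = \<lbrakk>g \<cdot> f'\<rbrakk>"
      using cls_plus[OF comp_hom[OF f' assms(2)] comp_hom[OF f' k(1)] stably_zero_pre[OF k(2,1) f']] by simp
    also have "g \<cdot> f' = g \<cdot> f \<oplus> g \<cdot> h" using distl[OF assms(1) h(1) assms(2)] h by simp
    also have "\<lbrakk>g \<cdot> f \<oplus> g \<cdot> h\<rbrakk> = \<lbrakk>g \<cdot> f\<rbrakk>"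
      using cls_plus[OF comp_hom[OF assms] comp_hom[OF h(1) assms(2)] stably_zero_post[OF h(2,1) assms(2)]] .
    finally show ?thesis .
  qed
  then have "(\<Union>g'\<in>coef \<lbrakk>g\<rbrakk>. \<Union>f'\<in>coef \<lbrakk>f\<rbrakk>. coef \<lbrakk>g' \<cdot> f'\<rbrakk>) =
      (\<Union>g'\<in>coef \<lbrakk>g\<rbrakk>. \<Union>f'\<in>coef \<lbrakk>f\<rbrakk>. coef \<lbrakk>g \<cdot> f\<rbrakk>)"
    by (intro SUP_cong refl) simp
  also have "\<dots> = coef \<lbrakk>g \<cdot> f\<rbrakk>" using cls_self[OF assms(1)] cls_self[OF assms(2)] by blast
  finally have "(\<Union>g'\<in>coef \<lbrakk>g\<rbrakk>. \<Union>f'\<in>coef \<lbrakk>f\<rbrakk>. coef \<lbrakk>g' \<cdot> f'\<rbrakk>) = coef \<lbrakk>g \<cdot> f\<rbrakk>" .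
  then show ?thesis
    using homD[OF assms(1)] homD[OF assms(2)] homD[OF comp_hom[OF assms]]
    unfolding stable_cat_def by (intro arr.expand) simp
qed

lemma stable_pls:
  assumes "f \<in> hom C A B" "g \<in> hom C A B"
  shows "pls D \<lbrakk>g\<rbrakk> \<lbrakk>f\<rbrakk> = \<lbrakk>g \<oplus> f\<rbrakk>"
proof -
  have "\<lbrakk>g' \<oplus> f'\<rbrakk> = \<lbrakk>g \<oplus> f\<rbrakk>" if mem: "g' \<in> coef \<lbrakk>g\<rbrakk>" "f' \<in> coef \<lbrakk>f\<rbrakk>" for g' f'
  proof -
    obtain h k where h: "h \<in> hom C A B" "sz h" "f' = f \<oplus> h" and k: "k \<in> hom C A B" "sz k" "g' = g \<oplus> k"
      using mem unfolding coef_cls[OF assms(1)] coef_cls[OF assms(2)] by blast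
    have f': "f' \<in> hom C A B" and g': "g' \<in> hom C A B" using h k assms by blast+
    have "g' \<oplus> f' = (g' \<oplus> f) \<oplus> h" using plus_assoc[OF g' assms(1) h(1)] h by simp
    then have "\<lbrakk>g' \<oplus> f'\<rbrakk> = \<lbrakk>g' \<oplus> f\<rbrakk>" using cls_plus[OF plus_hom[OF g' assms(1)] h(1,2)] by simp
    also have "g' \<oplus> f = f \<oplus> g'" using plus_comm g' assms by blast
    also have "\<dots> = (f \<oplus> g) \<oplus> k" using plus_assoc[OF assms k(1)] k by simp
    also have "\<lbrakk>\<dots>\<rbrakk> = \<lbrakk>f \<oplus> g\<rbrakk>" using cls_plus[OF plus_hom[OF assms] k(1,2)] .
    finally show ?thesis using plus_comm[OF assms] by simp
  qed
  then have "(\<Union>g'\<in>coef \<lbrakk>g\<rbrakk>. \<Union>f'\<in>coef \<lbrakk>f\<rbrakk>. coef \<lbrakk>g' \<oplus> f'\<rbrakk>) =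
      (\<Union>g'\<in>coef \<lbrakk>g\<rbrakk>. \<Union>f'\<in>coef \<lbrakk>f\<rbrakk>. coef \<lbrakk>g \<oplus> f\<rbrakk>)"
    by (intro SUP_cong refl) simp
  also have "\<dots> = coef \<lbrakk>g \<oplus> f\<rbrakk>" using cls_self[OF assms(1)] cls_self[OF assms(2)] by blast
  finally have "(\<Union>g'\<in>coef \<lbrakk>g\<rbrakk>. \<Union>f'\<in>coef \<lbrakk>f\<rbrakk>. coef \<lbrakk>g' \<oplus> f'\<rbrakk>) = coef \<lbrakk>g \<oplus> f\<rbrakk>" .
  then show ?thesis
    using homD[OF assms(1)] homD[OF assms(2)] homD[OF plus_hom[OF assms(2,1)]]
    unfolding stable_cat_def by (intro arr.expand) simp
qed

lemma stable_preadditive: "preadditive D"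
proof
  show "A \<in> obs D \<and> B \<in> obs D" if "k \<in> hom D A B" for k A B
    using that hom_obs stable_hom by auto
  show "idn D A \<in> hom D A A" if "A \<in> obs D" for A
    using that by (auto simp: stable_idn)
  show "zro D A B \<in> hom D A B" if "A \<in> obs D" "B \<in> obs D" for A B
    using that by (auto simp: stable_zro)
next
  fix k l m A B E F
  assume k: "k \<in> hom D A B"
  then obtain f where f: "f \<in> hom C A B" "k = \<lbrakk>f\<rbrakk>" using stable_homE by blast
  then have o: "A \<in> obs C" "B \<in> obs C" using hom_obs by blast+
  show "cmp D (idn D B) k = k" "cmp D k (idn D A) = k"
    using f o stable_cmp[OF f(1) id_hom] stable_cmp[OF id_hom f(1)] id_left[OF f(1)] id_right[OF f(1)]
    by (simp_all add: stable_idn)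
  show "pls D k (zro D A B) = k"
    using f stable_pls[OF zero_hom[OF o] f(1)] plus_zero[OF f(1)] by (simp add: stable_zro)
  show "\<exists>l\<in>hom D A B. pls D k l = zro D A B"
    using f stable_pls[OF neg_hom[OF f(1)] f(1)] plus_neg[OF f(1)] cls_hom[OF neg_hom[OF f(1)]]
    by (auto simp: stable_zro)
  {
    assume "l \<in> hom D B E"
    then obtain g where g: "g \<in> hom C B E" "l = \<lbrakk>g\<rbrakk>" using stable_homE by blast
    show "cmp D l k \<in> hom D A E" using f g stable_cmp[OF f(1) g(1)] comp_hom by auto
    assume "m \<in> hom D E F"
    then obtain h where h: "h \<in> hom C E F" "m = \<lbrakk>h\<rbrakk>" using stable_homE by blast
    show "cmp D m (cmp D l k) = cmp D (cmp D m l) k"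
      using f g h stable_cmp[OF f(1) g(1)] stable_cmp[OF comp_hom[OF f(1) g(1)] h(1)]
        stable_cmp[OF g(1) h(1)] stable_cmp[OF f(1) comp_hom[OF g(1) h(1)]] comp_assoc[OF f(1) g(1) h(1)]
      by simp
  }
  {
    assume "l \<in> hom D A B"
    then obtain g where g: "g \<in> hom C A B" "l = \<lbrakk>g\<rbrakk>" using stable_homE by blast
    show "pls D k l \<in> hom D A B" using f g stable_pls[OF g(1) f(1)] plus_hom by auto
    show "pls D k l = pls D l k"
      using f g stable_pls[OF g(1) f(1)] stable_pls[OF f(1) g(1)] plus_comm[OF f(1) g(1)] by simp
    {
      assume "m \<in> hom D A B"
      then obtain h where h: "h \<in> hom C A B" "m = \<lbrakk>h\<rbrakk>" using stable_homE by blast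
      show "pls D (pls D k l) m = pls D k (pls D l m)"
        using f g h stable_pls[OF g(1) f(1)] stable_pls[OF h(1) plus_hom[OF f(1) g(1)]]
          stable_pls[OF h(1) g(1)] stable_pls[OF plus_hom[OF g(1) h(1)] f(1)] plus_assoc[OF f(1) g(1) h(1)]
        by simp
    }
    {
      assume "m \<in> hom D B E"
      then obtain h where h: "h \<in> hom C B E" "m = \<lbrakk>h\<rbrakk>" using stable_homE by blast
      show "cmp D m (pls D k l) = pls D (cmp D m k) (cmp D m l)"
        using f g h stable_pls[OF g(1) f(1)] stable_cmp[OF plus_hom[OF f(1) g(1)] h(1)]
          stable_cmp[OF f(1) h(1)] stable_cmp[OF g(1) h(1)] distl[OF f(1) g(1) h(1)]
          stable_pls[OF comp_hom[OF g(1) h(1)] comp_hom[OF f(1) h(1)]] by simp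
    }
  }
  {
    assume "l \<in> hom D B E" "m \<in> hom D B E"
    then obtain g h where g: "g \<in> hom C B E" "l = \<lbrakk>g\<rbrakk>" and h: "h \<in> hom C B E" "m = \<lbrakk>h\<rbrakk>"
      using stable_homE by metis
    show "cmp D (pls D l m) k = pls D (cmp D l k) (cmp D m k)"
      using f g h stable_pls[OF h(1) g(1)] stable_cmp[OF f(1) plus_hom[OF g(1) h(1)]]
        stable_cmp[OF f(1) h(1)] stable_cmp[OF f(1) g(1)] distr[OF f(1) g(1) h(1)]
        stable_pls[OF comp_hom[OF f(1) h(1)] comp_hom[OF f(1) g(1)]] by simp
  }
qed

lemma stable_isomorphic: assumes "isomorphic C A B" shows "isomorphic D A B"
proof -
  obtain f g where *: "f \<in> hom C A B" "g \<in> hom C B A" "g \<cdot> f = \<I> A" "f \<cdot> g = \<I> B"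
    using assms isomorphicE by metis
  show ?thesis
    using preadditive.isomorphicI[OF stable_preadditive cls_hom[OF *(1)] cls_hom[OF *(2)]]
      stable_cmp[OF *(1,2)] stable_cmp[OF *(2,1)] * by (simp add: stable_idn)
qed

end

section \<open>Strict isomorphisms and the triangulated automorphisms they induce\<close>

locale strict_iso = preadditive C for C :: "('o, 'm) addcat" +
  fixes G0 H0 :: "'o \<Rightarrow> 'o" and G1 H1 :: "'m \<Rightarrow> 'm"
  assumes G0: "A \<in> obs C \<Longrightarrow> G0 A \<in> obs C" and H0: "A \<in> obs C \<Longrightarrow> H0 A \<in> obs C"
    and H0_G0: "A \<in> obs C \<Longrightarrow> H0 (G0 A) = A" and G0_H0: "A \<in> obs C \<Longrightarrow> G0 (H0 A) = A"
    and G1: "f \<in> hom C A B \<Longrightarrow> G1 f \<in> hom C (G0 A) (G0 B)"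
    and H1: "f \<in> hom C A B \<Longrightarrow> H1 f \<in> hom C (H0 A) (H0 B)"
    and H1_G1: "f \<in> hom C A B \<Longrightarrow> H1 (G1 f) = f" and G1_H1: "f \<in> hom C A B \<Longrightarrow> G1 (H1 f) = f"
    and G1_cmp: "f \<in> hom C A B \<Longrightarrow> g \<in> hom C B E \<Longrightarrow> G1 (cmp C g f) = cmp C (G1 g) (G1 f)"
    and G1_pls: "f \<in> hom C A B \<Longrightarrow> g \<in> hom C A B \<Longrightarrow> G1 (pls C g f) = pls C (G1 g) (G1 f)"
    and G1_idn: "A \<in> obs C \<Longrightarrow> G1 (idn C A) = idn C (G0 A)"
begin

lemma H1_cmp: assumes "f \<in> hom C A B" "g \<in> hom C B E" shows "H1 (g \<cdot> f) = H1 g \<cdot> H1 f"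
  using G1_cmp[OF H1[OF assms(1)] H1[OF assms(2)]] G1_H1 assms H1_G1[OF comp_hom[OF H1[OF assms(1)] H1[OF assms(2)]]]
  by simp

lemma H1_pls: assumes "f \<in> hom C A B" "g \<in> hom C A B" shows "H1 (g \<oplus> f) = H1 g \<oplus> H1 f"
  using G1_pls[OF H1[OF assms(1)] H1[OF assms(2)]] G1_H1 assms H1_G1[OF plus_hom[OF H1[OF assms(2)] H1[OF assms(1)]]]
  by simp

lemma H1_idn: assumes "A \<in> obs C" shows "H1 (\<I> A) = \<I> (H0 A)"
  using G1_idn[OF H0[OF assms]] G0_H0[OF assms] H1_G1[OF id_hom[OF H0[OF assms]]] by simp

lemma inverse: "strict_iso C H0 G0 H1 G1"
  by unfold_locales
    (use G0 H0 H0_G0 G0_H0 G1 H1 H1_G1 G1_H1 H1_cmp H1_pls H1_idn in auto)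

lemma G1_zro: assumes "A \<in> obs C" "B \<in> obs C" shows "G1 (\<O> A B) = \<O> (G0 A) (G0 B)"
proof -
  have z: "\<O> A B \<in> hom C A B" using assms by blast
  have "G1 (\<O> A B) \<oplus> G1 (\<O> A B) = G1 (\<O> A B)" using G1_pls[OF z z] plus_zero[OF z] by simp
  then show ?thesis using plus_cancel_zero[OF G1[OF z] G1[OF z]] by simp
qed

lemma H1': "f \<in> hom C A (G0 B) \<Longrightarrow> B \<in> obs C \<Longrightarrow> H1 f \<in> hom C (H0 A) B"
  "f \<in> hom C (G0 A) B \<Longrightarrow> A \<in> obs C \<Longrightarrow> H1 f \<in> hom C A (H0 B)"
  "f \<in> hom C (G0 A) (G0 B) \<Longrightarrow> A \<in> obs C \<Longrightarrow> B \<in> obs C \<Longrightarrow> H1 f \<in> hom C A B"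
  using H1[of f A "G0 B"] H1[of f "G0 A" B] H1[of f "G0 A" "G0 B"] H0_G0[of A] H0_G0[of B] by auto

lemma G1': "f \<in> hom C A (H0 B) \<Longrightarrow> B \<in> obs C \<Longrightarrow> G1 f \<in> hom C (G0 A) B"
  "f \<in> hom C (H0 A) B \<Longrightarrow> A \<in> obs C \<Longrightarrow> G1 f \<in> hom C A (G0 B)"
  "f \<in> hom C (H0 A) (H0 B) \<Longrightarrow> A \<in> obs C \<Longrightarrow> B \<in> obs C \<Longrightarrow> G1 f \<in> hom C A B"
  using G1[of f A "H0 B"] G1[of f "H0 A" B] G1[of f "H0 A" "H0 B"] G0_H0[of A] G0_H0[of B] by auto

lemma G1_inj: "f \<in> hom C A B \<Longrightarrow> g \<in> hom C A B \<Longrightarrow> G1 f = G1 g \<Longrightarrow> f = g"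
  using H1_G1 by metis

lemma G1_is_iso: assumes "is_iso C f" "f \<in> hom C A B" shows "is_iso C (G1 f)"
proof -
  obtain g where g: "g \<in> hom C B A" "g \<cdot> f = \<I> A" "f \<cdot> g = \<I> B" using is_isoE assms by metis
  have o: "A \<in> obs C" "B \<in> obs C" using g hom_obs by blast+
  show ?thesis
    using is_isoI[OF G1[OF assms(2)] G1[OF g(1)]] G1_cmp[OF assms(2) g(1)] G1_cmp[OF g(1) assms(2)]
      g G1_idn[OF o(1)] G1_idn[OF o(2)] by simp
qed

lemma G1_isomorphic: "isomorphic C A B \<Longrightarrow> isomorphic C (G0 A) (G0 B)"
  unfolding isomorphic_def using G1_is_iso G1 by blast

lemma G1_is_kernel:
  assumes "is_kernel C i q" "i \<in> hom C A B" "q \<in> hom C B E"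
  shows "is_kernel C (G1 i) (G1 q)"
proof (rule is_kernelI[OF G1[OF assms(2)] G1[OF assms(3)]])
  have o: "A \<in> obs C" "B \<in> obs C" "E \<in> obs C" using assms hom_obs by blast+
  show "G1 q \<cdot> G1 i = \<O> (G0 A) (G0 E)"
    using G1_cmp[OF assms(2,3)] is_kernelD(1)[OF assms] G1_zro o by simp
  fix X f assume f: "f \<in> hom C X (G0 B)"
  then have oX: "X \<in> obs C" using hom_obs by blast
  assume 0: "G1 q \<cdot> f = \<O> X (G0 E)"
  have f': "H1 f \<in> hom C (H0 X) B" using H1'(1) f o by blast
  have "G1 (q \<cdot> H1 f) = G1 (\<O> (H0 X) E)"
    using G1_cmp[OF f' assms(3)] G1_H1[OF f] 0 G1_zro[OF H0[OF oX] o(3)] G0_H0[OF oX] by simp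
  then have "q \<cdot> H1 f = \<O> (H0 X) E"
    using G1_inj[OF comp_hom[OF f' assms(3)] zero_hom[OF H0[OF oX] o(3)]] by blast
  then obtain h where h: "h \<in> hom C (H0 X) A" "i \<cdot> h = H1 f" using is_kernelD(2)[OF assms f'] by blast
  then have "G1 i \<cdot> G1 h = f" using G1_cmp[OF h(1) assms(2)] G1_H1[OF f] by simp
  then show "\<exists>h\<in>hom C X (G0 A). G1 i \<cdot> h = f" using G1'(2)[OF h(1) oX] by blast
next
  have o: "A \<in> obs C" "B \<in> obs C" "E \<in> obs C" using assms hom_obs by blast+
  fix X h h' assume h: "h \<in> hom C X (G0 A)" "h' \<in> hom C X (G0 A)" "G1 i \<cdot> h = G1 i \<cdot> h'"
  have "H1 (G1 i \<cdot> h) = i \<cdot> H1 h" "H1 (G1 i \<cdot> h') = i \<cdot> H1 h'"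
    using H1_cmp[OF h(1) G1[OF assms(2)]] H1_cmp[OF h(2) G1[OF assms(2)]] H1_G1[OF assms(2)] by simp_all
  then have "H1 h = H1 h'" using is_kernelD(3)[OF assms H1'(1)[OF h(1) o(1)] H1'(1)[OF h(2) o(1)]] h(3) by simp
  then show "h = h'" using G1_H1 h by metis
qed

lemma G1_is_cokernel:
  assumes "is_cokernel C i q" "i \<in> hom C A B" "q \<in> hom C B E"
  shows "is_cokernel C (G1 i) (G1 q)"
proof (rule is_cokernelI[OF G1[OF assms(2)] G1[OF assms(3)]])
  have o: "A \<in> obs C" "B \<in> obs C" "E \<in> obs C" using assms hom_obs by blast+
  show "G1 q \<cdot> G1 i = \<O> (G0 A) (G0 E)"
    using G1_cmp[OF assms(2,3)] is_cokernelD(1)[OF assms] G1_zro o by simp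
  fix X f assume f: "f \<in> hom C (G0 B) X"
  then have oX: "X \<in> obs C" using hom_obs by blast
  assume 0: "f \<cdot> G1 i = \<O> (G0 A) X"
  have f': "H1 f \<in> hom C B (H0 X)" using H1'(2) f o by blast
  have "G1 (H1 f \<cdot> i) = G1 (\<O> A (H0 X))"
    using G1_cmp[OF assms(2) f'] G1_H1[OF f] 0 G1_zro[OF o(1) H0[OF oX]] G0_H0[OF oX] by simp
  then have "H1 f \<cdot> i = \<O> A (H0 X)"
    using G1_inj[OF comp_hom[OF assms(2) f'] zero_hom[OF o(1) H0[OF oX]]] by blast
  then obtain h where h: "h \<in> hom C E (H0 X)" "h \<cdot> q = H1 f" using is_cokernelD(2)[OF assms f'] by blast
  then have "G1 h \<cdot> G1 q = f" using G1_cmp[OF assms(3) h(1)] G1_H1[OF f] by simp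
  then show "\<exists>h\<in>hom C (G0 E) X. h \<cdot> G1 q = f" using G1'(1)[OF h(1) oX] by blast
next
  have o: "A \<in> obs C" "B \<in> obs C" "E \<in> obs C" using assms hom_obs by blast+
  fix X h h' assume h: "h \<in> hom C (G0 E) X" "h' \<in> hom C (G0 E) X" "h \<cdot> G1 q = h' \<cdot> G1 q"
  have "H1 (h \<cdot> G1 q) = H1 h \<cdot> q" "H1 (h' \<cdot> G1 q) = H1 h' \<cdot> q"
    using H1_cmp[OF G1[OF assms(3)] h(1)] H1_cmp[OF G1[OF assms(3)] h(2)] H1_G1[OF assms(3)] by simp_all
  then have "H1 h = H1 h'" using is_cokernelD(3)[OF assms H1'(2)[OF h(1) o(3)] H1'(2)[OF h(2) o(3)]] h(3) by simp
  then show "h = h'" using G1_H1 h by metis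
qed

lemma G1_is_pullback:
  assumes pb: "is_pullback C k w m q" and k: "k \<in> hom C I Z" and w: "w \<in> hom C E Z"
  shows "is_pullback C (G1 k) (G1 w) (G1 m) (G1 q)"
proof -
  obtain T where m: "m \<in> hom C T I" and q: "q \<in> hom C T E" and sq: "k \<cdot> m = w \<cdot> q"
    and pbe: "\<And>X a b. a \<in> hom C X I \<Longrightarrow> b \<in> hom C X E \<Longrightarrow> k \<cdot> a = w \<cdot> b \<Longrightarrow>
      \<exists>h\<in>hom C X T. m \<cdot> h = a \<and> q \<cdot> h = b"
    and pbu: "\<And>X h h'. h \<in> hom C X T \<Longrightarrow> h' \<in> hom C X T \<Longrightarrow> m \<cdot> h = m \<cdot> h' \<Longrightarrow> q \<cdot> h = q \<cdot> h' \<Longrightarrow> h = h'"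
    using is_pullbackE[OF pb k w] by metis
  have o: "I \<in> obs C" "Z \<in> obs C" "E \<in> obs C" "T \<in> obs C" using k w m hom_obs by blast+
  show ?thesis
  proof (rule is_pullbackI[OF G1[OF k] G1[OF w] G1[OF m] G1[OF q]])
    show "G1 k \<cdot> G1 m = G1 w \<cdot> G1 q" using G1_cmp[OF m k] G1_cmp[OF q w] sq by simp
  next
    fix X a b assume a: "a \<in> hom C X (G0 I)" and b: "b \<in> hom C X (G0 E)" and eq: "G1 k \<cdot> a = G1 w \<cdot> b"
    have oX: "X \<in> obs C" using a hom_obs by blast
    have "k \<cdot> H1 a = w \<cdot> H1 b"
      using eq H1_cmp[OF a G1[OF k]] H1_cmp[OF b G1[OF w]] H1_G1[OF k] H1_G1[OF w] by simp
    then obtain h where h: "h \<in> hom C (H0 X) T" "m \<cdot> h = H1 a" "q \<cdot> h = H1 b"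
      using pbe[OF H1'(1)[OF a o(1)] H1'(1)[OF b o(3)]] by blast
    have "G1 m \<cdot> G1 h = a \<and> G1 q \<cdot> G1 h = b"
      using G1_cmp[OF h(1) m] G1_cmp[OF h(1) q] h G1_H1[OF a] G1_H1[OF b] by simp
    then show "\<exists>h\<in>hom C X (G0 T). G1 m \<cdot> h = a \<and> G1 q \<cdot> h = b" using G1'(2)[OF h(1) oX] by blast
  next
    fix X h h' assume h: "h \<in> hom C X (G0 T)" "h' \<in> hom C X (G0 T)"
      "G1 m \<cdot> h = G1 m \<cdot> h'" "G1 q \<cdot> h = G1 q \<cdot> h'"
    have "m \<cdot> H1 h = m \<cdot> H1 h'"
      using h(3) H1_cmp[OF h(1) G1[OF m]] H1_cmp[OF h(2) G1[OF m]] H1_G1[OF m] by simp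
    moreover have "q \<cdot> H1 h = q \<cdot> H1 h'"
      using h(4) H1_cmp[OF h(1) G1[OF q]] H1_cmp[OF h(2) G1[OF q]] H1_G1[OF q] by simp
    ultimately have "H1 h = H1 h'" using pbu[OF H1'(1)[OF h(1) o(4)] H1'(1)[OF h(2) o(4)]] by blast
    then show "h = h'" using G1_H1 h by metis
  qed
qed

end

text \<open>Strict compatibility with the hull, the inclusion and the projection, and not only with
  the object A[1], is used to carry the completions that define the shift of a morphism to
  completions.\<close>

locale strict_triangle_iso = stable_setup C CF + strict_iso C G0 H0 G1 H1
  for C :: "('o, 'm) addcat" and CF and G0 H0 and G1 H1 +
  fixes T :: "('o, 'm) susp"
  assumes CF_hom: "(i, q) \<in> CF \<Longrightarrow> \<exists>A B E. i \<in> hom C A B \<and> q \<in> hom C B E"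
    and CF_G: "(i, q) \<in> CF \<Longrightarrow> (G1 i, G1 q) \<in> CF"
    and CF_H: "(i, q) \<in> CF \<Longrightarrow> (H1 i, H1 q) \<in> CF"
    and sus_obs: "A \<in> obs C \<Longrightarrow> sus T A \<in> obs C" and hull_obs: "A \<in> obs C \<Longrightarrow> inj_hull T A \<in> obs C"
    and inc_hom: "A \<in> obs C \<Longrightarrow> inc T A \<in> hom C A (inj_hull T A)"
    and prj_hom: "A \<in> obs C \<Longrightarrow> prj T A \<in> hom C (inj_hull T A) (sus T A)"
    and sus_G: "A \<in> obs C \<Longrightarrow> sus T (G0 A) = G0 (sus T A)"
    and hull_G: "A \<in> obs C \<Longrightarrow> inj_hull T (G0 A) = G0 (inj_hull T A)"
    and inc_G: "A \<in> obs C \<Longrightarrow> inc T (G0 A) = G1 (inc T A)"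
    and prj_G: "A \<in> obs C \<Longrightarrow> prj T (G0 A) = G1 (prj T A)"
begin

lemma inverse_triangle: "strict_triangle_iso C CF H0 G0 H1 G1 T"
proof -
  interpret inv: strict_iso C H0 G0 H1 G1 by (rule inverse)
  show ?thesis
  proof unfold_locales
    fix A assume A: "A \<in> obs C"
    show "sus T (H0 A) = H0 (sus T A)"
      using sus_G[OF H0[OF A]] G0_H0[OF A] H0_G0[OF sus_obs[OF H0[OF A]]] by simp
    show "inj_hull T (H0 A) = H0 (inj_hull T A)"
      using hull_G[OF H0[OF A]] G0_H0[OF A] H0_G0[OF hull_obs[OF H0[OF A]]] by simp
    show "inc T (H0 A) = H1 (inc T A)"
      using inc_G[OF H0[OF A]] G0_H0[OF A] H1_G1[OF inc_hom[OF H0[OF A]]] by simp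
    show "prj T (H0 A) = H1 (prj T A)"
      using prj_G[OF H0[OF A]] G0_H0[OF A] H1_G1[OF prj_hom[OF H0[OF A]]] by simp
  qed (use CF_hom CF_G CF_H sus_obs hull_obs inc_hom prj_hom in auto)
qed

text \<open>A stable morphism is a coset of maps, so the image of the coset is available without
  choosing a representative.\<close>

definition F1 :: "('o, 'm set) arr \<Rightarrow> ('o, 'm set) arr" where
  "F1 k = Arr (G0 (asrc k)) (G0 (atgt k)) (G1 ` coef k)"

lemma projective_G: assumes "projective C CF P" shows "projective C CF (G0 P)"
proof -
  have P: "P \<in> obs C" using assms unfolding projective_def by simp
  have "\<exists>h\<in>hom C (G0 P) (src C q). q \<cdot> h = f" if iq: "(i, q) \<in> CF" and f0: "f \<in> hom C (G0 P) (tgt C q)" for i q f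
  proof -
  obtain A B E where i: "i \<in> hom C A B" and q: "q \<in> hom C B E" using CF_hom[OF iq] by blast
  have f: "f \<in> hom C (G0 P) E" using f0 homD[OF q] by simp
  have "H1 f \<in> hom C P (tgt C (H1 q))" using H1'(2)[OF f P] homD[OF H1[OF q]] by simp
  then obtain h where "h \<in> hom C P (src C (H1 q))" "H1 q \<cdot> h = H1 f"
    using assms CF_H[OF iq] unfolding projective_def by blast
  then have h: "h \<in> hom C P (H0 B)" "H1 q \<cdot> h = H1 f" using homD[OF H1[OF q]] by simp_all
  have "B \<in> obs C" using q hom_obs by blast
  then have "G1 h \<in> hom C (G0 P) (src C q)" using G1'(1)[OF h(1)] homD[OF q] by simp
  moreover have "q \<cdot> G1 h = f" using G1_cmp[OF h(1) H1[OF q]] G1_H1[OF q] G1_H1[OF f] h by simp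
  ultimately show ?thesis by blast
  qed
  then show ?thesis using G0[OF P] unfolding projective_def by blast
qed

lemma injective_G: assumes "injective C CF P" shows "injective C CF (G0 P)"
proof -
  have P: "P \<in> obs C" using assms unfolding injective_def by simp
  have "\<exists>h\<in>hom C (tgt C i) (G0 P). h \<cdot> i = f" if iq: "(i, q) \<in> CF" and f0: "f \<in> hom C (src C i) (G0 P)" for i q f
  proof -
  obtain A B E where i: "i \<in> hom C A B" and q: "q \<in> hom C B E" using CF_hom[OF iq] by blast
  have f: "f \<in> hom C A (G0 P)" using f0 homD[OF i] by simp
  have "H1 f \<in> hom C (src C (H1 i)) P" using H1'(1)[OF f P] homD[OF H1[OF i]] by simp
  then obtain h where "h \<in> hom C (tgt C (H1 i)) P" "h \<cdot> H1 i = H1 f"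
    using assms CF_H[OF iq] unfolding injective_def by blast
  then have h: "h \<in> hom C (H0 B) P" "h \<cdot> H1 i = H1 f" using homD[OF H1[OF i]] by simp_all
  have "B \<in> obs C" using q hom_obs by blast
  then have "G1 h \<in> hom C (tgt C i) (G0 P)" using G1'(2)[OF h(1)] homD[OF i] by simp
  moreover have "G1 h \<cdot> i = f" using G1_cmp[OF H1[OF i] h(1)] G1_H1[OF i] G1_H1[OF f] h by simp
  ultimately show ?thesis by blast
  qed
  then show ?thesis using G0[OF P] unfolding injective_def by blast
qed

lemma stably_zero_G: assumes "sz f" "f \<in> hom C A B" shows "sz (G1 f)"
proof -
  obtain P a b where *: "projinj C CF P" "a \<in> hom C A P" "b \<in> hom C P B" "f = b \<cdot> a"
    using stably_zeroE[OF assms] .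
  have "projinj C CF (G0 P)" using * projective_G injective_G unfolding projinj_def by blast
  then show ?thesis using stably_zeroI[OF _ G1[OF *(2)] G1[OF *(3)]] G1_cmp[OF *(2,3)] *(4) by simp
qed

lemma F1_cls: assumes f: "f \<in> hom C A B" shows "F1 \<lbrakk>f\<rbrakk> = \<lbrakk>G1 f\<rbrakk>"
proof -
  interpret inv: strict_triangle_iso C CF H0 G0 H1 G1 T by (rule inverse_triangle)
  have o: "A \<in> obs C" "B \<in> obs C" using f hom_obs by blast+
  have "G1 ` coef \<lbrakk>f\<rbrakk> = coef \<lbrakk>G1 f\<rbrakk>"
  proof
    show "G1 ` coef \<lbrakk>f\<rbrakk> \<subseteq> coef \<lbrakk>G1 f\<rbrakk>"
      using coef_cls[OF f] coef_cls[OF G1[OF f]] G1_pls[OF _ f] stably_zero_G G1 by fastforce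
    show "coef \<lbrakk>G1 f\<rbrakk> \<subseteq> G1 ` coef \<lbrakk>f\<rbrakk>"
    proof
      fix x assume "x \<in> coef \<lbrakk>G1 f\<rbrakk>"
      then obtain h where h: "h \<in> hom C (G0 A) (G0 B)" "sz h" "x = G1 f \<oplus> h" using coef_cls[OF G1[OF f]] by auto
      have h': "H1 h \<in> hom C A B" using H1'(3)[OF h(1) o] .
      have "f \<oplus> H1 h \<in> coef \<lbrakk>f\<rbrakk>" using coef_cls[OF f] h' inv.stably_zero_G[OF h(2,1)] by blast
      moreover have "G1 (f \<oplus> H1 h) = x" using G1_pls[OF h' f] G1_H1[OF h(1)] h by simp
      ultimately show "x \<in> G1 ` coef \<lbrakk>f\<rbrakk>" by blast
    qed
  qed
  then show ?thesis unfolding F1_def using homD[OF f] homD[OF G1[OF f]] by (intro arr.expand) simp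
qed

lemma stable_strict_iso: "strict_iso D G0 H0 F1 (strict_triangle_iso.F1 H0 H1)"
proof -
  interpret inv: strict_triangle_iso C CF H0 G0 H1 G1 T by (rule inverse_triangle)
  interpret S: preadditive D by (rule stable_preadditive)
  show ?thesis
  proof unfold_locales
    fix k l A B E assume "k \<in> hom D A B"
    then obtain f where f: "f \<in> hom C A B" "k = \<lbrakk>f\<rbrakk>" using stable_homE by blast
    show "F1 k \<in> hom D (G0 A) (G0 B)" "inv.F1 k \<in> hom D (H0 A) (H0 B)"
      using f F1_cls[OF f(1)] inv.F1_cls[OF f(1)] G1 H1 by auto
    show "inv.F1 (F1 k) = k" "F1 (inv.F1 k) = k"
      using f F1_cls[OF f(1)] inv.F1_cls[OF f(1)] F1_cls[OF H1[OF f(1)]] inv.F1_cls[OF G1[OF f(1)]]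
        H1_G1[OF f(1)] G1_H1[OF f(1)] by simp_all
    {
      assume "l \<in> hom D B E"
      then obtain g where g: "g \<in> hom C B E" "l = \<lbrakk>g\<rbrakk>" using stable_homE by blast
      show "F1 (cmp D l k) = cmp D (F1 l) (F1 k)"
        using f g stable_cmp[OF f(1) g(1)] F1_cls[OF f(1)] F1_cls[OF g(1)] F1_cls[OF comp_hom[OF f(1) g(1)]]
          stable_cmp[OF G1[OF f(1)] G1[OF g(1)]] G1_cmp[OF f(1) g(1)] by simp
    }
    assume "l \<in> hom D A B"
    then obtain g where g: "g \<in> hom C A B" "l = \<lbrakk>g\<rbrakk>" using stable_homE by blast
    show "F1 (pls D l k) = pls D (F1 l) (F1 k)"
      using f g stable_pls[OF f(1) g(1)] F1_cls[OF f(1)] F1_cls[OF g(1)] F1_cls[OF plus_hom[OF g(1) f(1)]]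
        stable_pls[OF G1[OF f(1)] G1[OF g(1)]] G1_pls[OF f(1) g(1)] by simp
  next
    fix A assume A: "A \<in> obs D"
    then show "F1 (idn D A) = idn D (G0 A)"
      using F1_cls[OF id_hom] G1_idn by (simp add: stable_idn)
  qed (use G0 H0 G0_H0 H0_G0 in auto)
qed

lemma F1_hom: "k \<in> hom D A B \<Longrightarrow> F1 k \<in> hom D (G0 A) (G0 B)"
  using strict_iso.G1[OF stable_strict_iso] .

text \<open>\<open>shift_mor\<close> collects every completion of every representative. Applied to G
  and to its inverse, this puts the completions for A, B in bijection with those for their
  images.\<close>

lemma shift_fillers:
  assumes A: "A \<in> obs C" and B: "B \<in> obs C" and S: "S \<subseteq> hom C A B"
    and h: "h \<in> hom C (sus T A) (sus T B)" and f: "f \<in> S"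
    and k: "k \<in> hom C (inj_hull T A) (inj_hull T B)" "k \<cdot> inc T A = inc T B \<cdot> f" "h \<cdot> prj T A = prj T B \<cdot> k"
  shows "G1 h \<in> {h \<in> hom C (sus T (G0 A)) (sus T (G0 B)). \<exists>f\<in>G1 ` S.
    \<exists>k\<in>hom C (inj_hull T (G0 A)) (inj_hull T (G0 B)).
      k \<cdot> inc T (G0 A) = inc T (G0 B) \<cdot> f \<and> h \<cdot> prj T (G0 A) = prj T (G0 B) \<cdot> k}"
proof -
  have f': "f \<in> hom C A B" using f S by blast
  have "G1 k \<cdot> inc T (G0 A) = inc T (G0 B) \<cdot> G1 f"
    using G1_cmp[OF inc_hom[OF A] k(1)] G1_cmp[OF f' inc_hom[OF B]] k(2) inc_G A B by simp
  moreover have "G1 h \<cdot> prj T (G0 A) = prj T (G0 B) \<cdot> G1 k"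
    using G1_cmp[OF prj_hom[OF A] h] G1_cmp[OF k(1) prj_hom[OF B]] k(3) prj_G A B by simp
  moreover have "G1 h \<in> hom C (sus T (G0 A)) (sus T (G0 B))" using G1[OF h] sus_G A B by simp
  moreover have "G1 k \<in> hom C (inj_hull T (G0 A)) (inj_hull T (G0 B))" using G1[OF k(1)] hull_G A B by simp
  ultimately show ?thesis using f by blast
qed

lemma F1_shift: assumes "\<phi> \<in> mors D" shows "F1 (shift_mor C CF T \<phi>) = shift_mor C CF T (F1 \<phi>)"
proof -
  interpret inv: strict_triangle_iso C CF H0 G0 H1 G1 T by (rule inverse_triangle)
  obtain f where f0: "f \<in> mors C" "\<phi> = \<lbrakk>f\<rbrakk>" using assms unfolding stable_cat_def by auto
  define A B where "A = asrc \<phi>" and "B = atgt \<phi>"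
  have f: "f \<in> hom C A B" using f0 mors_hom A_def B_def by simp
  have o: "A \<in> obs C" "B \<in> obs C" using f hom_obs by blast+
  define S where "S = coef \<phi>"
  have S: "S \<subseteq> hom C A B" unfolding S_def f0 using cls_coef_hom[OF f] by blast
  define W where "W = (\<lambda>A B S. {h \<in> hom C (sus T A) (sus T B).
        \<exists>f\<in>S. \<exists>k\<in>hom C (inj_hull T A) (inj_hull T B).
          cmp C k (inc T A) = cmp C (inc T B) f \<and> cmp C h (prj T A) = cmp C (prj T B) k})"
  have sh: "shift_mor C CF T \<psi> = Arr (sus T (asrc \<psi>)) (sus T (atgt \<psi>))
    (\<Union>h\<in>W (asrc \<psi>) (atgt \<psi>) (coef \<psi>). coef \<lbrakk>h\<rbrakk>)" for \<psi>
    unfolding shift_mor_def W_def Let_def ..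
  have W1: "G1 ` W A B S \<subseteq> W (G0 A) (G0 B) (G1 ` S)"
    using shift_fillers[OF o S] unfolding W_def by blast
  have "G1 ` S \<subseteq> hom C (G0 A) (G0 B)" using S G1 by blast
  then have "H1 ` W (G0 A) (G0 B) (G1 ` S) \<subseteq> W (H0 (G0 A)) (H0 (G0 B)) (H1 ` G1 ` S)"
    using inv.shift_fillers[OF G0[OF o(1)] G0[OF o(2)], of "G1 ` S"] unfolding W_def by blast
  moreover have "H1 ` G1 ` S = S" using S H1_G1 by (force simp: image_image)
  ultimately have W2: "H1 ` W (G0 A) (G0 B) (G1 ` S) \<subseteq> W A B S" using H0_G0 o by simp
  have W3: "W (G0 A) (G0 B) (G1 ` S) \<subseteq> G1 ` W A B S"
  proof
    fix h assume h: "h \<in> W (G0 A) (G0 B) (G1 ` S)"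
    then have "G1 (H1 h) = h" using G1_H1 unfolding W_def by blast
    then show "h \<in> G1 ` W A B S" using W2 h by (metis image_eqI subsetD)
  qed
  have W: "W (G0 A) (G0 B) (G1 ` S) = G1 ` W A B S" using W1 W3 by blast
  have "G1 ` coef \<lbrakk>h\<rbrakk> = coef \<lbrakk>G1 h\<rbrakk>" if "h \<in> W A B S" for h
  proof -
    have "h \<in> hom C (sus T A) (sus T B)" using that unfolding W_def by blast
    then show ?thesis using F1_cls unfolding F1_def by (metis arr.sel(3))
  qed
  then have "G1 ` (\<Union>h\<in>W A B S. coef \<lbrakk>h\<rbrakk>) = (\<Union>h\<in>G1 ` W A B S. coef \<lbrakk>h\<rbrakk>)" by (simp add: image_UN)
  then show ?thesis
    unfolding sh using W sus_G o unfolding F1_def S_def[symmetric] A_def[symmetric] B_def[symmetric] arr.sel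
    by simp
qed

lemma standard_triangle_G:
  assumes "standard_triangle C CF T (\<phi>, \<psi>, \<omega>)"
  shows "standard_triangle C CF T (F1 \<phi>, F1 \<psi>, F1 \<omega>)"
proof -
  obtain X Y Z u v w k where o: "X \<in> obs C" "Y \<in> obs C" "Z \<in> obs C" and u: "u \<in> hom C X Y"
    and v: "v \<in> hom C Y Z" and w: "w \<in> hom C Z (sus T X)" and k: "k \<in> hom C (inj_hull T X) Z"
    and cf: "(v, w) \<in> CF" and e: "v \<cdot> u = k \<cdot> inc T X" "w \<cdot> k = prj T X"
    and t: "\<phi> = \<lbrakk>u\<rbrakk>" "\<psi> = \<lbrakk>v\<rbrakk>" "\<omega> = \<lbrakk>w\<rbrakk>"
    using assms unfolding standard_triangle_def by auto
  have "G1 v \<cdot> G1 u = G1 k \<cdot> inc T (G0 X)" "G1 w \<cdot> G1 k = prj T (G0 X)"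
    using G1_cmp[OF u v] G1_cmp[OF inc_hom[OF o(1)] k] G1_cmp[OF k w] e inc_G[OF o(1)] prj_G[OF o(1)] by simp_all
  moreover have "G1 w \<in> hom C (G0 Z) (sus T (G0 X))" using G1[OF w] sus_G[OF o(1)] by simp
  moreover have "G1 k \<in> hom C (inj_hull T (G0 X)) (G0 Z)" using G1[OF k] hull_G[OF o(1)] by simp
  ultimately show ?thesis
    unfolding standard_triangle_def
    using G0[OF o(1)] G0[OF o(2)] G0[OF o(3)] G1[OF u] G1[OF v] CF_G[OF cf] t F1_cls[OF u] F1_cls[OF v] F1_cls[OF w]
    by metis
qed

lemma shift_hom_ex: "k \<in> mors D \<Longrightarrow> F1 k \<in> mors D"
  using F1_hom unfolding hom_def by blast

text \<open>Stated for arbitrary sets of coefficients because it is applied to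
  \<open>shift_mor\<close>, a union of classes about which \<open>shift_mor_sub\<close> records only
  source and target.\<close>

lemma F1_cmp_raw:
  assumes "coef k \<subseteq> hom C A B" "coef l \<subseteq> hom C B E"
  shows "F1 (cmp D l k) = cmp D (F1 l) (F1 k)"
proof -
  have "G1 ` coef \<lbrakk>g \<cdot> f\<rbrakk> = coef \<lbrakk>G1 g \<cdot> G1 f\<rbrakk>" if "g \<in> coef l" "f \<in> coef k" for g f
  proof -
    have fg: "f \<in> hom C A B" "g \<in> hom C B E" using that assms by blast+
    show ?thesis using F1_cls[OF comp_hom[OF fg]] G1_cmp[OF fg] unfolding F1_def by (metis arr.sel(3))
  qed
  then have e: "G1 ` (\<Union>g\<in>coef l. \<Union>f\<in>coef k. coef \<lbrakk>g \<cdot> f\<rbrakk>) =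
      (\<Union>g\<in>coef l. \<Union>f\<in>coef k. coef \<lbrakk>G1 g \<cdot> G1 f\<rbrakk>)"
    unfolding image_UN by (intro SUP_cong refl)
  have "cmp D (F1 l) (F1 k) = Arr (G0 (asrc k)) (G0 (atgt l))
      (\<Union>g\<in>coef l. \<Union>f\<in>coef k. coef \<lbrakk>G1 g \<cdot> G1 f\<rbrakk>)"
    unfolding F1_def stable_cat_def by simp
  moreover have "F1 (cmp D l k) = Arr (G0 (asrc k)) (G0 (atgt l))
      (G1 ` (\<Union>g\<in>coef l. \<Union>f\<in>coef k. coef \<lbrakk>g \<cdot> f\<rbrakk>))"
    unfolding F1_def stable_cat_def by (simp only: arr.sel addcat.simps)
  ultimately show ?thesis by (simp only: e)
qed

lemma shift_mor_sub: "coef (shift_mor C CF T \<alpha>) \<subseteq> hom C (sus T (asrc \<alpha>)) (sus T (atgt \<alpha>))"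
proof
  fix x assume "x \<in> coef (shift_mor C CF T \<alpha>)"
  then obtain h where "h \<in> hom C (sus T (asrc \<alpha>)) (sus T (atgt \<alpha>))" "x \<in> coef \<lbrakk>h\<rbrakk>"
    unfolding shift_mor_def Let_def arr.sel by blast
  then show "x \<in> hom C (sus T (asrc \<alpha>)) (sus T (atgt \<alpha>))" using cls_coef_hom by blast
qed

lemma distinguished_G:
  assumes "distinguished C CF T (k, l, m)"
  shows "distinguished C CF T (F1 k, F1 l, F1 m)"
proof -
  interpret S: preadditive D by (rule stable_preadditive)
  interpret SI: strict_iso D G0 H0 F1 "strict_triangle_iso.F1 H0 H1" by (rule stable_strict_iso)
  obtain k' l' m' a b c where k: "k \<in> mors D" and l: "l \<in> hom D (atgt k) (atgt l)"
    and m: "m \<in> hom D (atgt l) (sus T (asrc k))" and st: "standard_triangle C CF T (k', l', m')"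
    and a: "a \<in> hom D (asrc k) (asrc k')" and b: "b \<in> hom D (atgt k) (atgt k')"
    and c: "c \<in> hom D (atgt l) (atgt l')" and iso: "is_iso D a" "is_iso D b" "is_iso D c"
    and sq: "cmp D b k = cmp D k' a" "cmp D c l = cmp D l' b"
      "cmp D (shift_mor C CF T a) m = cmp D m' c"
    using assms(1) unfolding distinguished_def Let_def prod.case by blast
  have sel: "asrc (F1 \<alpha>) = G0 (asrc \<alpha>)" "atgt (F1 \<alpha>) = G0 (atgt \<alpha>)" for \<alpha> unfolding F1_def by simp_all
  have hd: "asrc \<alpha> = A" "atgt \<alpha> = B" if "\<alpha> \<in> hom D A B" for \<alpha> A B
    using that unfolding hom_def stable_cat_def by auto
  have kh: "k \<in> hom D (asrc k) (atgt k)" using k unfolding hom_def stable_cat_def by simp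
  have oX: "asrc k \<in> obs C" using S.hom_obs[OF kh] by simp
  obtain X Y Z u v w where u: "X \<in> obs C" "u \<in> hom C X Y" "v \<in> hom C Y Z" "w \<in> hom C Z (sus T X)"
    and t: "k' = \<lbrakk>u\<rbrakk>" "l' = \<lbrakk>v\<rbrakk>" "m' = \<lbrakk>w\<rbrakk>"
    using st unfolding standard_triangle_def by auto
  have k': "k' \<in> hom D X Y" and l': "l' \<in> hom D Y Z" and m': "m' \<in> hom D Z (sus T X)"
    unfolding t using u by blast+
  have a1: "a \<in> hom D (asrc k) X" and b1: "b \<in> hom D (atgt k) Y" and c1: "c \<in> hom D (atgt l) Z"
    using a b c hd[OF k'] hd[OF l'] by simp_all
  have am: "a \<in> mors D" using a S.homD by blast
  have mc: "coef m \<subseteq> hom C (atgt l) (sus T (asrc k))"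
  proof -
    obtain w' where "w' \<in> hom C (atgt l) (sus T (asrc k))" "m = \<lbrakk>w'\<rbrakk>" using stable_homE[OF m] .
    then show ?thesis using cls_coef_hom by blast
  qed
  have ok: "G0 (sus T (asrc k)) = sus T (G0 (asrc k))" using sus_G[OF oX] by simp
  have 1: "cmp D (F1 b) (F1 k) = cmp D (F1 k') (F1 a)"
    using SI.G1_cmp[OF kh b1] SI.G1_cmp[OF a1 k'] sq(1) by simp
  have 2: "cmp D (F1 c) (F1 l) = cmp D (F1 l') (F1 b)"
    using SI.G1_cmp[OF l c1] SI.G1_cmp[OF b1 l'] sq(2) by simp
  have 3: "cmp D (shift_mor C CF T (F1 a)) (F1 m) = cmp D (F1 m') (F1 c)"
    using F1_cmp_raw[OF mc shift_mor_sub[of a, unfolded hd[OF a1]]] SI.G1_cmp[OF c1 m'] sq(3) F1_shift[OF am] by simp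
  have h: "F1 k \<in> mors D" "F1 l \<in> hom D (atgt (F1 k)) (atgt (F1 l))"
    "F1 m \<in> hom D (atgt (F1 l)) (sus T (asrc (F1 k)))"
    "F1 a \<in> hom D (asrc (F1 k)) (asrc (F1 k'))" "F1 b \<in> hom D (atgt (F1 k)) (atgt (F1 k'))"
    "F1 c \<in> hom D (atgt (F1 l)) (atgt (F1 l'))"
    using shift_hom_ex[OF k] F1_hom[OF l] F1_hom[OF m] ok F1_hom[OF a] F1_hom[OF b] F1_hom[OF c]
    unfolding sel by simp_all
  have i: "is_iso D (F1 a)" "is_iso D (F1 b)" "is_iso D (F1 c)"
    using SI.G1_is_iso[OF iso(1) a] SI.G1_is_iso[OF iso(2) b] SI.G1_is_iso[OF iso(3) c] by simp_all
  show ?thesis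
    unfolding distinguished_def Let_def prod.case
    using h i 1 2 3 standard_triangle_G[OF st] by blast
qed

theorem strictly_triangulated:
  "strictly_triangulated_automorphism C CF T G0 F1"
proof -
  interpret S: preadditive D by (rule stable_preadditive)
  interpret SI: strict_iso D G0 H0 F1 "strict_triangle_iso.F1 H0 H1" by (rule stable_strict_iso)
  interpret inv: strict_triangle_iso C CF H0 G0 H1 G1 T by (rule inverse_triangle)
  have m: "\<phi> \<in> hom D (src D \<phi>) (tgt D \<phi>)" if "\<phi> \<in> mors D" for \<phi> using S.mors_hom[OF that] .
  have "additive_automorphism D G0 F1"
    unfolding additive_automorphism_def
  proof (intro conjI ballI impI)
    show "bij_betw G0 (obs D) (obs D)"
      by (rule bij_betw_byWitness[where f' = H0]) (use SI.H0_G0 SI.G0_H0 SI.G0 SI.H0 in auto)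
    show "bij_betw F1 (mors D) (mors D)"
      by (rule bij_betw_byWitness[where f' = inv.F1])
        (use SI.H1_G1[OF m] SI.G1_H1[OF m] shift_hom_ex inv.shift_hom_ex in auto)
    show "F1 (idn D A) = idn D (G0 A)" if "A \<in> obs D" for A using SI.G1_idn that by blast
  next
    fix \<phi> assume \<phi>: "\<phi> \<in> mors D"
    show "src D (F1 \<phi>) = G0 (src D \<phi>)" "tgt D (F1 \<phi>) = G0 (tgt D \<phi>)"
      using S.homD[OF F1_hom[OF m[OF \<phi>]]] by simp_all
    fix \<psi> assume \<psi>: "\<psi> \<in> mors D"
    show "F1 (cmp D \<psi> \<phi>) = cmp D (F1 \<psi>) (F1 \<phi>)" if "tgt D \<phi> = src D \<psi>"
      using SI.G1_cmp[OF m[OF \<phi>], of \<psi>] m[OF \<psi>] that by simp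
    show "F1 (pls D \<psi> \<phi>) = pls D (F1 \<psi>) (F1 \<phi>)" if "src D \<phi> = src D \<psi> \<and> tgt D \<phi> = tgt D \<psi>"
      using SI.G1_pls[OF m[OF \<phi>], of \<psi>] m[OF \<psi>] that by simp
  qed
  then show ?thesis
    unfolding strictly_triangulated_automorphism_def
    using sus_G F1_shift distinguished_G by auto
qed

end

section \<open>Points of the strip\<close>

text \<open>
  In the coordinates E(a,b) the orbit of a point is the nondecreasing sequence a, b, a + 2 pi,
  b + 2 pi, \<dots>, and sigma shifts the index.
\<close>

definition zz :: "real \<Rightarrow> real \<Rightarrow> int \<Rightarrow> real" where
  "zz a b i = (if even i then a else b) + 2 * pi * of_int (i div 2)"

text \<open>The coordinates (a,b) for which E(a,b) is defined, that is, for which (a, b - pi) lies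
  in the strip.\<close>

definition okp :: "real \<Rightarrow> real \<Rightarrow> bool" where
  "okp a b \<longleftrightarrow> a \<le> b \<and> b \<le> a + 2 * pi"

text \<open>The least power of sigma that carries (c,d) above (a,b), in E-coordinates. It is built
  from comparisons of endpoints and translations by 2 pi alone, which is why increasing maps
  commuting with that period preserve it.\<close>

definition dg :: "real \<Rightarrow> real \<Rightarrow> real \<Rightarrow> real \<Rightarrow> int" where
  "dg a b c d = (LEAST i. a \<le> zz c d i \<and> b \<le> zz c d (i + 1))"

lemma zz_0 [simp]: "zz a b 0 = a" and zz_1 [simp]: "zz a b 1 = b"
  by (simp_all add: zz_def)

lemma zz_minus_1 [simp]: "zz a b (-1) = b - 2 * pi"
  by (simp add: zz_def)

lemma zz_add_even: "even j \<Longrightarrow> zz a b (i + j) = zz a b i + pi * of_int j"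
  by (auto simp: zz_def algebra_simps elim!: evenE)

lemma zz_add_2: "zz a b (i + 2) = zz a b i + 2 * pi"
  using zz_add_even[of 2 a b i] by simp

lemma zz_even: "even i \<Longrightarrow> zz a b i = a + pi * of_int i"
  using zz_add_even[of i a b 0] by simp

lemma zz_odd: "odd i \<Longrightarrow> zz a b i = b + pi * of_int (i - 1)"
  using zz_add_even[of "i - 1" a b 1] by simp

lemma zz_zz: "zz (zz a b k) (zz a b (k + 1)) i = zz a b (k + i)"
  using zz_add_even[of i a b k] zz_add_even[of "i - 1" a b "k + 1"] zz_even[of i] zz_odd[of i]
  by (cases "even i") simp_all

lemma zz_step: "okp a b \<Longrightarrow> zz a b i \<le> zz a b (i + 1)"
  using zz_even[of i a b] zz_odd[of i a b] zz_even[of "i + 1" a b] zz_odd[of "i + 1" a b] unfolding okp_def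
  by (cases "even i") (simp_all add: algebra_simps)

lemma zz_mono: assumes "okp a b" "i \<le> j" shows "zz a b i \<le> zz a b j"
  using assms(2)
proof (induction j rule: int_ge_induct)
  case (step j)
  then show ?case using zz_step[OF assms(1), of j] by linarith
qed simp

lemma okp_zz: "okp a b \<Longrightarrow> okp (zz a b k) (zz a b (k + 1))"
  using zz_step[of a b k] zz_step[of a b "k + 1"] zz_add_2[of a b k] unfolding okp_def by (simp add: algebra_simps)

text \<open>The integers are not well-ordered. The omitted element k0 bounds the upward closed set
  from below, so the least element is found by counting up from k0.\<close>

lemma Least_int_le_iff:
  fixes P :: "int \<Rightarrow> bool"
  assumes up: "\<And>i j. P i \<Longrightarrow> i \<le> j \<Longrightarrow> P j" and "P i0" and "\<not> P k0"
  shows "(LEAST i. P i) \<le> j \<longleftrightarrow> P j"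
proof -
  have "k0 < i0" using assms by (meson not_le)
  then have "\<exists>n::nat. P (k0 + int n)" using assms(2) by (intro exI[of _ "nat (i0 - k0)"]) simp
  then obtain n where n: "P (k0 + int n)" and min: "\<And>m. m < n \<Longrightarrow> \<not> P (k0 + int m)"
    using exists_least_iff[of "\<lambda>n. P (k0 + int n)"] by blast
  have least: "k0 + int n \<le> i" if "P i" for i
  proof (rule ccontr)
    assume "\<not> k0 + int n \<le> i"
    moreover have "k0 < i" using that assms by (meson not_le)
    ultimately have "P (k0 + int (nat (i - k0)))" "nat (i - k0) < n" using that by auto
    then show False using min by blast
  qed
  have eq: "(LEAST i. P i) = k0 + int n" by (rule Least_equality) (use n least in auto)
  show ?thesis unfolding eq using up[OF n, of j] least[of j] by blast
qed

text \<open>The working form of the definition: identities between degrees are proved below by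
  comparing, with \<open>dg_eqI\<close>, the integers that bound them.\<close>

lemma dg_le_iff:
  assumes "okp c d"
  shows "dg a b c d \<le> i \<longleftrightarrow> a \<le> zz c d i \<and> b \<le> zz c d (i + 1)"
proof -
  obtain n :: nat where "max (max (a - c) (b - d)) (c - a) < real n" using reals_Archimedean2 by blast
  then have n: "a - c < real n" "b - d < real n" "c - a < real n" by simp_all
  let ?P = "\<lambda>i. a \<le> zz c d i \<and> b \<le> zz c d (i + 1)"
  have pin: "real n \<le> pi * (2 * real n)"
    using pi_gt3 mult_right_mono[of 1 "2 * pi" "real n"] by simp
  have "zz c d (2 * int n) = c + pi * (2 * real n)" "zz c d (2 * int n + 1) = d + pi * (2 * real n)"
    "zz c d (- 2 * int n) = c - pi * (2 * real n)"
    using zz_even[of "2 * int n" c d] zz_odd[of "2 * int n + 1" c d] zz_even[of "- 2 * int n" c d] by simp_all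
  then have P: "?P (2 * int n)" "\<not> ?P (- 2 * int n)" using n pin by linarith+
  have up: "?P j" if "?P i" "i \<le> j" for i j
    using that zz_mono[OF assms that(2)] zz_mono[OF assms, of "i + 1" "j + 1"] by linarith
  show ?thesis unfolding dg_def by (rule Least_int_le_iff[where P = ?P, OF up P])
qed

lemma dg_eqI: "(\<And>i. x \<le> i \<longleftrightarrow> y \<le> i) \<Longrightarrow> x = (y :: int)"
  by (meson order_antisym order_refl)

text \<open>Apart from translations by multiples of 2 pi, an odd shift k exchanges the two
  inequalities.\<close>

lemma zz_compare_shift:
  "zz a b k \<le> zz c d m \<and> zz a b (k + 1) \<le> zz c d (m + 1) \<longleftrightarrow>
   a \<le> zz c d (m - k) \<and> b \<le> zz c d (m - k + 1)"
proof (cases "even k")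
  case True
  have "m - k + k = m" "m - k + 1 + k = m + 1" by auto
  then show ?thesis
    using zz_add_even[OF True, of c d "m - k"] zz_add_even[OF True, of c d "m - k + 1"]
      zz_even[OF True, of a b] zz_odd[of "k + 1" a b] True by auto
next
  case False
  have "even (k - 1)" "even (k + 1)" "m - k + 1 + (k - 1) = m" "m - k + (k + 1) = m + 1" using False by auto
  then show ?thesis
    using zz_add_even[of "k - 1" c d "m - k + 1"] zz_add_even[of "k + 1" c d "m - k"]
      zz_odd[OF False, of a b] zz_even[of "k + 1" a b] by auto
qed

lemma dg_shift:
  assumes "okp c d"
  shows "dg (zz a b k) (zz a b (k + 1)) (zz c d l) (zz c d (l + 1)) = dg a b c d + k - l"
proof (rule dg_eqI)
  fix i
  have "dg (zz a b k) (zz a b (k + 1)) (zz c d l) (zz c d (l + 1)) \<le> i \<longleftrightarrow>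
    zz a b k \<le> zz c d (l + i) \<and> zz a b (k + 1) \<le> zz c d (l + i + 1)"
    using dg_le_iff[OF okp_zz[OF assms]] zz_zz by (simp add: add.assoc)
  also have "\<dots> \<longleftrightarrow> dg a b c d \<le> l + i - k" using zz_compare_shift dg_le_iff[OF assms] by simp
  finally show "dg (zz a b k) (zz a b (k + 1)) (zz c d l) (zz c d (l + 1)) \<le> i \<longleftrightarrow> dg a b c d + k - l \<le> i"
    by auto
qed

lemma dg_self: assumes "okp a b" shows "dg a b a b = 0"
proof -
  have "dg a b a b \<le> 0" using dg_le_iff[OF assms] by simp
  moreover have "\<not> dg a b a b \<le> -1"
    using dg_le_iff[OF assms, of a b "-1"] assms pi_gt_zero unfolding okp_def by (simp, linarith)
  ultimately show ?thesis by linarith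
qed

lemma dg_triangle: assumes "okp c d" "okp e f" shows "dg a b e f \<le> dg a b c d + dg c d e f"
proof -
  let ?i = "dg a b c d" and ?j = "dg c d e f"
  have 1: "a \<le> zz c d ?i" "b \<le> zz c d (?i + 1)" using dg_le_iff[OF assms(1), of a b ?i] by auto
  have "c \<le> zz e f ?j" "d \<le> zz e f (?j + 1)" using dg_le_iff[OF assms(2), of c d ?j] by auto
  then have "zz c d ?i \<le> zz e f (?i + ?j) \<and> zz c d (?i + 1) \<le> zz e f (?i + ?j + 1)"
    using zz_compare_shift[of c d ?i e f "?i + ?j"] by simp
  then show ?thesis using 1 dg_le_iff[OF assms(2), of a b "?i + ?j"] by linarith
qed

lemma dg_antisym:
  assumes "okp a b" "okp c d" "dg a b c d + dg c d a b = 0"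
  shows "\<exists>i. a = zz c d i \<and> b = zz c d (i + 1)"
proof -
  let ?i = "dg a b c d"
  have 1: "a \<le> zz c d ?i" "b \<le> zz c d (?i + 1)" using dg_le_iff[OF assms(2), of a b ?i] by auto
  have "c \<le> zz a b (- ?i)" "d \<le> zz a b (- ?i + 1)" using dg_le_iff[OF assms(1), of c d "- ?i"] assms(3) by auto
  then have "zz c d ?i \<le> a \<and> zz c d (?i + 1) \<le> b"
    using zz_compare_shift[of c d ?i a b 0] by simp
  then show ?thesis using 1 by (intro exI[of _ ?i]) linarith
qed

text \<open>In the product order (a,b) is the meet of (b,b) and (a,a+2 pi), also after applying a
  power of sigma to all three, and a point lies below a meet iff it lies below both.\<close>

lemma dg_meet:
  assumes "okp a b"
  shows "dg v w a b = max (dg v w b b) (dg v w a (a + 2 * pi))"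
proof (rule dg_eqI)
  fix i
  have ok: "okp b b" "okp a (a + 2 * pi)" using pi_gt_zero by (simp_all add: okp_def)
  have "v \<le> zz a b i \<and> w \<le> zz a b (i + 1) \<longleftrightarrow>
    (v \<le> zz b b i \<and> w \<le> zz b b (i + 1)) \<and> (v \<le> zz a (a + 2 * pi) i \<and> w \<le> zz a (a + 2 * pi) (i + 1))"
    using assms unfolding okp_def zz_def
    by (cases "even i") (auto simp: algebra_simps elim!: evenE oddE)
  then show "dg v w a b \<le> i \<longleftrightarrow> max (dg v w b b) (dg v w a (a + 2 * pi)) \<le> i"
    unfolding max.bounded_iff dg_le_iff[OF assms] dg_le_iff[OF ok(1)] dg_le_iff[OF ok(2)] .
qed

text \<open>Dually, (b,a+2 pi) is the join of the same two points.\<close>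

lemma dg_join:
  assumes "okp a b" "okp c d"
  shows "dg b (a + 2 * pi) c d = max (dg b b c d) (dg a (a + 2 * pi) c d)"
proof (rule dg_eqI)
  fix i
  have "b \<le> zz c d i \<and> a + 2 * pi \<le> zz c d (i + 1) \<longleftrightarrow>
    (b \<le> zz c d i \<and> b \<le> zz c d (i + 1)) \<and> (a \<le> zz c d i \<and> a + 2 * pi \<le> zz c d (i + 1))"
    using assms(1) unfolding okp_def by auto
  then show "dg b (a + 2 * pi) c d \<le> i \<longleftrightarrow> max (dg b b c d) (dg a (a + 2 * pi) c d) \<le> i"
    unfolding max.bounded_iff dg_le_iff[OF assms(2)] .
qed

text \<open>The rise in degree when a map E(a,b) \<rightarrow> E(c,d) is forced through the cheaper
  of the two boundary points (b,b) and (a,a+2 pi).\<close>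

definition nudg :: "real \<Rightarrow> real \<Rightarrow> real \<Rightarrow> real \<Rightarrow> int" where
  "nudg a b c d = min (dg b b c d) (dg a (a + 2 * pi) c d) - dg a b c d"

text \<open>In the least degree i the point (c,d) has come to lie above (a,b). It lies above (b,b)
  iff its first coordinate reaches b, and above (a,a+2 pi) iff its second one reaches a+2 pi. If
  neither happens, the next degree is enough for (b,b).\<close>

lemma nudg_cases:
  assumes "okp a b" "okp c d"
  shows "nudg a b c d =
    (if \<exists>i. a \<le> zz c d i \<and> zz c d i < b \<and> b \<le> zz c d (i + 1) \<and> zz c d (i + 1) < a + 2 * pi then 1 else 0)"
proof -
  let ?i = "dg a b c d"
  have 1: "a \<le> zz c d ?i" "b \<le> zz c d (?i + 1)" using dg_le_iff[OF assms(2), of a b ?i] by auto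
  have m: "zz c d ?i \<le> zz c d (?i + 1)" using zz_step assms by blast
  have up: "dg b b c d \<le> ?i + 1"
    using dg_le_iff[OF assms(2), of b b "?i + 1"] 1 zz_step[OF assms(2), of "?i + 1"] by auto
  have "okp a b" using assms by blast
  then have lo: "?i \<le> dg b b c d" "?i \<le> dg a (a + 2 * pi) c d"
    using dg_le_iff[OF assms(2), of a b "dg b b c d"] dg_le_iff[OF assms(2), of b b "dg b b c d"]
      dg_le_iff[OF assms(2), of a b "dg a (a + 2 * pi) c d"]
      dg_le_iff[OF assms(2), of a "a + 2 * pi" "dg a (a + 2 * pi) c d"] unfolding okp_def by auto
  have b: "dg b b c d \<le> ?i \<longleftrightarrow> b \<le> zz c d ?i"
    using dg_le_iff[OF assms(2), of b b ?i] m by auto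
  have a: "dg a (a + 2 * pi) c d \<le> ?i \<longleftrightarrow> a + 2 * pi \<le> zz c d (?i + 1)"
    using dg_le_iff[OF assms(2), of a "a + 2 * pi" ?i] 1 by auto
  show ?thesis
  proof (cases "zz c d ?i < b \<and> zz c d (?i + 1) < a + 2 * pi")
    case True
    then have "nudg a b c d = 1" using a b lo up unfolding nudg_def by auto
    then show ?thesis using 1 True by auto
  next
    case False
    then have "nudg a b c d = 0" using a b lo unfolding nudg_def by auto
    \<comment> \<open>An interleaving index is necessarily the least degree: the term with index i -
      1 lies 2 pi below the one with index i + 1, hence below a.\<close>
    moreover have "\<not> (\<exists>i. a \<le> zz c d i \<and> zz c d i < b \<and> b \<le> zz c d (i + 1) \<and> zz c d (i + 1) < a + 2 * pi)"
    proof
      assume "\<exists>i. a \<le> zz c d i \<and> zz c d i < b \<and> b \<le> zz c d (i + 1) \<and> zz c d (i + 1) < a + 2 * pi"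
      then obtain i where i: "a \<le> zz c d i" "zz c d i < b" "b \<le> zz c d (i + 1)" "zz c d (i + 1) < a + 2 * pi" by blast
      have "?i \<le> i" using dg_le_iff[OF assms(2), of a b i] i by simp
      moreover have e: "i - 1 + 2 = i + 1" by simp
      have "zz c d (i - 1) < a" using i zz_add_2[of c d "i - 1"] unfolding e by linarith
      then have "\<not> ?i \<le> i - 1" using dg_le_iff[OF assms(2), of a b "i - 1"] by simp
      ultimately have "?i = i" by simp
      then show False using i False by simp
    qed
    ultimately show ?thesis by simp
  qed
qed

lemma nudg_triangle:
  assumes "okp c d" "okp e f"
  shows "nudg a b e f \<le> nudg a b c d + dg a b c d + dg c d e f - dg a b e f"
  using dg_triangle[OF assms, of b b] dg_triangle[OF assms, of a "a + 2 * pi"] unfolding nudg_def by linarith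

lemma sigma_simp: "sigma (x, y, e) = (y + pi, x + pi, \<not> e)"
  by (simp add: sigma_def)

lemma inv_sigma: "inv sigma (x, y, e) = (y - pi, x - pi, \<not> e)"
proof -
  have "inj sigma" by (auto simp: inj_def sigma_def)
  then have "inv sigma (sigma (y - pi, x - pi, \<not> e)) = (y - pi, x - pi, \<not> e)" by (rule inv_f_f)
  then show ?thesis by (simp add: sigma_simp)
qed

lemma sigma_pow_coord:
  "sigma_pow i (x, y, e) = (zz x (y + pi) i, zz x (y + pi) (i + 1) - pi, if even i then e else \<not> e)"
proof -
  have 1: "(sigma ^^ n) (x, y, e) = (zz x (y + pi) (int n), zz x (y + pi) (int n + 1) - pi, if even n then e else \<not> e)" for n
  proof (induction n)
    case (Suc n)
    then show ?case using zz_add_2[of x "y + pi" "int n"] by (simp add: sigma_simp algebra_simps)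
  qed simp
  have 2: "(inv sigma ^^ n) (x, y, e) = (zz x (y + pi) (- int n), zz x (y + pi) (- int n + 1) - pi, if even n then e else \<not> e)" for n
  proof (induction n)
    case (Suc n)
    have "- 1 - int n + 2 = 1 - int n" by simp
    then show ?case using Suc zz_add_2[of x "y + pi" "- 1 - int n"] by (simp add: inv_sigma algebra_simps)
  qed simp
  show ?thesis
  proof (cases "0 \<le> i")
    case True
    then show ?thesis using 1[of "nat i"] by (simp add: sigma_pow_def even_nat_iff)
  next
    case False
    then show ?thesis using 2[of "nat (- i)"] by (simp add: sigma_pow_def even_nat_iff)
  qed
qed

lemma sigma_pow_plus: "sigma_pow i (x, y, True) = (zz x (y + pi) i, zz x (y + pi) (i + 1) - pi, even i)"
  by (cases "even i") (simp_all add: sigma_pow_coord)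

lemma Ept_eq: "Ept a b = range (\<lambda>i. (zz a b i, zz a b (i + 1) - pi, even i))"
  unfolding Ept_def Mpt_def sigma_orbit_def by (simp add: sigma_pow_plus)

text \<open>The sign of a point records the parity of the power of sigma. So E(a,b) and E(b,a+2 pi)
  are different orbits, although isomorphic, and only translations by 2 pi identify
  coordinates.\<close>

lemma Ept_eq_iff: "Ept a b = Ept c d \<longleftrightarrow> (\<exists>m::int. c = a + 2 * pi * m \<and> d = b + 2 * pi * m)"
proof
  assume "Ept a b = Ept c d"
  moreover have "(c, d - pi, True) \<in> Ept c d" unfolding Ept_eq by (rule range_eqI[of _ _ 0]) simp
  ultimately have "(c, d - pi, True) \<in> Ept a b" by simp
  then obtain i where i: "(c, d - pi, True) = (zz a b i, zz a b (i + 1) - pi, even i)"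
    unfolding Ept_eq by blast
  then have "even i" by simp
  then obtain m where "i = 2 * m" by (auto elim: evenE)
  then show "\<exists>m::int. c = a + 2 * pi * m \<and> d = b + 2 * pi * m"
    using i zz_even[of i a b] zz_odd[of "i + 1" a b] by (intro exI[of _ m]) simp
next
  assume "\<exists>m::int. c = a + 2 * pi * m \<and> d = b + 2 * pi * m"
  then obtain m :: int where "c = a + 2 * pi * m" "d = b + 2 * pi * m" by blast
  then have m: "c = zz a b (2 * m)" "d = zz a b (2 * m + 1)"
    using zz_even[of "2 * m" a b] zz_odd[of "2 * m + 1" a b] by simp_all
  have "Ept c d = range ((\<lambda>i. (zz a b i, zz a b (i + 1) - pi, even i)) \<circ> (\<lambda>i. 2 * m + i))"
    unfolding Ept_eq m comp_def zz_zz by (simp add: algebra_simps)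
  also have "\<dots> = Ept a b"
    unfolding Ept_eq image_comp[symmetric] by (simp add: surj_plus)
  finally show "Ept a b = Ept c d" by simp
qed

lemma Ept_periodic: "Ept (a + 2 * pi * of_int m) (b + 2 * pi * of_int m) = Ept a b"
  using Ept_eq_iff by metis

lemma Xpi_eq: "Xpi = {Ept a b | a b. okp a b}"
proof
  show "Xpi \<subseteq> {Ept a b | a b. okp a b}"
  proof
    fix X assume "X \<in> Xpi"
    then obtain x y e where X: "X = sigma_orbit (x, y, e)" "\<bar>x - y\<bar> \<le> pi" unfolding Xpi_def strip_def by auto
    show "X \<in> {Ept a b | a b. okp a b}"
    proof (cases e)
      case True
      then have "X = Ept x (y + pi)" using X unfolding Ept_def Mpt_def by simp
      then show ?thesis using X(2) unfolding okp_def by (force simp: abs_le_iff)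
    next
      case False
      have "X = range ((\<lambda>i. sigma_pow i (x, y, e)) \<circ> (\<lambda>i. 1 + i))"
        using X unfolding sigma_orbit_def image_comp[symmetric] by (simp add: surj_plus)
      also have "(\<lambda>i. sigma_pow i (x, y, e)) \<circ> (\<lambda>i. 1 + i) = (\<lambda>i. sigma_pow i (y + pi, x + pi, True))"
      proof
        fix i
        have "zz (y + pi) (x + 2 * pi) i = zz x (y + pi) (1 + i)" "zz (y + pi) (x + 2 * pi) (i + 1) = zz x (y + pi) (1 + (i + 1))"
          using zz_zz[of x "y + pi" 1 i] zz_zz[of x "y + pi" 1 "i + 1"] zz_add_2[of x "y + pi" 0] by simp_all
        then show "((\<lambda>i. sigma_pow i (x, y, e)) \<circ> (\<lambda>i. 1 + i)) i = sigma_pow i (y + pi, x + pi, True)"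
          using False by (simp add: sigma_pow_coord algebra_simps)
      qed
      finally have "X = Ept (y + pi) (x + 2 * pi)" unfolding Ept_def Mpt_def sigma_orbit_def by (simp add: algebra_simps)
      then show ?thesis using X(2) unfolding okp_def by (force simp: abs_le_iff)
    qed
  qed
next
  show "{Ept a b | a b. okp a b} \<subseteq> Xpi"
  proof clarify
    fix a b assume "okp a b"
    then have "(a, b - pi, True) \<in> strip" unfolding okp_def strip_def by (auto simp: abs_le_iff)
    then show "Ept a b \<in> Xpi" unfolding Xpi_def Ept_def Mpt_def by blast
  qed
qed

lemma XpiE: assumes "X \<in> Xpi" obtains a b where "okp a b" "X = Ept a b"
  using assms unfolding Xpi_eq by blast

lemma Ept_Xpi: "okp a b \<Longrightarrow> Ept a b \<in> Xpi"
  unfolding Xpi_eq by blast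

lemma rep_Ept: "\<exists>k e. rep (Ept a b) = (zz a b k, zz a b (k + 1) - pi, e)"
proof -
  have "rep (Ept a b) \<in> Ept a b" unfolding rep_def by (rule someI_ex) (auto simp: Ept_eq)
  then show ?thesis unfolding Ept_eq by auto
qed

text \<open>\<open>rep\<close> picks an arbitrary element of each orbit; the shifts k, l, m that
  this causes in \<open>min_deg\<close> cancel in the cocycle.\<close>

lemma cocyc_Ept:
  assumes "okp a b" "okp c d" "okp e f"
  shows "cocyc (Ept a b) (Ept c d) (Ept e f) = dg a b c d + dg c d e f - dg a b e f"
proof -
  have md: "min_deg (Ept a b) (Ept c d) = dg a b c d + k - l"
    if "okp c d" "rep (Ept a b) = (zz a b k, zz a b (k + 1) - pi, e1)"
      "rep (Ept c d) = (zz c d l, zz c d (l + 1) - pi, e2)" for a b c d k l e1 e2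
    unfolding min_deg_def that pt_le_def using dg_shift[OF that(1), of a b k l]
    unfolding dg_def by (simp add: sigma_pow_coord)
  obtain k e1 where 1: "rep (Ept a b) = (zz a b k, zz a b (k + 1) - pi, e1)" using rep_Ept by blast
  obtain l e2 where 2: "rep (Ept c d) = (zz c d l, zz c d (l + 1) - pi, e2)" using rep_Ept by blast
  obtain m e3 where 3: "rep (Ept e f) = (zz e f m, zz e f (m + 1) - pi, e3)" using rep_Ept by blast
  show ?thesis
    unfolding cocyc_def md[OF assms(2) 1 2] md[OF assms(3) 2 3] md[OF assms(3) 1 3] by simp
qed

section \<open>Functions of orbits, hulls of points, and the action of homeomorphisms\<close>

definition onpt :: "(real \<Rightarrow> real \<Rightarrow> 'a) \<Rightarrow> pt set \<Rightarrow> 'a" where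
  "onpt f X = (case SOME (a, b). okp a b \<and> X = Ept a b of (a, b) \<Rightarrow> f a b)"

text \<open>By \<open>Ept_eq_iff\<close> the coordinates of an orbit are unique up to a common
  translation by 2 pi m, so a function with this period does not see the choice.\<close>

lemma onpt_Ept:
  assumes "okp a b" "\<And>m::int. f (a + 2 * pi * of_int m) (b + 2 * pi * of_int m) = f a b"
  shows "onpt f (Ept a b) = f a b"
proof -
  have "\<exists>c. case c of (c, d) \<Rightarrow> okp c d \<and> Ept a b = Ept c d" using assms(1) by blast
  from someI_ex[OF this] obtain c d where
    s: "(SOME (c, d). okp c d \<and> Ept a b = Ept c d) = (c, d)" and "Ept a b = Ept c d"
    by (cases "SOME (c, d). okp c d \<and> Ept a b = Ept c d") auto
  then obtain m :: int where "c = a + 2 * pi * of_int m" "d = b + 2 * pi * of_int m" using Ept_eq_iff by blast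
  then show ?thesis unfolding onpt_def s using assms(2) by simp
qed

text \<open>The hull of X is I1 X + I2 X, where X is the meet of I1 X and I2 X, and X[1] is their join.\<close>

definition I1pt :: "pt set \<Rightarrow> pt set" where "I1pt = onpt (\<lambda>a b. Ept b b)"
definition I2pt :: "pt set \<Rightarrow> pt set" where "I2pt = onpt (\<lambda>a b. Ept a (a + 2 * pi))"
definition shpt :: "pt set \<Rightarrow> pt set" where "shpt = onpt (\<lambda>a b. Ept b (a + 2 * pi))"
text \<open>The maps of the hull sequence are those of degree 0 between the chosen coordinates,
  which are multiples of the basic morphisms by powers of u. The four exponents vanish except for b
  = a or b = a+2 pi, where some basic morphism has negative degree.\<close>

definition e1pt :: "pt set \<Rightarrow> nat" where "e1pt = onpt (\<lambda>a b. nat (- dg a b b b))"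
definition e2pt :: "pt set \<Rightarrow> nat" where "e2pt = onpt (\<lambda>a b. nat (- dg a b a (a + 2 * pi)))"
definition r1pt :: "pt set \<Rightarrow> nat" where "r1pt = onpt (\<lambda>a b. nat (- dg b b b (a + 2 * pi)))"
definition r2pt :: "pt set \<Rightarrow> nat" where "r2pt = onpt (\<lambda>a b. nat (- dg a (a + 2 * pi) b (a + 2 * pi)))"
definition hmpt :: "(real \<Rightarrow> real) \<Rightarrow> pt set \<Rightarrow> pt set" where "hmpt g = onpt (\<lambda>a b. Ept (g a) (g b))"

definition lift_map :: "(real \<Rightarrow> real) \<Rightarrow> bool" where
  "lift_map g \<longleftrightarrow> strict_mono g \<and> (\<forall>x. g (x + 2 * pi) = g x + 2 * pi)"

lemma dg_periodic: "dg (a + 2 * pi * of_int m) (b + 2 * pi * of_int m) (c + 2 * pi * of_int m) (d + 2 * pi * of_int m) = dg a b c d"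
proof -
  have "zz (c + 2 * pi * of_int m) (d + 2 * pi * of_int m) i = zz c d i + 2 * pi * of_int m" for i
    by (simp add: zz_def)
  then show ?thesis unfolding dg_def by simp
qed

lemma add_period_commute: "x + 2 * pi * of_int m + 2 * pi = (x + 2 * pi) + 2 * pi * of_int m"
  by simp

lemma lift_map_shift: assumes "lift_map g" shows "g (x + 2 * pi * of_int m) = g x + 2 * pi * of_int m"
proof -
  have up: "g (x + 2 * pi * real n) = g x + 2 * pi * real n" for x n
  proof (induction n)
    case (Suc n)
    have e: "y + 2 * pi * real (Suc n) = (y + 2 * pi * real n) + 2 * pi" for y by (simp add: algebra_simps)
    have "g ((x + 2 * pi * real n) + 2 * pi) = g (x + 2 * pi * real n) + 2 * pi"
      using assms unfolding lift_map_def by blast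
    then show ?case unfolding e Suc .
  qed simp
  show ?thesis
  proof (cases "0 \<le> m")
    case True
    then show ?thesis using up[of x "nat m"] by simp
  next
    case False
    then show ?thesis using up[of "x + 2 * pi * of_int m" "nat (- m)"] by simp
  qed
qed

lemma lift_map_okp: "lift_map g \<Longrightarrow> okp a b \<Longrightarrow> okp (g a) (g b)"
  unfolding lift_map_def okp_def by (metis strict_mono_less_eq)

lemma
  assumes "okp a b"
  shows I1pt_Ept: "I1pt (Ept a b) = Ept b b"
    and I2pt_Ept: "I2pt (Ept a b) = Ept a (a + 2 * pi)"
    and shpt_Ept: "shpt (Ept a b) = Ept b (a + 2 * pi)"
    and e1pt_Ept: "e1pt (Ept a b) = nat (- dg a b b b)"
    and e2pt_Ept: "e2pt (Ept a b) = nat (- dg a b a (a + 2 * pi))"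
    and r1pt_Ept: "r1pt (Ept a b) = nat (- dg b b b (a + 2 * pi))"
    and r2pt_Ept: "r2pt (Ept a b) = nat (- dg a (a + 2 * pi) b (a + 2 * pi))"
  unfolding I1pt_def I2pt_def shpt_def e1pt_def e2pt_def r1pt_def r2pt_def
  by (rule onpt_Ept[OF assms], simp only: add_period_commute Ept_periodic dg_periodic)+

lemma hmpt_Ept: "lift_map g \<Longrightarrow> okp a b \<Longrightarrow> hmpt g (Ept a b) = Ept (g a) (g b)"
  unfolding hmpt_def by (rule onpt_Ept) (auto simp: lift_map_shift Ept_periodic)

lemma lift_map_zz: assumes "lift_map g" shows "zz (g a) (g b) i = g (zz a b i)"
  using lift_map_shift[OF assms] unfolding zz_def by simp

lemma lift_map_dg: assumes "lift_map g" shows "dg (g a) (g b) (g c) (g d) = dg a b c d"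
  using assms unfolding dg_def lift_map_zz[OF assms] lift_map_def by (simp add: strict_mono_less_eq)

lemma lift_map_2pi: "lift_map g \<Longrightarrow> g (x + 2 * pi) = g x + 2 * pi"
  unfolding lift_map_def by simp

lemma okp_hull: "okp a b \<Longrightarrow> okp b b" "okp a b \<Longrightarrow> okp a (a + 2 * pi)" "okp a b \<Longrightarrow> okp b (a + 2 * pi)"
  using pi_gt_zero by (auto simp: okp_def)

lemma hmpt_Xpi: "lift_map g \<Longrightarrow> X \<in> Xpi \<Longrightarrow> hmpt g X \<in> Xpi"
  by (elim XpiE) (simp add: hmpt_Ept Ept_Xpi lift_map_okp)

lemma
  assumes "lift_map g" "X \<in> Xpi"
  shows hmpt_I1pt: "hmpt g (I1pt X) = I1pt (hmpt g X)" and hmpt_I2pt: "hmpt g (I2pt X) = I2pt (hmpt g X)"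
    and hmpt_shpt: "hmpt g (shpt X) = shpt (hmpt g X)" and e1pt_hmpt: "e1pt (hmpt g X) = e1pt X"
    and e2pt_hmpt: "e2pt (hmpt g X) = e2pt X" and r1pt_hmpt: "r1pt (hmpt g X) = r1pt X"
    and r2pt_hmpt: "r2pt (hmpt g X) = r2pt X"
proof -
  obtain a b where X: "okp a b" "X = Ept a b" using XpiE[OF assms(2)] .
  note 1 = lift_map_okp[OF assms(1) X(1)] and 2 = lift_map_2pi[OF assms(1), symmetric]
  note hmpt_Ept[OF assms(1)] lift_map_dg[OF assms(1)] okp_hull[OF X(1)] X(1)
  note s = this I1pt_Ept[OF X(1)] I2pt_Ept[OF X(1)] shpt_Ept[OF X(1)] e1pt_Ept[OF X(1)] e2pt_Ept[OF X(1)]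
    r1pt_Ept[OF X(1)] r2pt_Ept[OF X(1)] I1pt_Ept[OF 1] I2pt_Ept[OF 1] shpt_Ept[OF 1] e1pt_Ept[OF 1]
    e2pt_Ept[OF 1] r1pt_Ept[OF 1] r2pt_Ept[OF 1]
  show "hmpt g (I1pt X) = I1pt (hmpt g X)" "hmpt g (I2pt X) = I2pt (hmpt g X)"
    "hmpt g (shpt X) = shpt (hmpt g X)" "e1pt (hmpt g X) = e1pt X"
    "e2pt (hmpt g X) = e2pt X" "r1pt (hmpt g X) = r1pt X" "r2pt (hmpt g X) = r2pt X"
    unfolding X(2) by (simp_all add: s 2)
qed

lemma hmpt_cocyc:
  assumes "lift_map g" "X \<in> Xpi" "Y \<in> Xpi" "Z \<in> Xpi"
  shows "cocyc (hmpt g X) (hmpt g Y) (hmpt g Z) = cocyc X Y Z"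
proof -
  obtain a b c d e f where "okp a b" "X = Ept a b" "okp c d" "Y = Ept c d" "okp e f" "Z = Ept e f"
    using XpiE assms by metis
  then show ?thesis
    by (simp add: hmpt_Ept[OF assms(1)] cocyc_Ept lift_map_okp[OF assms(1)] lift_map_dg[OF assms(1)])
qed

lemma hmpt_comp:
  assumes "lift_map g" "lift_map h" "X \<in> Xpi" shows "hmpt g (hmpt h X) = hmpt (g \<circ> h) X"
proof -
  obtain a b where X: "okp a b" "X = Ept a b" using XpiE[OF assms(3)] .
  have "lift_map (g \<circ> h)" using assms(1,2) unfolding lift_map_def by (simp add: strict_mono_o)
  then show ?thesis using X assms(1,2) by (simp add: hmpt_Ept lift_map_okp)
qed

lemma hmpt_ident: "(\<And>x. g x = x + 2 * pi * of_int m) \<Longrightarrow> X \<in> Xpi \<Longrightarrow> hmpt g X = X"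
proof -
  assume g: "\<And>x. g x = x + 2 * pi * of_int m" and X: "X \<in> Xpi"
  have "lift_map g" unfolding lift_map_def strict_mono_def by (auto simp: g)
  then show "hmpt g X = X" using X by (elim XpiE) (simp add: hmpt_Ept g Ept_periodic)
qed

lemma rot_Ept: "rot p k (Ept a b) = Ept (a + real k * theta p) (b + real k * theta p)"
proof -
  have "zz (a + real k * theta p) (b + real k * theta p) i = zz a b i + real k * theta p" for i
    by (simp add: zz_def)
  then show ?thesis unfolding rot_def Ept_eq image_image by (simp add: algebra_simps)
qed

lemma lift_map_translate: "lift_map (\<lambda>x. x + t)"
  unfolding lift_map_def strict_mono_def by simp

lemma rot_hmpt: "X \<in> Xpi \<Longrightarrow> rot p k X = hmpt (\<lambda>x. x + real k * theta p) X"
  by (elim XpiE) (simp add: rot_Ept hmpt_Ept lift_map_translate)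

lemma shpt_Xpi: "X \<in> Xpi \<Longrightarrow> shpt X \<in> Xpi" and I1pt_Xpi: "X \<in> Xpi \<Longrightarrow> I1pt X \<in> Xpi"
  and I2pt_Xpi: "X \<in> Xpi \<Longrightarrow> I2pt X \<in> Xpi"
  by (elim XpiE; simp add: shpt_Ept I1pt_Ept I2pt_Ept Ept_Xpi okp_hull)+

text \<open>On points of the strip the cocycle is nonnegative by \<open>dg_triangle\<close>, so the
  truncation to a natural exponent is exact.\<close>

definition nc :: "pt set \<Rightarrow> pt set \<Rightarrow> pt set \<Rightarrow> nat" where
  "nc X Y Z = nat (cocyc X Y Z)"

lemma nc_Ept:
  assumes "okp a b" "okp c d" "okp e f"
  shows "int (nc (Ept a b) (Ept c d) (Ept e f)) = dg a b c d + dg c d e f - dg a b e f"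
  using dg_triangle[OF assms(2,3), of a b] unfolding nc_def cocyc_Ept[OF assms] by simp

text \<open>The exponent form of associativity: both sides are the sum of the three consecutive
  degrees minus the degree from X to W.\<close>

lemma nc_cocycle:
  assumes "X \<in> Xpi" "Y \<in> Xpi" "Z \<in> Xpi" "W \<in> Xpi"
  shows "nc X Y Z + nc X Z W = nc Y Z W + nc X Y W"
proof -
  obtain a b c d e f g h where "okp a b" "X = Ept a b" "okp c d" "Y = Ept c d" "okp e f" "Z = Ept e f"
    "okp g h" "W = Ept g h" using XpiE assms by metis
  then have "int (nc X Y Z + nc X Z W) = int (nc Y Z W + nc X Y W)" by (simp add: nc_Ept)
  then show ?thesis by linarith
qed

lemma nc_left [simp]: "X \<in> Xpi \<Longrightarrow> Y \<in> Xpi \<Longrightarrow> nc X X Y = 0"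
  and nc_right [simp]: "X \<in> Xpi \<Longrightarrow> Y \<in> Xpi \<Longrightarrow> nc X Y Y = 0"
  by (elim XpiE; simp add: nc_def cocyc_Ept dg_self)+

lemma hmpt_nc:
  "lift_map g \<Longrightarrow> X \<in> Xpi \<Longrightarrow> Y \<in> Xpi \<Longrightarrow> Z \<in> Xpi \<Longrightarrow> nc (hmpt g X) (hmpt g Y) (hmpt g Z) = nc X Y Z"
  by (simp add: nc_def hmpt_cocyc)

text \<open>A multiple of the basic morphism X \<rightarrow> Y factors through an injective iff u^nu X Y divides it.\<close>

definition mu1 :: "pt set \<Rightarrow> pt set \<Rightarrow> nat" where "mu1 X Y = e1pt X + nc X (I1pt X) Y"
definition mu2 :: "pt set \<Rightarrow> pt set \<Rightarrow> nat" where "mu2 X Y = e2pt X + nc X (I2pt X) Y"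
definition nu :: "pt set \<Rightarrow> pt set \<Rightarrow> nat" where "nu X Y = min (mu1 X Y) (mu2 X Y)"

lemma dg_hull_nonpos:
  assumes "okp a b"
  shows "dg a b b b \<le> 0" "dg a b a (a + 2 * pi) \<le> 0" "dg b b b (a + 2 * pi) \<le> 0"
    "dg a (a + 2 * pi) b (a + 2 * pi) \<le> 0"
  using assms dg_le_iff[OF okp_hull(1)[OF assms]] dg_le_iff[OF okp_hull(2)[OF assms]]
    dg_le_iff[OF okp_hull(3)[OF assms]] unfolding okp_def by simp_all

lemma mu_Ept:
  assumes "okp a b" "okp c d"
  shows "int (mu1 (Ept a b) (Ept c d)) = dg b b c d - dg a b c d"
    and "int (mu2 (Ept a b) (Ept c d)) = dg a (a + 2 * pi) c d - dg a b c d"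
  using dg_hull_nonpos[OF assms(1)] nc_Ept[OF assms(1) okp_hull(1)[OF assms(1)] assms(2)]
    nc_Ept[OF assms(1) okp_hull(2)[OF assms(1)] assms(2)]
  unfolding mu1_def mu2_def I1pt_Ept[OF assms(1)] I2pt_Ept[OF assms(1)] e1pt_Ept[OF assms(1)] e2pt_Ept[OF assms(1)]
  by simp_all

lemma nu_Ept: assumes "okp a b" "okp c d" shows "int (nu (Ept a b) (Ept c d)) = nudg a b c d"
  unfolding nu_def nudg_def using mu_Ept[OF assms] by (simp add: min_def)

lemma nu_Ept_iff:
  assumes "okp a b" "okp c d"
  shows "nu (Ept a b) (Ept c d) =
    (if \<exists>i. a \<le> zz c d i \<and> zz c d i < b \<and> b \<le> zz c d (i + 1) \<and> zz c d (i + 1) < a + 2 * pi then 1 else 0)"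
    (is "_ = (if ?P then 1 else 0)")
proof -
  have "int (nu (Ept a b) (Ept c d)) = int (if ?P then 1 else 0)"
    unfolding nu_Ept[OF assms] nudg_cases[OF assms] by (simp only: if_distrib[of int] of_nat_1 of_nat_0)
  then show ?thesis by (simp only: of_nat_eq_iff)
qed

lemma nu_triangle:
  assumes "X \<in> Xpi" "Y \<in> Xpi" "Z \<in> Xpi" shows "nu X Z \<le> nu X Y + nc X Y Z"
proof -
  obtain a b c d e f where "okp a b" "X = Ept a b" "okp c d" "Y = Ept c d" "okp e f" "Z = Ept e f"
    using XpiE assms by metis
  then show ?thesis using nudg_triangle[of c d e f a b] nu_Ept[of a b c d] nu_Ept[of a b e f] nc_Ept[of a b c d e f] by simp
qed

lemma hmpt_mu:
  assumes "lift_map g" "X \<in> Xpi" "Y \<in> Xpi"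
  shows "mu1 (hmpt g X) (hmpt g Y) = mu1 X Y" "mu2 (hmpt g X) (hmpt g Y) = mu2 X Y"
    "nu (hmpt g X) (hmpt g Y) = nu X Y"
  using assms by (simp_all add: mu1_def mu2_def nu_def e1pt_hmpt e2pt_hmpt hmpt_I1pt[symmetric] hmpt_I2pt[symmetric]
    hmpt_nc I1pt_Xpi I2pt_Xpi)

lemma hull_complex:
  assumes "X \<in> Xpi"
  shows "e1pt X + r1pt X + nc X (I1pt X) (shpt X) = e2pt X + r2pt X + nc X (I2pt X) (shpt X)"
proof -
  obtain a b where X: "okp a b" "X = Ept a b" using XpiE[OF assms] .
  note ok = okp_hull[OF X(1)]
  show ?thesis
    using dg_hull_nonpos[OF X(1)] nc_Ept[OF X(1) ok(1,3)] nc_Ept[OF X(1) ok(2,3)] unfolding X(2)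
    by (simp add: e1pt_Ept e2pt_Ept r1pt_Ept r2pt_Ept I1pt_Ept I2pt_Ept shpt_Ept X(1))
qed

text \<open>The k are the powers of u that a map from W gains on entering the two hull summands
  through X, the l those gained on passing from the summands to X[1]. Since X is the meet, its
  degree is the larger of the two, so one k vanishes; this is what \<open>power_split\<close>
  requires.\<close>

lemma hull_kernel:
  assumes "X \<in> Xpi" "W \<in> Xpi"
  defines "k1 \<equiv> e1pt X + nc W X (I1pt X)" and "k2 \<equiv> e2pt X + nc W X (I2pt X)"
    and "l1 \<equiv> r1pt X + nc W (I1pt X) (shpt X)" and "l2 \<equiv> r2pt X + nc W (I2pt X) (shpt X)"
  shows "k1 + l1 = k2 + l2" "k1 = 0 \<or> k2 = 0"
proof -
  obtain a b where X: "okp a b" "X = Ept a b" using XpiE[OF assms(1)] .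
  obtain v w where W: "okp v w" "W = Ept v w" using XpiE[OF assms(2)] .
  note ok = okp_hull[OF X(1)]
  note s = e1pt_Ept[OF X(1)] e2pt_Ept[OF X(1)] r1pt_Ept[OF X(1)] r2pt_Ept[OF X(1)] I1pt_Ept[OF X(1)]
    I2pt_Ept[OF X(1)] shpt_Ept[OF X(1)]
  have "int k1 = dg v w a b - dg v w b b" "int k2 = dg v w a b - dg v w a (a + 2 * pi)"
    "int l1 = dg v w b b - dg v w b (a + 2 * pi)" "int l2 = dg v w a (a + 2 * pi) - dg v w b (a + 2 * pi)"
    using dg_hull_nonpos[OF X(1)] nc_Ept[OF W(1) X(1) ok(1)] nc_Ept[OF W(1) X(1) ok(2)]
      nc_Ept[OF W(1) ok(1) ok(3)] nc_Ept[OF W(1) ok(2) ok(3)]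
    unfolding k1_def k2_def l1_def l2_def X(2) W(2) s by simp_all
  then show "k1 + l1 = k2 + l2" "k1 = 0 \<or> k2 = 0" using dg_meet[OF X(1), of v w] by linarith+
qed

text \<open>The dual exponents: n is the power gained by a map to Z when it is composed with the
  projection from a hull summand to X[1]. As X[1] is the join, one n vanishes.\<close>

lemma hull_cokernel:
  assumes "X \<in> Xpi" "Z \<in> Xpi"
  defines "n1 \<equiv> r1pt X + nc (I1pt X) (shpt X) Z" and "n2 \<equiv> r2pt X + nc (I2pt X) (shpt X) Z"
  shows "mu1 X Z + n1 = mu2 X Z + n2" "n1 = 0 \<or> n2 = 0"
proof -
  obtain a b where X: "okp a b" "X = Ept a b" using XpiE[OF assms(1)] .
  obtain c d where Z: "okp c d" "Z = Ept c d" using XpiE[OF assms(2)] .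
  note ok = okp_hull[OF X(1)]
  have "int n1 = dg b (a + 2 * pi) c d - dg b b c d" "int n2 = dg b (a + 2 * pi) c d - dg a (a + 2 * pi) c d"
    using dg_hull_nonpos[OF X(1)] nc_Ept[OF ok(1) ok(3) Z(1)] nc_Ept[OF ok(2) ok(3) Z(1)]
    unfolding n1_def n2_def X(2) Z(2) r1pt_Ept[OF X(1)] r2pt_Ept[OF X(1)] I1pt_Ept[OF X(1)]
      I2pt_Ept[OF X(1)] shpt_Ept[OF X(1)] by simp_all
  then show "mu1 X Z + n1 = mu2 X Z + n2" "n1 = 0 \<or> n2 = 0"
    using dg_join[OF X(1) Z(1)] mu_Ept[OF X(1) Z(1)] unfolding X(2) Z(2) by linarith+
qed

text \<open>The boundary |x - y| = pi of the strip, in E-coordinates.\<close>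

definition bdpt :: "pt set \<Rightarrow> bool" where
  "bdpt X \<longleftrightarrow> (\<exists>a. X = Ept a a \<or> X = Ept a (a + 2 * pi))"

lemma bdpt_Xpi: "bdpt X \<Longrightarrow> X \<in> Xpi"
  unfolding bdpt_def by (auto intro!: Ept_Xpi simp: okp_def)

lemma bdpt_hull: "X \<in> Xpi \<Longrightarrow> bdpt (I1pt X)" "X \<in> Xpi \<Longrightarrow> bdpt (I2pt X)"
  unfolding bdpt_def by (elim XpiE; auto simp: I1pt_Ept I2pt_Ept)+

lemma bdpt_hmpt: "lift_map g \<Longrightarrow> bdpt X \<Longrightarrow> bdpt (hmpt g X)"
  unfolding bdpt_def by (auto simp: hmpt_Ept okp_def lift_map_2pi)

text \<open>As a target, a boundary point has consecutive endpoints that coincide or lie 2 pi apart,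
  which leaves no room for an interleaving. As a source, one of the half-open intervals [a,b) and
  [b,a+2 pi) that should contain a term is empty.\<close>

lemma nu_bdpt: assumes "X \<in> Xpi" "bdpt Y" shows "nu X Y = 0" "nu Y X = 0"
proof -
  obtain a b where X: "okp a b" "X = Ept a b" using XpiE[OF assms(1)] .
  obtain c d where Y: "okp c d" "Y = Ept c d" "d = c \<or> d = c + 2 * pi"
  proof -
    obtain e where "Y = Ept e e \<or> Y = Ept e (e + 2 * pi)" using assms(2) unfolding bdpt_def by blast
    moreover have "okp e e" "okp e (e + 2 * pi)" using pi_gt_zero by (simp_all add: okp_def)
    ultimately show ?thesis using that by blast
  qed
  have "\<not> (a \<le> zz c d i \<and> zz c d i < b \<and> b \<le> zz c d (i + 1) \<and> zz c d (i + 1) < a + 2 * pi)" for i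
  proof -
    have "zz c d i = zz c d (i + 1) \<or> zz c d (i + 1) = zz c d i + 2 * pi"
      using Y(3) zz_even[of i c d] zz_odd[of i c d] zz_even[of "i + 1" c d] zz_odd[of "i + 1" c d]
      by (cases "even i") (auto simp: algebra_simps)
    then show ?thesis by linarith
  qed
  then show "nu X Y = 0" unfolding X(2) Y(2) nu_Ept_iff[OF X(1) Y(1)] by (simp add: not_le)
  show "nu Y X = 0" unfolding X(2) Y(2) nu_Ept_iff[OF Y(1) X(1)] using Y(3) zz_mono[OF X(1)] by force
qed

section \<open>Matrices over the Frobenius category\<close>

lemma sum_single:
  fixes t :: "nat \<Rightarrow> 'a::comm_monoid_add"
  assumes "i < n" "\<And>k. k < n \<Longrightarrow> k \<noteq> i \<Longrightarrow> t k = 0"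
  shows "(\<Sum>k<n. t k) = t i"
proof -
  have "(\<Sum>k<n. t k) = sum t {i}" by (rule sum.mono_neutral_right) (use assms in auto)
  then show ?thesis by simp
qed

lemma sum_pair:
  fixes t :: "nat \<Rightarrow> 'a::comm_monoid_add"
  assumes "i < n" "j < n" "i \<noteq> j" "\<And>k. k < n \<Longrightarrow> k \<noteq> i \<Longrightarrow> k \<noteq> j \<Longrightarrow> t k = 0"
  shows "(\<Sum>k<n. t k) = t i + t j"
proof -
  have "(\<Sum>k<n. t k) = sum t {i, j}" by (rule sum.mono_neutral_right) (use assms in auto)
  then show ?thesis using assms by simp
qed

definition fmat :: "pt set list \<Rightarrow> pt set list \<Rightarrow> (nat \<Rightarrow> nat \<Rightarrow> 'r) \<Rightarrow> 'r::idom fmor" where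
  "fmat X Y m = Arr X Y (\<lambda>i j. if i < length Y \<and> j < length X then m i j else 0)"

lemma fmat_sel [simp]: "asrc (fmat X Y m) = X" "atgt (fmat X Y m) = Y"
  "coef (fmat X Y m) i j = (if i < length Y \<and> j < length X then m i j else 0)"
  by (simp_all add: fmat_def)

abbreviation "pts X \<equiv> set X \<subseteq> Xpi"
abbreviation "homF u \<equiv> hom (Fpi u)"
abbreviation "cmpF u \<equiv> cmp (Fpi u)"
abbreviation "plsF u \<equiv> pls (Fpi u)"
abbreviation "idnF u \<equiv> idn (Fpi u)"
abbreviation "zroF u \<equiv> zro (Fpi u)"

lemma Fpi_obs [simp]: "obs (Fpi u) = {X. pts X}"
  by (simp add: Fpi_def)

lemma homF_iff:
  "f \<in> homF u X Y \<longleftrightarrow> pts X \<and> pts Y \<and> asrc f = X \<and> atgt f = Y \<and>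
    (\<forall>i j. \<not> (i < length Y \<and> j < length X) \<longrightarrow> coef f i j = 0)"
  unfolding hom_def Fpi_def by (cases f) auto

lemma fmat_hom [intro]: "pts X \<Longrightarrow> pts Y \<Longrightarrow> fmat X Y m \<in> homF u X Y"
  unfolding homF_iff by simp

lemma homFD:
  assumes "f \<in> homF u X Y"
  shows "pts X" "pts Y" "asrc f = X" "atgt f = Y"
    "\<not> (i < length Y \<and> j < length X) \<Longrightarrow> coef f i j = 0"
    "i < length X \<Longrightarrow> X ! i \<in> Xpi" "i < length Y \<Longrightarrow> Y ! i \<in> Xpi"
  using assms unfolding homF_iff by (auto dest: nth_mem)

lemma Fpi_eqI:
  assumes "f \<in> homF u X Y" "g \<in> homF u X Y"
    and "\<And>i j. i < length Y \<Longrightarrow> j < length X \<Longrightarrow> coef f i j = coef g i j"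
  shows "f = g"
proof (rule arr.expand)
  have "coef f i j = coef g i j" for i j
    using homFD(5)[OF assms(1)] homFD(5)[OF assms(2)] assms(3)
    by (cases "i < length Y \<and> j < length X") auto
  then show "asrc f = asrc g \<and> atgt f = atgt g \<and> coef f = coef g"
    using homFD(3,4)[OF assms(1)] homFD(3,4)[OF assms(2)] by auto
qed

lemma cmpF_hom:
  assumes "f \<in> homF u X Y" "g \<in> homF u Y Z"
  shows "cmpF u g f \<in> homF u X Z"
  using assms unfolding homF_iff by (simp add: Fpi_def)

lemma coef_cmp:
  assumes "f \<in> homF u X Y" "g \<in> homF u Y Z" "i < length Z" "k < length X"
  shows "coef (cmpF u g f) i k =
    (\<Sum>j<length Y. coef g i j * coef f j k * u ^ nc (X ! k) (Y ! j) (Z ! i))"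
  using assms unfolding homF_iff by (simp add: Fpi_def nc_def)

lemma plsF_hom:
  "f \<in> homF u X Y \<Longrightarrow> g \<in> homF u X Y \<Longrightarrow> plsF u f g \<in> homF u X Y"
  unfolding homF_iff by (simp add: Fpi_def)

lemma coef_pls [simp]: "coef (plsF u f g) i j = coef f i j + coef g i j"
  by (simp add: Fpi_def)

lemma coef_zro [simp]: "coef (zroF u X Y) i j = 0"
  by (simp add: Fpi_def)

lemma coef_idn: "coef (idnF u X) i j = (if i = j \<and> i < length X then 1 else 0)"
  by (simp add: Fpi_def)

lemma zroF_hom: "pts X \<Longrightarrow> pts Y \<Longrightarrow> zroF u X Y \<in> homF u X Y"
  unfolding homF_iff by (simp add: Fpi_def)

lemma idnF_hom: "pts X \<Longrightarrow> idnF u X \<in> homF u X X"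
  unfolding homF_iff by (simp add: Fpi_def)

lemma Fpi_assoc:
  assumes f: "f \<in> homF u X Y" and g: "g \<in> homF u Y Z" and h: "h \<in> homF u Z W"
  shows "cmpF u h (cmpF u g f) = cmpF u (cmpF u h g) f"
proof (rule Fpi_eqI)
  note gf = cmpF_hom[OF f g] and hg = cmpF_hom[OF g h]
  show "cmpF u h (cmpF u g f) \<in> homF u X W" "cmpF u (cmpF u h g) f \<in> homF u X W"
    using cmpF_hom gf hg f h by blast+
  fix i l assume il: "i < length W" "l < length X"
  have e: "u ^ nc (X ! l) (Y ! j) (Z ! k) * u ^ nc (X ! l) (Z ! k) (W ! i) =
      u ^ nc (Y ! j) (Z ! k) (W ! i) * u ^ nc (X ! l) (Y ! j) (W ! i)" if "j < length Y" "k < length Z" for j k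
    unfolding power_add[symmetric]
    using nc_cocycle[OF homFD(6)[OF f il(2)] homFD(6)[OF g that(1)] homFD(6)[OF h that(2)] homFD(7)[OF h il(1)]]
    by simp
  have "coef (cmpF u h (cmpF u g f)) i l = (\<Sum>k<length Z. \<Sum>j<length Y. coef h i k * coef g k j * coef f j l *
      (u ^ nc (X ! l) (Y ! j) (Z ! k) * u ^ nc (X ! l) (Z ! k) (W ! i)))"
    by (simp add: coef_cmp[OF gf h il] coef_cmp[OF f g _ il(2)] sum_distrib_left sum_distrib_right ac_simps)
  also have "\<dots> = (\<Sum>k<length Z. \<Sum>j<length Y. coef h i k * coef g k j * coef f j l *
      (u ^ nc (Y ! j) (Z ! k) (W ! i) * u ^ nc (X ! l) (Y ! j) (W ! i)))"
    by (intro sum.cong refl) (simp add: e)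
  also have "\<dots> = (\<Sum>j<length Y. \<Sum>k<length Z. coef h i k * coef g k j * coef f j l *
      (u ^ nc (Y ! j) (Z ! k) (W ! i) * u ^ nc (X ! l) (Y ! j) (W ! i)))"
    by (rule sum.swap)
  also have "\<dots> = coef (cmpF u (cmpF u h g) f) i l"
    by (simp add: coef_cmp[OF f hg il] coef_cmp[OF g h il(1)] sum_distrib_left sum_distrib_right ac_simps)
  finally show "coef (cmpF u h (cmpF u g f)) i l = coef (cmpF u (cmpF u h g) f) i l" .
qed

lemma Fpi_preadditive: "preadditive (Fpi (u::'r::idom))"
proof
  fix f g h :: "'r fmor" and X Y Z W
  assume f: "f \<in> homF u X Y"
  show "X \<in> obs (Fpi u) \<and> Y \<in> obs (Fpi u)" using homFD[OF f] by simp
  have id: "idnF u X \<in> homF u X X" "idnF u Y \<in> homF u Y Y"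
    using idnF_hom homFD[OF f] by blast+
  have ii: "coef (idnF u V) i i = 1" if "i < length V" for V i using that by (simp add: coef_idn)
  show "cmpF u (idnF u Y) f = f"
  proof (rule Fpi_eqI[OF cmpF_hom[OF f id(2)] f])
    fix i j assume ij: "i < length Y" "j < length X"
    show "coef (cmpF u (idnF u Y) f) i j = coef f i j"
      unfolding coef_cmp[OF f id(2) ij]
      by (subst sum_single[OF ij(1)]) (use ij homFD(6,7)[OF f] in \<open>auto simp: coef_idn\<close>)
  qed
  show "cmpF u f (idnF u X) = f"
  proof (rule Fpi_eqI[OF cmpF_hom[OF id(1) f] f])
    fix i j assume ij: "i < length Y" "j < length X"
    show "coef (cmpF u f (idnF u X)) i j = coef f i j"
      unfolding coef_cmp[OF id(1) f ij]
      by (subst sum_single[OF ij(2)]) (use ij homFD(6,7)[OF f] in \<open>auto simp: coef_idn\<close>)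
  qed
  show "plsF u f (zroF u X Y) = f"
    by (rule Fpi_eqI[OF plsF_hom[OF f zroF_hom] f]) (use homFD[OF f] in auto)
  let ?n = "fmat X Y (\<lambda>i j. - coef f i j)"
  have n: "?n \<in> homF u X Y" using homFD[OF f] by blast
  have "plsF u f ?n = zroF u X Y"
    by (rule Fpi_eqI[OF plsF_hom[OF f n] zroF_hom]) (use homFD[OF f] in auto)
  then show "\<exists>g\<in>homF u X Y. plsF u f g = zroF u X Y" using n by blast
  show "cmpF u g f \<in> homF u X Z" if "g \<in> homF u Y Z" using cmpF_hom f that by blast
  show "cmpF u h (cmpF u g f) = cmpF u (cmpF u h g) f"
    if "g \<in> homF u Y Z" "h \<in> homF u Z W" using Fpi_assoc f that by blast
  {
    assume g: "g \<in> homF u X Y"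
    show fg: "plsF u f g \<in> homF u X Y" using plsF_hom f g by blast
    show "plsF u f g = plsF u g f"
      by (rule Fpi_eqI[OF fg plsF_hom[OF g f]]) simp
    show "plsF u (plsF u f g) h = plsF u f (plsF u g h)" if h: "h \<in> homF u X Y"
      by (rule Fpi_eqI[OF plsF_hom[OF fg h] plsF_hom[OF f plsF_hom[OF g h]]]) (simp add: add.assoc)
    show "cmpF u h (plsF u f g) = plsF u (cmpF u h f) (cmpF u h g)"
      if h: "h \<in> homF u Y Z"
      by (rule Fpi_eqI[OF cmpF_hom[OF fg h] plsF_hom[OF cmpF_hom[OF f h] cmpF_hom[OF g h]]])
        (simp add: coef_cmp[OF fg h] coef_cmp[OF f h] coef_cmp[OF g h] sum.distrib[symmetric] algebra_simps)
  }
  show "cmpF u (plsF u g h) f = plsF u (cmpF u g f) (cmpF u h f)"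
    if g: "g \<in> homF u Y Z" and h: "h \<in> homF u Y Z"
    by (rule Fpi_eqI[OF cmpF_hom[OF f plsF_hom[OF g h]] plsF_hom[OF cmpF_hom[OF f g] cmpF_hom[OF f h]]])
      (simp add: coef_cmp[OF f plsF_hom[OF g h]] coef_cmp[OF f h] coef_cmp[OF f g] sum.distrib[symmetric] algebra_simps)
qed (use idnF_hom zroF_hom in auto)

section \<open>Standard hull sequences of sums of points\<close>

definition JL :: "pt set list \<Rightarrow> pt set list" where "JL X = map I1pt X @ map I2pt X"
definition SL :: "pt set list \<Rightarrow> pt set list" where "SL X = map shpt X"

definition incF :: "'r::idom \<Rightarrow> pt set list \<Rightarrow> 'r fmor" where
  "incF u X = fmat X (JL X) (\<lambda>i j. if i = j then u ^ e1pt (X ! j) else if i = length X + j then u ^ e2pt (X ! j) else 0)"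

definition prjF :: "'r::idom \<Rightarrow> pt set list \<Rightarrow> 'r fmor" where
  "prjF u X = fmat (JL X) (SL X)
    (\<lambda>i j. if j = i then u ^ r1pt (X ! i) else if j = length X + i then - (u ^ r2pt (X ! i)) else 0)"

text \<open>The choice depends on the entry and the exponent only, which lets \<open>facF\<close>
  commute with homeomorphisms.\<close>

definition quo :: "'r::idom \<Rightarrow> 'r \<Rightarrow> nat \<Rightarrow> 'r" where
  "quo u m e = (SOME k. m = k * u ^ e)"

text \<open>An explicit extension of f along the inclusion of the hull: each entry is sent through
  the summand with the smaller exponent, ties going to the first one.\<close>

definition facF :: "'r::idom \<Rightarrow> 'r fmor \<Rightarrow> 'r fmor" where
  "facF u f = (let X = asrc f; Y = atgt f; n = length X in fmat (JL X) Y
    (\<lambda>i j. if j < n then (if mu1 (X ! j) (Y ! i) \<le> mu2 (X ! j) (Y ! i)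
              then quo u (coef f i j) (mu1 (X ! j) (Y ! i)) else 0)
           else (if mu1 (X ! (j - n)) (Y ! i) \<le> mu2 (X ! (j - n)) (Y ! i) then 0
              else quo u (coef f i (j - n)) (mu2 (X ! (j - n)) (Y ! i)))))"

lemma JL_Xpi: "pts X \<Longrightarrow> pts (JL X)"
  unfolding JL_def using I1pt_Xpi I2pt_Xpi by auto

lemma SL_Xpi: "pts X \<Longrightarrow> pts (SL X)"
  unfolding SL_def using shpt_Xpi by auto

lemma JL_length [simp]: "length (JL X) = 2 * length X" and SL_length [simp]: "length (SL X) = length X"
  by (simp_all add: JL_def SL_def)

lemma JL_nth: "i < length X \<Longrightarrow> JL X ! i = I1pt (X ! i)" "i < length X \<Longrightarrow> JL X ! (length X + i) = I2pt (X ! i)"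
  by (simp_all add: JL_def nth_append)

lemma SL_nth: "i < length X \<Longrightarrow> SL X ! i = shpt (X ! i)"
  by (simp add: SL_def)

lemma JL_bdpt: "pts X \<Longrightarrow> set (JL X) \<subseteq> Collect bdpt"
  unfolding JL_def using bdpt_hull by auto

lemma incF_hom: "pts X \<Longrightarrow> incF u X \<in> homF u X (JL X)"
  unfolding incF_def using JL_Xpi by blast

lemma prjF_hom: "pts X \<Longrightarrow> prjF u X \<in> homF u (JL X) (SL X)"
  unfolding prjF_def using JL_Xpi SL_Xpi by blast

lemma split_double:
  fixes i n :: nat
  assumes "i < 2 * n" obtains "i < n" | i' where "i' < n" "i = n + i'"
  using assms that(1) that(2)[of "i - n"] by (cases "i < n") auto

lemma coef_cmp_prjF:
  assumes X: "pts X" and f: "f \<in> homF u W (JL X)" and i: "i < length X" and k: "k < length W"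
  shows "coef (cmpF u (prjF u X) f) i k =
    coef f i k * u ^ (r1pt (X ! i) + nc (W ! k) (I1pt (X ! i)) (shpt (X ! i))) -
    coef f (length X + i) k * u ^ (r2pt (X ! i) + nc (W ! k) (I2pt (X ! i)) (shpt (X ! i)))"
proof -
  have "coef (cmpF u (prjF u X) f) i k =
    (\<Sum>j<2 * length X. coef (prjF u X) i j * coef f j k * u ^ nc (W ! k) (JL X ! j) (SL X ! i))"
    using coef_cmp[OF f prjF_hom[OF X] _ k] i by simp
  also have "\<dots> = coef (prjF u X) i i * coef f i k * u ^ nc (W ! k) (JL X ! i) (SL X ! i) +
      coef (prjF u X) i (length X + i) * coef f (length X + i) k * u ^ nc (W ! k) (JL X ! (length X + i)) (SL X ! i)"
    by (rule sum_pair) (use i in \<open>auto simp: prjF_def\<close>)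
  finally show ?thesis using i by (cases "X = []") (simp_all add: prjF_def JL_nth SL_nth power_add)
qed

lemma coef_cmp_incF:
  assumes X: "pts X" and h: "h \<in> homF u W X" and i: "i < length X" and k: "k < length W"
  shows "coef (cmpF u (incF u X) h) i k = coef h i k * u ^ (e1pt (X ! i) + nc (W ! k) (X ! i) (I1pt (X ! i)))"
    and "coef (cmpF u (incF u X) h) (length X + i) k =
      coef h i k * u ^ (e2pt (X ! i) + nc (W ! k) (X ! i) (I2pt (X ! i)))"
proof -
  have "coef (cmpF u (incF u X) h) i k =
    (\<Sum>j<length X. coef (incF u X) i j * coef h j k * u ^ nc (W ! k) (X ! j) (JL X ! i))"
    using coef_cmp[OF h incF_hom[OF X] _ k] i by simp
  also have "\<dots> = coef (incF u X) i i * coef h i k * u ^ nc (W ! k) (X ! i) (JL X ! i)"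
    by (rule sum_single) (use i in \<open>auto simp: incF_def\<close>)
  finally show "coef (cmpF u (incF u X) h) i k = coef h i k * u ^ (e1pt (X ! i) + nc (W ! k) (X ! i) (I1pt (X ! i)))"
    using i by (simp add: incF_def JL_nth power_add)
  have "coef (cmpF u (incF u X) h) (length X + i) k =
    (\<Sum>j<length X. coef (incF u X) (length X + i) j * coef h j k * u ^ nc (W ! k) (X ! j) (JL X ! (length X + i)))"
    using coef_cmp[OF h incF_hom[OF X] _ k] i by simp
  also have "\<dots> = coef (incF u X) (length X + i) i * coef h i k * u ^ nc (W ! k) (X ! i) (JL X ! (length X + i))"
    by (rule sum_single) (use i in \<open>auto simp: incF_def\<close>)
  finally show "coef (cmpF u (incF u X) h) (length X + i) k =
      coef h i k * u ^ (e2pt (X ! i) + nc (W ! k) (X ! i) (I2pt (X ! i)))"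
    using i by (cases "X = []") (simp_all add: incF_def JL_nth power_add)
qed

lemma coef_incF_cmp:
  assumes X: "pts X" and h: "h \<in> homF u (JL X) Z" and i: "i < length Z" and k: "k < length X"
  shows "coef (cmpF u h (incF u X)) i k =
    coef h i k * u ^ mu1 (X ! k) (Z ! i) + coef h i (length X + k) * u ^ mu2 (X ! k) (Z ! i)"
proof -
  have "coef (cmpF u h (incF u X)) i k =
    (\<Sum>j<2 * length X. coef h i j * coef (incF u X) j k * u ^ nc (X ! k) (JL X ! j) (Z ! i))"
    using coef_cmp[OF incF_hom[OF X] h i k] by simp
  also have "\<dots> = coef h i k * coef (incF u X) k k * u ^ nc (X ! k) (JL X ! k) (Z ! i) +
      coef h i (length X + k) * coef (incF u X) (length X + k) k * u ^ nc (X ! k) (JL X ! (length X + k)) (Z ! i)"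
    by (rule sum_pair) (use k in \<open>auto simp: incF_def\<close>)
  finally show ?thesis using k by (cases "X = []") (simp_all add: incF_def JL_nth power_add mu1_def mu2_def)
qed

lemma coef_prjF_cmp:
  assumes X: "pts X" and h: "h \<in> homF u (SL X) Z" and i: "i < length Z" and k: "k < length X"
  shows "coef (cmpF u h (prjF u X)) i k = coef h i k * u ^ (r1pt (X ! k) + nc (I1pt (X ! k)) (shpt (X ! k)) (Z ! i))"
    and "coef (cmpF u h (prjF u X)) i (length X + k) =
      - coef h i k * u ^ (r2pt (X ! k) + nc (I2pt (X ! k)) (shpt (X ! k)) (Z ! i))"
proof -
  have "coef (cmpF u h (prjF u X)) i k =
    (\<Sum>j<length X. coef h i j * coef (prjF u X) j k * u ^ nc (JL X ! k) (SL X ! j) (Z ! i))"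
    using coef_cmp[OF prjF_hom[OF X] h i] k by simp
  also have "\<dots> = coef h i k * coef (prjF u X) k k * u ^ nc (JL X ! k) (SL X ! k) (Z ! i)"
    by (rule sum_single) (use k in \<open>auto simp: prjF_def\<close>)
  finally show "coef (cmpF u h (prjF u X)) i k = coef h i k * u ^ (r1pt (X ! k) + nc (I1pt (X ! k)) (shpt (X ! k)) (Z ! i))"
    using k by (simp add: prjF_def JL_nth SL_nth power_add)
  have "coef (cmpF u h (prjF u X)) i (length X + k) =
    (\<Sum>j<length X. coef h i j * coef (prjF u X) j (length X + k) * u ^ nc (JL X ! (length X + k)) (SL X ! j) (Z ! i))"
    using coef_cmp[OF prjF_hom[OF X] h i] k by simp
  also have "\<dots> = coef h i k * coef (prjF u X) k (length X + k) * u ^ nc (JL X ! (length X + k)) (SL X ! k) (Z ! i)"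
    by (rule sum_single) (use k in \<open>auto simp: prjF_def\<close>)
  finally show "coef (cmpF u h (prjF u X)) i (length X + k) =
      - coef h i k * u ^ (r2pt (X ! k) + nc (I2pt (X ! k)) (shpt (X ! k)) (Z ! i))"
    using k by (cases "X = []") (simp_all add: prjF_def JL_nth SL_nth power_add)
qed

lemma prjF_incF:
  assumes X: "pts X" shows "cmpF u (prjF u X) (incF u X) = zroF u X (SL X)"
proof (rule Fpi_eqI[OF cmpF_hom[OF incF_hom[OF X] prjF_hom[OF X]] zroF_hom[OF X SL_Xpi[OF X]]])
  fix i k assume i: "i < length (SL X)" and k: "k < length X"
  have "X ! i \<in> Xpi" using i X by auto
  then have e: "e1pt (X ! i) + r1pt (X ! i) + nc (X ! i) (I1pt (X ! i)) (shpt (X ! i)) =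
      e2pt (X ! i) + r2pt (X ! i) + nc (X ! i) (I2pt (X ! i)) (shpt (X ! i))" by (rule hull_complex)
  have p: "u ^ e1pt (X ! i) * u ^ (r1pt (X ! i) + nc (X ! i) (I1pt (X ! i)) (shpt (X ! i))) =
      u ^ e2pt (X ! i) * u ^ (r2pt (X ! i) + nc (X ! i) (I2pt (X ! i)) (shpt (X ! i)))"
    unfolding power_add[symmetric] using e by (simp add: add.assoc)
  then show "coef (cmpF u (prjF u X) (incF u X)) i k = coef (zroF u X (SL X)) i k"
    using i k by (subst coef_cmp_prjF[OF X incF_hom[OF X]]) (auto simp: incF_def)
qed

text \<open>Both halves of an entry equation f1 * u^l1 = f2 * u^l2 are divided by the same power of u.\<close>

lemma power_split:
  fixes u :: "'r::idom"
  assumes "u \<noteq> 0" "f1 * u ^ l1 = f2 * u ^ l2" "k1 + l1 = k2 + l2" "k1 = 0 \<or> k2 = 0"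
  shows "\<exists>!h. f1 = h * u ^ k1 \<and> f2 = h * u ^ k2"
proof (cases "k1 = 0")
  case True
  then have "f1 * u ^ k2 * u ^ l2 = f2 * u ^ l2" using assms(2,3) by (simp add: power_add mult.assoc)
  then have "f2 = f1 * u ^ k2" using assms(1) by simp
  then show ?thesis using True by auto
next
  case False
  then have "l2 = k1 + l1" "k2 = 0" using assms by auto
  then have "f1 * u ^ l1 = f2 * u ^ k1 * u ^ l1" using assms(2) by (simp add: power_add mult.assoc)
  then have "f1 = f2 * u ^ k1" using assms(1) by simp
  then show ?thesis using \<open>k2 = 0\<close> by auto
qed

lemma incF_mono:
  assumes "u \<noteq> 0" and X: "pts X" and h: "h \<in> homF u W X" "h' \<in> homF u W X"
    and eq: "cmpF u (incF u X) h = cmpF u (incF u X) h'"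
  shows "h = h'"
proof (rule Fpi_eqI[OF h])
  fix i k assume i: "i < length X" and k: "k < length W"
  show "coef h i k = coef h' i k"
    using coef_cmp_incF(1)[OF X h(1) i k] coef_cmp_incF(1)[OF X h(2) i k] eq assms(1) by simp
qed

lemma incF_prjF_kernel:
  assumes u: "u \<noteq> 0" and X: "pts X" shows "is_kernel (Fpi u) (incF u X) (prjF u X)"
proof -
  interpret F: preadditive "Fpi u" by (rule Fpi_preadditive)
  show ?thesis
  proof (rule F.is_kernelI[OF incF_hom[OF X] prjF_hom[OF X] prjF_incF[OF X]])
    fix W f assume f: "f \<in> homF u W (JL X)" and z: "cmpF u (prjF u X) f = zroF u W (SL X)"
    let ?k1 = "\<lambda>i k. e1pt (X ! i) + nc (W ! k) (X ! i) (I1pt (X ! i))"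
    let ?k2 = "\<lambda>i k. e2pt (X ! i) + nc (W ! k) (X ! i) (I2pt (X ! i))"
    have "\<exists>h. coef f i k = h * u ^ ?k1 i k \<and> coef f (length X + i) k = h * u ^ ?k2 i k"
      if i: "i < length X" and k: "k < length W" for i k
    proof -
      have m: "X ! i \<in> Xpi" "W ! k \<in> Xpi" using X i homFD(6)[OF f k] by auto
      have "coef f i k * u ^ (r1pt (X ! i) + nc (W ! k) (I1pt (X ! i)) (shpt (X ! i))) =
        coef f (length X + i) k * u ^ (r2pt (X ! i) + nc (W ! k) (I2pt (X ! i)) (shpt (X ! i)))"
        using coef_cmp_prjF[OF X f i k] z by simp
      from power_split[OF u this hull_kernel[OF m]] show ?thesis by blast
    qed
    then obtain m where m: "\<And>i k. i < length X \<Longrightarrow> k < length W \<Longrightarrow>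
        coef f i k = m i k * u ^ ?k1 i k \<and> coef f (length X + i) k = m i k * u ^ ?k2 i k" by metis
    have h: "fmat W X m \<in> homF u W X" using X homFD[OF f] by blast
    have "cmpF u (incF u X) (fmat W X m) = f"
    proof (rule Fpi_eqI[OF cmpF_hom[OF h incF_hom[OF X]] f])
      fix i k assume i: "i < length (JL X)" and k: "k < length W"
      have "i < 2 * length X" using i by simp
      then show "coef (cmpF u (incF u X) (fmat W X m)) i k = coef f i k"
      proof (cases rule: split_double)
        case 1
        then show ?thesis using coef_cmp_incF(1)[OF X h 1 k] m k by simp
      next
        case (2 i')
        then show ?thesis using coef_cmp_incF(2)[OF X h 2(1) k] m k by simp
      qed
    qed
    then show "\<exists>h\<in>homF u W X. cmpF u (incF u X) h = f" using h by blast
  qed (rule incF_mono[OF u X])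
qed

lemma incF_prjF_cokernel:
  assumes u: "u \<noteq> 0" and X: "pts X" shows "is_cokernel (Fpi u) (incF u X) (prjF u X)"
proof -
  interpret F: preadditive "Fpi u" by (rule Fpi_preadditive)
  show ?thesis
  proof (rule F.is_cokernelI[OF incF_hom[OF X] prjF_hom[OF X] prjF_incF[OF X]])
    fix Z f assume f: "f \<in> homF u (JL X) Z" and z: "cmpF u f (incF u X) = zroF u X Z"
    let ?n1 = "\<lambda>i k. r1pt (X ! k) + nc (I1pt (X ! k)) (shpt (X ! k)) (Z ! i)"
    let ?n2 = "\<lambda>i k. r2pt (X ! k) + nc (I2pt (X ! k)) (shpt (X ! k)) (Z ! i)"
    \<comment> \<open>The entry in the second half is negated because \<open>prjF\<close> carries a
      minus sign there.\<close>
    have "\<exists>h. coef f i k = h * u ^ ?n1 i k \<and> - coef f i (length X + k) = h * u ^ ?n2 i k"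
      if i: "i < length Z" and k: "k < length X" for i k
    proof -
      have m: "X ! k \<in> Xpi" "Z ! i \<in> Xpi" using X k homFD(7)[OF f i] by auto
      have "coef f i k * u ^ mu1 (X ! k) (Z ! i) = - coef f i (length X + k) * u ^ mu2 (X ! k) (Z ! i)"
        using coef_incF_cmp[OF X f i k] z by (simp add: eq_neg_iff_add_eq_0)
      moreover have "?n1 i k + mu1 (X ! k) (Z ! i) = ?n2 i k + mu2 (X ! k) (Z ! i)"
        using hull_cokernel(1)[OF m] by linarith
      ultimately show ?thesis using power_split[OF u _ _ hull_cokernel(2)[OF m]] by blast
    qed
    then obtain m where m: "\<And>i k. i < length Z \<Longrightarrow> k < length X \<Longrightarrow>
        coef f i k = m i k * u ^ ?n1 i k \<and> - coef f i (length X + k) = m i k * u ^ ?n2 i k" by metis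
    have h: "fmat (SL X) Z m \<in> homF u (SL X) Z" using SL_Xpi[OF X] homFD[OF f] by blast
    have "cmpF u (fmat (SL X) Z m) (prjF u X) = f"
    proof (rule Fpi_eqI[OF cmpF_hom[OF prjF_hom[OF X] h] f])
      fix i k assume i: "i < length Z" and k: "k < length (JL X)"
      have "k < 2 * length X" using k by simp
      then show "coef (cmpF u (fmat (SL X) Z m) (prjF u X)) i k = coef f i k"
      proof (cases rule: split_double)
        case 1
        then show ?thesis using coef_prjF_cmp(1)[OF X h i 1] m[OF i 1] i by simp
      next
        case (2 k')
        then show ?thesis using coef_prjF_cmp(2)[OF X h i 2(1)] m[OF i 2(1)] i by (simp add: minus_equation_iff)
      qed
    qed
    then show "\<exists>h\<in>homF u (SL X) Z. cmpF u h (prjF u X) = f" using h by blast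
  next
    fix Z h h' assume h: "h \<in> homF u (SL X) Z" "h' \<in> homF u (SL X) Z"
      and eq: "cmpF u h (prjF u X) = cmpF u h' (prjF u X)"
    show "h = h'"
    proof (rule Fpi_eqI[OF h])
      fix i k assume i: "i < length Z" and "k < length (SL X)"
      then have k: "k < length X" by simp
      show "coef h i k = coef h' i k"
        using coef_prjF_cmp(1)[OF X h(1) i k] coef_prjF_cmp(1)[OF X h(2) i k] eq u by simp
    qed
  qed
qed

lemma facF:
  assumes f: "f \<in> homF u X Y"
    and dvd: "\<And>i j. i < length Y \<Longrightarrow> j < length X \<Longrightarrow> u ^ nu (X ! j) (Y ! i) dvd coef f i j"
  shows "facF u f \<in> homF u (JL X) Y" "cmpF u (facF u f) (incF u X) = f"
proof -
  have X: "pts X" and Y: "pts Y" using homFD[OF f] by blast+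
  show h: "facF u f \<in> homF u (JL X) Y"
    unfolding facF_def Let_def homFD(3,4)[OF f] using JL_Xpi[OF X] Y by blast
  have q: "quo u m e * u ^ e = m" if "u ^ e dvd m" for m e
  proof -
    have "\<exists>k. m = k * u ^ e" using that by (auto simp: dvd_def mult.commute)
    from someI_ex[OF this] show ?thesis unfolding quo_def by simp
  qed
  show "cmpF u (facF u f) (incF u X) = f"
  proof (rule Fpi_eqI[OF cmpF_hom[OF incF_hom[OF X] h] f])
    fix i k assume i: "i < length Y" and k: "k < length X"
    have "coef (cmpF u (facF u f) (incF u X)) i k =
      (if mu1 (X ! k) (Y ! i) \<le> mu2 (X ! k) (Y ! i) then quo u (coef f i k) (mu1 (X ! k) (Y ! i)) * u ^ mu1 (X ! k) (Y ! i)
       else quo u (coef f i k) (mu2 (X ! k) (Y ! i)) * u ^ mu2 (X ! k) (Y ! i))"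
      unfolding coef_incF_cmp[OF X h i k] using i k homFD(3,4)[OF f] by (simp add: facF_def Let_def)
    also have "\<dots> = coef f i k"
      using q[of "nu (X ! k) (Y ! i)" "coef f i k"] dvd[OF i k] unfolding nu_def min_def
      by (cases "mu1 (X ! k) (Y ! i) \<le> mu2 (X ! k) (Y ! i)") simp_all
    finally show "coef (cmpF u (facF u f) (incF u X)) i k = coef f i k" .
  qed
qed

lemma nu_dvd_if_factor:
  assumes X: "pts X" and h: "h \<in> homF u (JL X) Y" and i: "i < length Y" and k: "k < length X"
  shows "u ^ nu (X ! k) (Y ! i) dvd coef (cmpF u h (incF u X)) i k"
proof -
  have "u ^ nu (X ! k) (Y ! i) dvd u ^ mu1 (X ! k) (Y ! i)" "u ^ nu (X ! k) (Y ! i) dvd u ^ mu2 (X ! k) (Y ! i)"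
    unfolding nu_def by (auto intro: le_imp_power_dvd)
  then show ?thesis unfolding coef_incF_cmp[OF X h i k] by (intro dvd_add dvd_mult)
qed

section \<open>Homeomorphisms acting on matrices\<close>

abbreviation "hml g \<equiv> map (hmpt g)"
abbreviation "psh g \<equiv> push_mor (hmpt g)"

lemma push_sel [simp]: "asrc (push_mor h f) = map h (asrc f)" "atgt (push_mor h f) = map h (atgt f)"
  "coef (push_mor h f) = coef f"
  by (simp_all add: push_mor_def)

lemma hml_Xpi: "lift_map g \<Longrightarrow> pts X \<Longrightarrow> pts (hml g X)"
  using hmpt_Xpi by auto

lemma psh_hom: "lift_map g \<Longrightarrow> f \<in> homF u X Y \<Longrightarrow> psh g f \<in> homF u (hml g X) (hml g Y)"
  unfolding homF_iff using hmpt_Xpi by auto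

lemma psh_cmp:
  assumes g: "lift_map g" and f: "f \<in> homF u X Y" and h: "h \<in> homF u Y Z"
  shows "psh g (cmpF u h f) = cmpF u (psh g h) (psh g f)"
proof (rule Fpi_eqI[OF psh_hom[OF g cmpF_hom[OF f h]] cmpF_hom[OF psh_hom[OF g f] psh_hom[OF g h]]])
  fix i k assume i: "i < length (hml g Z)" and k: "k < length (hml g X)"
  then have ik: "i < length Z" "k < length X" by simp_all
  have "coef (cmpF u (psh g h) (psh g f)) i k =
    (\<Sum>j<length Y. coef h i j * coef f j k * u ^ nc (hmpt g (X ! k)) (hmpt g (Y ! j)) (hmpt g (Z ! i)))"
    unfolding coef_cmp[OF psh_hom[OF g f] psh_hom[OF g h] i k] using ik by simp
  also have "\<dots> = coef (cmpF u h f) i k"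
    unfolding coef_cmp[OF f h ik]
    by (intro sum.cong refl) (use hmpt_nc[OF g] homFD(6,7)[OF f] homFD(7)[OF h] ik in simp)
  finally show "coef (psh g (cmpF u h f)) i k = coef (cmpF u (psh g h) (psh g f)) i k" by simp
qed

lemma psh_pls: "psh g (plsF u f h) = plsF u (psh g f) (psh g h)"
  by (simp add: push_mor_def Fpi_def)

lemma psh_idn: "psh g (idnF u X) = idnF u (hml g X)"
  by (simp add: push_mor_def Fpi_def)

lemma hml_id: "(\<And>x. g (h x) = x) \<Longrightarrow> lift_map g \<Longrightarrow> lift_map h \<Longrightarrow> pts X \<Longrightarrow> hml g (hml h X) = X"
  using hmpt_comp hmpt_ident[of "g \<circ> h" 0] by (auto intro!: map_idI)

lemma psh_strict_iso:
  assumes g: "lift_map g" "lift_map h" "\<And>x. h (g x) = x" "\<And>x. g (h x) = x"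
  shows "strict_iso (Fpi u) (hml g) (hml h) (psh g) (psh h)"
proof -
  interpret F: preadditive "Fpi u" by (rule Fpi_preadditive)
  have id: "psh h (psh g f) = f" if "f \<in> homF u X Y" "lift_map g" "lift_map h" "\<And>x. h (g x) = x" for f X Y g h
    using homFD[OF that(1)] hml_id[of h g] that by (intro arr.expand) simp
  show ?thesis
    by unfold_locales
      (use g hml_Xpi hml_id psh_hom psh_cmp psh_pls psh_idn id in auto)
qed

lemma hml_JL: "lift_map g \<Longrightarrow> pts X \<Longrightarrow> hml g (JL X) = JL (hml g X)"
  unfolding JL_def using hmpt_I1pt hmpt_I2pt by auto

lemma hml_SL: "lift_map g \<Longrightarrow> pts X \<Longrightarrow> hml g (SL X) = SL (hml g X)"
  unfolding SL_def using hmpt_shpt by auto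

lemma psh_incF: assumes g: "lift_map g" and X: "pts X" shows "psh g (incF u X) = incF u (hml g X)"
proof (rule Fpi_eqI)
  show "psh g (incF u X) \<in> homF u (hml g X) (JL (hml g X))"
    using psh_hom[OF g incF_hom[OF X]] hml_JL[OF g X] by simp
  fix i j assume "i < length (JL (hml g X))" and j: "j < length (hml g X)"
  then show "coef (psh g (incF u X)) i j = coef (incF u (hml g X)) i j"
    using X e1pt_hmpt[OF g] e2pt_hmpt[OF g] by (auto simp: incF_def dest: nth_mem)
qed (use incF_hom hml_Xpi g X in blast)

lemma psh_prjF: assumes g: "lift_map g" and X: "pts X" shows "psh g (prjF u X) = prjF u (hml g X)"
proof (rule Fpi_eqI)
  show "psh g (prjF u X) \<in> homF u (JL (hml g X)) (SL (hml g X))"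
    using psh_hom[OF g prjF_hom[OF X]] hml_JL[OF g X] hml_SL[OF g X] by simp
  fix i j assume "i < length (SL (hml g X))" and j: "j < length (JL (hml g X))"
  then show "coef (psh g (prjF u X)) i j = coef (prjF u (hml g X)) i j"
    using X r1pt_hmpt[OF g] r2pt_hmpt[OF g] by (auto simp: prjF_def dest: nth_mem)
qed (use prjF_hom hml_Xpi g X in blast)

text \<open>The case distinction and the quotients in \<open>facF\<close> refer to entries and
  exponents only, and both are preserved.\<close>

lemma psh_facF:
  assumes g: "lift_map g" and f: "f \<in> homF u X Y"
  shows "psh g (facF u f) = facF u (psh g f)"
proof -
  note hd = homFD[OF f]
  have m: "mu1 (hmpt g (X ! j)) (hmpt g (Y ! i)) = mu1 (X ! j) (Y ! i)"
    "mu2 (hmpt g (X ! j)) (hmpt g (Y ! i)) = mu2 (X ! j) (Y ! i)" if "i < length Y" "j < length X" for i j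
    using hmpt_mu[OF g hd(6)[OF that(2)] hd(7)[OF that(1)]] by simp_all
  have c: "coef (facF u f) i j = coef (facF u (psh g f)) i j" for i j
    unfolding facF_def Let_def push_sel hd(3,4) fmat_sel JL_length length_map
    by (cases "i < length Y"; cases "j < length X"; cases "j < 2 * length X") (simp_all add: m)
  have sel: "asrc (facF u k) = JL (asrc k)" "atgt (facF u k) = atgt k" for k :: "'a fmor"
    by (simp_all add: facF_def Let_def)
  have "coef (facF u f) = coef (facF u (psh g f))" by (intro ext c)
  then show ?thesis
    using hml_JL[OF g hd(1)] hd(3,4) by (intro arr.expand) (simp add: sel)
qed

section \<open>Identifying the given exact structure\<close>

locale fpi =
  fixes u :: "'r::idom" and CF :: "('r fmor \<times> 'r fmor) set"
  assumes dvr: "dvr_uniformizer u" and frob: "Fpi_frobenius u CF"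

sublocale fpi \<subseteq> F: exact_category "Fpi u" CF
  by (intro exact_category.intro exact_category_axioms.intro Fpi_preadditive)
    (use frob in \<open>simp add: Fpi_frobenius_def frobenius_def\<close>)

context fpi
begin

lemma u_nonzero: "u \<noteq> 0" and u_nonunit: "\<not> u dvd 1"
  using dvr unfolding dvr_uniformizer_def by auto

lemma u_power_unit: "u ^ n dvd 1 \<Longrightarrow> n = 0"
  using u_nonunit by (cases n) (auto dest: dvd_mult_left)

text \<open>A sum that is 1 modulo u has a summand without a factor u. This is how an isomorphism of
  points is extracted from a stable isomorphism of orbit objects.\<close>

lemma nc_zero_if_unit_sum:
  assumes "finite J" "(\<Sum>j\<in>J. a j * u ^ c j) = 1 + u * z"
  shows "\<exists>j\<in>J. c j = 0"
proof (rule ccontr)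
  assume "\<not> (\<exists>j\<in>J. c j = 0)"
  then have "u dvd a j * u ^ c j" if "j \<in> J" for j using that by (intro dvd_mult dvd_power) auto
  then have "u dvd (\<Sum>j\<in>J. a j * u ^ c j)" by (rule dvd_sum)
  then show False using assms(2) u_nonunit by (simp add: dvd_add_left_iff)
qed

lemma isomorphic_points:
  assumes "isomorphic (Fpi u) [X] [Y]" shows "X \<in> Xpi" "Y \<in> Xpi" "nc X Y X = 0"
proof -
  obtain f g where f: "f \<in> homF u [X] [Y]" and g: "g \<in> homF u [Y] [X]"
    and gf: "cmpF u g f = idnF u [X]" using F.isomorphicE[OF assms] by metis
  show "X \<in> Xpi" "Y \<in> Xpi" using homFD[OF f] by auto
  have "coef g 0 0 * coef f 0 0 * u ^ nc X Y X = 1"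
    using coef_cmp[OF f g, of 0 0] gf by (simp add: coef_idn)
  then have "u ^ nc X Y X dvd 1" by (metis dvd_triv_right)
  then show "nc X Y X = 0" by (rule u_power_unit)
qed

lemma nc_zero_coord:
  assumes "okp a b" "okp c d" "nc (Ept a b) (Ept c d) (Ept a b) = 0"
  shows "\<exists>i. a = zz c d i \<and> b = zz c d (i + 1)"
  using dg_antisym[OF assms(1,2)] nc_Ept[OF assms(1,2,1)] assms(3) dg_self[OF assms(1)] by simp

text \<open>By \<open>nc_zero_coord\<close> the endpoints of X are consecutive terms of the sequence
  of Y, and for a boundary point such terms coincide or differ by 2 pi.\<close>

lemma bdpt_if_iso: assumes "nc X Y X = 0" "X \<in> Xpi" "bdpt Y" shows "bdpt X"
proof -
  obtain a b where X: "okp a b" "X = Ept a b" using XpiE[OF assms(2)] .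
  obtain e where e: "Y = Ept e e \<or> Y = Ept e (e + 2 * pi)" using assms(3) unfolding bdpt_def by blast
  moreover have "okp e e" "okp e (e + 2 * pi)" using pi_gt_zero by (simp_all add: okp_def)
  ultimately obtain d where Y: "okp e d" "Y = Ept e d" "d = e \<or> d = e + 2 * pi" by blast
  obtain i where i: "a = zz e d i" "b = zz e d (i + 1)"
    using nc_zero_coord[OF X(1) Y(1)] assms(1) X(2) Y(2) by auto
  have "b = a \<or> b = a + 2 * pi"
    unfolding i using Y(3) zz_even[of i e d] zz_odd[of i e d] zz_even[of "i + 1" e d] zz_odd[of "i + 1" e d]
    by (cases "even i") (auto simp: algebra_simps)
  then show ?thesis unfolding bdpt_def X(2) by blast
qed

text \<open>The endomorphism ring of a point is the domain R, whose only idempotents are 0 and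
  1.\<close>

lemma point_indecomposable: assumes "X \<in> Xpi" shows "indecomposable (Fpi u) [X]"
proof (rule F.indecomposableI)
  show "[X] \<in> obs (Fpi u)" using assms by simp
  have "coef (idnF u [X]) 0 0 \<noteq> coef (zroF u [X] [X]) 0 0" by (simp add: coef_idn)
  then have "idnF u [X] \<noteq> zroF u [X] [X]" by (rule contrapos_nn) (rule arg_cong)
  then show "\<not> zero_object (Fpi u) [X]" unfolding zero_object_def by blast
  fix e e' assume e: "e \<in> homF u [X] [X]" and e': "e' \<in> homF u [X] [X]"
    and idem: "cmpF u e e = e" and s: "plsF u e e' = idnF u [X]"
  have "coef e 0 0 * coef e 0 0 = coef e 0 0"
    using coef_cmp[OF e e, of 0 0] idem assms by simp
  then have "coef e 0 0 = 0 \<or> coef e 0 0 = 1" by simp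
  moreover have "coef e 0 0 + coef e' 0 0 = 1"
    using arg_cong[OF s, of "\<lambda>f. coef f 0 0"] by (simp add: coef_idn)
  ultimately have "coef e 0 0 = 0 \<or> coef e' 0 0 = 0" by auto
  then show "e = zroF u [X] [X] \<or> e' = zroF u [X] [X]"
    using Fpi_eqI[OF e zroF_hom] Fpi_eqI[OF e' zroF_hom] assms by auto
qed

lemma Fpi_projective_iff_injective: "X \<in> obs (Fpi u) \<Longrightarrow> projective (Fpi u) CF X \<longleftrightarrow> injective (Fpi u) CF X"
  using frob unfolding Fpi_frobenius_def frobenius_def by blast

lemma point_projinj_iff: assumes "X \<in> Xpi" shows "projinj (Fpi u) CF [X] \<longleftrightarrow> bdpt X"
proof -
  have P: "projinj (Fpi u) CF [X] \<longleftrightarrow> (\<exists>x y. \<bar>x - y\<bar> = pi \<and> isomorphic (Fpi u) [X] [Mpt x y])"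
  proof -
    have "\<forall>P\<in>obs (Fpi u). indecomposable (Fpi u) P \<and> projinj (Fpi u) CF P \<longleftrightarrow>
        (\<exists>x y. \<bar>x - y\<bar> = pi \<and> isomorphic (Fpi u) P [Mpt x y])"
      using frob unfolding Fpi_frobenius_def by (rule conjunct2)
    moreover have "[X] \<in> obs (Fpi u)" using assms by simp
    ultimately show ?thesis using point_indecomposable[OF assms] by blast
  qed
  have bd: "bdpt (Mpt x y)" if "\<bar>x - y\<bar> = pi" for x y
  proof -
    have "Mpt x y = Ept x (y + pi)" by (simp add: Ept_def)
    moreover have "y + pi = x \<or> y + pi = x + 2 * pi" using that by linarith
    ultimately have "Mpt x y = Ept x x \<or> Mpt x y = Ept x (x + 2 * pi)" by metis
    then show ?thesis unfolding bdpt_def by blast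
  qed
  show ?thesis
  proof
    assume "projinj (Fpi u) CF [X]"
    then obtain x y where xy: "\<bar>x - y\<bar> = pi" "isomorphic (Fpi u) [X] [Mpt x y]" using P by blast
    show "bdpt X" using bdpt_if_iso[OF isomorphic_points(3)[OF xy(2)] assms bd[OF xy(1)]] .
  next
    assume "bdpt X"
    then obtain a where "X = Mpt a (a - pi) \<or> X = Mpt a (a + pi)"
      unfolding bdpt_def Ept_def by (auto simp: algebra_simps)
    moreover have "isomorphic (Fpi u) [X] [X]" using F.isomorphic_refl assms by simp
    moreover have "\<bar>a - (a - pi)\<bar> = pi" "\<bar>a - (a + pi)\<bar> = pi" by simp_all
    ultimately show "projinj (Fpi u) CF [X]" using P by blast
  qed
qed

lemma conflation_hom:
  assumes "(i, q) \<in> CF"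
  obtains A B D where "i \<in> homF u A B" "q \<in> homF u B D"
  using F.conflationE[OF assms] by blast

lemma injective_ext:
  assumes "injective (Fpi u) CF J" "(i, q) \<in> CF" "i \<in> homF u A B" "f \<in> homF u A J"
  obtains k where "k \<in> homF u B J" "cmpF u k i = f"
  using assms(1,2,4) F.homD[OF assms(3)] unfolding injective_def by blast

lemma projective_lift:
  assumes "projective (Fpi u) CF J" "(i, q) \<in> CF" "q \<in> homF u B D" "f \<in> homF u J D"
  obtains k where "k \<in> homF u J B" "cmpF u q k = f"
  using assms(1,2,4) F.homD[OF assms(3)] unfolding projective_def by blast

text \<open>A map into a sum of points is extended one row at a time, each single boundary point
  being injective.\<close>

lemma injective_if_bdpt:
  assumes X: "set X \<subseteq> Collect bdpt" shows "injective (Fpi u) CF X"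
proof -
  have X': "pts X" using X bdpt_Xpi by auto
  have "\<exists>h\<in>homF u (tgt (Fpi u) i) X. cmpF u h i = f"
    if iq: "(i, q) \<in> CF" and f0: "f \<in> homF u (src (Fpi u) i) X" for i q f
  proof -
    obtain A B D where i: "i \<in> homF u A B" and q: "q \<in> homF u B D" using conflation_hom[OF iq] .
    have f: "f \<in> homF u A X" using f0 F.homD[OF i] by simp
    have A: "pts A" and B: "pts B" using homFD[OF i] by blast+
    have "\<exists>k. k \<in> homF u B [X ! r] \<and> (\<forall>j<length A. coef (cmpF u k i) 0 j = coef f r j)"
      if r: "r < length X" for r
    proof -
      have Xr: "X ! r \<in> Xpi" "bdpt (X ! r)" using X X' r nth_mem by blast+
      have "injective (Fpi u) CF [X ! r]" using point_projinj_iff[OF Xr(1)] Xr(2) unfolding projinj_def by blast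
      moreover have "fmat A [X ! r] (\<lambda>_ j. coef f r j) \<in> homF u A [X ! r]" using A Xr(1) by auto
      ultimately obtain k where "k \<in> homF u B [X ! r]" "cmpF u k i = fmat A [X ! r] (\<lambda>_ j. coef f r j)"
        using injective_ext[OF _ iq i] by blast
      then show ?thesis by auto
    qed
    then obtain k where k: "\<And>r. r < length X \<Longrightarrow> k r \<in> homF u B [X ! r]"
      and kf: "\<And>r j. r < length X \<Longrightarrow> j < length A \<Longrightarrow> coef (cmpF u (k r) i) 0 j = coef f r j" by metis
    let ?K = "fmat B X (\<lambda>r j. coef (k r) 0 j)"
    have K: "?K \<in> homF u B X" using B X' by blast
    have "cmpF u ?K i = f"
    proof (rule Fpi_eqI[OF cmpF_hom[OF i K] f])
      fix r j assume r: "r < length X" and j: "j < length A"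
      have "coef (cmpF u ?K i) r j = coef (cmpF u (k r) i) 0 j"
        using coef_cmp[OF i K r j] coef_cmp[OF i k[OF r] _ j, of 0] r by simp
      then show "coef (cmpF u ?K i) r j = coef f r j" using kf[OF r j] by simp
    qed
    then show ?thesis using K F.homD[OF i] by blast
  qed
  then show ?thesis using X' unfolding injective_def by auto
qed

text \<open>A direct summand of an injective is injective; \<open>?s\<close> and \<open>?t\<close>
  exhibit the point as a summand of X.\<close>

lemma bdpt_if_injective:
  assumes inj: "injective (Fpi u) CF X" shows "set X \<subseteq> Collect bdpt"
proof
  fix x assume "x \<in> set X"
  then obtain r where r: "r < length X" "X ! r = x" unfolding in_set_conv_nth by blast
  have X: "pts X" using inj unfolding injective_def by simp
  have x: "x \<in> Xpi" using X \<open>x \<in> set X\<close> by blast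
  let ?s = "fmat [x] X (\<lambda>i _. if i = r then 1 else 0)" and ?t = "fmat X [x] (\<lambda>_ j. if j = r then 1 else 0)"
  have s: "?s \<in> homF u [x] X" and t: "?t \<in> homF u X [x]" using X x by auto
  have ts: "cmpF u ?t ?s = idnF u [x]"
  proof (rule Fpi_eqI[OF cmpF_hom[OF s t]])
    fix i j assume ij: "i < length [x]" "j < length [x]"
    have "coef (cmpF u ?t ?s) i j = (\<Sum>k<length X. coef ?t i k * coef ?s k j * u ^ nc x (X ! k) x)"
      using coef_cmp[OF s t ij] ij by simp
    also have "\<dots> = coef ?t i r * coef ?s r j * u ^ nc x (X ! r) x"
      by (rule sum_single) (use r ij in auto)
    finally show "coef (cmpF u ?t ?s) i j = coef (idnF u [x]) i j" using r ij x by (simp add: coef_idn)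
  qed (use x idnF_hom in simp)
  have "injective (Fpi u) CF [x]"
  proof -
    have "\<exists>h\<in>homF u (tgt (Fpi u) i) [x]. cmpF u h i = f"
      if iq: "(i, q) \<in> CF" and f0: "f \<in> homF u (src (Fpi u) i) [x]" for i q f
    proof -
      obtain A B D where i: "i \<in> homF u A B" and q: "q \<in> homF u B D" using conflation_hom[OF iq] .
      have f: "f \<in> homF u A [x]" using f0 F.homD[OF i] by simp
      obtain k where k: "k \<in> homF u B X" "cmpF u k i = cmpF u ?s f"
        using injective_ext[OF inj iq i F.comp_hom[OF f s]] .
      have "cmpF u (cmpF u ?t k) i = f"
        using F.comp_assoc[OF i k(1) t] F.comp_assoc[OF f s t] k(2) ts F.id_left[OF f] by simp
      then show ?thesis using F.comp_hom[OF k(1) t] F.homD[OF i] by blast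
    qed
    then show ?thesis using x unfolding injective_def by auto
  qed
  then have "projinj (Fpi u) CF [x]" using Fpi_projective_iff_injective x unfolding projinj_def by simp
  then show "x \<in> Collect bdpt" using point_projinj_iff[OF x] by simp
qed

text \<open>The Frobenius axioms supply some conflation with inflation j : X \<rightarrow> I and I
  injective. The points of I lie on the boundary, so nu vanishes and \<open>facF\<close> writes j as
  a multiple of \<open>incF\<close>; conversely \<open>incF\<close> extends along j because its
  target is injective. \<open>conflation_if_mutual_factor\<close> then applies.\<close>

lemma std_conflation: assumes X: "pts X" shows "(incF u X, prjF u X) \<in> CF"
proof -
  have "\<exists>(i, q)\<in>CF. src (Fpi u) i = X \<and> injective (Fpi u) CF (tgt (Fpi u) i)"
    using frob X unfolding Fpi_frobenius_def frobenius_def by auto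
  then obtain j k where jk: "(j, k) \<in> CF" "src (Fpi u) j = X" "injective (Fpi u) CF (tgt (Fpi u) j)" by blast
  obtain A I Z where j0: "j \<in> homF u A I" and k: "k \<in> homF u I Z" using conflation_hom[OF jk(1)] .
  have AI: "A = X" "tgt (Fpi u) j = I" using F.homD[OF j0] jk(2) by simp_all
  have j: "j \<in> homF u X I" using j0 AI by simp
  have I: "set I \<subseteq> Collect bdpt" using bdpt_if_injective jk(3) AI by simp
  have "u ^ nu (X ! c) (I ! r) dvd coef j r c" if "r < length I" "c < length X" for r c
    using nu_bdpt(1)[of "X ! c" "I ! r"] X I that nth_mem by (metis (no_types, lifting) mem_Collect_eq one_dvd power_0 subsetD)
  note m = facF[OF j this]
  obtain n where n: "n \<in> homF u I (JL X)" "cmpF u n j = incF u X"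
    using injective_ext[OF injective_if_bdpt[OF JL_bdpt[OF X]] jk(1) j incF_hom[OF X]] .
  show ?thesis
    using F.conflation_if_mutual_factor[OF jk(1) j k incF_prjF_kernel[OF u_nonzero X]
        incF_prjF_cokernel[OF u_nonzero X] incF_hom[OF X] prjF_hom[OF X] n m] .
qed

text \<open>CF is not given by a formula, but every conflation is a pullback of the standard hull
  sequence of its first term. Homeomorphisms carry standard sequences to standard sequences and
  pullbacks to pullbacks.\<close>

lemma conflation_psh:
  assumes g: "lift_map g" "lift_map h" "\<And>x. h (g x) = x" "\<And>x. g (h x) = x" and iq: "(i, q) \<in> CF"
  shows "(psh g i, psh g q) \<in> CF"
proof -
  interpret S: strict_iso "Fpi u" "hml g" "hml h" "psh g" "psh h" by (rule psh_strict_iso[OF g])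
  obtain A B D where i: "i \<in> homF u A B" and q: "q \<in> homF u B D" using conflation_hom[OF iq] .
  have A: "pts A" using homFD[OF i] by blast
  obtain m where m: "m \<in> homF u B (JL A)" "cmpF u m i = incF u A"
    using injective_ext[OF injective_if_bdpt[OF JL_bdpt[OF A]] iq i incF_hom[OF A]] .
  have "cmpF u (cmpF u (prjF u A) m) i = zroF u A (SL A)"
    unfolding F.comp_assoc[OF i m(1) prjF_hom[OF A], symmetric] m(2) by (rule prjF_incF[OF A])
  then obtain z where z: "z \<in> homF u D (SL A)" "cmpF u z q = cmpF u (prjF u A) m"
    using F.is_cokernelD(2)[OF F.conflation_cokernel[OF iq] i q F.comp_hom[OF m(1) prjF_hom[OF A]]] by blast
  have pb: "is_pullback (Fpi u) (prjF u A) z m q"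
    by (rule F.conflation_square_pullback[OF std_conflation[OF A] incF_hom[OF A] prjF_hom[OF A] iq i q m z])
  have gA: "pts (hml g A)" using hml_Xpi g A by blast
  have pg: "psh g (prjF u A) \<in> homF u (JL (hml g A)) (SL (hml g A))"
    unfolding psh_prjF[OF g(1) A] using prjF_hom[OF gA] .
  have e: "hml g (JL A) = JL (hml g A)" "hml g (SL A) = SL (hml g A)" using hml_JL hml_SL g A by blast+
  have std: "(psh g (incF u A), psh g (prjF u A)) \<in> CF"
    unfolding psh_prjF[OF g(1) A] psh_incF[OF g(1) A] using std_conflation[OF gA] .
  show ?thesis
    using F.conflation_if_pullback[OF std pg S.G1_is_kernel[OF F.conflation_kernel[OF iq] i q] S.G1[OF i] S.G1[OF q]
        S.G1[OF m(1), unfolded e] S.G1[OF z(1), unfolded e] S.G1_is_pullback[OF pb prjF_hom[OF A] z(1)]] .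
qed

end

section \<open>Equivariant objects\<close>

definition smulF :: "'r::idom \<Rightarrow> 'r fmor \<Rightarrow> 'r fmor" where
  "smulF r f = Arr (asrc f) (atgt f) (\<lambda>i j. r * coef f i j)"

definition fsum :: "pt set list \<Rightarrow> pt set list \<Rightarrow> nat \<Rightarrow> (nat \<Rightarrow> 'r::idom fmor) \<Rightarrow> 'r fmor" where
  "fsum X Y n t = Arr X Y (\<lambda>i j. \<Sum>g<n. coef (t g) i j)"

lemma smulF_hom: "f \<in> homF u X Y \<Longrightarrow> smulF r f \<in> homF u X Y"
  unfolding homF_iff smulF_def by simp

lemma coef_smulF [simp]: "coef (smulF r f) i j = r * coef f i j"
  by (simp add: smulF_def)

lemma smulF_cmp:
  assumes f: "f \<in> homF u X Y" and g: "g \<in> homF u Y Z"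
  shows "cmpF u (smulF r g) f = smulF r (cmpF u g f)"
    and "cmpF u g (smulF r f) = smulF r (cmpF u g f)"
proof -
  show "cmpF u (smulF r g) f = smulF r (cmpF u g f)"
    by (rule Fpi_eqI[OF cmpF_hom[OF f smulF_hom[OF g]] smulF_hom[OF cmpF_hom[OF f g]]])
      (simp add: coef_cmp[OF f smulF_hom[OF g]] coef_cmp[OF f g] sum_distrib_left ac_simps)
  show "cmpF u g (smulF r f) = smulF r (cmpF u g f)"
    by (rule Fpi_eqI[OF cmpF_hom[OF smulF_hom[OF f] g] smulF_hom[OF cmpF_hom[OF f g]]])
      (simp add: coef_cmp[OF smulF_hom[OF f] g] coef_cmp[OF f g] sum_distrib_left ac_simps)
qed

lemma psh_smulF: "psh g (smulF r f) = smulF r (psh g f)"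
  by (simp add: push_mor_def smulF_def)

lemma fsum_hom:
  assumes "pts X" "pts Y" "\<And>g. g < n \<Longrightarrow> t g \<in> homF u X Y"
  shows "fsum X Y n t \<in> homF u X Y"
  using assms unfolding homF_iff fsum_def by auto

lemma coef_fsum [simp]: "coef (fsum X Y n t) i j = (\<Sum>g<n. coef (t g) i j)"
  by (simp add: fsum_def)

lemma fsum_cmp:
  assumes X: "pts X" and f: "f \<in> homF u X Y" and t: "\<And>g. g < n \<Longrightarrow> t g \<in> homF u Y Z"
    and Z: "pts Z"
  shows "cmpF u (fsum Y Z n t) f = fsum X Z n (\<lambda>g. cmpF u (t g) f)"
proof (rule Fpi_eqI)
  have Y: "pts Y" using homFD[OF f] by blast
  have s: "fsum Y Z n t \<in> homF u Y Z" by (rule fsum_hom[OF Y Z]) (rule t)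
  show "cmpF u (fsum Y Z n t) f \<in> homF u X Z" using cmpF_hom[OF f s] .
  show "fsum X Z n (\<lambda>g. cmpF u (t g) f) \<in> homF u X Z"
    by (intro fsum_hom X Z cmpF_hom[OF f t])
  fix i k assume i: "i < length Z" and k: "k < length X"
  have "coef (cmpF u (fsum Y Z n t) f) i k =
      (\<Sum>j<length Y. \<Sum>g<n. coef (t g) i j * coef f j k * u ^ nc (X ! k) (Y ! j) (Z ! i))"
    unfolding coef_cmp[OF f s i k] by (simp add: sum_distrib_right)
  also have "\<dots> = (\<Sum>g<n. \<Sum>j<length Y. coef (t g) i j * coef f j k * u ^ nc (X ! k) (Y ! j) (Z ! i))"
    by (rule sum.swap)
  also have "\<dots> = (\<Sum>g<n. coef (cmpF u (t g) f) i k)"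
    by (intro sum.cong refl) (simp add: coef_cmp[OF f t i k])
  finally show "coef (cmpF u (fsum Y Z n t) f) i k = coef (fsum X Z n (\<lambda>g. cmpF u (t g) f)) i k" by simp
qed

lemma cmp_fsum:
  assumes X: "pts X" and f: "f \<in> homF u Y Z" and t: "\<And>g. g < n \<Longrightarrow> t g \<in> homF u X Y"
  shows "cmpF u f (fsum X Y n t) = fsum X Z n (\<lambda>g. cmpF u f (t g))"
proof (rule Fpi_eqI)
  have Y: "pts Y" and Z: "pts Z" using homFD[OF f] by blast+
  have s: "fsum X Y n t \<in> homF u X Y" by (rule fsum_hom[OF X Y]) (rule t)
  show "cmpF u f (fsum X Y n t) \<in> homF u X Z" using cmpF_hom[OF s f] .
  show "fsum X Z n (\<lambda>g. cmpF u f (t g)) \<in> homF u X Z"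
    by (intro fsum_hom X Z cmpF_hom[OF t f])
  fix i k assume i: "i < length Z" and k: "k < length X"
  have "coef (cmpF u f (fsum X Y n t)) i k =
      (\<Sum>j<length Y. \<Sum>g<n. coef f i j * coef (t g) j k * u ^ nc (X ! k) (Y ! j) (Z ! i))"
    unfolding coef_cmp[OF s f i k] by (simp add: sum_distrib_right sum_distrib_left)
  also have "\<dots> = (\<Sum>g<n. \<Sum>j<length Y. coef f i j * coef (t g) j k * u ^ nc (X ! k) (Y ! j) (Z ! i))"
    by (rule sum.swap)
  also have "\<dots> = (\<Sum>g<n. coef (cmpF u f (t g)) i k)"
    by (intro sum.cong refl) (simp add: coef_cmp[OF t f i k])
  finally show "coef (cmpF u f (fsum X Y n t)) i k = coef (fsum X Z n (\<lambda>g. cmpF u f (t g))) i k" by simp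
qed

lemma psh_fsum: "psh g (fsum X Y n t) = fsum (hml g X) (hml g Y) n (\<lambda>k. psh g (t k))"
  by (simp add: push_mor_def fsum_def)

lemma fsum_reindex:
  assumes "bij_betw s {..<n} {..<n}" shows "fsum X Y n (\<lambda>g. t (s g)) = fsum X Y n t"
  unfolding fsum_def using sum.reindex_bij_betw[OF assms, of "\<lambda>g. coef (t g) i j" for i j] by simp

lemma fsum_cong: "(\<And>g. g < n \<Longrightarrow> t g = t' g) \<Longrightarrow> fsum X Y n t = fsum X Y n t'"
  unfolding fsum_def by simp

lemma bij_betw_add_mod: assumes "0 < p" shows "bij_betw (\<lambda>g. (h + g) mod p) {..<p} {..<p::nat}"
proof -
  have "inj_on (\<lambda>g. (h + g) mod p) {..<p}"
  proof (rule inj_onI)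
    fix x y assume "x \<in> {..<p}" "y \<in> {..<p}" "(h + x) mod p = (h + y) mod p"
    then show "x = y"
      using mod_eq_dvd_iff_nat[of "h + x" "h + y" p] mod_eq_dvd_iff_nat[of "h + y" "h + x" p]
        nat_dvd_not_less[of "x - y" p] nat_dvd_not_less[of "y - x" p]
      by (cases x y rule: linorder_cases) auto
  qed
  moreover have "(\<lambda>g. (h + g) mod p) ` {..<p} \<subseteq> {..<p}" using assms by auto
  ultimately show ?thesis using endo_inj_surj[of "{..<p}"] unfolding bij_betw_def by blast
qed

text \<open>Rotations are instances of lifted circle maps, so everything shown for
  \<open>hmpt\<close> applies to \<open>rot\<close>.\<close>

definition tau :: "nat \<Rightarrow> nat \<Rightarrow> real \<Rightarrow> real" where "tau p g = (\<lambda>x. x + real g * theta p)"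

abbreviation "hmt p g \<equiv> hml (tau p g)"
abbreviation "pst p g \<equiv> psh (tau p g)"

lemma lift_map_tau: "lift_map (tau p g)"
  unfolding tau_def by (rule lift_map_translate)

lemma rot_tau: "X \<in> Xpi \<Longrightarrow> rot p g X = hmpt (tau p g) X"
  unfolding tau_def by (rule rot_hmpt)

lemma rot_list: "pts X \<Longrightarrow> map (rot p g) X = hmt p g X"
  using rot_tau by auto

lemma rot_push: "f \<in> homF u X Y \<Longrightarrow> push_mor (rot p g) f = pst p g f"
  using rot_list homFD[of f u X Y] by (simp add: push_mor_def)

text \<open>Reducing the exponent modulo p changes the translation by a multiple of p theta = 2 pi,
  which points do not see.\<close>

lemma hmpt_tau: assumes p: "0 < p" and X: "X \<in> Xpi"
  shows "hmpt (tau p g) (hmpt (tau p h) X) = hmpt (tau p ((g + h) mod p)) X"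
proof -
  obtain a b where ab: "okp a b" "X = Ept a b" using XpiE[OF X] .
  have "real (g + h) = real ((g + h) mod p) + real p * real ((g + h) div p)"
    unfolding of_nat_mult[symmetric] of_nat_add[symmetric] by (simp only: mod_mult_div_eq)
  then have "real (g + h) * theta p = real ((g + h) mod p) * theta p + 2 * pi * real ((g + h) div p)"
    using p unfolding theta_def by (simp add: field_simps)
  then have e: "x + real h * theta p + real g * theta p = x + real ((g + h) mod p) * theta p + 2 * pi * of_int (int ((g + h) div p))" for x
    by (simp add: algebra_simps)
  have t: "hmpt (tau p k) (Ept c d) = Ept (c + real k * theta p) (d + real k * theta p)" if "okp c d" for c d k
    using hmpt_Ept[OF lift_map_tau that] by (simp add: tau_def)
  have "okp (a + real h * theta p) (b + real h * theta p)"
    using lift_map_okp[OF lift_map_tau ab(1), of p h] by (simp add: tau_def)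
  from t[OF this, of g] show ?thesis unfolding ab(2) t[OF ab(1)] e Ept_periodic .
qed

lemma hmpt_tau_0: "X \<in> Xpi \<Longrightarrow> hmpt (tau p 0) X = X"
  using hmpt_ident[of "tau p 0" 0] by (simp add: tau_def)

lemma psh_tau:
  assumes "0 < p" "f \<in> homF u X Y"
  shows "pst p g (pst p h f) = pst p ((g + h) mod p) f"
  using homFD[OF assms(2)] hmpt_tau[OF assms(1)] by (auto simp: push_mor_def)

lemma hml_tau: "0 < p \<Longrightarrow> pts X \<Longrightarrow> hmt p g (hmt p h X) = hmt p ((g + h) mod p) X"
  using hmpt_tau by auto

lemma hml_tau_0: "pts X \<Longrightarrow> hmt p 0 X = X"
  using hmpt_tau_0 by (auto intro!: map_idI)

lemma psh_tau_0: "f \<in> homF u X Y \<Longrightarrow> pst p 0 f = f"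
  using hml_tau_0 homFD[of f u X Y] by (intro arr.expand) simp

definition eqv :: "'r::idom \<Rightarrow> nat \<Rightarrow> 'r gob \<Rightarrow> 'r gob \<Rightarrow> 'r fmor \<Rightarrow> bool" where
  "eqv u p A B k \<longleftrightarrow> k \<in> homF u (fst A) (fst B) \<and>
    (\<forall>g<p. cmpF u k (snd A g) = cmpF u (snd B g) (pst p g k))"

lemma und_lift_mor [simp]: "und (lift_mor A B k) = Arr (fst A) (fst B) (coef k)"
  by (simp add: und_def lift_mor_def)

lemma und_lift: "k \<in> homF u (fst A) (fst B) \<Longrightarrow> und (lift_mor A B k) = k"
  unfolding und_lift_mor using homFD(3,4)[of k u "fst A" "fst B"] by (intro arr.expand) simp

lemma lift_und: "lift_mor (asrc f) (atgt f) (und f) = f"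
  by (simp add: und_def lift_mor_def)

lemma lift_mor_sel [simp]: "asrc (lift_mor A B k) = A" "atgt (lift_mor A B k) = B" "coef (lift_mor A B k) = coef k"
  by (simp_all add: lift_mor_def)

lemma G_obs [simp]: "obs (FpiG u p) = gobs u p"
  by (simp add: FpiG_def)

lemma G_hom_iff:
  "f \<in> hom (FpiG u p) A B \<longleftrightarrow> A \<in> gobs u p \<and> B \<in> gobs u p \<and> asrc f = A \<and> atgt f = B \<and> eqv u p A B (und f)"
proof -
  have "und f \<in> mors (Fpi u) \<longleftrightarrow> und f \<in> homF u (fst A) (fst B)" if "asrc f = A" "atgt f = B"
    using that unfolding hom_def Fpi_def und_def by auto
  then show ?thesis
    using rot_push[of "und f" u "fst A" "fst B"] unfolding eqv_def hom_def[of "FpiG u p"]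
    by (auto simp: FpiG_def)
qed

lemma G_homI: "A \<in> gobs u p \<Longrightarrow> B \<in> gobs u p \<Longrightarrow> eqv u p A B k \<Longrightarrow> lift_mor A B k \<in> hom (FpiG u p) A B"
  unfolding G_hom_iff using und_lift[of k u A B] by (simp add: eqv_def del: und_lift_mor)

lemma G_homD:
  assumes "f \<in> hom (FpiG u p) A B"
  shows "A \<in> gobs u p" "B \<in> gobs u p" "asrc f = A" "atgt f = B" "und f \<in> homF u (fst A) (fst B)"
    "g < p \<Longrightarrow> cmpF u (und f) (snd A g) = cmpF u (snd B g) (pst p g (und f))"
    "lift_mor A B (und f) = f" "coef (und f) = coef f"
  using assms lift_und[of f] unfolding G_hom_iff eqv_def by (auto simp: und_def)

lemma G_eqI: "f \<in> hom (FpiG u p) A B \<Longrightarrow> g \<in> hom (FpiG u p) A B \<Longrightarrow> und f = und g \<Longrightarrow> f = g"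
  using G_homD(7) by metis

lemma gobsD:
  assumes "A \<in> gobs u p"
  shows "pts (fst A)" "g < p \<Longrightarrow> snd A g \<in> homF u (hmt p g (fst A)) (fst A)"
    "g < p \<Longrightarrow> is_iso (Fpi u) (snd A g)"
    "g < p \<Longrightarrow> h < p \<Longrightarrow> snd A ((g + h) mod p) = cmpF u (snd A g) (pst p g (snd A h))"
    "snd A \<in> extensional {..<p}"
proof -
  obtain X \<xi> where A: "A = (X, \<xi>)" by (cases A)
  show X: "pts (fst A)" and "snd A \<in> extensional {..<p}"
    using assms unfolding A gobs_def by auto
  show h: "snd A g \<in> homF u (hmt p g (fst A)) (fst A)" if "g < p" for g
  proof -
    have "pts X" "\<xi> g \<in> homF u (map (rot p g) X) X" using assms that unfolding A gobs_def by auto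
    then show ?thesis unfolding A fst_conv snd_conv using rot_list[of X p g] by (simp only:)
  qed
  show "g < p \<Longrightarrow> is_iso (Fpi u) (snd A g)" using assms unfolding A gobs_def by auto
  show "snd A ((g + h) mod p) = cmpF u (snd A g) (pst p g (snd A h))" if "g < p" "h < p"
    using assms that rot_push[OF h[OF that(2)]] unfolding A gobs_def by auto
qed

text \<open>Invertibility of p in R is what allows averages over the group; it will come from the
  characteristic of the residue field.\<close>

locale gfpi = fpi u CF for u :: "'r::idom" and CF +
  fixes p :: nat
  assumes p3: "3 \<le> p" and p_odd: "odd p" and p_unit: "(of_nat p :: 'r) dvd 1"
begin

abbreviation "GG \<equiv> FpiG u p"
abbreviation "CG \<equiv> conflG u p CF"

lemma p0: "0 < p" using p3 by simp

lemma tau_strict_iso: "strict_iso (Fpi u) (hmt p g) (hml (\<lambda>x. x - real g * theta p)) (pst p g) (psh (\<lambda>x. x - real g * theta p))"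
  by (rule psh_strict_iso) (use lift_map_translate[of "- (real g * theta p)"] lift_map_tau in \<open>auto simp: tau_def\<close>)

lemma psh_tau_hom: "f \<in> homF u X Y \<Longrightarrow> pst p g f \<in> homF u (hmt p g X) (hmt p g Y)"
  by (rule psh_hom[OF lift_map_tau])

lemma psh_tau_cmp: "f \<in> homF u X Y \<Longrightarrow> h \<in> homF u Y Z \<Longrightarrow>
    pst p g (cmpF u h f) = cmpF u (pst p g h) (pst p g f)"
  by (rule psh_cmp[OF lift_map_tau])

text \<open>The cocycle condition with both group elements trivial makes this map idempotent, and it
  is invertible.\<close>

lemma xi_0: assumes "A \<in> gobs u p" shows "snd A 0 = idnF u (fst A)"
proof -
  have h: "snd A 0 \<in> homF u (fst A) (fst A)"
    using gobsD(2)[OF assms p0] hml_tau_0[OF gobsD(1)[OF assms]] by simp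
  have e: "cmpF u (snd A 0) (snd A 0) = snd A 0"
    using gobsD(4)[OF assms p0 p0] psh_tau_0[OF h] by simp
  obtain f where f: "f \<in> homF u (fst A) (fst A)" "cmpF u f (snd A 0) = idnF u (fst A)"
    using F.is_isoE[OF gobsD(3)[OF assms p0] h] by blast
  have "cmpF u f (cmpF u (snd A 0) (snd A 0)) = snd A 0"
    using F.comp_assoc[OF h h f(1)] f(2) F.id_left[OF h] by simp
  then show ?thesis using e f(2) by simp
qed

text \<open>By the cocycle condition the inverse of the structure map of g is the g-rotation of the
  structure map of -g. The reduction modulo p covers g = 0.\<close>

definition xinv :: "'r gob \<Rightarrow> nat \<Rightarrow> 'r fmor" where
  "xinv A g = pst p g (snd A ((p - g) mod p))"

lemma neg_mod: "(p - g) mod p < p" "g < p \<Longrightarrow> (g + (p - g) mod p) mod p = 0" "g < p \<Longrightarrow> ((p - g) mod p + g) mod p = 0"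
  using p0 by (auto simp: mod_add_right_eq mod_add_left_eq)

lemma xinv:
  assumes A: "A \<in> gobs u p" and g: "g < p"
  shows xinv_hom: "xinv A g \<in> homF u (fst A) (hmt p g (fst A))"
    and xi_xinv: "cmpF u (snd A g) (xinv A g) = idnF u (fst A)"
    and xinv_xi: "cmpF u (xinv A g) (snd A g) = idnF u (hmt p g (fst A))"
proof -
  note X = gobsD(1)[OF A]
  note h = gobsD(2)[OF A g]
  have "hmt p g (hmt p ((p - g) mod p) (fst A)) = fst A"
    using hml_tau[OF p0 X, of g "(p - g) mod p"] neg_mod(2)[OF g] hml_tau_0[OF X] by simp
  then show x: "xinv A g \<in> homF u (fst A) (hmt p g (fst A))"
    using psh_tau_hom[OF gobsD(2)[OF A neg_mod(1)], of g g] unfolding xinv_def by simp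
  show 1: "cmpF u (snd A g) (xinv A g) = idnF u (fst A)"
    using gobsD(4)[OF A g neg_mod(1), of g] neg_mod(2)[OF g] xi_0[OF A] unfolding xinv_def by simp
  obtain f where f: "f \<in> homF u (fst A) (hmt p g (fst A))"
    "cmpF u f (snd A g) = idnF u (hmt p g (fst A))"
    using F.is_isoE[OF gobsD(3)[OF A g] h] by blast
  have "f = xinv A g"
    using F.comp_assoc[OF x h f(1)] 1 f F.id_right[OF f(1)] F.id_left[OF x] by simp
  then show "cmpF u (xinv A g) (snd A g) = idnF u (hmt p g (fst A))" using f by simp
qed

text \<open>Invertibility of the structure maps follows from the cocycle condition once the one for
  the trivial element is the identity.\<close>

lemma gobsI:
  assumes X: "pts X" and ext: "\<xi> \<in> extensional {..<p}"
    and h: "\<And>g. g < p \<Longrightarrow> \<xi> g \<in> homF u (hmt p g X) X"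
    and c: "\<And>g h. g < p \<Longrightarrow> h < p \<Longrightarrow> \<xi> ((g + h) mod p) = cmpF u (\<xi> g) (pst p g (\<xi> h))"
    and 0: "\<xi> 0 = idnF u X"
  shows "(X, \<xi>) \<in> gobs u p"
proof -
  have iso: "is_iso (Fpi u) (\<xi> g)" if g: "g < p" for g
  proof (rule F.is_isoI[OF h[OF g]])
    let ?m = "(p - g) mod p"
    have e: "hmt p g (hml (tau p ?m) X) = X"
      using hml_tau[OF p0 X, of g ?m] neg_mod(2)[OF g] hml_tau_0[OF X] by simp
    show "pst p g (\<xi> ?m) \<in> homF u X (hmt p g X)"
      using psh_tau_hom[OF h[OF neg_mod(1)], of g g] e by simp
    show "cmpF u (\<xi> g) (pst p g (\<xi> ?m)) = idnF u X"
      using c[OF g neg_mod(1), of g] neg_mod(2)[OF g] 0 by simp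
    have "pst p g (cmpF u (\<xi> ?m) (psh (tau p ?m) (\<xi> g))) = pst p g (idnF u X)"
      using c[OF neg_mod(1) g, of g] neg_mod(3)[OF g] 0 by simp
    moreover have "psh (tau p ?m) (\<xi> g) \<in> homF u X (hml (tau p ?m) X)"
      using psh_tau_hom[OF h[OF g], of ?m] hml_tau[OF p0 X, of ?m g] neg_mod(3)[OF g] hml_tau_0[OF X] by simp
    moreover have "pst p g (psh (tau p ?m) (\<xi> g)) = \<xi> g"
      using psh_tau[OF p0 h[OF g], of g ?m] neg_mod(2)[OF g] psh_tau_0[OF h[OF g]] by simp
    ultimately show "cmpF u (pst p g (\<xi> ?m)) (\<xi> g) = idnF u (hmt p g X)"
      using psh_tau_cmp[OF _ h[OF neg_mod(1)], of "psh (tau p ?m) (\<xi> g)" X g g] psh_idn by simp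
  qed
  have h': "\<xi> g \<in> homF u (map (rot p g) X) X" if "g < p" for g
    unfolding rot_list[OF X] using h[OF that] .
  have c': "\<xi> ((g + k) mod p) = cmpF u (\<xi> g) (push_mor (rot p g) (\<xi> k))" if "g < p" "k < p" for g k
    unfolding rot_push[OF h[OF that(2)]] using c[OF that] .
  show ?thesis unfolding gobs_def using X ext h' c' iso by simp
qed

lemma und_cmp [simp]: "f \<in> hom GG A B \<Longrightarrow> g \<in> hom GG B E \<Longrightarrow> und (cmp GG g f) = cmpF u (und g) (und f)"
  using und_lift[OF cmpF_hom[OF G_homD(5) G_homD(5)], of f u p A B g p E] G_homD(3,4)[of f u p A B]
    G_homD(3,4)[of g u p B E]
  by (simp add: FpiG_def del: und_lift_mor)

lemma und_pls [simp]: "f \<in> hom GG A B \<Longrightarrow> g \<in> hom GG A B \<Longrightarrow> und (pls GG g f) = plsF u (und g) (und f)"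
  using und_lift[OF plsF_hom[OF G_homD(5) G_homD(5)], of g u p A B f p] G_homD(3,4)[of f u p A B]
  by (simp add: FpiG_def del: und_lift_mor)

lemma und_idn [simp]: "A \<in> gobs u p \<Longrightarrow> und (idn GG A) = idnF u (fst A)"
  using und_lift[OF idnF_hom[OF gobsD(1)]] by (simp add: FpiG_def del: und_lift_mor)

lemma und_zro [simp]: "A \<in> gobs u p \<Longrightarrow> B \<in> gobs u p \<Longrightarrow> und (zro GG A B) = zroF u (fst A) (fst B)"
  using und_lift[OF zroF_hom[OF gobsD(1) gobsD(1)]] by (simp add: FpiG_def del: und_lift_mor)

lemma eqv_cmp:
  assumes A: "A \<in> gobs u p" "B \<in> gobs u p" "E \<in> gobs u p" and f: "eqv u p A B f" and h: "eqv u p B E h"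
  shows "eqv u p A E (cmpF u h f)"
proof -
  have f': "f \<in> homF u (fst A) (fst B)" and h': "h \<in> homF u (fst B) (fst E)"
    using f h unfolding eqv_def by auto
  have "cmpF u (cmpF u h f) (snd A g) = cmpF u (snd E g) (pst p g (cmpF u h f))"
    if g: "g < p" for g
  proof -
    have ef: "cmpF u f (snd A g) = cmpF u (snd B g) (pst p g f)"
      and eh: "cmpF u h (snd B g) = cmpF u (snd E g) (pst p g h)"
      using f h g unfolding eqv_def by auto
    show ?thesis
      unfolding F.comp_assoc[OF gobsD(2)[OF A(1) g] f' h', symmetric] ef
        F.comp_assoc[OF psh_tau_hom[OF f'] gobsD(2)[OF A(2) g] h'] eh psh_tau_cmp[OF f' h']
      by (rule F.comp_assoc[OF psh_tau_hom[OF f'] psh_tau_hom[OF h'] gobsD(2)[OF A(3) g], symmetric])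
  qed
  then show ?thesis unfolding eqv_def using cmpF_hom[OF f' h'] by blast
qed

lemma eqv_pls:
  assumes A: "A \<in> gobs u p" "B \<in> gobs u p" and f: "eqv u p A B f" and h: "eqv u p A B h"
  shows "eqv u p A B (plsF u h f)"
proof -
  have f': "f \<in> homF u (fst A) (fst B)" and h': "h \<in> homF u (fst A) (fst B)"
    using f h unfolding eqv_def by auto
  have "cmpF u (plsF u h f) (snd A g) = cmpF u (snd B g) (pst p g (plsF u h f))"
    if g: "g < p" for g
    unfolding F.distr[OF gobsD(2)[OF A(1) g] h' f'] psh_pls
      F.distl[OF psh_tau_hom[OF h'] psh_tau_hom[OF f'] gobsD(2)[OF A(2) g]]
    using f h g unfolding eqv_def by simp
  then show ?thesis unfolding eqv_def using plsF_hom[OF h' f'] by blast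
qed

lemma eqv_smulF:
  assumes A: "A \<in> gobs u p" "B \<in> gobs u p" and f: "eqv u p A B f"
  shows "eqv u p A B (smulF r f)"
proof -
  have f': "f \<in> homF u (fst A) (fst B)" using f unfolding eqv_def by auto
  have "cmpF u (smulF r f) (snd A g) = cmpF u (snd B g) (pst p g (smulF r f))" if g: "g < p" for g
    unfolding smulF_cmp(1)[OF gobsD(2)[OF A(1) g] f'] psh_smulF
      smulF_cmp(2)[OF psh_tau_hom[OF f'] gobsD(2)[OF A(2) g]]
    using f g unfolding eqv_def by simp
  then show ?thesis unfolding eqv_def using smulF_hom[OF f'] by blast
qed

lemma eqv_idn: assumes "A \<in> gobs u p" shows "eqv u p A A (idnF u (fst A))"
  unfolding eqv_def psh_idn
  using idnF_hom[OF gobsD(1)[OF assms]] F.id_left[OF gobsD(2)[OF assms]] F.id_right[OF gobsD(2)[OF assms]] by simp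

lemma eqv_zro: assumes "A \<in> gobs u p" "B \<in> gobs u p" shows "eqv u p A B (zroF u (fst A) (fst B))"
proof -
  have z: "zroF u (fst A) (fst B) \<in> homF u (fst A) (fst B)"
    using zroF_hom gobsD(1) assms by blast
  have "smulF 0 (zroF u (fst A) (fst B)) = zroF u (fst A) (fst B)"
    by (rule Fpi_eqI[OF smulF_hom[OF z] z]) simp
  have "pst p g (zroF u (fst A) (fst B)) = zroF u (hmt p g (fst A)) (hmt p g (fst B))" for g
    by (simp add: push_mor_def Fpi_def)
  then show ?thesis
    unfolding eqv_def using z F.comp_zero[OF gobsD(2)[OF assms(1)]] F.zero_comp[OF gobsD(2)[OF assms(2)]]
      hml_Xpi[OF lift_map_tau gobsD(1)[OF assms(1)]] gobsD(1)[OF assms(2)] by simp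
qed

lemma G_preadditive: "preadditive GG"
proof
  fix f g h :: "'r gmor" and A B E W
  assume f: "f \<in> hom GG A B"
  note A = G_homD(1)[OF f] and B = G_homD(2)[OF f]
  show "A \<in> obs GG \<and> B \<in> obs GG" using A B by simp
  have id: "idn GG V \<in> hom GG V V" if "V \<in> gobs u p" for V
    using G_homI[OF that that eqv_idn[OF that]] by (simp add: FpiG_def)
  have z: "zro GG A B \<in> hom GG A B"
    using G_homI[OF A B eqv_zro[OF A B]] by (simp add: FpiG_def)
  have ch: "cmp GG g f \<in> hom GG A E" if "f \<in> hom GG A B" "g \<in> hom GG B E" for f g A B E
    using G_homI[OF G_homD(1)[OF that(1)] G_homD(2)[OF that(2)] eqv_cmp[OF G_homD(1,2)[OF that(1)] G_homD(2)[OF that(2)]]]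
      that unfolding G_hom_iff by (simp add: FpiG_def)
  have ph: "pls GG f g \<in> hom GG A B" if "f \<in> hom GG A B" "g \<in> hom GG A B" for f g A B
    using G_homI[OF G_homD(1,2)[OF that(1)] eqv_pls[OF G_homD(1,2)[OF that(1)]]]
      that unfolding G_hom_iff by (simp add: FpiG_def)
  note f' = G_homD(5)[OF f]
  show "cmp GG (idn GG B) f = f"
    by (rule G_eqI[OF ch[OF f id[OF B]] f]) (simp add: und_cmp[OF f id[OF B]] B F.id_left[OF f'])
  show "cmp GG f (idn GG A) = f"
    by (rule G_eqI[OF ch[OF id[OF A] f] f]) (simp add: und_cmp[OF id[OF A] f] A F.id_right[OF f'])
  show "pls GG f (zro GG A B) = f"
    by (rule G_eqI[OF ph[OF f z] f]) (simp add: und_pls[OF z f] A B F.plus_zero[OF f'])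
  have n: "lift_mor A B (smulF (-1) (und f)) \<in> hom GG A B"
    using G_homI[OF A B eqv_smulF[OF A B]] f unfolding G_hom_iff by blast
  have "pls GG f (lift_mor A B (smulF (-1) (und f))) = zro GG A B"
  proof (rule G_eqI[OF ph[OF f n] z])
    have "plsF u (und f) (smulF (-1) (und f)) = zroF u (fst A) (fst B)"
      by (rule Fpi_eqI[OF plsF_hom[OF f' smulF_hom[OF f']] zroF_hom[OF gobsD(1)[OF A] gobsD(1)[OF B]]]) simp
    then show "und (pls GG f (lift_mor A B (smulF (-1) (und f)))) = und (zro GG A B)"
      using und_pls[OF n f] und_lift[OF smulF_hom[OF f']] A B by (simp del: und_lift_mor)
  qed
  then show "\<exists>g\<in>hom GG A B. pls GG f g = zro GG A B" using n by blast
  show "cmp GG g f \<in> hom GG A E" if "g \<in> hom GG B E" using ch[OF f that] .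
  show "cmp GG h (cmp GG g f) = cmp GG (cmp GG h g) f" if g: "g \<in> hom GG B E" and h: "h \<in> hom GG E W"
    by (rule G_eqI[OF ch[OF ch[OF f g] h] ch[OF f ch[OF g h]]])
      (simp add: und_cmp[OF f g] und_cmp[OF ch[OF f g] h] und_cmp[OF g h] und_cmp[OF f ch[OF g h]]
        F.comp_assoc[OF f' G_homD(5)[OF g] G_homD(5)[OF h]])
  {
    assume g: "g \<in> hom GG A B"
    note g' = G_homD(5)[OF g]
    show "pls GG f g \<in> hom GG A B" using ph[OF f g] .
    show "pls GG f g = pls GG g f"
      by (rule G_eqI[OF ph[OF f g] ph[OF g f]]) (simp add: und_pls[OF f g] und_pls[OF g f] F.plus_comm[OF f' g'])
    show "pls GG (pls GG f g) h = pls GG f (pls GG g h)" if h: "h \<in> hom GG A B"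
      by (rule G_eqI[OF ph[OF ph[OF f g] h] ph[OF f ph[OF g h]]])
        (simp add: und_pls[OF h ph[OF f g]] und_pls[OF g f] und_pls[OF ph[OF g h] f] und_pls[OF h g]
          F.plus_assoc[OF f' g' G_homD(5)[OF h]])
    show "cmp GG h (pls GG f g) = pls GG (cmp GG h f) (cmp GG h g)" if h: "h \<in> hom GG B E"
      by (rule G_eqI[OF ch[OF ph[OF f g] h] ph[OF ch[OF f h] ch[OF g h]]])
        (simp add: und_pls[OF g f] und_cmp[OF ph[OF f g] h] und_pls[OF ch[OF g h] ch[OF f h]] und_cmp[OF f h]
          und_cmp[OF g h] F.distl[OF f' g' G_homD(5)[OF h]])
  }
  show "cmp GG (pls GG g h) f = pls GG (cmp GG g f) (cmp GG h f)"
    if g: "g \<in> hom GG B E" and h: "h \<in> hom GG B E"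
    by (rule G_eqI[OF ch[OF f ph[OF g h]] ph[OF ch[OF f g] ch[OF f h]]])
      (simp add: und_pls[OF h g] und_cmp[OF f ph[OF g h]] und_pls[OF ch[OF f h] ch[OF f g]] und_cmp[OF f h]
        und_cmp[OF f g] F.distr[OF f' G_homD(5)[OF g] G_homD(5)[OF h]])
next
  show "idn GG A \<in> hom GG A A" if "A \<in> obs GG" for A
    using that G_homI[OF _ _ eqv_idn] by (simp add: FpiG_def)
  show "zro GG A B \<in> hom GG A B" if "A \<in> obs GG" "B \<in> obs GG" for A B
    using that G_homI[OF _ _ eqv_zro] by (simp add: FpiG_def)
qed

text \<open>The action of g on the underlying maps A \<rightarrow> B, whose invariants are the
  equivariant maps; \<open>trF\<close> is the corresponding trace.\<close>

definition conjF :: "'r gob \<Rightarrow> 'r gob \<Rightarrow> nat \<Rightarrow> 'r fmor \<Rightarrow> 'r fmor" where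
  "conjF A B g k = cmpF u (snd B g) (cmpF u (pst p g k) (xinv A g))"

definition trF :: "'r gob \<Rightarrow> 'r gob \<Rightarrow> 'r fmor \<Rightarrow> 'r fmor" where
  "trF A B k = fsum (fst A) (fst B) p (\<lambda>g. conjF A B g k)"

lemma conjF_hom:
  assumes "A \<in> gobs u p" "B \<in> gobs u p" "k \<in> homF u (fst A) (fst B)" "g < p"
  shows "conjF A B g k \<in> homF u (fst A) (fst B)"
  unfolding conjF_def
  using F.comp_hom[OF F.comp_hom[OF xinv_hom[OF assms(1,4)] psh_tau_hom[OF assms(3)]] gobsD(2)[OF assms(2,4)]] .

lemma trF_hom:
  assumes "A \<in> gobs u p" "B \<in> gobs u p" "k \<in> homF u (fst A) (fst B)"
  shows "trF A B k \<in> homF u (fst A) (fst B)"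
  unfolding trF_def using fsum_hom[OF gobsD(1)[OF assms(1)] gobsD(1)[OF assms(2)] conjF_hom[OF assms]] .

text \<open>Moving the structure map of h past the conjugate by h + g leaves the rotated conjugate
  by g. Summation over g merely permutes the terms, so the trace is equivariant.\<close>

lemma conjF_equivariant:
  assumes A: "A \<in> gobs u p" and B: "B \<in> gobs u p" and k: "k \<in> homF u (fst A) (fst B)"
    and h: "h < p" and g: "g < p"
  shows "cmpF u (conjF A B ((h + g) mod p) k) (snd A h) =
    cmpF u (snd B h) (pst p h (conjF A B g k))"
proof -
  let ?m = "(h + g) mod p"
  have m: "?m < p" using p0 by simp
  note X = gobsD(1)[OF A] and Y = gobsD(1)[OF B]
  note xg = xinv_hom[OF A g] and xm = xinv_hom[OF A m] and ah = gobsD(2)[OF A h] and bh = gobsD(2)[OF B h]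
    and bg = gobsD(2)[OF B g] and bm = gobsD(2)[OF B m] and ag = gobsD(2)[OF A g] and am = gobsD(2)[OF A m]
  note hX = hml_tau[OF p0 X, of h g] and hY = hml_tau[OF p0 Y, of h g]
  have hxg: "pst p h (xinv A g) \<in> homF u (hmt p h (fst A)) (hml (tau p ?m) (fst A))"
    using psh_tau_hom[OF xg, of h] unfolding hX .
  have hag: "pst p h (snd A g) \<in> homF u (hml (tau p ?m) (fst A)) (hmt p h (fst A))"
    using psh_tau_hom[OF ag, of h] unfolding hX .
  have hbg: "pst p h (snd B g) \<in> homF u (hml (tau p ?m) (fst B)) (hmt p h (fst B))"
    using psh_tau_hom[OF bg, of h] unfolding hY .
  have mk: "psh (tau p ?m) k \<in> homF u (hml (tau p ?m) (fst A)) (hml (tau p ?m) (fst B))"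
    using psh_tau_hom[OF k] .
  have 1: "cmpF u (xinv A ?m) (snd A h) = pst p h (xinv A g)"
  proof -
    have "cmpF u (pst p h (snd A g)) (pst p h (xinv A g)) = idnF u (hmt p h (fst A))"
      unfolding psh_tau_cmp[OF xg ag, symmetric] xi_xinv[OF A g] by (rule psh_idn)
    then have "snd A h = cmpF u (snd A h) (cmpF u (pst p h (snd A g)) (pst p h (xinv A g)))"
      using F.id_right[OF ah] by simp
    also have "\<dots> = cmpF u (snd A ?m) (pst p h (xinv A g))"
      unfolding F.comp_assoc[OF hxg hag ah] gobsD(4)[OF A h g] ..
    finally have "cmpF u (xinv A ?m) (snd A h) =
        cmpF u (xinv A ?m) (cmpF u (snd A ?m) (pst p h (xinv A g)))" by simp
    then show ?thesis unfolding F.comp_assoc[OF hxg am xm] xinv_xi[OF A m] F.id_left[OF hxg] .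
  qed
  have kx: "cmpF u (psh (tau p ?m) k) (xinv A ?m) \<in> homF u (fst A) (hml (tau p ?m) (fst B))"
    using F.comp_hom[OF xm mk] .
  have khx: "cmpF u (psh (tau p ?m) k) (pst p h (xinv A g)) \<in>
      homF u (hmt p h (fst A)) (hml (tau p ?m) (fst B))"
    using F.comp_hom[OF hxg mk] .
  have "cmpF u (conjF A B ?m k) (snd A h) =
      cmpF u (snd B ?m) (cmpF u (psh (tau p ?m) k) (pst p h (xinv A g)))"
    unfolding conjF_def F.comp_assoc[OF ah kx bm, symmetric] F.comp_assoc[OF ah xm mk, symmetric] 1 ..
  also have "\<dots> = cmpF u (snd B h) (cmpF u (pst p h (snd B g))
      (cmpF u (psh (tau p ?m) k) (pst p h (xinv A g))))"
    unfolding gobsD(4)[OF B h g] F.comp_assoc[OF khx hbg bh] ..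
  also have "psh (tau p ?m) k = pst p h (pst p g k)"
    using psh_tau[OF p0 k, of h g] by simp
  also have "cmpF u (pst p h (snd B g))
      (cmpF u (pst p h (pst p g k)) (pst p h (xinv A g))) = pst p h (conjF A B g k)"
    unfolding conjF_def psh_tau_cmp[OF F.comp_hom[OF xg psh_tau_hom[OF k]] bg] psh_tau_cmp[OF xg psh_tau_hom[OF k]] ..
  finally show ?thesis .
qed

lemma trF_eqv:
  assumes A: "A \<in> gobs u p" and B: "B \<in> gobs u p" and k: "k \<in> homF u (fst A) (fst B)"
  shows "eqv u p A B (trF A B k)"
proof -
  note X = gobsD(1)[OF A] and Y = gobsD(1)[OF B] and ck = conjF_hom[OF A B k]
  have "cmpF u (trF A B k) (snd A h) = cmpF u (snd B h) (pst p h (trF A B k))" if h: "h < p" for h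
  proof -
    have hX: "pts (hmt p h (fst A))" using hml_Xpi lift_map_tau X by blast
    have "cmpF u (trF A B k) (snd A h) =
        fsum (hmt p h (fst A)) (fst B) p (\<lambda>g. cmpF u (conjF A B g k) (snd A h))"
      unfolding trF_def using fsum_cmp[OF hX gobsD(2)[OF A h] ck Y] .
    also have "\<dots> = fsum (hmt p h (fst A)) (fst B) p (\<lambda>g. cmpF u (conjF A B ((h + g) mod p) k) (snd A h))"
      using fsum_reindex[OF bij_betw_add_mod[OF p0, of h], symmetric] .
    also have "\<dots> = fsum (hmt p h (fst A)) (fst B) p (\<lambda>g. cmpF u (snd B h) (pst p h (conjF A B g k)))"
      using conjF_equivariant[OF A B k h] by (intro fsum_cong)
    also have "\<dots> = cmpF u (snd B h) (pst p h (trF A B k))"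
      unfolding trF_def psh_fsum using cmp_fsum[OF hX gobsD(2)[OF B h] psh_tau_hom[OF ck]] by simp
    finally show ?thesis .
  qed
  then show ?thesis unfolding eqv_def using trF_hom[OF A B k] by blast
qed

lemma trF_pre:
  assumes A: "A \<in> gobs u p" and B: "B \<in> gobs u p" and E: "E \<in> gobs u p"
    and x: "eqv u p E A x" and k: "k \<in> homF u (fst A) (fst B)"
  shows "trF E B (cmpF u k x) = cmpF u (trF A B k) x"
proof -
  have x': "x \<in> homF u (fst E) (fst A)" using x unfolding eqv_def by blast
  have "conjF E B g (cmpF u k x) = cmpF u (conjF A B g k) x" if g: "g < p" for g
  proof -
    note xA = xinv_hom[OF A g] and xE = xinv_hom[OF E g] and gx = psh_tau_hom[OF x', of g] and gk = psh_tau_hom[OF k, of g]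
    have "cmpF u (pst p g x) (xinv E g) = cmpF u (cmpF u (xinv A g) (snd A g)) (cmpF u (pst p g x) (xinv E g))"
      unfolding xinv_xi[OF A g] using F.id_left[OF F.comp_hom[OF xE gx]] by simp
    also have "\<dots> = cmpF u (xinv A g) (cmpF u (cmpF u (snd A g) (pst p g x)) (xinv E g))"
      unfolding F.comp_assoc[OF F.comp_hom[OF xE gx] gobsD(2)[OF A g] xA, symmetric] F.comp_assoc[OF xE gx gobsD(2)[OF A g]] ..
    also have "cmpF u (snd A g) (pst p g x) = cmpF u x (snd E g)" using x g unfolding eqv_def by simp
    also have "cmpF u (cmpF u x (snd E g)) (xinv E g) = x"
      unfolding F.comp_assoc[OF xE gobsD(2)[OF E g] x', symmetric] xi_xinv[OF E g] F.id_right[OF x'] ..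
    finally have 1: "cmpF u (pst p g x) (xinv E g) = cmpF u (xinv A g) x" .
    show ?thesis
      unfolding conjF_def psh_tau_cmp[OF x' k] F.comp_assoc[OF xE gx gk, symmetric] 1
        F.comp_assoc[OF x' xA gk] F.comp_assoc[OF x' F.comp_hom[OF xA gk] gobsD(2)[OF B g]] ..
  qed
  then have "trF E B (cmpF u k x) = fsum (fst E) (fst B) p (\<lambda>g. cmpF u (conjF A B g k) x)"
    unfolding trF_def by (intro fsum_cong)
  also have "\<dots> = cmpF u (trF A B k) x"
    unfolding trF_def by (rule fsum_cmp[OF gobsD(1)[OF E] x' _ gobsD(1)[OF B], symmetric]) (rule conjF_hom[OF A B k])
  finally show ?thesis .
qed

lemma trF_post:
  assumes A: "A \<in> gobs u p" and B: "B \<in> gobs u p" and E: "E \<in> gobs u p"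
    and x: "eqv u p B E x" and k: "k \<in> homF u (fst A) (fst B)"
  shows "trF A E (cmpF u x k) = cmpF u x (trF A B k)"
proof -
  have x': "x \<in> homF u (fst B) (fst E)" using x unfolding eqv_def by blast
  have "conjF A E g (cmpF u x k) = cmpF u x (conjF A B g k)" if g: "g < p" for g
  proof -
    note xA = xinv_hom[OF A g] and gx = psh_tau_hom[OF x', of g] and gk = psh_tau_hom[OF k, of g]
    have 1: "cmpF u (snd E g) (pst p g x) = cmpF u x (snd B g)" using x g unfolding eqv_def by simp
    show ?thesis
      unfolding conjF_def psh_tau_cmp[OF k x'] F.comp_assoc[OF xA gk gx, symmetric]
        F.comp_assoc[OF F.comp_hom[OF xA gk] gx gobsD(2)[OF E g]] 1
        F.comp_assoc[OF F.comp_hom[OF xA gk] gobsD(2)[OF B g] x'] ..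
  qed
  then have "trF A E (cmpF u x k) = fsum (fst A) (fst E) p (\<lambda>g. cmpF u x (conjF A B g k))"
    unfolding trF_def by (intro fsum_cong)
  also have "\<dots> = cmpF u x (trF A B k)"
    unfolding trF_def by (rule cmp_fsum[OF gobsD(1)[OF A] x', symmetric]) (rule conjF_hom[OF A B k])
  finally show ?thesis .
qed

lemma trF_self:
  assumes A: "A \<in> gobs u p" and B: "B \<in> gobs u p" and k: "eqv u p A B k"
  shows "trF A B k = smulF (of_nat p) k"
proof -
  have k': "k \<in> homF u (fst A) (fst B)" using k unfolding eqv_def by blast
  have "conjF A B g k = k" if g: "g < p" for g
  proof -
    have 1: "cmpF u (snd B g) (pst p g k) = cmpF u k (snd A g)" using k g unfolding eqv_def by simp
    show ?thesis
      unfolding conjF_def F.comp_assoc[OF xinv_hom[OF A g] psh_tau_hom[OF k'] gobsD(2)[OF B g]] 1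
        F.comp_assoc[OF xinv_hom[OF A g] gobsD(2)[OF A g] k', symmetric] xi_xinv[OF A g] F.id_right[OF k'] ..
  qed
  then have "trF A B k = fsum (fst A) (fst B) p (\<lambda>g. k)" unfolding trF_def by (intro fsum_cong)
  also have "\<dots> = smulF (of_nat p) k"
    by (rule Fpi_eqI[OF fsum_hom[OF gobsD(1)[OF A] gobsD(1)[OF B] k'] smulF_hom[OF k']]) simp
  finally show ?thesis .
qed

definition pinv :: 'r where "pinv = (SOME v. of_nat p * v = 1)"

lemma pinv: "of_nat p * pinv = 1"
proof -
  have "\<exists>v::'r. of_nat p * v = 1" using p_unit by (auto simp: dvd_def)
  from someI_ex[OF this] show ?thesis unfolding pinv_def .
qed

text \<open>The Reynolds operator: a projection onto equivariant maps, linear over equivariant maps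
  on both sides. An extension or a lift found in \<open>Fpi u\<close> is thereby replaced by an
  equivariant one.\<close>

definition avg :: "'r gob \<Rightarrow> 'r gob \<Rightarrow> 'r fmor \<Rightarrow> 'r fmor" where
  "avg A B k = smulF pinv (trF A B k)"

lemma avg:
  assumes A: "A \<in> gobs u p" and B: "B \<in> gobs u p" and E: "E \<in> gobs u p"
  shows avg_eqv: "k \<in> homF u (fst A) (fst B) \<Longrightarrow> eqv u p A B (avg A B k)"
    and avg_self: "eqv u p A B k \<Longrightarrow> avg A B k = k"
    and avg_pre: "eqv u p E A x \<Longrightarrow> k \<in> homF u (fst A) (fst B) \<Longrightarrow>
      avg E B (cmpF u k x) = cmpF u (avg A B k) x"
    and avg_post: "eqv u p B E y \<Longrightarrow> k \<in> homF u (fst A) (fst B) \<Longrightarrow>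
      avg A E (cmpF u y k) = cmpF u y (avg A B k)"
proof -
  show "k \<in> homF u (fst A) (fst B) \<Longrightarrow> eqv u p A B (avg A B k)"
    unfolding avg_def using eqv_smulF[OF A B trF_eqv[OF A B]] .
  show "avg A B k = k" if k: "eqv u p A B k"
  proof -
    have k': "k \<in> homF u (fst A) (fst B)" using k unfolding eqv_def by blast
    show ?thesis
      unfolding avg_def trF_self[OF A B k]
      by (rule Fpi_eqI[OF smulF_hom[OF smulF_hom[OF k']] k'])
        (use pinv in \<open>simp add: mult.assoc[symmetric] mult.commute\<close>)
  qed
  show "avg E B (cmpF u k x) = cmpF u (avg A B k) x"
    if x: "eqv u p E A x" and k: "k \<in> homF u (fst A) (fst B)"
  proof -
    have "x \<in> homF u (fst E) (fst A)" using x unfolding eqv_def by blast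
    then show ?thesis unfolding avg_def trF_pre[OF A B E x k] using smulF_cmp(1)[OF _ trF_hom[OF A B k]] by simp
  qed
  show "avg A E (cmpF u y k) = cmpF u y (avg A B k)"
    if y: "eqv u p B E y" and k: "k \<in> homF u (fst A) (fst B)"
  proof -
    have "y \<in> homF u (fst B) (fst E)" using y unfolding eqv_def by blast
    then show ?thesis unfolding avg_def trF_post[OF A B E y k] using smulF_cmp(2)[OF trF_hom[OF A B k]] by simp
  qed
qed

lemma conflG_hom:
  assumes "(i, q) \<in> CG"
  obtains A B E where "i \<in> hom GG A B" "q \<in> hom GG B E" "(und i, und q) \<in> CF"
proof -
  have "i \<in> mors GG" "q \<in> mors GG" "atgt i = asrc q" "(und i, und q) \<in> CF"
    using assms unfolding conflG_def by auto
  then have "i \<in> hom GG (asrc i) (asrc q)" "q \<in> hom GG (asrc q) (atgt q)"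
    unfolding hom_def by (auto simp: FpiG_def)
  then show ?thesis using that \<open>(und i, und q) \<in> CF\<close> by blast
qed

lemma G_src_tgt: "f \<in> hom GG A B \<Longrightarrow> src GG f = A \<and> tgt GG f = B"
  unfolding hom_def by simp

lemma injective_G:
  assumes P: "P \<in> gobs u p" and J: "set (fst P) \<subseteq> Collect bdpt" shows "injective GG CG P"
proof -
  have "\<exists>h\<in>hom GG (tgt GG i) P. cmp GG h i = f"
    if iq: "(i, q) \<in> CG" and f0: "f \<in> hom GG (src GG i) P" for i q f
  proof -
    obtain A B E where i: "i \<in> hom GG A B" and cf: "(und i, und q) \<in> CF" using conflG_hom[OF iq] by metis
    have f: "f \<in> hom GG A P" using f0 G_src_tgt[OF i] by simp
    note A = G_homD(1)[OF i] and B = G_homD(2)[OF i]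
    obtain k where k: "k \<in> homF u (fst B) (fst P)" "cmpF u k (und i) = und f"
      using injective_ext[OF injective_if_bdpt[OF J] cf G_homD(5)[OF i] G_homD(5)[OF f]] .
    have ei: "eqv u p A B (und i)" and ef: "eqv u p A P (und f)" using i f unfolding G_hom_iff by blast+
    let ?h = "lift_mor B P (avg B P k)"
    have h: "?h \<in> hom GG B P" using G_homI[OF B P avg_eqv[OF B P B k(1)]] .
    have uh: "und ?h = avg B P k"
      using avg_eqv[OF B P B k(1)] und_lift unfolding eqv_def by blast
    have "cmp GG ?h i = f"
    proof (rule G_eqI[OF preadditive.comp_hom[OF G_preadditive i h] f])
      have "und (cmp GG ?h i) = cmpF u (avg B P k) (und i)" using und_cmp[OF i h] uh by simp
      also have "\<dots> = avg A P (und f)" using avg_pre[OF B P A ei k(1)] k(2) by simp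
      finally show "und (cmp GG ?h i) = und f" using avg_self[OF A P P ef] by simp
    qed
    then show ?thesis using h G_src_tgt[OF i] by auto
  qed
  then show ?thesis using P unfolding injective_def by auto
qed

lemma projective_G:
  assumes P: "P \<in> gobs u p" and J: "set (fst P) \<subseteq> Collect bdpt" shows "projective GG CG P"
proof -
  have pr: "projective (Fpi u) CF (fst P)"
    using Fpi_projective_iff_injective[of "fst P"] injective_if_bdpt[OF J] gobsD(1)[OF P] by simp
  have "\<exists>h\<in>hom GG P (src GG q). cmp GG q h = f"
    if iq: "(i, q) \<in> CG" and f0: "f \<in> hom GG P (tgt GG q)" for i q f
  proof -
    obtain A B E where q: "q \<in> hom GG B E" and cf: "(und i, und q) \<in> CF" using conflG_hom[OF iq] by metis
    have f: "f \<in> hom GG P E" using f0 G_src_tgt[OF q] by simp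
    note B = G_homD(1)[OF q] and E = G_homD(2)[OF q]
    obtain k where k: "k \<in> homF u (fst P) (fst B)" "cmpF u (und q) k = und f"
      using projective_lift[OF pr cf G_homD(5)[OF q] G_homD(5)[OF f]] .
    have ei: "eqv u p B E (und q)" and ef: "eqv u p P E (und f)" using q f unfolding G_hom_iff by blast+
    let ?h = "lift_mor P B (avg P B k)"
    have h: "?h \<in> hom GG P B" using G_homI[OF P B avg_eqv[OF P B B k(1)]] .
    have uh: "und ?h = avg P B k"
      using avg_eqv[OF P B B k(1)] und_lift unfolding eqv_def by blast
    have "cmp GG q ?h = f"
    proof (rule G_eqI[OF preadditive.comp_hom[OF G_preadditive h q] f])
      have "und (cmp GG q ?h) = cmpF u (und q) (avg P B k)" using und_cmp[OF h q] uh by simp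
      also have "\<dots> = avg P E (und f)" using avg_post[OF P B E ei k(1)] k(2) by simp
      finally show "und (cmp GG q ?h) = und f" using avg_self[OF P E E ef] by simp
    qed
    then show ?thesis using h G_src_tgt[OF q] by auto
  qed
  then show ?thesis using P unfolding projective_def by auto
qed

end

context preadditive
begin

text \<open>
  If i : A \<rightarrow> B1 + B2 has first component jj with cokernel kk, and its second component is l jj,
  then after the shear (1, -l) the map i is jj followed by the inclusion of B1.
\<close>

lemma sheared_kernel_cokernel:
  assumes K: "is_kernel C jj kk" and CK: "is_cokernel C jj kk"
    and jj: "jj \<in> hom C A B1" and kk: "kk \<in> hom C B1 C1"
    and i1: "i1 \<in> hom C B1 B" and r1: "r1 \<in> hom C B B1" and i2: "i2 \<in> hom C B2 B" and r2: "r2 \<in> hom C B B2"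
    and B: "r1 \<cdot> i1 = \<I> B1" "r2 \<cdot> i2 = \<I> B2" "r1 \<cdot> i2 = \<O> B2 B1" "r2 \<cdot> i1 = \<O> B1 B2" "i1 \<cdot> r1 \<oplus> i2 \<cdot> r2 = \<I> B"
    and a1: "a1 \<in> hom C C1 Q" and b1: "b1 \<in> hom C Q C1" and a2: "a2 \<in> hom C B2 Q" and b2: "b2 \<in> hom C Q B2"
    and Q: "b1 \<cdot> a1 = \<I> C1" "b2 \<cdot> a2 = \<I> B2" "b1 \<cdot> a2 = \<O> B2 C1" "b2 \<cdot> a1 = \<O> C1 B2" "a1 \<cdot> b1 \<oplus> a2 \<cdot> b2 = \<I> Q"
    and i: "i \<in> hom C A B" and l: "l \<in> hom C B1 B2" and r1i: "r1 \<cdot> i = jj" and linc: "l \<cdot> jj = r2 \<cdot> i"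
  defines "q \<equiv> a1 \<cdot> (kk \<cdot> r1) \<oplus> a2 \<cdot> (r2 \<oplus> neg (l \<cdot> r1))"
  shows "q \<in> hom C B Q" "is_kernel C i q" "is_cokernel C i q"
proof -
  have o: "A \<in> obs C" "B \<in> obs C" "B1 \<in> obs C" "B2 \<in> obs C" "C1 \<in> obs C" "Q \<in> obs C"
    using i jj kk a2 hom_obs by blast+
  let ?s = "r2 \<oplus> neg (l \<cdot> r1)"
  have lr: "l \<cdot> r1 \<in> hom C B B2" and pr: "kk \<cdot> r1 \<in> hom C B C1" using l r1 kk by blast+
  have s: "?s \<in> hom C B B2" using r2 lr by blast
  have x1: "a1 \<cdot> (kk \<cdot> r1) \<in> hom C B Q" and x2: "a2 \<cdot> ?s \<in> hom C B Q" using a1 pr a2 s by blast+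
  show q: "q \<in> hom C B Q" unfolding q_def using x1 x2 by blast
  have b1q: "b1 \<cdot> q = kk \<cdot> r1"
    unfolding q_def distl[OF x1 x2 b1] comp_assoc[OF pr a1 b1] comp_assoc[OF s a2 b1] Q(1,3) id_left[OF pr]
      comp_zero[OF s o(5)] plus_zero[OF pr] ..
  have b2q: "b2 \<cdot> q = ?s"
    unfolding q_def distl[OF x1 x2 b2] comp_assoc[OF pr a1 b2] comp_assoc[OF s a2 b2] Q(2,4) id_left[OF s]
      comp_zero[OF pr o(4)] zero_plus[OF s] ..
  have sc: "?s \<cdot> f = r2 \<cdot> f \<oplus> neg (l \<cdot> (r1 \<cdot> f))" if "f \<in> hom C X B" for f X
    unfolding distr[OF that r2 neg_hom[OF lr]] neg_comp[OF that lr] comp_assoc[OF that r1 l] ..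
  have li: "l \<cdot> jj \<in> hom C A B2" using jj l by blast
  have si: "?s \<cdot> i = \<O> A B2" unfolding sc[OF i] r1i linc[symmetric] plus_neg[OF li] ..
  have qi: "q \<cdot> i = \<O> A Q"
    unfolding q_def distr[OF i x1 x2] comp_assoc[OF i pr a1, symmetric] comp_assoc[OF i s a2, symmetric] si
      comp_assoc[OF i r1 kk, symmetric] r1i is_kernelD(1)[OF K jj kk] zero_comp[OF a1 o(1)] zero_comp[OF a2 o(1)]
      plus_zero[OF zero_hom[OF o(1,6)]] ..
  have joint: "f = g" if f: "f \<in> hom C X B" and g: "g \<in> hom C X B" and e: "r1 \<cdot> f = r1 \<cdot> g" "r2 \<cdot> f = r2 \<cdot> g" for f g X
  proof -
    have "h = i1 \<cdot> (r1 \<cdot> h) \<oplus> i2 \<cdot> (r2 \<cdot> h)" if h: "h \<in> hom C X B" for h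
      unfolding comp_assoc[OF h r1 i1] comp_assoc[OF h r2 i2] distr[OF h comp_hom[OF r1 i1] comp_hom[OF r2 i2], symmetric] B(5)
      using id_left[OF h] by simp
    from this[OF f] this[OF g] show ?thesis using e by simp
  qed
  show "is_kernel C i q"
  proof (rule is_kernelI[OF i q qi])
    fix X f assume f: "f \<in> hom C X B" and z: "q \<cdot> f = \<O> X Q"
    have oX: "X \<in> obs C" using f hom_obs by blast
    have "kk \<cdot> (r1 \<cdot> f) = b1 \<cdot> (q \<cdot> f)" unfolding comp_assoc[OF f q b1] b1q comp_assoc[OF f r1 kk] ..
    then have "kk \<cdot> (r1 \<cdot> f) = \<O> X C1" unfolding z zero_comp[OF b1 oX] .
    then obtain h where h: "h \<in> hom C X A" "jj \<cdot> h = r1 \<cdot> f"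
      using is_kernelD(2)[OF K jj kk comp_hom[OF f r1]] by blast
    have "?s \<cdot> f = b2 \<cdot> (q \<cdot> f)" unfolding comp_assoc[OF f q b2] b2q ..
    then have "r2 \<cdot> f \<oplus> neg (l \<cdot> (r1 \<cdot> f)) = \<O> X B2" unfolding z zero_comp[OF b2 oX] sc[OF f] .
    then have "r2 \<cdot> f = l \<cdot> (r1 \<cdot> f)" using eq_if_diff_zero[OF comp_hom[OF f r2] comp_hom[OF comp_hom[OF f r1] l]] by blast
    also have "\<dots> = r2 \<cdot> (i \<cdot> h)"
      unfolding h(2)[symmetric] comp_assoc[OF h(1) jj l] linc comp_assoc[OF h(1) i r2] ..
    finally have "r2 \<cdot> (i \<cdot> h) = r2 \<cdot> f" by simp
    moreover have "r1 \<cdot> (i \<cdot> h) = r1 \<cdot> f" unfolding comp_assoc[OF h(1) i r1] r1i h(2) ..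
    ultimately have "i \<cdot> h = f" using joint[OF comp_hom[OF h(1) i] f] by blast
    then show "\<exists>h\<in>hom C X A. i \<cdot> h = f" using h by blast
  next
    fix X h h' assume h: "h \<in> hom C X A" "h' \<in> hom C X A" "i \<cdot> h = i \<cdot> h'"
    have "jj \<cdot> h = jj \<cdot> h'"
      unfolding r1i[symmetric] comp_assoc[OF h(1) i r1, symmetric] comp_assoc[OF h(2) i r1, symmetric] h(3) ..
    then show "h = h'" using is_kernelD(3)[OF K jj kk h(1,2)] by blast
  qed
  have qi1: "q \<cdot> i1 = a1 \<cdot> kk \<oplus> a2 \<cdot> neg l"
  proof -
    have "?s \<cdot> i1 = neg l"
      unfolding sc[OF i1] B(1,4) id_right[OF l] zero_plus[OF neg_hom[OF l]] ..
    then show ?thesis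
      unfolding q_def distr[OF i1 x1 x2] comp_assoc[OF i1 pr a1, symmetric] comp_assoc[OF i1 s a2, symmetric]
        comp_assoc[OF i1 r1 kk, symmetric] B(1) id_right[OF kk] by simp
  qed
  have qi2: "q \<cdot> i2 = a2"
  proof -
    have n0: "neg (\<O> B2 B2) = \<O> B2 B2"
      using zero_plus[OF neg_hom[OF zero_hom[OF o(4,4)]]] plus_neg[OF zero_hom[OF o(4,4)]] by simp
    have "?s \<cdot> i2 = \<I> B2"
      unfolding sc[OF i2] B(2,3) zero_comp[OF l o(4)] n0 plus_zero[OF id_hom[OF o(4)]] ..
    then show ?thesis
      unfolding q_def distr[OF i2 x1 x2] comp_assoc[OF i2 pr a1, symmetric] comp_assoc[OF i2 s a2, symmetric]
        comp_assoc[OF i2 r1 kk, symmetric] B(3) zero_comp[OF kk o(4)] zero_comp[OF a1 o(4)]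
      using id_right[OF a2] zero_plus[OF a2] by simp
  qed
  show "is_cokernel C i q"
  proof (rule is_cokernelI[OF i q qi])
    fix E f assume f: "f \<in> hom C B E" and z: "f \<cdot> i = \<O> A E"
    have f1: "f \<cdot> i1 \<in> hom C B1 E" and f2: "f \<cdot> i2 \<in> hom C B2 E" using f i1 i2 by blast+
    have f2l: "(f \<cdot> i2) \<cdot> l \<in> hom C B1 E" using f2 l by blast
    have split: "f \<cdot> g = (f \<cdot> i1) \<cdot> (r1 \<cdot> g) \<oplus> (f \<cdot> i2) \<cdot> (r2 \<cdot> g)" if g: "g \<in> hom C X B" for g X
    proof -
      have "f \<cdot> g = f \<cdot> ((i1 \<cdot> r1 \<oplus> i2 \<cdot> r2) \<cdot> g)" unfolding B(5) id_left[OF g] ..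
      also have "\<dots> = f \<cdot> (i1 \<cdot> (r1 \<cdot> g)) \<oplus> f \<cdot> (i2 \<cdot> (r2 \<cdot> g))"
        unfolding distr[OF g comp_hom[OF r1 i1] comp_hom[OF r2 i2]] comp_assoc[OF g r1 i1, symmetric]
          comp_assoc[OF g r2 i2, symmetric]
        by (rule distl[OF comp_hom[OF comp_hom[OF g r1] i1] comp_hom[OF comp_hom[OF g r2] i2] f])
      finally show ?thesis
        unfolding comp_assoc[OF comp_hom[OF g r1] i1 f] comp_assoc[OF comp_hom[OF g r2] i2 f] .
    qed
    \<comment> \<open>In sheared coordinates the first component of f is f i1 + f i2 l. The equation
      f i = 0 says that it kills \<open>jj\<close>, so it descends along \<open>kk\<close>.\<close>
    have "(f \<cdot> i1 \<oplus> (f \<cdot> i2) \<cdot> l) \<cdot> jj = \<O> A E"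
      unfolding distr[OF jj f1 f2l] comp_assoc[OF jj l f2, symmetric] linc
      using split[OF i] z r1i by simp
    then obtain h where h: "h \<in> hom C C1 E" "h \<cdot> kk = f \<cdot> i1 \<oplus> (f \<cdot> i2) \<cdot> l"
      using is_cokernelD(2)[OF CK jj kk plus_hom[OF f1 f2l]] by blast
    let ?h = "h \<cdot> b1 \<oplus> (f \<cdot> i2) \<cdot> b2"
    have hb: "h \<cdot> b1 \<in> hom C Q E" and fb: "(f \<cdot> i2) \<cdot> b2 \<in> hom C Q E" using h b1 f2 b2 by blast+
    have lrE: "(f \<cdot> i2) \<cdot> (l \<cdot> r1) \<in> hom C B E" using f2 lr by blast
    have "?h \<cdot> q = h \<cdot> (kk \<cdot> r1) \<oplus> (f \<cdot> i2) \<cdot> ?s"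
      unfolding distr[OF q hb fb] comp_assoc[OF q b1 h(1), symmetric] comp_assoc[OF q b2 f2, symmetric] b1q b2q ..
    also have "h \<cdot> (kk \<cdot> r1) = (f \<cdot> i1) \<cdot> r1 \<oplus> (f \<cdot> i2) \<cdot> (l \<cdot> r1)"
      unfolding comp_assoc[OF r1 kk h(1)] h(2) distr[OF r1 f1 f2l] comp_assoc[OF r1 l f2] ..
    also have "(f \<cdot> i2) \<cdot> ?s = (f \<cdot> i2) \<cdot> r2 \<oplus> neg ((f \<cdot> i2) \<cdot> (l \<cdot> r1))"
      unfolding distl[OF r2 neg_hom[OF lr] f2] comp_neg[OF lr f2] ..
    also have "((f \<cdot> i1) \<cdot> r1 \<oplus> (f \<cdot> i2) \<cdot> (l \<cdot> r1)) \<oplus> ((f \<cdot> i2) \<cdot> r2 \<oplus> neg ((f \<cdot> i2) \<cdot> (l \<cdot> r1))) =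
        (f \<cdot> i1) \<cdot> r1 \<oplus> (f \<cdot> i2) \<cdot> r2"
      unfolding plus_assoc[OF comp_hom[OF r1 f1] lrE plus_hom[OF comp_hom[OF r2 f2] neg_hom[OF lrE]]]
        diff_plus[OF comp_hom[OF r2 f2] lrE] ..
    also have "\<dots> = f" using split[OF id_hom[OF o(2)]] id_right[OF f] id_right[OF r1] id_right[OF r2] by simp
    finally show "\<exists>h\<in>hom C Q E. h \<cdot> q = f" using plus_hom[OF hb fb] by blast
  next
    fix E h h' assume h: "h \<in> hom C Q E" and h': "h' \<in> hom C Q E" and e: "h \<cdot> q = h' \<cdot> q"
    have 2: "h \<cdot> a2 = h' \<cdot> a2"
      unfolding qi2[symmetric] comp_assoc[OF i2 q h] comp_assoc[OF i2 q h'] e ..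
    have exp: "g \<cdot> (q \<cdot> i1) = (g \<cdot> a2) \<cdot> neg l \<oplus> (g \<cdot> a1) \<cdot> kk" if g: "g \<in> hom C Q E" for g
      unfolding qi1 distl[OF comp_hom[OF kk a1] comp_hom[OF neg_hom[OF l] a2] g] comp_assoc[OF kk a1 g]
        comp_assoc[OF neg_hom[OF l] a2 g]
      by (rule plus_comm[OF comp_hom[OF kk comp_hom[OF a1 g]] comp_hom[OF neg_hom[OF l] comp_hom[OF a2 g]]])
    have "h \<cdot> (q \<cdot> i1) = h' \<cdot> (q \<cdot> i1)" unfolding comp_assoc[OF i1 q h] comp_assoc[OF i1 q h'] e ..
    then have "(h \<cdot> a1) \<cdot> kk = (h' \<cdot> a1) \<cdot> kk"
      unfolding exp[OF h] exp[OF h'] 2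
      using plus_cancel[OF comp_hom[OF neg_hom[OF l] comp_hom[OF a2 h']] comp_hom[OF kk comp_hom[OF a1 h]]
          comp_hom[OF kk comp_hom[OF a1 h']]] by blast
    then have 1: "h \<cdot> a1 = h' \<cdot> a1"
      using is_cokernelD(3)[OF CK jj kk comp_hom[OF a1 h] comp_hom[OF a1 h']] by blast
    have "g = (g \<cdot> a1) \<cdot> b1 \<oplus> (g \<cdot> a2) \<cdot> b2" if g: "g \<in> hom C Q E" for g
      unfolding comp_assoc[OF b1 a1 g, symmetric] comp_assoc[OF b2 a2 g, symmetric]
        distl[OF comp_hom[OF b1 a1] comp_hom[OF b2 a2] g, symmetric] Q(5) id_right[OF g] ..
    from this[OF h] this[OF h'] show "h = h'" using 1 2 by simp
  qed
qed

end

text \<open>The 0-1 matrix selects points that coincide with those of X, so the cocycle exponent of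
  the only surviving term is 0.\<close>

lemma coef_cmp_colsel:
  assumes f: "f \<in> homF u Y Z" and X: "pts X"
    and s: "\<And>j. j < length X \<Longrightarrow> \<sigma> j < length Y \<and> Y ! \<sigma> j = X ! j" and i: "i < length Z" and j: "j < length X"
  shows "coef (cmpF u f (fmat X Y (\<lambda>i j. if i = \<sigma> j then 1 else 0))) i j = coef f i (\<sigma> j)"
proof -
  have m: "fmat X Y (\<lambda>i j. if i = \<sigma> j then 1 else 0) \<in> homF u X Y" using X homFD(1)[OF f] by blast
  have "X ! j \<in> Xpi" "Z ! i \<in> Xpi" using X j homFD(7)[OF f i] by auto
  then have n: "nc (X ! j) (X ! j) (Z ! i) = 0" by simp
  show ?thesis
    unfolding coef_cmp[OF m f i j]
    by (subst sum_single[of "\<sigma> j"]) (use s[OF j] j n in auto)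
qed

lemma coef_cmp_rowsel:
  assumes f: "f \<in> homF u W Y" and X: "pts X"
    and s: "\<And>i. i < length X \<Longrightarrow> \<sigma> i < length Y \<and> Y ! \<sigma> i = X ! i" and i: "i < length X" and j: "j < length W"
  shows "coef (cmpF u (fmat Y X (\<lambda>i j. if j = \<sigma> i then 1 else 0)) f) i j = coef f (\<sigma> i) j"
proof -
  have m: "fmat Y X (\<lambda>i j. if j = \<sigma> i then 1 else 0) \<in> homF u Y X" using X homFD(2)[OF f] by blast
  have "X ! i \<in> Xpi" "W ! j \<in> Xpi" using X i homFD(6)[OF f j] by auto
  then have n: "nc (W ! j) (X ! i) (X ! i) = 0" by simp
  show ?thesis
    unfolding coef_cmp[OF f m i j]
    by (subst sum_single[of "\<sigma> i"]) (use s[OF i] i n in auto)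
qed

definition inlF :: "pt set list \<Rightarrow> pt set list \<Rightarrow> 'r::idom fmor" where
  "inlF X Y = fmat X (X @ Y) (\<lambda>i j. if i = j then 1 else 0)"
definition inrF :: "pt set list \<Rightarrow> pt set list \<Rightarrow> 'r::idom fmor" where
  "inrF X Y = fmat Y (X @ Y) (\<lambda>i j. if i = length X + j then 1 else 0)"
definition prlF :: "pt set list \<Rightarrow> pt set list \<Rightarrow> 'r::idom fmor" where
  "prlF X Y = fmat (X @ Y) X (\<lambda>i j. if j = i then 1 else 0)"
definition prrF :: "pt set list \<Rightarrow> pt set list \<Rightarrow> 'r::idom fmor" where
  "prrF X Y = fmat (X @ Y) Y (\<lambda>i j. if j = length X + i then 1 else 0)"

lemma coef_biproduct:
  "coef (inlF X Y) i j = (if i < length X + length Y \<and> j < length X \<and> i = j then 1 else 0)"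
  "coef (inrF X Y) i j = (if i < length X + length Y \<and> j < length Y \<and> i = length X + j then 1 else 0)"
  "coef (prlF X Y) i j = (if i < length X \<and> j < length X + length Y \<and> j = i then 1 else 0)"
  "coef (prrF X Y) i j = (if i < length Y \<and> j < length X + length Y \<and> j = length X + i then 1 else 0)"
  by (simp_all add: inlF_def inrF_def prlF_def prrF_def)

lemma append_biproduct:
  fixes u :: "'r::idom"
  assumes X: "pts X" and Y: "pts Y"
  shows "inlF X Y \<in> homF u X (X @ Y)" "inrF X Y \<in> homF u Y (X @ Y)"
    "prlF X Y \<in> homF u (X @ Y) X" "prrF X Y \<in> homF u (X @ Y) Y"
    "cmpF u (prlF X Y) (inlF X Y) = idnF u X" "cmpF u (prrF X Y) (inrF X Y) = idnF u Y"
    "cmpF u (prlF X Y) (inrF X Y) = zroF u Y X" "cmpF u (prrF X Y) (inlF X Y) = zroF u X Y"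
    "plsF u (cmpF u (inlF X Y) (prlF X Y)) (cmpF u (inrF X Y) (prrF X Y)) = idnF u (X @ Y)"
proof -
  have XY: "pts (X @ Y)" using X Y by simp
  show h: "inlF X Y \<in> homF u X (X @ Y)" "inrF X Y \<in> homF u Y (X @ Y)"
    "prlF X Y \<in> homF u (X @ Y) X" "prrF X Y \<in> homF u (X @ Y) Y"
    unfolding inlF_def inrF_def prlF_def prrF_def using X Y XY by blast+
  have il: "coef (cmpF u f (inlF X Y)) i j = coef f i j"
    if "f \<in> homF u (X @ Y) Z" "i < length Z" "j < length X" for f Z i j
    unfolding inlF_def by (rule coef_cmp_colsel[OF that(1) X _ that(2,3)]) (simp add: nth_append)
  have ir: "coef (cmpF u f (inrF X Y)) i j = coef f i (length X + j)"
    if "f \<in> homF u (X @ Y) Z" "i < length Z" "j < length Y" for f Z i j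
    unfolding inrF_def by (rule coef_cmp_colsel[OF that(1) Y _ that(2,3)]) simp
  show "cmpF u (prlF X Y) (inlF X Y) = idnF u X"
    by (rule Fpi_eqI[OF cmpF_hom[OF h(1,3)] idnF_hom[OF X]]) (auto simp: il[OF h(3)] coef_biproduct coef_idn)
  show "cmpF u (prrF X Y) (inrF X Y) = idnF u Y"
    by (rule Fpi_eqI[OF cmpF_hom[OF h(2,4)] idnF_hom[OF Y]]) (auto simp: ir[OF h(4)] coef_biproduct coef_idn)
  show "cmpF u (prlF X Y) (inrF X Y) = zroF u Y X"
    by (rule Fpi_eqI[OF cmpF_hom[OF h(2,3)] zroF_hom[OF Y X]]) (auto simp: ir[OF h(3)] coef_biproduct)
  show "cmpF u (prrF X Y) (inlF X Y) = zroF u X Y"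
    by (rule Fpi_eqI[OF cmpF_hom[OF h(1,4)] zroF_hom[OF X Y]]) (auto simp: il[OF h(4)] coef_biproduct)
  show "plsF u (cmpF u (inlF X Y) (prlF X Y)) (cmpF u (inrF X Y) (prrF X Y)) = idnF u (X @ Y)"
  proof (rule Fpi_eqI[OF plsF_hom[OF cmpF_hom[OF h(3,1)] cmpF_hom[OF h(4,2)]] idnF_hom[OF XY]])
    fix i j assume i: "i < length (X @ Y)" and j: "j < length (X @ Y)"
    have xx: "nc V V V = 0" if "V \<in> Xpi" for V using that by simp
    have V: "(X @ Y) ! i \<in> Xpi" using XY i nth_mem by blast
    have 1: "coef (cmpF u (inlF X Y) (prlF X Y)) i j = (if i = j \<and> i < length X then 1 else 0)"
    proof (cases "i < length X")
      case True
      show ?thesis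
        unfolding coef_cmp[OF h(3,1) i j]
        by (subst sum_single[OF True]) (use True i j xx V in \<open>auto simp: coef_biproduct nth_append\<close>)
    next
      case False
      then have "coef (inlF X Y :: 'r fmor) i k = 0" if "k < length X" for k using that by (simp add: coef_biproduct)
      then show ?thesis unfolding coef_cmp[OF h(3,1) i j] using False by simp
    qed
    have 2: "coef (cmpF u (inrF X Y) (prrF X Y)) i j = (if i = j \<and> length X \<le> i then 1 else 0)"
    proof (cases "length X \<le> i")
      case True
      then obtain i' where i': "i = length X + i'" "i' < length Y" using i le_Suc_ex by force
      show ?thesis
        unfolding coef_cmp[OF h(4,2) i j]
        by (subst sum_single[OF i'(2)]) (use i' i j xx V in \<open>auto simp: coef_biproduct\<close>)
    next
      case False
      then have "coef (inrF X Y :: 'r fmor) i k = 0" if "k < length Y" for k using that by (simp add: coef_biproduct)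
      then show ?thesis unfolding coef_cmp[OF h(4,2) i j] using False by simp
    qed
    show "coef (plsF u (cmpF u (inlF X Y) (prlF X Y)) (cmpF u (inrF X Y) (prrF X Y))) i j =
        coef (idnF u (X @ Y)) i j"
      using 1 2 i by (simp add: coef_idn)
  qed
qed

lemma psh_biproduct:
  "psh g (inlF X Y) = inlF (hml g X) (hml g Y)" "psh g (inrF X Y) = inrF (hml g X) (hml g Y)"
  "psh g (prlF X Y) = prlF (hml g X) (hml g Y)" "psh g (prrF X Y) = prrF (hml g X) (hml g Y)"
  by (simp_all add: push_mor_def inlF_def inrF_def prlF_def prrF_def fmat_def)

section \<open>Permutation objects\<close>

definition perm_ok :: "nat \<Rightarrow> pt set list \<Rightarrow> (nat \<Rightarrow> nat \<Rightarrow> nat) \<Rightarrow> bool" where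
  "perm_ok p Y \<tau> \<longleftrightarrow> pts Y \<and>
    (\<forall>h<p. \<forall>j<length Y. \<tau> h j < length Y \<and> Y ! \<tau> h j = hmpt (tau p h) (Y ! j)) \<and>
    (\<forall>g<p. \<forall>h<p. \<forall>j<length Y. \<tau> ((g + h) mod p) j = \<tau> g (\<tau> h j)) \<and> (\<forall>j<length Y. \<tau> 0 j = j)"

text \<open>\<open>Sob p X\<close>, its hull and its suspension all have this shape. By
  \<open>eqv_permob_iff\<close>, equivariance of the hull maps then amounts to invariance of their
  entries under permutations of the indices.\<close>

definition permob :: "nat \<Rightarrow> pt set list \<Rightarrow> (nat \<Rightarrow> nat \<Rightarrow> nat) \<Rightarrow> 'r::idom gob" where
  "permob p Y \<tau> = (Y, \<lambda>h\<in>{..<p}. fmat (map (rot p h) Y) Y (\<lambda>i j. if i = \<tau> h j then 1 else 0))"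

lemma permob_fst [simp]: "fst (permob p Y \<tau>) = Y"
  by (simp add: permob_def)

lemma permob_snd: "pts Y \<Longrightarrow> h < p \<Longrightarrow>
    snd (permob p Y \<tau>) h = fmat (hmt p h Y) Y (\<lambda>i j. if i = \<tau> h j then 1 else 0)"
  by (simp only: permob_def snd_conv restrict_apply lessThan_iff if_True rot_list)

lemma perm_okD:
  assumes "perm_ok p Y \<tau>"
  shows "pts Y" "h < p \<Longrightarrow> j < length Y \<Longrightarrow> \<tau> h j < length Y"
    "h < p \<Longrightarrow> j < length Y \<Longrightarrow> Y ! \<tau> h j = hmpt (tau p h) (Y ! j)"
    "g < p \<Longrightarrow> h < p \<Longrightarrow> j < length Y \<Longrightarrow> \<tau> ((g + h) mod p) j = \<tau> g (\<tau> h j)" "j < length Y \<Longrightarrow> \<tau> 0 j = j"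
  using assms unfolding perm_ok_def by auto

lemma coef_cmp_perm:
  assumes P: "perm_ok p Y \<tau>" and f: "f \<in> homF u Y Z" and h: "h < p" and i: "i < length Z" and j: "j < length Y"
  shows "coef (cmpF u f (snd (permob p Y \<tau>) h)) i j = coef f i (\<tau> h j)"
  unfolding permob_snd[OF perm_okD(1)[OF P] h]
  by (rule coef_cmp_colsel[OF f hml_Xpi[OF lift_map_tau perm_okD(1)[OF P]] _ i])
    (use perm_okD(2,3)[OF P h] j in auto)

definition GX :: "nat \<Rightarrow> pt set list \<Rightarrow> pt set list" where
  "GX p X = concat (map (\<lambda>g. map (rot p g) X) [0..<p])"

definition tS :: "nat \<Rightarrow> nat \<Rightarrow> nat \<Rightarrow> nat \<Rightarrow> nat" where
  "tS p n h j = ((h + j div n) mod p) * n + j mod n"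

text \<open>The action on the indices of a hull, which permutes the two blocks of N summands in
  parallel.\<close>

definition tD :: "nat \<Rightarrow> (nat \<Rightarrow> nat \<Rightarrow> nat) \<Rightarrow> nat \<Rightarrow> nat \<Rightarrow> nat" where
  "tD N \<tau> h j = (if j < N then \<tau> h j else N + \<tau> h (j - N))"

lemma length_concat_blocks: "length (concat (map (\<lambda>g. map (f g) X) [0..<p])) = p * length X"
  by (induction p) simp_all

lemma nth_concat_blocks:
  "g < p \<Longrightarrow> a < length X \<Longrightarrow> concat (map (\<lambda>g. map (f g) X) [0..<p]) ! (g * length X + a) = f g (X ! a)"
proof (induction p)
  case (Suc p)
  have l: "length (concat (map (\<lambda>g. map (f g) X) [0..<p])) = p * length X" by (rule length_concat_blocks)
  show ?case
  proof (cases "g < p")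
    case True
    have "g * length X + a < (g + 1) * length X" using Suc.prems by simp
    also have "\<dots> \<le> p * length X" using True by (intro mult_right_mono) auto
    finally show ?thesis using Suc True l by (simp add: nth_append)
  next
    case False
    then have "g = p" using Suc.prems by simp
    then show ?thesis using Suc.prems l by (simp add: nth_append)
  qed
qed simp

lemma GX_length [simp]: "length (GX p X) = p * length X"
  unfolding GX_def by (rule length_concat_blocks)

lemma GX_nth: "g < p \<Longrightarrow> a < length X \<Longrightarrow> GX p X ! (g * length X + a) = rot p g (X ! a)"
  unfolding GX_def by (rule nth_concat_blocks)

lemma GX_set: "set (GX p X) = (\<Union>g\<in>{..<p}. rot p g ` set X)"
  unfolding GX_def by auto

lemma GX_Xpi: "pts X \<Longrightarrow> pts (GX p X)"
  unfolding GX_set using rot_tau hmpt_Xpi[OF lift_map_tau] by force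

lemma block_index:
  fixes j p n :: nat
  assumes "j < p * n" obtains g a where "g < p" "a < n" "j = g * n + a" "j div n = g" "j mod n = a"
proof
  have n: "0 < n" using assms by (cases n) auto
  show "j div n < p" using assms n by (simp add: less_mult_imp_div_less)
  show "j mod n < n" using n by simp
qed auto

lemma tS_block: "a < n \<Longrightarrow> tS p n h (g * n + a) = ((h + g) mod p) * n + a"
  by (simp add: tS_def)

lemma tS_less: "0 < p \<Longrightarrow> j < p * n \<Longrightarrow> tS p n h j < p * n"
proof -
  assume p: "0 < p" and j: "j < p * n"
  obtain g a where a: "a < n" "j = g * n + a" using block_index[OF j] .
  have "((h + g) mod p) * n + a < ((h + g) mod p + 1) * n" using a by simp
  also have "\<dots> \<le> p * n" using p by (intro mult_right_mono) (auto simp: Suc_le_eq)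
  finally show "tS p n h j < p * n" unfolding a(2) tS_block[OF a(1)] .
qed

lemma Sob_permob:
  assumes X: "pts X" and p: "0 < p"
  shows "Sob p X = permob p (GX p X) (tS p (length X))"
  unfolding Sob_def Let_def permob_def GX_def[symmetric]
  by (intro arg_cong2[of _ _ _ _ Pair] refl restrict_ext, intro arr.expand)
    (use tS_less[OF p] in \<open>auto simp: fun_eq_iff tS_def\<close>)

lemma Sob_perm_ok:
  assumes X: "pts X" and p: "0 < p"
  shows "perm_ok p (GX p X) (tS p (length X))"
  unfolding perm_ok_def
proof (intro conjI allI impI)
  show "pts (GX p X)" using GX_Xpi X .
  fix j assume "j < length (GX p X)"
  then have j: "j < p * length X" by simp
  obtain g a where a: "g < p" "a < length X" "j = g * length X + a" using block_index[OF j] .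
  have Xa: "X ! a \<in> Xpi" using X a by auto
  show "tS p (length X) 0 j = j" unfolding a(3) tS_block[OF a(2)] using a(1) by simp
  fix h assume "h < p"
  show "tS p (length X) h j < length (GX p X)" using tS_less[OF p j] by simp
  have "(h + g) mod p < p" using p by simp
  then have "GX p X ! tS p (length X) h j = hmpt (tau p ((h + g) mod p)) (X ! a)"
    unfolding a(3) tS_block[OF a(2)] using GX_nth[OF _ a(2)] rot_tau[OF Xa] by simp
  also have "\<dots> = hmpt (tau p h) (GX p X ! j)"
    unfolding a(3) GX_nth[OF a(1,2)] rot_tau[OF Xa] hmpt_tau[OF p Xa] ..
  finally show "GX p X ! tS p (length X) h j = hmpt (tau p h) (GX p X ! j)" .
next
  fix g h j assume "j < length (GX p X)"
  then have j: "j < p * length X" by simp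
  obtain g' a where a: "g' < p" "a < length X" "j = g' * length X + a" using block_index[OF j] .
  show "tS p (length X) ((g + h) mod p) j = tS p (length X) g (tS p (length X) h j)"
    unfolding a(3) tS_block[OF a(2)] by (simp add: mod_add_left_eq mod_add_right_eq add.assoc)
qed

lemma perm_ok_JL: assumes P: "perm_ok p Y \<tau>" shows "perm_ok p (JL Y) (tD (length Y) \<tau>)"
proof -
  let ?N = "length Y"
  note Y = perm_okD(1)[OF P]
  have r: "tD ?N \<tau> h j < 2 * ?N \<and> JL Y ! tD ?N \<tau> h j = hmpt (tau p h) (JL Y ! j)"
    if h: "h < p" and j: "j < 2 * ?N" for h j
    using j
  proof (cases rule: split_double)
    case 1
    then show ?thesis
      using perm_okD(2,3)[OF P h 1] hmpt_I1pt[OF lift_map_tau subsetD[OF Y nth_mem[OF 1]], of p h]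
      by (simp add: tD_def JL_nth)
  next
    case (2 j')
    then show ?thesis
      using perm_okD(2,3)[OF P h 2(1)] hmpt_I2pt[OF lift_map_tau subsetD[OF Y nth_mem[OF 2(1)]], of p h]
      by (simp add: tD_def JL_nth 2(2))
  qed
  have c: "tD ?N \<tau> ((g + h) mod p) j = tD ?N \<tau> g (tD ?N \<tau> h j)" if g: "g < p" and h: "h < p" and j: "j < 2 * ?N" for g h j
    using j
  proof (cases rule: split_double)
    case 1
    then show ?thesis using perm_okD(2,4)[OF P] g h by (simp add: tD_def)
  next
    case (2 j')
    then show ?thesis using perm_okD(4)[OF P g h 2(1)] by (simp add: tD_def)
  qed
  have z: "tD ?N \<tau> 0 j = j" if j: "j < 2 * ?N" for j
    using j
  proof (cases rule: split_double)
    case 1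
    then show ?thesis using perm_okD(5)[OF P] by (simp add: tD_def)
  next
    case (2 j')
    then show ?thesis using perm_okD(5)[OF P 2(1)] by (simp add: tD_def)
  qed
  show ?thesis unfolding perm_ok_def using JL_Xpi[OF Y] r c z by simp
qed

lemma perm_ok_SL: assumes P: "perm_ok p Y \<tau>" shows "perm_ok p (SL Y) \<tau>"
proof -
  note Y = perm_okD(1)[OF P]
  have "SL Y ! \<tau> h j = hmpt (tau p h) (SL Y ! j)" if "h < p" "j < length Y" for h j
    using perm_okD(2,3)[OF P that] that(2) hmpt_shpt[OF lift_map_tau subsetD[OF Y nth_mem[OF that(2)]], of p h]
    by (simp add: SL_nth)
  then show ?thesis using P SL_Xpi[OF Y] unfolding perm_ok_def by simp
qed

lemma GX_SL: assumes X: "pts X" shows "SL (GX p X) = GX p (SL X)"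
proof -
  have "map shpt (map (rot p g) X) = map (rot p g) (map shpt X)" for g
    using X rot_tau hmpt_shpt[OF lift_map_tau] shpt_Xpi by auto
  moreover have "map (map shpt) (map f L) = map (\<lambda>g. map shpt (f g)) L" for f and L :: "nat list" by simp
  ultimately have "map (map shpt) (map (\<lambda>g. map (rot p g) X) [0..<p]) = map (\<lambda>g. map (rot p g) (map shpt X)) [0..<p]"
    by (simp only:)
  then show ?thesis unfolding SL_def GX_def map_concat by (simp only:)
qed

context gfpi
begin

lemma permob_gobs: assumes P: "perm_ok p Y \<tau>" shows "permob p Y \<tau> \<in> gobs u p"
proof -
  note Y = perm_okD(1)[OF P]
  let ?x = "\<lambda>h. fmat (hmt p h Y) Y (\<lambda>i j. if i = \<tau> h j then 1 else 0) :: 'r fmor"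
  have xs: "snd (permob p Y \<tau>) h = ?x h" if "h < p" for h using permob_snd[OF Y that] .
  have hX: "pts (hmt p h Y)" for h using hml_Xpi[OF lift_map_tau Y] .
  have xh: "?x h \<in> homF u (hmt p h Y) Y" for h using hX Y by blast
  have "(Y, snd (permob p Y \<tau>)) \<in> gobs u p"
  proof (rule gobsI[OF Y])
    show "snd (permob p Y \<tau>) \<in> extensional {..<p}" unfolding permob_def by simp
    show "snd (permob p Y \<tau> :: 'r gob) g \<in> homF u (hmt p g Y) Y" if "g < p" for g
      unfolding xs[OF that] using xh .
    show "snd (permob p Y \<tau> :: 'r gob) 0 = idnF u Y"
      unfolding xs[OF p0]
    proof (rule Fpi_eqI[OF _ idnF_hom[OF Y]])
      show "?x 0 \<in> homF u Y Y" using xh[of 0] hml_tau_0[OF Y] by simp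
    qed (use perm_okD(5)[OF P] in \<open>auto simp: coef_idn\<close>)
    fix g h assume g: "g < p" and h: "h < p"
    have gh: "(g + h) mod p < p" using p0 by simp
    note e = hml_tau[OF p0 Y, of g h]
    have ph: "pst p g (?x h) \<in> homF u (hmt p ((g + h) mod p) Y) (hmt p g Y)"
      using psh_tau_hom[OF xh, of g h] unfolding e .
    have ps: "pst p g (?x h) = fmat (hmt p ((g + h) mod p) Y) (hmt p g Y) (\<lambda>i j. if i = \<tau> h j then 1 else 0)"
      unfolding e[symmetric] by (simp add: push_mor_def fmat_def)
    show "snd (permob p Y \<tau> :: 'r gob) ((g + h) mod p) = cmpF u (snd (permob p Y \<tau>) g) (pst p g (snd (permob p Y \<tau>) h))"
      unfolding xs[OF g] xs[OF h] xs[OF gh]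
    proof (rule Fpi_eqI[OF xh cmpF_hom[OF ph xh]])
      fix i j assume i: "i < length Y" and j: "j < length (hmt p ((g + h) mod p) Y)"
      have j': "j < length Y" using j by simp
      have sel: "\<tau> h j < length (hmt p g Y) \<and> hmt p g Y ! \<tau> h j = hmt p ((g + h) mod p) Y ! j"
        if "j < length (hmt p ((g + h) mod p) Y)" for j
      proof -
        have jl: "j < length Y" using that by simp
        show ?thesis
          using perm_okD(2,3)[OF P h jl] hmpt_tau[OF p0 subsetD[OF Y nth_mem[OF jl]], of g h] jl by simp
      qed
      have "coef (cmpF u (?x g) (pst p g (?x h))) i j = coef (?x g) i (\<tau> h j)"
        unfolding ps by (rule coef_cmp_colsel[OF xh hX sel i j])
      also have "\<dots> = coef (?x ((g + h) mod p)) i j"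
        using perm_okD(2,4)[OF P] g h i j' by simp
      finally show "coef (?x ((g + h) mod p)) i j = coef (cmpF u (?x g) (pst p g (?x h))) i j" by simp
    qed
  qed
  then show ?thesis unfolding permob_def by simp
qed

lemma perm_inverse:
  assumes P: "perm_ok p Y \<tau>" and h: "h < p" and i: "i < length Y"
  shows "\<tau> ((p - h) mod p) i < length Y" "\<tau> h (\<tau> ((p - h) mod p) i) = i" "\<tau> ((p - h) mod p) (\<tau> h i) = i"
  using perm_okD(2,4,5)[OF P] neg_mod h i by (metis (no_types, lifting))+

lemma perm_inj: "perm_ok p Y \<tau> \<Longrightarrow> h < p \<Longrightarrow> i < length Y \<Longrightarrow> j < length Y \<Longrightarrow> \<tau> h i = \<tau> h j \<Longrightarrow> i = j"
  using perm_inverse(3) by metis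

text \<open>Evaluated in row \<tau> h i, because the only nonzero entry of the permutation matrix in
  that row stands in column i.\<close>

lemma coef_perm_cmp:
  assumes P: "perm_ok p Z \<tau>" and f: "f \<in> homF u Y Z" and h: "h < p" and i: "i < length Z" and j: "j < length Y"
  shows "coef (cmpF u (snd (permob p Z \<tau>) h) (pst p h f)) (\<tau> h i) j = coef f i j"
proof -
  note Z = perm_okD(1)[OF P] and ti = perm_okD(2,3)[OF P h i]
  have xh: "snd (permob p Z \<tau>) h \<in> homF u (hmt p h Z) Z"
    using gobsD(2)[OF permob_gobs[OF P] h] by simp
  have j': "j < length (hmt p h Y)" using j by simp
  have Xp: "hmpt (tau p h) (Y ! j) \<in> Xpi" "hmpt (tau p h) (Z ! i) \<in> Xpi"
    using hmpt_Xpi[OF lift_map_tau] homFD(6)[OF f j] homFD(7)[OF f i] by blast+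
  show ?thesis
    unfolding coef_cmp[OF psh_tau_hom[OF f] xh ti(1) j']
    by (subst sum_single[of i]) (use i j ti Xp perm_inj[OF P h i] in \<open>auto simp: permob_snd[OF Z h]\<close>)
qed

lemma eqv_permob_iff:
  assumes P: "perm_ok p Y \<tau>" and P': "perm_ok p Z \<tau>'" and f: "f \<in> homF u Y Z"
  shows "eqv u p (permob p Y \<tau>) (permob p Z \<tau>') f \<longleftrightarrow>
    (\<forall>h<p. \<forall>i<length Z. \<forall>j<length Y. coef f (\<tau>' h i) (\<tau> h j) = coef f i j)"
proof -
  have "cmpF u f (snd (permob p Y \<tau>) h) = cmpF u (snd (permob p Z \<tau>') h) (pst p h f) \<longleftrightarrow>
    (\<forall>i<length Z. \<forall>j<length Y. coef f (\<tau>' h i) (\<tau> h j) = coef f i j)" if h: "h < p" for h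
  proof
    assume e: "cmpF u f (snd (permob p Y \<tau>) h) = cmpF u (snd (permob p Z \<tau>') h) (pst p h f)"
    show "\<forall>i<length Z. \<forall>j<length Y. coef f (\<tau>' h i) (\<tau> h j) = coef f i j"
      using coef_cmp_perm[OF P f h perm_okD(2)[OF P' h]] coef_perm_cmp[OF P' f h] e by simp
  next
    assume a: "\<forall>i<length Z. \<forall>j<length Y. coef f (\<tau>' h i) (\<tau> h j) = coef f i j"
    have xY: "snd (permob p Y \<tau>) h \<in> homF u (hmt p h Y) Y"
      using gobsD(2)[OF permob_gobs[OF P] h] by simp
    have xZ: "snd (permob p Z \<tau>') h \<in> homF u (hmt p h Z) Z"
      using gobsD(2)[OF permob_gobs[OF P'] h] by simp
    show "cmpF u f (snd (permob p Y \<tau>) h) = cmpF u (snd (permob p Z \<tau>') h) (pst p h f)"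
    proof (rule Fpi_eqI[OF cmpF_hom[OF xY f] cmpF_hom[OF psh_tau_hom[OF f] xZ]])
      fix i j assume i: "i < length Z" and "j < length (hmt p h Y)"
      then have j: "j < length Y" by simp
      note v = perm_inverse(1,2)[OF P' h i]
      show "coef (cmpF u f (snd (permob p Y \<tau>) h)) i j =
          coef (cmpF u (snd (permob p Z \<tau>') h) (pst p h f)) i j"
        using coef_cmp_perm[OF P f h i j] coef_perm_cmp[OF P' f h v(1) j] a v j by metis
    qed
  qed
  then show ?thesis unfolding eqv_def using f by auto
qed

lemma incF_eqv:
  assumes P: "perm_ok p Y \<tau>"
  shows "eqv u p (permob p Y \<tau>) (permob p (JL Y) (tD (length Y) \<tau>)) (incF u Y)"
  unfolding eqv_permob_iff[OF P perm_ok_JL[OF P] incF_hom[OF perm_okD(1)[OF P]]]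
proof (intro allI impI)
  fix h i j assume h: "h < p" and "i < length (JL Y)" and j: "j < length Y"
  then have i: "i < 2 * length Y" by simp
  have Yj: "Y ! j \<in> Xpi" using perm_okD(1)[OF P] j by auto
  have e: "e1pt (Y ! \<tau> h j) = e1pt (Y ! j)" "e2pt (Y ! \<tau> h j) = e2pt (Y ! j)"
    unfolding perm_okD(3)[OF P h j] using e1pt_hmpt e2pt_hmpt lift_map_tau Yj by blast+
  note tj = perm_okD(2)[OF P h j]
  from i show "coef (incF u Y) (tD (length Y) \<tau> h i) (\<tau> h j) = coef (incF u Y) i j"
  proof (cases rule: split_double)
    case 1
    then show ?thesis
      using perm_okD(2)[OF P h 1] tj perm_inj[OF P h 1 j] e j by (auto simp: incF_def tD_def)
  next
    case (2 i')
    then show ?thesis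
      using perm_okD(2)[OF P h 2(1)] tj perm_inj[OF P h 2(1) j] e j by (auto simp: incF_def tD_def)
  qed
qed

lemma prjF_eqv:
  assumes P: "perm_ok p Y \<tau>"
  shows "eqv u p (permob p (JL Y) (tD (length Y) \<tau>)) (permob p (SL Y) \<tau>) (prjF u Y)"
  unfolding eqv_permob_iff[OF perm_ok_JL[OF P] perm_ok_SL[OF P] prjF_hom[OF perm_okD(1)[OF P]]]
proof (intro allI impI)
  fix h i j assume h: "h < p" and "i < length (SL Y)" and "j < length (JL Y)"
  then have i: "i < length Y" and j: "j < 2 * length Y" by simp_all
  have Yi: "Y ! i \<in> Xpi" using perm_okD(1)[OF P] i by auto
  have e: "r1pt (Y ! \<tau> h i) = r1pt (Y ! i)" "r2pt (Y ! \<tau> h i) = r2pt (Y ! i)"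
    unfolding perm_okD(3)[OF P h i] using r1pt_hmpt r2pt_hmpt lift_map_tau Yi by blast+
  note ti = perm_okD(2)[OF P h i]
  from j show "coef (prjF u Y) (\<tau> h i) (tD (length Y) \<tau> h j) = coef (prjF u Y) i j"
  proof (cases rule: split_double)
    case 1
    then show ?thesis
      using perm_okD(2)[OF P h 1] ti perm_inj[OF P h 1 i] e i by (auto simp: prjF_def tD_def)
  next
    case (2 j')
    then show ?thesis
      using perm_okD(2)[OF P h 2(1)] ti perm_inj[OF P h 2(1) i] e i by (auto simp: prjF_def tD_def)
  qed
qed

end

section \<open>The canonical suspension\<close>

context gfpi
begin

text \<open>The structure map induced on a cokernel. Being unique, it is preserved by every
  automorphism that preserves the defining equation.\<close>

definition quoXi :: "'r gob \<Rightarrow> 'r fmor \<Rightarrow> nat \<Rightarrow> 'r fmor" where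
  "quoXi B q g = (THE f. f \<in> homF u (hmt p g (atgt q)) (atgt q) \<and>
     cmpF u f (pst p g q) = cmpF u q (snd B g))"

definition quoG :: "'r gob \<Rightarrow> 'r fmor \<Rightarrow> 'r gob" where
  "quoG B q = (atgt q, \<lambda>g\<in>{..<p}. quoXi B q g)"

lemma psh_tau_cokernel:
  assumes "is_cokernel (Fpi u) i q" "i \<in> homF u X Y" "q \<in> homF u Y Z"
  shows "is_cokernel (Fpi u) (pst p g i) (pst p g q)"
  using strict_iso.G1_is_cokernel[OF tau_strict_iso assms] .

lemma quoXi_ex1:
  assumes A: "A \<in> gobs u p" and B: "B \<in> gobs u p" and i: "eqv u p A B i"
    and CK: "is_cokernel (Fpi u) i q" and q: "q \<in> homF u (fst B) Q" and g: "g < p"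
  shows "\<exists>!f. f \<in> homF u (hmt p g Q) Q \<and> cmpF u f (pst p g q) = cmpF u q (snd B g)"
proof -
  have i': "i \<in> homF u (fst A) (fst B)" and ie: "cmpF u i (snd A g) = cmpF u (snd B g) (pst p g i)"
    using i g unfolding eqv_def by auto
  note gi = psh_tau_hom[OF i', of g] and gq = psh_tau_hom[OF q, of g] and bg = gobsD(2)[OF B g] and ag = gobsD(2)[OF A g]
  note CK' = psh_tau_cokernel[OF CK i' q, of g]
  have Q: "Q \<in> obs (Fpi u)" using homFD(2)[OF q] by simp
  have "cmpF u (cmpF u q (snd B g)) (pst p g i) = zroF u (hmt p g (fst A)) Q"
    unfolding F.comp_assoc[OF gi bg q, symmetric] ie[symmetric] F.comp_assoc[OF ag i' q] F.is_cokernelD(1)[OF CK i' q]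
    by (rule F.comp_zero[OF ag Q])
  then obtain f where f: "f \<in> homF u (hmt p g Q) Q" "cmpF u f (pst p g q) = cmpF u q (snd B g)"
    using F.is_cokernelD(2)[OF CK' gi gq F.comp_hom[OF bg q]] by blast
  show ?thesis
  proof (rule ex1I[of _ f])
    fix f' assume "f' \<in> homF u (hmt p g Q) Q \<and> cmpF u f' (pst p g q) = cmpF u q (snd B g)"
    then show "f' = f" using F.is_cokernelD(3)[OF CK' gi gq, of f' Q f] f by simp
  qed (use f in blast)
qed

text \<open>The unit and cocycle conditions are checked after composing with rotations of q, which
  are cokernels and hence epimorphisms.\<close>

lemma quoG:
  assumes A: "A \<in> gobs u p" and B: "B \<in> gobs u p" and i: "eqv u p A B i"
    and CK: "is_cokernel (Fpi u) i q" and q: "q \<in> homF u (fst B) Q"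
  shows "quoG B q \<in> gobs u p" "fst (quoG B q) = Q" "eqv u p B (quoG B q) q"
proof -
  have Qa: "atgt q = Q" using homFD(4)[OF q] .
  show fQ: "fst (quoG B q) = Q" unfolding quoG_def Qa by simp
  have Q: "pts Q" using homFD(2)[OF q] .
  have i': "i \<in> homF u (fst A) (fst B)" using i unfolding eqv_def by blast
  have xq: "quoXi B q g \<in> homF u (hmt p g Q) Q"
    "cmpF u (quoXi B q g) (pst p g q) = cmpF u q (snd B g)" if "g < p" for g
    using theI'[OF quoXi_ex1[OF A B i CK q that]] unfolding quoXi_def Qa by blast+
  let ?x = "\<lambda>g\<in>{..<p}. quoXi B q g"
  have x: "?x g = quoXi B q g" if "g < p" for g using that by simp
  have "(Q, ?x) \<in> gobs u p"
  proof (rule gobsI[OF Q])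
    show "?x \<in> extensional {..<p}" by simp
    show "?x g \<in> homF u (hmt p g Q) Q" if "g < p" for g unfolding x[OF that] using xq(1)[OF that] .
    have c0: "is_cokernel (Fpi u) (pst p g i) (pst p g q)" for g by (rule psh_tau_cokernel[OF CK i' q])
    show "?x 0 = idnF u Q"
      unfolding x[OF p0]
    proof (rule F.is_cokernelD(3)[OF CK i' q])
      show "quoXi B q 0 \<in> homF u Q Q" using xq(1)[OF p0] hml_tau_0[OF Q] by simp
      show "cmpF u (quoXi B q 0) q = cmpF u (idnF u Q) q"
        using xq(2)[OF p0] psh_tau_0[OF q] xi_0[OF B] F.id_right[OF q] F.id_left[OF q] by simp
    qed (rule idnF_hom[OF Q])
    fix g h assume g: "g < p" and h: "h < p"
    let ?m = "(g + h) mod p"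
    have m: "?m < p" using p0 by simp
    have gxh: "pst p g (quoXi B q h) \<in> homF u (hml (tau p ?m) Q) (hmt p g Q)"
      using psh_tau_hom[OF xq(1)[OF h], of g] unfolding hml_tau[OF p0 Q] .
    note mq = psh_tau_hom[OF q, of ?m] and gq = psh_tau_hom[OF q, of g] and hq = psh_tau_hom[OF q, of h]
    have gbh: "pst p g (snd B h) \<in> homF u (hml (tau p ?m) (fst B)) (hmt p g (fst B))"
      using psh_tau_hom[OF gobsD(2)[OF B h], of g] unfolding hml_tau[OF p0 gobsD(1)[OF B]] .
    show "?x ?m = cmpF u (?x g) (pst p g (?x h))"
      unfolding x[OF g] x[OF h] x[OF m]
    proof (rule F.is_cokernelD(3)[OF c0 psh_tau_hom[OF i'] mq xq(1)[OF m] F.comp_hom[OF gxh xq(1)[OF g]]])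
      have "cmpF u (pst p g (quoXi B q h)) (psh (tau p ?m) q) = pst p g (cmpF u q (snd B h))"
        unfolding psh_tau[OF p0 q, symmetric] psh_tau_cmp[OF hq xq(1)[OF h], symmetric] xq(2)[OF h] ..
      also have "\<dots> = cmpF u (pst p g q) (pst p g (snd B h))"
        by (rule psh_tau_cmp[OF gobsD(2)[OF B h] q])
      finally have 1: "cmpF u (pst p g (quoXi B q h)) (psh (tau p ?m) q) =
        cmpF u (pst p g q) (pst p g (snd B h))" .
      show "cmpF u (quoXi B q ?m) (psh (tau p ?m) q) =
        cmpF u (cmpF u (quoXi B q g) (pst p g (quoXi B q h))) (psh (tau p ?m) q)"
        unfolding F.comp_assoc[OF mq gxh xq(1)[OF g], symmetric] 1 F.comp_assoc[OF gbh gq xq(1)[OF g]] xq(2)[OF g] xq(2)[OF m]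
          gobsD(4)[OF B g h]
        by (rule F.comp_assoc[OF gbh gobsD(2)[OF B g] q])
    qed
  qed
  then show "quoG B q \<in> gobs u p" unfolding quoG_def Qa .
  show "eqv u p B (quoG B q) q" unfolding eqv_def fQ using q xq(2) unfolding quoG_def Qa by simp
qed

text \<open>The rotations of J by nontrivial elements, so that S J splits as J and this complement
  on underlying objects.\<close>

definition RR :: "pt set list \<Rightarrow> pt set list" where
  "RR J = concat (map (\<lambda>g. map (rot p g) J) [1..<p])"

lemma GX_split: assumes "pts J" shows "GX p J = J @ RR J"
proof -
  have "[0..<p] = 0 # [1..<p]" using p0 upt_conv_Cons by simp
  moreover have "map (rot p 0) J = J" using rot_list[OF assms, of p 0] hml_tau_0[OF assms] by simp
  ultimately show ?thesis unfolding GX_def RR_def by simp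
qed

definition isS :: "'r gob \<Rightarrow> bool" where "isS A \<longleftrightarrow> (\<exists>X. pts X \<and> A = Sob p X)"

text \<open>The number of summands of X is recovered from S X, so the index action depends on the
  object and not on a chosen X.\<close>

definition tA :: "'r gob \<Rightarrow> nat \<Rightarrow> nat \<Rightarrow> nat" where "tA A = tS p (length (fst A) div p)"

definition iF :: "'r gob \<Rightarrow> 'r fmor" where
  "iF A = (let J = JL (fst A) in trF A (Sob p J) (cmpF u (inlF J (RR J)) (incF u (fst A))))"

text \<open>The cokernel of \<open>iF A\<close> provided by \<open>sheared_kernel_cokernel\<close>:
  the J-component of \<open>iF A\<close> is the standard inclusion, and l expresses the other
  component through it.\<close>

definition qF :: "'r gob \<Rightarrow> 'r fmor" where
  "qF A = (let X = fst A; J = JL X; R = RR J; l = facF u (cmpF u (prrF J R) (iF A)) in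
     plsF u (cmpF u (inlF (SL X) R) (cmpF u (prjF u X) (prlF J R)))
       (cmpF u (inrF (SL X) R) (plsF u (prrF J R) (smulF (-1) (cmpF u l (prlF J R))))))"

text \<open>
  Normalization prescribes the suspension of S X, and an automorphism has to commute with it, hence
  the case distinction.  The map iF A is the sum of the conjugates of the inclusion of the
  underlying object into its hull.
\<close>

definition hullG :: "'r gob \<Rightarrow> 'r gob" where
  "hullG A = (if isS A then permob p (JL (fst A)) (tD (length (fst A)) (tA A)) else Sob p (JL (fst A)))"
definition incG :: "'r gob \<Rightarrow> 'r fmor" where
  "incG A = (if isS A then incF u (fst A) else iF A)"
definition prjG :: "'r gob \<Rightarrow> 'r fmor" where
  "prjG A = (if isS A then prjF u (fst A) else qF A)"
definition susG :: "'r gob \<Rightarrow> 'r gob" where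
  "susG A = (if isS A then permob p (SL (fst A)) (tA A) else quoG (Sob p (JL (fst A))) (qF A))"

definition TT :: "('r gob, 'r gmor) susp" where
  "TT = \<lparr>inj_hull = hullG, sus = susG, inc = (\<lambda>A. lift_mor A (hullG A) (incG A)),
     prj = (\<lambda>A. lift_mor (hullG A) (susG A) (prjG A))\<rparr>"

lemma isS_perm:
  assumes "isS A" obtains X where "pts X" "A = Sob p X" "A = permob p (fst A) (tA A)" "perm_ok p (fst A) (tA A)"
    "fst A = GX p X"
proof -
  obtain X where X: "pts X" "A = Sob p X" using assms unfolding isS_def by blast
  have A: "A = permob p (GX p X) (tS p (length X))" using X Sob_permob[OF X(1) p0] by simp
  then have f: "fst A = GX p X" by simp
  then have t: "tA A = tS p (length X)" using p0 unfolding tA_def by simp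
  have "A = permob p (fst A) (tA A)" unfolding f t by (rule A)
  moreover have "perm_ok p (fst A) (tA A)" unfolding f t by (rule Sob_perm_ok[OF X(1) p0])
  ultimately show ?thesis using that X f by blast
qed

lemma Sob_gobs: assumes "pts X" shows "Sob p X \<in> gobs u p"
  unfolding Sob_permob[OF assms p0] by (rule permob_gobs[OF Sob_perm_ok[OF assms p0]])

lemma Sob_fst: assumes "pts X" shows "fst (Sob p X :: 'r gob) = GX p X"
  unfolding Sob_permob[OF assms p0] by simp

lemma neg_smulF: assumes "f \<in> homF u X Y" shows "F.neg f = smulF (-1) f"
proof -
  have s: "smulF (-1) f \<in> homF u X Y" using smulF_hom[OF assms] .
  have "plsF u f (smulF (-1) f) = zroF u X Y"
    by (rule Fpi_eqI[OF plsF_hom[OF assms s] zroF_hom]) (use homFD[OF assms] in auto)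
  then show ?thesis using F.plus_cancel[OF assms F.neg_hom[OF assms] s] F.plus_neg[OF assms] by simp
qed

text \<open>J is the block of S J with index 0, and the structure map of g moves this block to the
  block g. Of the conjugates that make up \<open>iF A\<close>, only the one for the trivial element
  has a component in J.\<close>

lemma iF_first:
  assumes A: "A \<in> gobs u p"
  defines "J \<equiv> JL (fst A)"
  shows "iF A \<in> homF u (fst A) (J @ RR J)" "eqv u p A (Sob p J) (iF A)"
    "cmpF u (prlF J (RR J)) (iF A) = incF u (fst A)"
proof -
  note X = gobsD(1)[OF A]
  have J: "pts J" unfolding J_def using JL_Xpi[OF X] .
  note SJ = Sob_gobs[OF J]
  have fS: "fst (Sob p J :: 'r gob) = J @ RR J" using Sob_fst[OF J] GX_split[OF J] by simp
  have R: "pts (RR J)" using gobsD(1)[OF SJ] unfolding fS by simp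
  note bp = append_biproduct[OF J R, where u = u]
  have inc: "incF u (fst A) \<in> homF u (fst A) J" unfolding J_def using incF_hom[OF X] .
  let ?k = "cmpF u (inlF J (RR J)) (incF u (fst A))"
  have k: "?k \<in> homF u (fst A) (fst (Sob p J :: 'r gob))" unfolding fS using cmpF_hom[OF inc bp(1)] .
  have iF: "iF A = trF A (Sob p J) ?k" unfolding iF_def J_def Let_def ..
  show "iF A \<in> homF u (fst A) (J @ RR J)" "eqv u p A (Sob p J) (iF A)"
    using trF_hom[OF A SJ k] trF_eqv[OF A SJ k] unfolding iF fS by blast+
  have sel: "cmpF u (prlF J (RR J)) (cmpF u (snd (Sob p J) g) (pst p g (inlF J (RR J)))) =
      (if g = 0 then idnF u J else zroF u (hmt p g J) J)" if g: "g < p" for g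
  proof -
    have xg: "snd (Sob p J) g \<in> homF u (hmt p g (J @ RR J)) (J @ RR J)"
      using gobsD(2)[OF SJ g] unfolding fS .
    note il = psh_tau_hom[OF bp(1), of g]
    have hJ: "pts (hmt p g J)" using hml_Xpi[OF lift_map_tau J] .
    show ?thesis
    proof (cases "g = 0")
      case True
      have "snd (Sob p J :: 'r gob) 0 = idnF u (J @ RR J)" using xi_0[OF SJ] unfolding fS .
      then show ?thesis using True psh_tau_0[OF bp(1)] F.id_left[OF bp(1)] bp(5) by simp
    next
      case False
      have "cmpF u (prlF J (RR J)) (cmpF u (snd (Sob p J) g) (pst p g (inlF J (RR J)))) = zroF u (hmt p g J) J"
      proof (rule Fpi_eqI[OF cmpF_hom[OF cmpF_hom[OF il xg] bp(3)] zroF_hom[OF hJ J]])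
        fix i j assume i: "i < length J" and j: "j < length (hmt p g J)"
        have j': "j < length J" using j by simp
        have i': "i < length (J @ RR J)" using i by simp
        have "coef (cmpF u (prlF J (RR J)) (cmpF u (snd (Sob p J) g) (pst p g (inlF J (RR J))))) i j =
            coef (cmpF u (snd (Sob p J) g) (pst p g (inlF J (RR J)))) i j"
          unfolding prlF_def
          by (rule coef_cmp_rowsel[OF cmpF_hom[OF il xg] J _ i j]) (simp add: nth_append)
        also have "\<dots> = coef (snd (Sob p J) g) i j"
        proof -
          have e: "hmt p g (J @ RR J) = hmt p g J @ hmt p g (RR J)" by simp
          show ?thesis
            unfolding psh_biproduct unfolding inlF_def
            by (rule coef_cmp_colsel[OF xg[unfolded e] hJ _ i' j]) (simp add: nth_append)
        qed
        also have "\<dots> = 0"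
        proof -
          \<comment> \<open>Column j of block 0 has its entry in block g, beyond the first
            \<open>length J\<close> rows since g \<noteq> 0.\<close>
          have "tS p (length J) g j = g * length J + j" using tS_block[OF j', of p g 0] g by simp
          moreover have "length J \<le> g * length J" using False by simp
          ultimately have "i \<noteq> tS p (length J) g j" using i by linarith
          then show ?thesis
            unfolding Sob_permob[OF J p0] permob_snd[OF GX_Xpi[OF J] g] by simp
        qed
        finally show "coef (cmpF u (prlF J (RR J)) (cmpF u (snd (Sob p J) g) (pst p g (inlF J (RR J))))) i j =
            coef (zroF u (hmt p g J) J) i j" by simp
      qed
      then show ?thesis using False by simp
    qed
  qed
  have cj: "cmpF u (prlF J (RR J)) (conjF A (Sob p J) g ?k) =
      (if g = 0 then incF u (fst A) else zroF u (fst A) J)" if g: "g < p" for g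
  proof -
    have xg: "snd (Sob p J) g \<in> homF u (hmt p g (J @ RR J)) (J @ RR J)"
      using gobsD(2)[OF SJ g] unfolding fS .
    note il = psh_tau_hom[OF bp(1), of g] and ic = psh_tau_hom[OF inc, of g] and xi = xinv_hom[OF A g]
    note w = F.comp_hom[OF xi ic]
    have "cmpF u (prlF J (RR J)) (conjF A (Sob p J) g ?k) =
      cmpF u (cmpF u (prlF J (RR J)) (cmpF u (snd (Sob p J) g) (pst p g (inlF J (RR J)))))
        (cmpF u (pst p g (incF u (fst A))) (xinv A g))"
      unfolding conjF_def psh_tau_cmp[OF inc bp(1)] F.comp_assoc[OF xi ic il, symmetric]
        F.comp_assoc[OF w il xg] F.comp_assoc[OF w F.comp_hom[OF il xg] bp(3)] ..
    also have "\<dots> = (if g = 0 then incF u (fst A) else zroF u (fst A) J)"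
    proof (cases "g = 0")
      case True
      have "xinv A 0 = idnF u (fst A)"
        using xi_xinv[OF A p0] xi_0[OF A] F.id_left[OF xinv_hom[OF A p0]] hml_tau_0[OF X] by simp
      then show ?thesis
        unfolding sel[OF g] using True psh_tau_0[OF inc] F.id_right[OF inc] F.id_left[OF inc] by simp
    next
      case False
      then show ?thesis unfolding sel[OF g] using F.comp_zero[OF w, of J] J by simp
    qed
    finally show ?thesis .
  qed
  have "cmpF u (prlF J (RR J)) (iF A) = fsum (fst A) J p (\<lambda>g. cmpF u (prlF J (RR J)) (conjF A (Sob p J) g ?k))"
    unfolding iF trF_def fS
    by (rule cmp_fsum[OF X bp(3)]) (use conjF_hom[OF A SJ k] fS in simp)
  also have "\<dots> = fsum (fst A) J p (\<lambda>g. if g = 0 then incF u (fst A) else zroF u (fst A) J)"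
    using cj by (intro fsum_cong)
  also have "\<dots> = incF u (fst A)"
  proof (rule Fpi_eqI[OF fsum_hom[OF X J] inc])
    show "(if g = 0 then incF u (fst A) else zroF u (fst A) J) \<in> homF u (fst A) J" for g
      using inc zroF_hom[OF X J, of u] by simp
    fix i j
    show "coef (fsum (fst A) J p (\<lambda>g. if g = 0 then incF u (fst A) else zroF u (fst A) J)) i j = coef (incF u (fst A)) i j"
      unfolding coef_fsum by (subst sum_single[OF p0]) auto
  qed
  finally show "cmpF u (prlF J (RR J)) (iF A) = incF u (fst A)" .
qed

lemma bdpt_tau: "bdpt Y \<Longrightarrow> bdpt (rot p g Y)"
  using bdpt_hmpt[OF lift_map_tau] rot_tau bdpt_Xpi by metis

lemma general_conflation:
  assumes A: "A \<in> gobs u p"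
  defines "J \<equiv> JL (fst A)"
  shows "qF A \<in> homF u (J @ RR J) (SL (fst A) @ RR J)" "(iF A, qF A) \<in> CF"
    "set (J @ RR J) \<subseteq> Collect bdpt"
    "\<exists>n\<in>homF u J (J @ RR J). cmpF u n (incF u (fst A)) = iF A"
proof -
  note X = gobsD(1)[OF A]
  have J: "pts J" unfolding J_def using JL_Xpi[OF X] .
  have Jb: "set J \<subseteq> Collect bdpt" unfolding J_def using JL_bdpt[OF X] .
  show JRb: "set (J @ RR J) \<subseteq> Collect bdpt"
    using Jb bdpt_tau unfolding RR_def by auto
  then have R: "pts (RR J)" and Rb: "set (RR J) \<subseteq> Collect bdpt" using bdpt_Xpi by auto
  have S: "pts (SL (fst A))" using SL_Xpi[OF X] .
  note bp = append_biproduct[OF J R, where u = u] and bq = append_biproduct[OF S R, where u = u]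
  note i = iF_first[OF A, folded J_def]
  have inc: "incF u (fst A) \<in> homF u (fst A) J" unfolding J_def using incF_hom[OF X] .
  have prj: "prjF u (fst A) \<in> homF u J (SL (fst A))" unfolding J_def using prjF_hom[OF X] .
  define l where "l = facF u (cmpF u (prrF J (RR J)) (iF A))"
  have r2i: "cmpF u (prrF J (RR J)) (iF A) \<in> homF u (fst A) (RR J)" using cmpF_hom[OF i(1) bp(4)] .
  \<comment> \<open>The points of \<open>RR J\<close> lie on the boundary, so the exponent is 0 and
    \<open>facF\<close> extends this component over the hull.\<close>
  have dvd: "u ^ nu (fst A ! c) (RR J ! r) dvd coef (cmpF u (prrF J (RR J)) (iF A)) r c"
    if "r < length (RR J)" "c < length (fst A)" for r c
  proof -
    have "fst A ! c \<in> Xpi" "bdpt (RR J ! r)" using X Rb that nth_mem by blast+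
    then show ?thesis using nu_bdpt(1) by simp
  qed
  have l: "l \<in> homF u J (RR J)" "cmpF u l (incF u (fst A)) = cmpF u (prrF J (RR J)) (iF A)"
    unfolding l_def J_def by (rule facF[OF r2i[unfolded J_def] dvd[unfolded J_def]]; assumption)+
  have q: "qF A = plsF u (cmpF u (inlF (SL (fst A)) (RR J)) (cmpF u (prjF u (fst A)) (prlF J (RR J))))
      (cmpF u (inrF (SL (fst A)) (RR J)) (plsF u (prrF J (RR J)) (F.neg (cmpF u l (prlF J (RR J))))))"
    unfolding qF_def Let_def J_def[symmetric] l_def[symmetric] neg_smulF[OF cmpF_hom[OF bp(3) l(1)]] ..
  note sk = F.sheared_kernel_cokernel[OF incF_prjF_kernel[OF u_nonzero X] incF_prjF_cokernel[OF u_nonzero X] inc prj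
      bp(1,3,2,4) bp(5,6,7,8,9) bq(1,3,2,4) bq(5,6,7,8,9) i(1) l(1) i(3) l(2), folded q]
  show "qF A \<in> homF u (J @ RR J) (SL (fst A) @ RR J)" using sk(1) .
  obtain n where n: "n \<in> homF u J (J @ RR J)" "cmpF u n (incF u (fst A)) = iF A"
    using injective_ext[OF injective_if_bdpt[OF JRb] std_conflation[OF X] inc i(1)] .
  then show "\<exists>n\<in>homF u J (J @ RR J). cmpF u n (incF u (fst A)) = iF A" by blast
  show "(iF A, qF A) \<in> CF"
    using F.conflation_if_mutual_factor[OF std_conflation[OF X] inc prj sk(2,3) i(1) sk(1) n bp(3) i(3)] .
qed

text \<open>The mutual factorizations of \<open>incG A\<close> and \<open>incF u (fst A)\<close> let
  stable vanishing be tested on the standard hull of the underlying sum of points, whichever case of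
  the definition applies.\<close>

lemma suspension_data:
  assumes A: "A \<in> gobs u p"
  shows "hullG A \<in> gobs u p" "set (fst (hullG A)) \<subseteq> Collect bdpt" "susG A \<in> gobs u p"
    "eqv u p A (hullG A) (incG A)" "eqv u p (hullG A) (susG A) (prjG A)" "(incG A, prjG A) \<in> CF"
    "\<exists>n\<in>homF u (JL (fst A)) (fst (hullG A)). cmpF u n (incF u (fst A)) = incG A"
    "\<exists>m\<in>homF u (fst (hullG A)) (JL (fst A)). cmpF u m (incG A) = incF u (fst A)"
proof -
  note X = gobsD(1)[OF A]
  have "hullG A \<in> gobs u p \<and> set (fst (hullG A)) \<subseteq> Collect bdpt \<and> susG A \<in> gobs u p \<and>
    eqv u p A (hullG A) (incG A) \<and> eqv u p (hullG A) (susG A) (prjG A) \<and> (incG A, prjG A) \<in> CF \<and>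
    (\<exists>n\<in>homF u (JL (fst A)) (fst (hullG A)). cmpF u n (incF u (fst A)) = incG A) \<and>
    (\<exists>m\<in>homF u (fst (hullG A)) (JL (fst A)). cmpF u m (incG A) = incF u (fst A))"
  proof (cases "isS A")
    case True
    obtain X' where X': "A = permob p (fst A) (tA A)" "perm_ok p (fst A) (tA A)" using isS_perm[OF True] .
    have e: "hullG A = permob p (JL (fst A)) (tD (length (fst A)) (tA A))" "incG A = incF u (fst A)"
      "prjG A = prjF u (fst A)" "susG A = permob p (SL (fst A)) (tA A)"
      unfolding hullG_def incG_def prjG_def susG_def using True by simp_all
    have inc: "eqv u p A (hullG A) (incG A)" unfolding e using incF_eqv[OF X'(2)] X'(1) by simp
    have id: "idnF u (JL (fst A)) \<in> homF u (JL (fst A)) (JL (fst A))" using idnF_hom[OF JL_Xpi[OF X]] .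
    show ?thesis
      using inc permob_gobs[OF perm_ok_JL[OF X'(2)]] permob_gobs[OF perm_ok_SL[OF X'(2)]] prjF_eqv[OF X'(2)]
        std_conflation[OF X] JL_bdpt[OF X] F.id_left[OF incF_hom[OF X]] id
      unfolding e by auto
  next
    case False
    have J: "pts (JL (fst A))" using JL_Xpi[OF X] .
    have e: "hullG A = Sob p (JL (fst A))" "incG A = iF A"
      "prjG A = qF A" "susG A = quoG (Sob p (JL (fst A))) (qF A)"
      unfolding hullG_def incG_def prjG_def susG_def using False by simp_all
    have fS: "fst (hullG A) = JL (fst A) @ RR (JL (fst A))" unfolding e using Sob_fst[OF J] GX_split[OF J] by simp
    note i = iF_first[OF A] and q = general_conflation[OF A]
    note SJ = Sob_gobs[OF J]
    have R: "set (RR (JL (fst A))) \<subseteq> Xpi" using gobsD(1)[OF SJ] fS[unfolded e] by simp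
    note Q = quoG[OF A SJ i(2) F.conflation_cokernel[OF q(2)] q(1)[folded fS, unfolded e]]
    show ?thesis
      unfolding fS using SJ Q i q append_biproduct(3)[OF J R, where u = u] unfolding e by blast
  qed
  then show "hullG A \<in> gobs u p" "set (fst (hullG A)) \<subseteq> Collect bdpt" "susG A \<in> gobs u p"
    "eqv u p A (hullG A) (incG A)" "eqv u p (hullG A) (susG A) (prjG A)" "(incG A, prjG A) \<in> CF"
    "\<exists>n\<in>homF u (JL (fst A)) (fst (hullG A)). cmpF u n (incF u (fst A)) = incG A"
    "\<exists>m\<in>homF u (fst (hullG A)) (JL (fst A)). cmpF u m (incG A) = incF u (fst A)"
    by blast+
qed

lemma TT_sel [simp]: "inj_hull TT A = hullG A" "sus TT A = susG A"
  "inc TT A = lift_mor A (hullG A) (incG A)" "prj TT A = lift_mor (hullG A) (susG A) (prjG A)"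
  by (simp_all add: TT_def)

lemma TT_hom:
  assumes A: "A \<in> gobs u p"
  shows "inc TT A \<in> hom GG A (hullG A)" "prj TT A \<in> hom GG (hullG A) (susG A)" "(inc TT A, prj TT A) \<in> CG"
    "und (inc TT A) = incG A" "und (prj TT A) = prjG A"
proof -
  note d = suspension_data[OF A]
  show h: "inc TT A \<in> hom GG A (hullG A)" "prj TT A \<in> hom GG (hullG A) (susG A)"
    using G_homI[OF A d(1,4)] G_homI[OF d(1,3,5)] by simp_all
  show e: "und (inc TT A) = incG A" "und (prj TT A) = prjG A"
    using d(4,5) und_lift unfolding eqv_def TT_sel by blast+
  have "inc TT A \<in> mors GG" "prj TT A \<in> mors GG" using h unfolding hom_def by auto
  then show "(inc TT A, prj TT A) \<in> CG"
    using d(6) e unfolding conflG_def by simp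
qed

lemma TT_suspension: "suspension GG CG TT"
  unfolding suspension_def
proof (intro ballI conjI)
  fix A assume "A \<in> obs GG"
  then have A: "A \<in> gobs u p" by simp
  show "injective GG CG (inj_hull TT A)" unfolding TT_sel by (rule injective_G[OF suspension_data(1,2)[OF A]])
  show "sus TT A \<in> obs GG" using suspension_data(3)[OF A] by simp
  show "inc TT A \<in> hom GG A (inj_hull TT A)" unfolding TT_sel(1) by (rule TT_hom(1)[OF A])
  show "prj TT A \<in> hom GG (inj_hull TT A) (sus TT A)" unfolding TT_sel(1,2) by (rule TT_hom(2)[OF A])
  show "(inc TT A, prj TT A) \<in> CG" by (rule TT_hom(3)[OF A])
qed

lemma hull_projinj: "A \<in> gobs u p \<Longrightarrow> projinj GG CG (hullG A)"
  unfolding projinj_def using injective_G[OF suspension_data(1,2)] projective_G[OF suspension_data(1,2)] by simp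

text \<open>The case \<open>isS\<close> applies, and the suspension of points commutes with the
  rotations that build S X.\<close>

lemma TT_normalized: "normalized p TT"
  unfolding normalized_def
proof (intro allI impI)
  fix zs :: "(real \<times> real) list"
  assume z: "\<forall>(x, y)\<in>set zs. x \<le> y \<and> y \<le> x + 2 * pi"
  let ?X = "map (\<lambda>(x, y). Ept x y) zs"
  have X: "set ?X \<subseteq> Xpi" using z Ept_Xpi by (force simp: okp_def)
  have S: "SL ?X = map (\<lambda>(x, y). Ept y (x + 2 * pi)) zs"
    unfolding SL_def using z shpt_Ept by (force simp: okp_def)
  have iS: "isS (Sob p ?X)" unfolding isS_def using X by blast
  have "susG (Sob p ?X) = permob p (SL (GX p ?X)) (tA (Sob p ?X))" unfolding susG_def using iS Sob_fst[OF X] by simp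
  also have "tA (Sob p ?X) = tS p (length (SL ?X))" unfolding tA_def Sob_fst[OF X] using p0 by simp
  also have "permob p (SL (GX p ?X)) (tS p (length (SL ?X))) = Sob p (SL ?X)"
    unfolding GX_SL[OF X] Sob_permob[OF SL_Xpi[OF X] p0] ..
  finally show "sus TT (Sob p ?X) = Sob p (map (\<lambda>(x, y). Ept y (x + 2 * pi)) zs)" unfolding S by simp
qed

text \<open>A map that factors through a projective-injective extends over the hull, so its matrix
  factors through \<open>incF\<close> and its entries are divisible. Conversely \<open>facF\<close>
  gives an underlying factorization through the hull, which averaging makes equivariant.\<close>

lemma stably_zero_G_iff:
  assumes f: "f \<in> hom GG A B"
  shows "stably_zero GG CG f \<longleftrightarrow>
    (\<forall>i<length (fst B). \<forall>j<length (fst A). u ^ nu (fst A ! j) (fst B ! i) dvd coef f i j)"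
proof -
  note A = G_homD(1)[OF f] and B = G_homD(2)[OF f]
  note X = gobsD(1)[OF A] and Y = gobsD(1)[OF B] and f' = G_homD(5)[OF f]
  note d = suspension_data[OF A] and T = TT_hom[OF A]
  have ef: "eqv u p A B (und f)" using f unfolding G_hom_iff by blast
  have incA: "incG A \<in> homF u (fst A) (fst (hullG A))" using d(4) unfolding eqv_def by blast
  show ?thesis
  proof
    assume "stably_zero GG CG f"
    then obtain P a b where P: "projinj GG CG P" and a: "a \<in> hom GG A P" and b: "b \<in> hom GG P B" and fba: "f = cmp GG b a"
      using G_src_tgt[OF f] unfolding stably_zero_def by auto
    have "injective GG CG P" using P unfolding projinj_def by blast
    moreover have "a \<in> hom GG (src GG (inc TT A)) P" using a G_src_tgt[OF T(1)] by simp
    ultimately obtain k0 where k0: "k0 \<in> hom GG (tgt GG (inc TT A)) P" "cmp GG k0 (inc TT A) = a"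
      using T(3) unfolding injective_def by blast
    then have k: "k0 \<in> hom GG (hullG A) P" using G_src_tgt[OF T(1)] by simp
    have ua: "und a = cmpF u (und k0) (incG A)" using und_cmp[OF T(1) k] k0(2) T(4) by simp
    obtain n where n: "n \<in> homF u (JL (fst A)) (fst (hullG A))" "cmpF u n (incF u (fst A)) = incG A"
      using d(7) by blast
    note b' = G_homD(5)[OF b] and k' = G_homD(5)[OF k]
    let ?h = "cmpF u (und b) (cmpF u (und k0) n)"
    have h: "?h \<in> homF u (JL (fst A)) (fst B)" using cmpF_hom[OF cmpF_hom[OF n(1) k'] b'] .
    have "cmpF u ?h (incF u (fst A)) = und f"
      unfolding F.comp_assoc[OF incF_hom[OF X] cmpF_hom[OF n(1) k'] b', symmetric]
        F.comp_assoc[OF incF_hom[OF X] n(1) k', symmetric] n(2) ua[symmetric] fba und_cmp[OF a b] ..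
    then show "\<forall>i<length (fst B). \<forall>j<length (fst A). u ^ nu (fst A ! j) (fst B ! i) dvd coef f i j"
      using nu_dvd_if_factor[OF X h] G_homD(8)[OF f] by simp
  next
    assume dvd: "\<forall>i<length (fst B). \<forall>j<length (fst A). u ^ nu (fst A ! j) (fst B ! i) dvd coef f i j"
    have dvd': "u ^ nu (fst A ! j) (fst B ! i) dvd coef (und f) i j" if "i < length (fst B)" "j < length (fst A)" for i j
      using dvd that G_homD(8)[OF f] by simp
    have k: "facF u (und f) \<in> homF u (JL (fst A)) (fst B)" "cmpF u (facF u (und f)) (incF u (fst A)) = und f"
      by (rule facF[OF f' dvd']; assumption)+
    obtain m where m: "m \<in> homF u (fst (hullG A)) (JL (fst A))" "cmpF u m (incG A) = incF u (fst A)"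
      using d(8) by blast
    let ?k = "cmpF u (facF u (und f)) m"
    have k1: "?k \<in> homF u (fst (hullG A)) (fst B)" using cmpF_hom[OF m(1) k(1)] .
    have k2: "cmpF u ?k (incG A) = und f"
      unfolding F.comp_assoc[OF incA m(1) k(1), symmetric] m(2) k(2) ..
    let ?h = "lift_mor (hullG A) B (avg (hullG A) B ?k)"
    have ae: "eqv u p (hullG A) B (avg (hullG A) B ?k)" using avg_eqv[OF d(1) B B k1] .
    have h: "?h \<in> hom GG (hullG A) B" using G_homI[OF d(1) B ae] .
    have uh: "und ?h = avg (hullG A) B ?k" using ae und_lift unfolding eqv_def by blast
    have "f = cmp GG ?h (inc TT A)"
    proof (rule G_eqI[OF f preadditive.comp_hom[OF G_preadditive T(1) h]])
      show "und f = und (cmp GG ?h (inc TT A))"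
        unfolding und_cmp[OF T(1) h] uh T(4) avg_pre[OF d(1) B A d(4) k1, symmetric] k2
        by (rule avg_self[OF A B B ef, symmetric])
    qed
    then show "stably_zero GG CG f"
      unfolding stably_zero_def using hull_projinj[OF A] T(1) h G_src_tgt[OF f] preadditive.homD[OF G_preadditive f]
      by blast
  qed
qed

lemma G_stable_setup: "stable_setup GG CG"
proof -
  interpret G: preadditive GG by (rule G_preadditive)
  show ?thesis
  proof
    fix f g A B assume f: "f \<in> hom GG A B" and g: "g \<in> hom GG A B" and s: "stably_zero GG CG f" "stably_zero GG CG g"
    have "coef (pls GG f g) i j = coef f i j + coef g i j" for i j
      using und_pls[OF g f] G_homD(8)[OF f] G_homD(8)[OF g] G_homD(8)[OF G.plus_hom[OF f g]] by (metis coef_pls)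
    then show "stably_zero GG CG (pls GG f g)"
      using s unfolding stably_zero_G_iff[OF f] stably_zero_G_iff[OF g] stably_zero_G_iff[OF G.plus_hom[OF f g]] by simp
  next
    fix A B assume o: "A \<in> obs GG" "B \<in> obs GG"
    then have z: "zro GG A B \<in> hom GG A B" by blast
    have "coef (zro GG A B) i j = 0" for i j
      using und_zro[of A B] G_homD(8)[OF z] o by (metis coef_zro G_obs)
    then show "stably_zero GG CG (zro GG A B)" unfolding stably_zero_G_iff[OF z] by simp
  qed
qed

end

section \<open>Automorphisms induced by equivariant homeomorphisms\<close>

locale gaut = gfpi u CF p for u :: "'r::idom" and CF p +
  fixes \<gamma> \<delta> :: "real \<Rightarrow> real"
  assumes lift: "lift_map \<gamma>" "lift_map \<delta>" and inv: "\<And>x. \<delta> (\<gamma> x) = x" "\<And>x. \<gamma> (\<delta> x) = x"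
    and theta: "\<And>x. \<gamma> (x + theta p) = \<gamma> x + theta p" "\<And>x. \<delta> (x + theta p) = \<delta> x + theta p"
begin

text \<open>The inverse is a parameter of the locale, so that each result is available with the two
  maps exchanged.\<close>

lemma symmetric: "gaut u CF p \<delta> \<gamma>"
  by unfold_locales (use lift inv theta in auto)

lemma comm_tau: "\<gamma> (tau p g x) = tau p g (\<gamma> x)"
proof (induction g)
  case (Suc g)
  have "x + real (Suc g) * theta p = (x + real g * theta p) + theta p" for x by (simp add: algebra_simps)
  then show ?case using Suc theta(1) unfolding tau_def by (simp only:)
qed (simp add: tau_def)

lemma hmpt_comm: "X \<in> Xpi \<Longrightarrow> hmpt \<gamma> (hmpt (tau p g) X) = hmpt (tau p g) (hmpt \<gamma> X)"
  using hmpt_comp[OF lift(1) lift_map_tau, of X p g] hmpt_comp[OF lift_map_tau lift(1), of X p g] comm_tau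
  by (simp add: comp_def)

lemma hml_comm: "pts X \<Longrightarrow> hml \<gamma> (hmt p g X) = hmt p g (hml \<gamma> X)"
  using hmpt_comm by auto

lemma hml_rot: "pts X \<Longrightarrow> hml \<gamma> (map (rot p g) X) = map (rot p g) (hml \<gamma> X)"
  using hml_comm rot_list hml_Xpi[OF lift(1)] by metis

lemma psh_comm: "f \<in> homF u X Y \<Longrightarrow> psh \<gamma> (pst p g f) = pst p g (psh \<gamma> f)"
  using homFD[of f u X Y] hml_comm by (intro arr.expand) simp

definition A0 :: "'r gob \<Rightarrow> 'r gob" where
  "A0 A = (hml \<gamma> (fst A), \<lambda>k\<in>{..<p}. psh \<gamma> (snd A k))"

definition A1 :: "'r gmor \<Rightarrow> 'r gmor" where
  "A1 f = lift_mor (A0 (asrc f)) (A0 (atgt f)) (psh \<gamma> (und f))"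

lemma A0_fst [simp]: "fst (A0 A) = hml \<gamma> (fst A)" and A0_snd: "g < p \<Longrightarrow> snd (A0 A) g = psh \<gamma> (snd A g)"
  by (simp_all add: A0_def)

lemma A0_gobs: assumes A: "A \<in> gobs u p" shows "A0 A \<in> gobs u p"
proof -
  note X = gobsD(1)[OF A]
  let ?x = "\<lambda>k\<in>{..<p}. psh \<gamma> (snd A k)"
  have x: "?x g = psh \<gamma> (snd A g)" if "g < p" for g using that by simp
  have "(hml \<gamma> (fst A), ?x) \<in> gobs u p"
  proof (rule gobsI[OF hml_Xpi[OF lift(1) X]])
    show "?x g \<in> homF u (hmt p g (hml \<gamma> (fst A))) (hml \<gamma> (fst A))" if g: "g < p" for g
      unfolding x[OF g] hml_comm[OF X, symmetric] by (rule psh_hom[OF lift(1) gobsD(2)[OF A g]])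
    show "?x 0 = idnF u (hml \<gamma> (fst A))" unfolding x[OF p0] xi_0[OF A] psh_idn ..
    fix g h assume g: "g < p" and h: "h < p"
    have m: "(g + h) mod p < p" using p0 by simp
    have gh: "pst p g (snd A h) \<in> homF u (hmt p ((g + h) mod p) (fst A)) (hmt p g (fst A))"
      using psh_tau_hom[OF gobsD(2)[OF A h], of g] unfolding hml_tau[OF p0 X] .
    show "?x ((g + h) mod p) = cmpF u (?x g) (pst p g (?x h))"
      unfolding x[OF g] x[OF h] x[OF m] gobsD(4)[OF A g h] psh_comm[OF gobsD(2)[OF A h], symmetric]
      by (rule psh_cmp[OF lift(1) gh gobsD(2)[OF A g]])
  qed simp
  then show ?thesis unfolding A0_def .
qed

lemma eqv_A: assumes A: "A \<in> gobs u p" and B: "B \<in> gobs u p" and k: "eqv u p A B k"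
  shows "eqv u p (A0 A) (A0 B) (psh \<gamma> k)"
proof -
  have k': "k \<in> homF u (fst A) (fst B)" using k unfolding eqv_def by blast
  have "cmpF u (psh \<gamma> k) (snd (A0 A) g) = cmpF u (snd (A0 B) g) (pst p g (psh \<gamma> k))" if g: "g < p" for g
  proof -
    have e: "cmpF u k (snd A g) = cmpF u (snd B g) (pst p g k)" using k g unfolding eqv_def by blast
    show ?thesis
      unfolding A0_snd[OF g] psh_comm[OF k', symmetric] psh_cmp[OF lift(1) gobsD(2)[OF A g] k', symmetric]
        psh_cmp[OF lift(1) psh_tau_hom[OF k'] gobsD(2)[OF B g], symmetric] e ..
  qed
  then show ?thesis unfolding eqv_def using psh_hom[OF lift(1) k'] by simp
qed

lemma und_A1: assumes "f \<in> hom GG A B" shows "und (A1 f) = psh \<gamma> (und f)"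
  unfolding A1_def using und_lift[of "psh \<gamma> (und f)" u "A0 A" "A0 B"] psh_hom[OF lift(1) G_homD(5)[OF assms]] G_homD(3,4)[OF assms]
  by (simp del: und_lift_mor)

lemma A1_hom: assumes f: "f \<in> hom GG A B" shows "A1 f \<in> hom GG (A0 A) (A0 B)"
proof -
  have "eqv u p A B (und f)" using f unfolding G_hom_iff by blast
  then show ?thesis
    using G_homI[OF A0_gobs[OF G_homD(1)[OF f]] A0_gobs[OF G_homD(2)[OF f]] eqv_A[OF G_homD(1,2)[OF f]]] G_homD(3,4)[OF f]
    unfolding A1_def by simp
qed

lemma A0_inverse: assumes A: "A \<in> gobs u p" shows "gaut.A0 p \<delta> (A0 A) = A"
proof -
  interpret s: gaut u CF p \<delta> \<gamma> by (rule symmetric)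
  have X: "hml \<delta> (hml \<gamma> (fst A)) = fst A" using hml_id[OF inv(1) lift(2,1) gobsD(1)[OF A]] .
  have "snd (s.A0 (A0 A)) g = snd A g" for g
  proof (cases "g < p")
    case True
    have "psh \<delta> (psh \<gamma> (snd A g)) = snd A g"
      using strict_iso.H1_G1[OF psh_strict_iso[OF lift inv] gobsD(2)[OF A True]] .
    then show ?thesis unfolding s.A0_snd[OF True] A0_snd[OF True] .
  next
    \<comment> \<open>Outside the exponents below p both families have the default value
      \<open>undefined\<close>, by extensionality.\<close>
    case False
    have "snd A g = undefined" using extensional_arb[OF gobsD(5)[OF A], of g] False by simp
    then show ?thesis using False unfolding s.A0_def by simp
  qed
  then have "snd (s.A0 (A0 A)) = snd A" by (rule ext)
  moreover have "fst (s.A0 (A0 A)) = fst A" unfolding s.A0_fst A0_fst by (rule X)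
  ultimately show ?thesis by (intro prod_eqI)
qed

lemma A1_inverse: assumes f: "f \<in> hom GG A B" shows "gaut.A1 p \<delta> (A1 f) = f"
proof -
  interpret s: gaut u CF p \<delta> \<gamma> by (rule symmetric)
  have h: "s.A1 (A1 f) \<in> hom GG A B"
    using s.A1_hom[OF A1_hom[OF f]] A0_inverse[OF G_homD(1)[OF f]] A0_inverse[OF G_homD(2)[OF f]] by simp
  show ?thesis
    by (rule G_eqI[OF h f])
      (simp add: s.und_A1[OF A1_hom[OF f]] und_A1[OF f] strict_iso.H1_G1[OF psh_strict_iso[OF lift inv] G_homD(5)[OF f]])
qed

lemma G_strict_iso: "strict_iso GG A0 (gaut.A0 p \<delta>) A1 (gaut.A1 p \<delta>)"
proof -
  interpret s: gaut u CF p \<delta> \<gamma> by (rule symmetric)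
  interpret G: preadditive GG by (rule G_preadditive)
  show ?thesis
  proof unfold_locales
    fix A assume "A \<in> obs GG"
    then have A: "A \<in> gobs u p" by simp
    show "A0 A \<in> obs GG" "s.A0 A \<in> obs GG" using A0_gobs[OF A] s.A0_gobs[OF A] by simp_all
    show "s.A0 (A0 A) = A" "A0 (s.A0 A) = A" using A0_inverse[OF A] s.A0_inverse[OF A] by simp_all
    have i: "idn GG A \<in> hom GG A A" "idn GG (A0 A) \<in> hom GG (A0 A) (A0 A)"
      using A A0_gobs[OF A] G.id_hom by simp_all
    show "A1 (idn GG A) = idn GG (A0 A)"
      by (rule G_eqI[OF A1_hom[OF i(1)] i(2)]) (simp add: und_A1[OF i(1)] A A0_gobs[OF A] psh_idn)
  next
    fix f g A B E assume f: "f \<in> hom GG A B"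
    show "A1 f \<in> hom GG (A0 A) (A0 B)" "s.A1 f \<in> hom GG (s.A0 A) (s.A0 B)" using A1_hom[OF f] s.A1_hom[OF f] .
    show "s.A1 (A1 f) = f" "A1 (s.A1 f) = f" using A1_inverse[OF f] s.A1_inverse[OF f] by simp_all
    show "A1 (cmp GG g f) = cmp GG (A1 g) (A1 f)" if g: "g \<in> hom GG B E"
      by (rule G_eqI[OF A1_hom[OF G.comp_hom[OF f g]] G.comp_hom[OF A1_hom[OF f] A1_hom[OF g]]])
        (simp add: und_A1[OF G.comp_hom[OF f g]] und_cmp[OF f g] und_cmp[OF A1_hom[OF f] A1_hom[OF g]]
          und_A1[OF f] und_A1[OF g] psh_cmp[OF lift(1) G_homD(5)[OF f] G_homD(5)[OF g]])
    show "A1 (pls GG g f) = pls GG (A1 g) (A1 f)" if g: "g \<in> hom GG A B"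
      by (rule G_eqI[OF A1_hom[OF G.plus_hom[OF g f]] G.plus_hom[OF A1_hom[OF g] A1_hom[OF f]]])
        (simp add: und_A1[OF G.plus_hom[OF g f]] und_pls[OF f g] und_pls[OF A1_hom[OF f] A1_hom[OF g]]
          und_A1[OF f] und_A1[OF g] psh_pls)
  qed
qed

lemma A1_conflG: assumes iq: "(i, q) \<in> CG" shows "(A1 i, A1 q) \<in> CG"
proof -
  obtain A B E where i: "i \<in> hom GG A B" and q: "q \<in> hom GG B E" and cf: "(und i, und q) \<in> CF" using conflG_hom[OF iq] .
  have "(psh \<gamma> (und i), psh \<gamma> (und q)) \<in> CF" using conflation_psh[OF lift inv cf] .
  moreover have "A1 i \<in> mors GG" "A1 q \<in> mors GG" using A1_hom[OF i] A1_hom[OF q] unfolding hom_def by auto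
  moreover have "atgt (A1 i) = asrc (A1 q)" using G_homD(3,4)[OF i] G_homD(3,4)[OF q] by (simp add: A1_def)
  ultimately show ?thesis unfolding conflG_def using und_A1[OF i] und_A1[OF q] by simp
qed

lemma A0_permob: assumes Y: "pts Y" shows "A0 (permob p Y \<tau>) = permob p (hml \<gamma> Y) \<tau>"
proof -
  have "psh \<gamma> (fmat (map (rot p h) Y) Y m) = fmat (map (rot p h) (hml \<gamma> Y)) (hml \<gamma> Y) m" for h m
    using hml_rot[OF Y, of h] by (intro arr.expand) (simp add: fmat_def)
  then show ?thesis unfolding A0_def permob_def by (auto intro!: restrict_ext)
qed

lemma GX_hml: assumes X: "pts X" shows "hml \<gamma> (GX p X) = GX p (hml \<gamma> X)"
proof -
  have "map (hmpt \<gamma>) (concat (map f L)) = concat (map (\<lambda>g. map (hmpt \<gamma>) (f g)) L)" for f and L :: "nat list"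
    by (simp add: map_concat comp_def)
  then show ?thesis unfolding GX_def hml_rot[OF X, symmetric] .
qed

lemma RR_hml: assumes X: "pts X" shows "hml \<gamma> (RR X) = RR (hml \<gamma> X)"
proof -
  have "map (hmpt \<gamma>) (concat (map f L)) = concat (map (\<lambda>g. map (hmpt \<gamma>) (f g)) L)" for f and L :: "nat list"
    by (simp add: map_concat comp_def)
  then show ?thesis unfolding RR_def hml_rot[OF X, symmetric] .
qed

lemma A0_Sob: assumes X: "pts X" shows "A0 (Sob p X) = Sob p (hml \<gamma> X)"
  unfolding Sob_permob[OF X p0] Sob_permob[OF hml_Xpi[OF lift(1) X] p0] A0_permob[OF GX_Xpi[OF X]] GX_hml[OF X] by simp

lemma isS_A0: "isS A \<Longrightarrow> isS (A0 A)"
  unfolding isS_def using A0_Sob hml_Xpi[OF lift(1)] by blast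

lemma isS_A0_iff: assumes A: "A \<in> gobs u p" shows "isS (A0 A) \<longleftrightarrow> isS A"
  using gaut.isS_A0[OF symmetric, of "A0 A"] A0_inverse[OF A] isS_A0[of A] by auto

lemma tA_A0: "tA (A0 A) = tA A"
  unfolding tA_def by simp

lemma trF_A:
  assumes A: "A \<in> gobs u p" and B: "B \<in> gobs u p" and k: "k \<in> homF u (fst A) (fst B)"
  shows "psh \<gamma> (trF A B k) = trF (A0 A) (A0 B) (psh \<gamma> k)"
proof -
  have x: "psh \<gamma> (xinv A g) = xinv (A0 A) g" if g: "g < p" for g
    unfolding xinv_def A0_snd[OF neg_mod(1)] by (rule psh_comm[OF gobsD(2)[OF A neg_mod(1)]])
  have "psh \<gamma> (conjF A B g k) = conjF (A0 A) (A0 B) g (psh \<gamma> k)" if g: "g < p" for g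
    unfolding conjF_def A0_snd[OF g] x[OF g, symmetric] psh_comm[OF k, symmetric]
      psh_cmp[OF lift(1) F.comp_hom[OF xinv_hom[OF A g] psh_tau_hom[OF k]] gobsD(2)[OF B g]]
      psh_cmp[OF lift(1) xinv_hom[OF A g] psh_tau_hom[OF k]] ..
  then show ?thesis unfolding trF_def psh_fsum A0_fst by (intro fsum_cong)
qed

text \<open>The transported structure maps satisfy the equation by which \<open>quoXi\<close> is
  determined uniquely.\<close>

lemma quoG_A:
  assumes A: "A \<in> gobs u p" and B: "B \<in> gobs u p" and i: "eqv u p A B i" and cf: "(i, q) \<in> CF"
    and q: "q \<in> homF u (fst B) Q"
  shows "A0 (quoG B q) = quoG (A0 B) (psh \<gamma> q)"
proof -
  have i': "i \<in> homF u (fst A) (fst B)" using i unfolding eqv_def by blast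
  have Qa: "atgt q = Q" using homFD(4)[OF q] .
  have Q: "pts Q" using homFD(2)[OF q] .
  have cf': "(psh \<gamma> i, psh \<gamma> q) \<in> CF" using conflation_psh[OF lift inv cf] .
  have q': "psh \<gamma> q \<in> homF u (fst (A0 B)) (hml \<gamma> Q)" using psh_hom[OF lift(1) q] by simp
  have "psh \<gamma> (quoXi B q g) = quoXi (A0 B) (psh \<gamma> q) g" if g: "g < p" for g
  proof -
    note ex = quoXi_ex1[OF A B i F.conflation_cokernel[OF cf] q g]
    have xq: "quoXi B q g \<in> homF u (hmt p g Q) Q"
      "cmpF u (quoXi B q g) (pst p g q) = cmpF u q (snd B g)"
      using theI'[OF ex] unfolding quoXi_def Qa by blast+
    have 1: "psh \<gamma> (quoXi B q g) \<in> homF u (hmt p g (hml \<gamma> Q)) (hml \<gamma> Q)"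
      using psh_hom[OF lift(1) xq(1)] unfolding hml_comm[OF Q] .
    have 2: "cmpF u (psh \<gamma> (quoXi B q g)) (pst p g (psh \<gamma> q)) = cmpF u (psh \<gamma> q) (snd (A0 B) g)"
      unfolding psh_comm[OF q, symmetric] psh_cmp[OF lift(1) psh_tau_hom[OF q] xq(1), symmetric] xq(2) A0_snd[OF g]
      by (rule psh_cmp[OF lift(1) gobsD(2)[OF B g] q])
    show ?thesis
      unfolding quoXi_def[of "A0 B"] push_sel(2) Qa
      by (rule the1_equality[symmetric, OF quoXi_ex1[OF A0_gobs[OF A] A0_gobs[OF B] eqv_A[OF A B i]
            F.conflation_cokernel[OF cf'] q' g]]) (use 1 2 in blast)
  qed
  then show ?thesis unfolding quoG_def A0_def[of "(_, _)"] by (auto intro!: restrict_ext)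
qed

lemma iF_A: assumes A: "A \<in> gobs u p" shows "psh \<gamma> (iF A) = iF (A0 A)"
proof -
  note X = gobsD(1)[OF A]
  have J: "pts (JL (fst A))" using JL_Xpi[OF X] .
  have fS: "fst (Sob p (JL (fst A)) :: 'r gob) = JL (fst A) @ RR (JL (fst A))" using Sob_fst[OF J] GX_split[OF J] by simp
  have R: "set (RR (JL (fst A))) \<subseteq> Xpi" using gobsD(1)[OF Sob_gobs[OF J]] unfolding fS by simp
  note bp = append_biproduct[OF J R, where u = u]
  have k: "cmpF u (inlF (JL (fst A)) (RR (JL (fst A)))) (incF u (fst A)) \<in> homF u (fst A) (fst (Sob p (JL (fst A)) :: 'r gob))"
    unfolding fS using cmpF_hom[OF incF_hom[OF X] bp(1)] .
  show ?thesis
    unfolding iF_def Let_def trF_A[OF A Sob_gobs[OF J] k] A0_Sob[OF J] psh_cmp[OF lift(1) incF_hom[OF X] bp(1)]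
      psh_incF[OF lift(1) X] psh_biproduct A0_fst RR_hml[OF J] hml_JL[OF lift(1) X] ..
qed

lemma qF_A: assumes A: "A \<in> gobs u p" shows "psh \<gamma> (qF A) = qF (A0 A)"
proof -
  note X = gobsD(1)[OF A]
  have J: "pts (JL (fst A))" using JL_Xpi[OF X] .
  have S: "pts (SL (fst A))" using SL_Xpi[OF X] .
  have fS: "fst (Sob p (JL (fst A)) :: 'r gob) = JL (fst A) @ RR (JL (fst A))" using Sob_fst[OF J] GX_split[OF J] by simp
  have R: "set (RR (JL (fst A))) \<subseteq> Xpi" using gobsD(1)[OF Sob_gobs[OF J]] unfolding fS by simp
  note bp = append_biproduct[OF J R, where u = u] and bq = append_biproduct[OF S R, where u = u]
  note i = iF_first(1)[OF A]
  let ?r = "cmpF u (prrF (JL (fst A)) (RR (JL (fst A)))) (iF A)"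
  have r: "?r \<in> homF u (fst A) (RR (JL (fst A)))" using cmpF_hom[OF i bp(4)] .
  have l: "facF u ?r \<in> homF u (JL (fst A)) (RR (JL (fst A)))"
    unfolding facF_def Let_def homFD(3,4)[OF r] using J R by blast
  note lr = smulF_hom[OF cmpF_hom[OF bp(3) l], of "-1"]
  note pr = cmpF_hom[OF bp(3) prjF_hom[OF X]]
  show ?thesis
    unfolding qF_def Let_def psh_pls psh_cmp[OF lift(1) pr bq(1)] psh_cmp[OF lift(1) bp(3) prjF_hom[OF X]]
      psh_cmp[OF lift(1) plsF_hom[OF bp(4) lr] bq(2)] psh_smulF psh_cmp[OF lift(1) bp(3) l] psh_facF[OF lift(1) r]
      psh_cmp[OF lift(1) i bp(4)] psh_biproduct psh_prjF[OF lift(1) X] iF_A[OF A] A0_fst RR_hml[OF J]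
      hml_JL[OF lift(1) X] hml_SL[OF lift(1) X] ..
qed

text \<open>The test \<open>isS\<close> is invariant under the automorphism, and in either case
  every ingredient of the suspension has been shown to commute with it.\<close>

lemma suspension_A:
  assumes A: "A \<in> gobs u p"
  shows "hullG (A0 A) = A0 (hullG A)" "susG (A0 A) = A0 (susG A)" "incG (A0 A) = psh \<gamma> (incG A)" "prjG (A0 A) = psh \<gamma> (prjG A)"
proof -
  note X = gobsD(1)[OF A]
  have J: "pts (JL (fst A))" using JL_Xpi[OF X] .
  note iS = isS_A0_iff[OF A]
  show "hullG (A0 A) = A0 (hullG A)"
    unfolding hullG_def iS using A0_permob[OF J] A0_Sob[OF J] hml_JL[OF lift(1) X] tA_A0[of A] by simp
  show "incG (A0 A) = psh \<gamma> (incG A)"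
    unfolding incG_def iS using psh_incF[OF lift(1) X, of u] iF_A[OF A] by simp
  show "prjG (A0 A) = psh \<gamma> (prjG A)"
    unfolding prjG_def iS using psh_prjF[OF lift(1) X, of u] qF_A[OF A] by simp
  have "quoG (Sob p (JL (fst (A0 A)))) (qF (A0 A)) = A0 (quoG (Sob p (JL (fst A))) (qF A))"
  proof -
    have fS: "fst (Sob p (JL (fst A)) :: 'r gob) = JL (fst A) @ RR (JL (fst A))" using Sob_fst[OF J] GX_split[OF J] by simp
    note g = general_conflation[OF A] and i = iF_first[OF A]
    show ?thesis
      unfolding quoG_A[OF A Sob_gobs[OF J] i(2) g(2) g(1)[folded fS]] qF_A[OF A] A0_Sob[OF J] hml_JL[OF lift(1) X] A0_fst ..
  qed
  then show "susG (A0 A) = A0 (susG A)"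
    unfolding susG_def iS using A0_permob[OF SL_Xpi[OF X]] hml_SL[OF lift(1) X] tA_A0[of A] by simp
qed

lemma lift_mor_A: assumes "A \<in> gobs u p" "B \<in> gobs u p" "eqv u p A B k"
  shows "lift_mor (A0 A) (A0 B) (psh \<gamma> k) = A1 (lift_mor A B k)"
proof -
  have "und (lift_mor A B k) = k" using assms(3) und_lift unfolding eqv_def by blast
  then show ?thesis unfolding A1_def by simp
qed

lemma G_strict_triangle_iso: "strict_triangle_iso GG CG A0 (gaut.A0 p \<delta>) A1 (gaut.A1 p \<delta>) TT"
proof -
  interpret s: gaut u CF p \<delta> \<gamma> by (rule symmetric)
  interpret S: stable_setup GG CG by (rule G_stable_setup)
  interpret I: strict_iso GG A0 s.A0 A1 s.A1 by (rule G_strict_iso)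
  show ?thesis
  proof unfold_locales
    show "\<exists>A B E. i \<in> hom GG A B \<and> q \<in> hom GG B E" if "(i, q) \<in> CG" for i q
      using conflG_hom[OF that] by metis
    show "(A1 i, A1 q) \<in> CG" "(s.A1 i, s.A1 q) \<in> CG" if "(i, q) \<in> CG" for i q
      using A1_conflG[OF that] s.A1_conflG[OF that] .
    fix A assume "A \<in> obs GG"
    then have A: "A \<in> gobs u p" by simp
    note d = suspension_data[OF A]
    show "sus TT A \<in> obs GG" "inj_hull TT A \<in> obs GG" using d by simp_all
    show "inc TT A \<in> hom GG A (inj_hull TT A)" "prj TT A \<in> hom GG (inj_hull TT A) (sus TT A)"
      using TT_hom(1,2)[OF A] unfolding TT_sel(1,2) .
    show "sus TT (A0 A) = A0 (sus TT A)" "inj_hull TT (A0 A) = A0 (inj_hull TT A)"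
      using suspension_A[OF A] by simp_all
    show "inc TT (A0 A) = A1 (inc TT A)" "prj TT (A0 A) = A1 (prj TT A)"
      unfolding TT_sel suspension_A[OF A] by (rule lift_mor_A[OF A d(1,4)], rule lift_mor_A[OF d(1,3,5)])
  qed
qed

lemma A_induced:
  "strictly_triangulated_automorphism GG CG TT A0 (strict_triangle_iso.F1 A0 A1)"
  "induced_by u p CF \<gamma> A0 (strict_triangle_iso.F1 A0 A1)"
proof -
  interpret ST: strict_triangle_iso GG CG A0 "gaut.A0 p \<delta>" A1 "gaut.A1 p \<delta>" TT by (rule G_strict_triangle_iso)
  show "strictly_triangulated_automorphism GG CG TT A0 ST.F1" by (rule ST.strictly_triangulated)
  show "induced_by u p CF \<gamma> A0 ST.F1"
    unfolding induced_by_def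
  proof (intro exI[of _ "hmpt \<gamma>"] conjI allI impI ballI)
    show "hmpt \<gamma> (Ept x y) = Ept (\<gamma> x) (\<gamma> y)" if "x \<le> y \<and> y \<le> x + 2 * pi" for x y
      using hmpt_Ept[OF lift(1)] that unfolding okp_def by simp
    show "case A of (X, \<xi>) \<Rightarrow> A0 (X, \<xi>) = (map (hmpt \<gamma>) X, \<lambda>k\<in>{..<p}. push_mor (hmpt \<gamma>) (\<xi> k))" for A
      unfolding A0_def by (cases A) simp
    fix f assume "f \<in> mors GG"
    then have f: "f \<in> hom GG (src GG f) (tgt GG f)" by (simp add: hom_def)
    show "ST.F1 (stab_cls GG CG f) = stab_cls GG CG (lift_mor (A0 (asrc f)) (A0 (atgt f)) (push_mor (hmpt \<gamma>) (und f)))"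
      using ST.F1_cls[OF f] unfolding A1_def .
  qed
qed

lemma A0_stable_isomorphic: "isomorphic (CpiG u p CF) A B \<Longrightarrow> isomorphic (CpiG u p CF) (A0 A) (A0 B)"
proof -
  interpret ST: strict_triangle_iso GG CG A0 "gaut.A0 p \<delta>" A1 "gaut.A1 p \<delta>" TT by (rule G_strict_triangle_iso)
  show "isomorphic (CpiG u p CF) A B \<Longrightarrow> isomorphic (CpiG u p CF) (A0 A) (A0 B)"
    unfolding CpiG_def by (rule strict_iso.G1_isomorphic[OF ST.stable_strict_iso])
qed

lemma A0_SE: assumes "okp x y" shows "A0 (SE p x y) = SE p (\<gamma> x) (\<gamma> y)"
proof -
  have "set [Ept x y] \<subseteq> Xpi" using Ept_Xpi[OF assms] by simp
  then show ?thesis unfolding SE_def using A0_Sob hmpt_Ept[OF lift(1) assms] by simp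
qed

end

section \<open>Maximal noncrossing systems of arcs\<close>

text \<open>The extension by suprema, as for Dedekind cuts: density of the f i makes it strictly
  increasing, density of the f' i makes it onto. Values may repeat, and the equivalence of the two
  orders by \<le> keeps f i \<mapsto> f' i well defined; in the application one left end has many
  words.\<close>

lemma dense_order_extension:
  fixes f f' :: "'i \<Rightarrow> real"
  assumes ord: "\<And>i j. f i \<le> f j \<longleftrightarrow> f' i \<le> f' j"
    and dense: "\<And>a b. a < b \<Longrightarrow> \<exists>i. a < f i \<and> f i < b" and dense': "\<And>a b. a < b \<Longrightarrow> \<exists>i. a < f' i \<and> f' i < b"
  shows "\<exists>g. strict_mono g \<and> surj g \<and> (\<forall>i. g (f i) = f' i)"
proof -
  define g where "g t = Sup {f' i | i. f i \<le> t}" for t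
  have ne: "{f' i | i. f i \<le> t} \<noteq> {}" for t
  proof -
    obtain i where "t - 1 < f i" "f i < t" using dense[of "t - 1" t] by auto
    then have "f' i \<in> {f' i | i. f i \<le> t}" by (intro CollectI exI[of _ i]) simp
    then show ?thesis by blast
  qed
  have bd: "bdd_above {f' i | i. f i \<le> t}" for t
  proof -
    obtain j where "t < f j" using dense[of t "t + 1"] by auto
    then have "f' i \<le> f' j" if "f i \<le> t" for i using that ord by (meson less_eq_real_def order_trans)
    then show ?thesis by (intro bdd_aboveI[of _ "f' j"]) auto
  qed
  have le: "f' i \<le> g t" if "f i \<le> t" for i t
    unfolding g_def by (rule cSup_upper[OF _ bd]) (use that in auto)
  have ge: "g t \<le> f' j" if "t \<le> f j" for j t
    unfolding g_def by (rule cSup_least[OF ne]) (use that ord in \<open>auto intro: order_trans\<close>)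
  have gf: "g (f i) = f' i" for i using le[of i "f i"] ge[of "f i" i] by simp
  have mono: "g s < g t" if "s < t" for s t
  proof -
    obtain i where i: "s < f i" "f i < t" using dense[OF \<open>s < t\<close>] by auto
    obtain j where j: "f i < f j" "f j < t" using dense[OF i(2)] by auto
    have "f' i < f' j" using j(1) ord by (meson not_le)
    then show ?thesis using ge[of s i] le[of j t] i j by simp
  qed
  have "\<exists>t. g t = y" for y
  proof -
    let ?S = "{f i | i. f' i \<le> y}"
    obtain j where j: "y < f' j" using dense'[of y "y + 1"] by auto
    have ub: "f i \<le> f k" if "f' i \<le> y" "y < f' k" for i k using that ord by (meson less_eq_real_def order_trans)
    obtain i0 where "f' i0 < y" using dense'[of "y - 1" y] by auto
    then have "f i0 \<in> ?S" by (intro CollectI exI[of _ i0]) simp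
    then have ne': "?S \<noteq> {}" by blast
    have bd': "bdd_above ?S" using ub[OF _ j] by (intro bdd_aboveI[of _ "f j"]) auto
    have "g (Sup ?S) = y"
    proof (rule ccontr)
      assume "g (Sup ?S) \<noteq> y"
      then consider "g (Sup ?S) < y" | "y < g (Sup ?S)" by linarith
      then show False
      proof cases
        case 1
        then obtain i where i: "g (Sup ?S) < f' i" "f' i < y" using dense' by blast
        then have "f i \<le> Sup ?S" using bd' by (intro cSup_upper) auto
        then show False using le i by fastforce
      next
        case 2
        then obtain i where i: "y < f' i" "f' i < g (Sup ?S)" using dense' by blast
        have "Sup ?S \<le> f i" by (rule cSup_least[OF ne']) (use ub i in auto)
        then show False using ge i by fastforce
      qed
    qed
    then show ?thesis by blast
  qed
  then have "surj g" unfolding surj_def by metis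
  then show ?thesis using mono gf unfolding strict_mono_def by blast
qed

text \<open>The lift of a family of arcs to the line, with loops for y = x + t. Discreteness
  compares members of P with each other; that limits of members are members has to be derived from
  maximality.\<close>

locale arc_system =
  fixes t :: real and P :: "(real \<times> real) set"
  assumes t_pos: "0 < t"
    and dom: "(x, y) \<in> P \<Longrightarrow> x < y \<and> y \<le> x + t"
    and translate: "(x, y) \<in> P \<Longrightarrow> (x + of_int k * t, y + of_int k * t) \<in> P"
    and noncrossing: "(x, y) \<in> P \<Longrightarrow> (x', y') \<in> P \<Longrightarrow> \<not> (x < x' \<and> x' < y \<and> y < y')"
    and maximal: "x < y \<Longrightarrow> y \<le> x + t \<Longrightarrow>
      (\<And>x' y'. (x', y') \<in> P \<Longrightarrow> \<not> (x < x' \<and> x' < y \<and> y < y') \<and> \<not> (x' < x \<and> x < y' \<and> y' < y)) \<Longrightarrow> (x, y) \<in> P"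
    and discrete: "(x, y) \<in> P \<Longrightarrow> \<exists>e>0. \<forall>(x', y')\<in>P. \<bar>x' - x\<bar> < e \<longrightarrow> \<bar>y' - y\<bar> < e \<longrightarrow> (x', y') = (x, y)"
begin

text \<open>Inside an interval without endpoints a short arc would cross nothing and so belong to
  P.\<close>

lemma endpoints_dense: assumes "a < b" shows "\<exists>(x, y)\<in>P. a < x \<and> x < b \<or> a < y \<and> y < b"
proof (rule ccontr)
  assume no: "\<not> ?thesis"
  \<comment> \<open>Thirds of min (b - a) t place the new arc strictly inside (a,b) and keep its
    length below t.\<close>
  define s where "s = a + min (b - a) t / 3"
  define v where "v = a + 2 * min (b - a) t / 3"
  have sv: "a < s" "s < v" "v < b" "v \<le> s + t" using assms t_pos unfolding s_def v_def by (auto simp: min_def field_simps)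
  have "(s, v) \<in> P" by (rule maximal) (use sv no in fastforce)+
  then show False using no sv by fastforce
qed

text \<open>Strict crossing is an open condition, so a limit of arcs of P crosses none of them and
  belongs to P by maximality. Discreteness then makes arcs of N close to the limit equal to
  it.\<close>

lemma limit_arc:
  assumes xy: "x < y" "y \<le> x + t" and N: "N \<subseteq> P"
    and lim: "\<And>e. 0 < e \<Longrightarrow> \<exists>(x', y')\<in>N. \<bar>x' - x\<bar> < e \<and> \<bar>y' - y\<bar> < e"
  shows "(x, y) \<in> N"
proof -
  have "(x, y) \<in> P"
  proof (rule maximal[OF xy])
    fix x' y' assume P: "(x', y') \<in> P"
    show "\<not> (x < x' \<and> x' < y \<and> y < y') \<and> \<not> (x' < x \<and> x < y' \<and> y' < y)"
    proof (intro conjI notI)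
      assume a: "x < x' \<and> x' < y \<and> y < y'"
      define e where "e = min (x' - x) (min (y - x') (y' - y))"
      have "0 < e" using a unfolding e_def by simp
      then obtain v w where vw: "(v, w) \<in> N" "\<bar>v - x\<bar> < e" "\<bar>w - y\<bar> < e" using lim by blast
      then have "v < x' \<and> x' < w \<and> w < y'" unfolding e_def by (auto simp: abs_less_iff)
      then show False using noncrossing P N vw by blast
    next
      assume a: "x' < x \<and> x < y' \<and> y' < y"
      define e where "e = min (x - x') (min (y' - x) (y - y'))"
      have "0 < e" using a unfolding e_def by simp
      then obtain v w where vw: "(v, w) \<in> N" "\<bar>v - x\<bar> < e" "\<bar>w - y\<bar> < e" using lim by blast
      then have "x' < v \<and> v < y' \<and> y' < w" unfolding e_def by (auto simp: abs_less_iff)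
      then show False using noncrossing P N vw by blast
    qed
  qed
  then obtain e where "0 < e" "\<forall>(x', y')\<in>P. \<bar>x' - x\<bar> < e \<longrightarrow> \<bar>y' - y\<bar> < e \<longrightarrow> (x', y') = (x, y)"
    using discrete by blast
  then show ?thesis using lim[of e] N by fastforce
qed

lemma nested:
  assumes "(x, y) \<in> P" "(x', y') \<in> P" "x < z" "z < y" "x' < z" "z < y'"
  shows "x \<le> x' \<and> y' \<le> y \<or> x' \<le> x \<and> y \<le> y'"
  using noncrossing[OF assms(1,2)] noncrossing[OF assms(2,1)] assms(3-) by fastforce

text \<open>Arcs over a common point z form a chain by \<open>nested\<close>, so one and the same
  arc comes close to the infimum of the left ends and the supremum of the right ends;
  \<open>limit_arc\<close> shows that these bounds form a member of N.\<close>

lemma largest_arc: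
  assumes N: "N \<subseteq> P" and ne: "N \<noteq> {}" and z': "\<forall>x y. (x, y) \<in> N \<longrightarrow> x < z \<and> z < y"
  obtains X Y where "(X, Y) \<in> N" "\<forall>x y. (x, y) \<in> N \<longrightarrow> X \<le> x \<and> y \<le> Y"
proof -
  note z = z'[rule_format]
  define X where "X = Inf (fst ` N)"
  define Y where "Y = Sup (snd ` N)"
  have NP: "(x, y) \<in> P" if "(x, y) \<in> N" for x y using that N by blast
  have lo: "z - t \<le> x" and hi: "y \<le> z + t" if "(x, y) \<in> N" for x y using z[OF that] dom[OF NP[OF that]] by linarith+
  have bx: "bdd_below (fst ` N)" using lo by (intro bdd_belowI[of _ "z - t"]) auto
  have by1: "bdd_above (snd ` N)" using hi by (intro bdd_aboveI[of _ "z + t"]) auto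
  have X: "X \<le> x" and Y: "y \<le> Y" if "(x, y) \<in> N" for x y
    unfolding X_def Y_def using that by (auto intro!: cInf_lower[OF _ bx] cSup_upper[OF _ by1] image_eqI)
  have lim: "\<exists>(x, y)\<in>N. \<bar>x - X\<bar> < e \<and> \<bar>y - Y\<bar> < e" if e: "0 < e" for e
  proof -
    have "fst ` N \<noteq> {}" "snd ` N \<noteq> {}" using ne by auto
    obtain x1 where "x1 \<in> fst ` N" "x1 < X + e"
      using cInf_lessD[of "fst ` N" "X + e"] ne e unfolding X_def by auto
    then obtain y1 where 1: "(x1, y1) \<in> N" "x1 < X + e" by auto
    obtain y2 where "y2 \<in> snd ` N" "Y - e < y2"
      using less_cSupD[of "snd ` N" "Y - e"] ne e unfolding Y_def by auto
    then obtain x2 where 2: "(x2, y2) \<in> N" "Y - e < y2" by auto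
    have "x1 \<le> x2 \<and> y2 \<le> y1 \<or> x2 \<le> x1 \<and> y1 \<le> y2"
      using nested[OF NP[OF 1(1)] NP[OF 2(1)]] z[OF 1(1)] z[OF 2(1)] by blast
    then show ?thesis
    proof
      assume "x1 \<le> x2 \<and> y2 \<le> y1"
      then show ?thesis using 1 2 X[OF 1(1)] Y[OF 1(1)] by (intro bexI[OF _ 1(1)]) auto
    next
      assume "x2 \<le> x1 \<and> y1 \<le> y2"
      then show ?thesis using 1 2 X[OF 2(1)] Y[OF 2(1)] by (intro bexI[OF _ 2(1)]) auto
    qed
  qed
  obtain x0 y0 where 0: "(x0, y0) \<in> N" using ne by auto
  have "X < Y" using X[OF 0] Y[OF 0] z[OF 0] by linarith
  moreover have "Y \<le> X + t"
  proof (rule ccontr)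
    assume "\<not> Y \<le> X + t"
    define e where "e = (Y - X - t) / 2"
    have e: "0 < e" "Y - X - t = 2 * e" using \<open>\<not> Y \<le> X + t\<close> unfolding e_def by auto
    obtain x y where xy: "(x, y) \<in> N" "\<bar>x - X\<bar> < e" "\<bar>y - Y\<bar> < e" using lim[OF e(1)] by auto
    have "x - X < e" "Y - y < e" using xy unfolding abs_less_iff by auto
    then show False using dom[OF NP[OF xy(1)]] e by linarith
  qed
  ultimately have "(X, Y) \<in> N" by (rule limit_arc[OF _ _ N lim])
  then show ?thesis using that X Y by blast
qed

text \<open>The dual argument for arcs containing a fixed segment. Its positive length keeps the
  limit from degenerating.\<close>

lemma smallest_arc:
  assumes N: "N \<subseteq> P" and ne: "N \<noteq> {}" and xy: "x < y" and z': "\<forall>a b. (a, b) \<in> N \<longrightarrow> a \<le> x \<and> y \<le> b"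
  obtains A B where "(A, B) \<in> N" "\<forall>a b. (a, b) \<in> N \<longrightarrow> a \<le> A \<and> B \<le> b"
proof -
  note z = z'[rule_format]
  define A where "A = Sup (fst ` N)"
  define B where "B = Inf (snd ` N)"
  have NP: "(a, b) \<in> P" if "(a, b) \<in> N" for a b using that N by blast
  have ba: "bdd_above (fst ` N)" using z by (intro bdd_aboveI[of _ x]) auto
  have bb: "bdd_below (snd ` N)" using z by (intro bdd_belowI[of _ y]) auto
  have A: "a \<le> A" and B: "B \<le> b" if "(a, b) \<in> N" for a b
    unfolding A_def B_def using that by (auto intro!: cInf_lower[OF _ bb] cSup_upper[OF _ ba] image_eqI)
  have lim: "\<exists>(a, b)\<in>N. \<bar>a - A\<bar> < e \<and> \<bar>b - B\<bar> < e" if e: "0 < e" for e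
  proof -
    obtain a1 where "a1 \<in> fst ` N" "A - e < a1"
      using less_cSupD[of "fst ` N" "A - e"] ne e unfolding A_def by auto
    then obtain b1 where 1: "(a1, b1) \<in> N" "A - e < a1" by auto
    obtain b2 where "b2 \<in> snd ` N" "b2 < B + e"
      using cInf_lessD[of "snd ` N" "B + e"] ne e unfolding B_def by auto
    then obtain a2 where 2: "(a2, b2) \<in> N" "b2 < B + e" by auto
    have "a1 \<le> a2 \<and> b2 \<le> b1 \<or> a2 \<le> a1 \<and> b1 \<le> b2"
      using nested[OF NP[OF 1(1)] NP[OF 2(1)], of "(x + y) / 2"] z[OF 1(1)] z[OF 2(1)] xy by fastforce
    then show ?thesis
    proof
      assume "a1 \<le> a2 \<and> b2 \<le> b1"
      then show ?thesis using 1 2 A[OF 2(1)] B[OF 2(1)] by (intro bexI[OF _ 2(1)]) auto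
    next
      assume "a2 \<le> a1 \<and> b1 \<le> b2"
      then show ?thesis using 1 2 A[OF 1(1)] B[OF 1(1)] by (intro bexI[OF _ 1(1)]) auto
    qed
  qed
  obtain a0 b0 where 0: "(a0, b0) \<in> N" using ne by auto
  have "A \<le> x" unfolding A_def using ne z by (intro cSup_least) auto
  moreover have "y \<le> B" unfolding B_def using ne z by (intro cInf_greatest) auto
  moreover have "B \<le> A + t" using A[OF 0] B[OF 0] dom[OF NP[OF 0]] by linarith
  ultimately have "(A, B) \<in> N" using xy by (intro limit_arc[OF _ _ N lim]) auto
  then show ?thesis using that A B by blast
qed

text \<open>Let (X,Y) be the largest arc over a point z. An arc with X in its interior does not
  cross (X,Y), hence contains it and starts further left, against the choice of (X,Y). So the loop
  at X crosses nothing.\<close>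

lemma loop_exists: "\<exists>r. (r, r + t) \<in> P"
proof -
  obtain x0 y0 where 0: "(x0, y0) \<in> P" using endpoints_dense[of 0 1] by auto
  define z where "z = (x0 + y0) / 2"
  let ?N = "{(x, y) \<in> P. x < z \<and> z < y}"
  have "(x0, y0) \<in> ?N" using 0 dom[OF 0] unfolding z_def by auto
  then have ne: "?N \<noteq> {}" by blast
  have "?N \<subseteq> P" "\<forall>x y. (x, y) \<in> ?N \<longrightarrow> x < z \<and> z < y" by auto
  note N = this
  obtain X Y where XY: "(X, Y) \<in> ?N" and largest: "\<forall>x y. (x, y) \<in> ?N \<longrightarrow> X \<le> x \<and> y \<le> Y"
    by (rule largest_arc[OF N(1) ne N(2)]) (rule that)
  have P: "(X, Y) \<in> P" "X < z" "z < Y" using XY by auto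
  have cross: False if p: "(x, y) \<in> P" "x < X" "X < y" "y < X + t" for x y
  proof -
    have "Y \<le> y" using noncrossing[OF p(1) P(1)] p by linarith
    then have "(x, y) \<in> ?N" using p P by auto
    then show False using largest p by fastforce
  qed
  have "(X, X + t) \<in> P"
  proof (rule maximal)
    fix x y assume p: "(x, y) \<in> P"
    \<comment> \<open>An arc that passes over the right end X + t of the loop is translated to one
      that passes over X.\<close>
    have p': "(x - t, y - t) \<in> P" using translate[OF p, of "-1"] by simp
    show "\<not> (X < x \<and> x < X + t \<and> X + t < y) \<and> \<not> (x < X \<and> X < y \<and> y < X + t)"
    proof (intro conjI notI)
      assume "X < x \<and> x < X + t \<and> X + t < y"
      then have "x - t < X" "X < y - t" "y - t < X + t" using dom[OF p] by auto
      then show False using cross[OF p'] by blast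
    next
      assume "x < X \<and> X < y \<and> y < X + t"
      then show False using cross[OF p] by blast
    qed
  qed (use t_pos in auto)
  then show ?thesis by blast
qed

text \<open>If a shorter arc starts at a, let (a,c) be the longest one; an arc crossing (c,b) would
  cross (a,b) or (a,c), or start at a and be longer. An arc ending at b is treated likewise, and the
  last case shows that one of the two kinds exists.\<close>

lemma midpoint_exists:
  assumes ab: "(a, b) \<in> P" shows "\<exists>c. a < c \<and> c < b \<and> (a, c) \<in> P \<and> (c, b) \<in> P"
proof -
  note d = dom[OF ab]
  show ?thesis
  proof (cases "\<exists>y. (a, y) \<in> P \<and> y < b")
    case True
    then obtain y0 where y0: "(a, y0) \<in> P" "y0 < b" by blast
    define z where "z = (a + y0) / 2"
    let ?N = "{(x, y) \<in> P. x = a \<and> y < b \<and> z < y}"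
    have z: "a < z" "z < y0" using dom[OF y0(1)] unfolding z_def by auto
    then have "(a, y0) \<in> ?N" using y0 by auto
    then have ne: "?N \<noteq> {}" by blast
    have "?N \<subseteq> P" "\<forall>x y. (x, y) \<in> ?N \<longrightarrow> x < z \<and> z < y" using z by auto
    note N = this
    obtain X c where Xc: "(X, c) \<in> ?N" and largest: "\<forall>x y. (x, y) \<in> ?N \<longrightarrow> X \<le> x \<and> y \<le> c"
      by (rule largest_arc[OF N(1) ne N(2)]) (rule that)
    then have c: "(a, c) \<in> P" "z < c" "c < b" by auto
    have "(c, b) \<in> P"
    proof (rule maximal)
      fix x y assume p: "(x, y) \<in> P"
      have False if s: "x < c" "c < y" "y < b"
      proof -
        have "x = a" using noncrossing[OF c(1) p] noncrossing[OF p ab] s z c by linarith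
        then have "(x, y) \<in> ?N" using p s c by auto
        then show False using largest s by fastforce
      qed
      then show "\<not> (c < x \<and> x < b \<and> b < y) \<and> \<not> (x < c \<and> c < y \<and> y < b)"
        using noncrossing[OF ab p] c z by auto
    qed (use c z d in auto)
    then show ?thesis using c z by (intro exI[of _ c]) auto
  next
    case A: False
    show ?thesis
    proof (cases "\<exists>x. (x, b) \<in> P \<and> a < x")
      case True
      then obtain x0 where x0: "(x0, b) \<in> P" "a < x0" by blast
      define z where "z = (x0 + b) / 2"
      let ?N = "{(x, y) \<in> P. y = b \<and> a < x \<and> x < z}"
      have z: "x0 < z" "z < b" using dom[OF x0(1)] unfolding z_def by auto
      then have "(x0, b) \<in> ?N" using x0 by auto
      then have ne: "?N \<noteq> {}" by blast
      have "?N \<subseteq> P" "\<forall>x y. (x, y) \<in> ?N \<longrightarrow> x < z \<and> z < y" using z by auto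
      note N = this
      obtain c Y where cY: "(c, Y) \<in> ?N" and largest: "\<forall>x y. (x, y) \<in> ?N \<longrightarrow> c \<le> x \<and> y \<le> Y"
        by (rule largest_arc[OF N(1) ne N(2)]) (rule that)
      then have c: "(c, b) \<in> P" "a < c" "c < z" by auto
      have "(a, c) \<in> P"
      proof (rule maximal)
        fix x y assume p: "(x, y) \<in> P"
        have False if s: "a < x" "x < c" "c < y"
        proof -
          have "y = b" using noncrossing[OF p c(1)] noncrossing[OF ab p] s z c by linarith
          then have "(x, y) \<in> ?N" using p s c by auto
          then show False using largest s by fastforce
        qed
        then show "\<not> (a < x \<and> x < c \<and> c < y) \<and> \<not> (x < a \<and> a < y \<and> y < c)"
          using noncrossing[OF p ab] c z by auto
      qed (use c z d in auto)
      then show ?thesis using c z by (intro exI[of _ c]) auto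
    next
      case B: False
      \<comment> \<open>As no shorter arc starts at a, the arc (a,z) is missing from P and so is
        crossed by some member. That member does not cross (a,b), hence lies inside it, and strictly
        so because no shorter arc ends at b.\<close>
      have mid: "\<exists>x y. (x, y) \<in> P \<and> a < x \<and> x < z \<and> z < y \<and> y < b" if z: "a < z" "z < b" for z
      proof -
        have "(a, z) \<notin> P" using A z by blast
        then obtain x y where p: "(x, y) \<in> P" and cr: "a < x \<and> x < z \<and> z < y \<or> x < a \<and> a < y \<and> y < z"
          using maximal[of a z] z d by (smt (verit))
        then have "a < x \<and> x < z \<and> z < y" using noncrossing[OF p ab] z by auto
        moreover have "y \<le> b" using noncrossing[OF ab p] calculation z by auto
        moreover have "y \<noteq> b" using B p calculation by auto
        ultimately show ?thesis using p by fastforce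
      qed
      define z where "z = (a + b) / 2"
      have z: "a < z" "z < b" using d unfolding z_def by auto
      let ?N = "{(x, y) \<in> P. a < x \<and> x < z \<and> z < y \<and> y < b}"
      have ne: "?N \<noteq> {}" using mid[OF z] by auto
      have "?N \<subseteq> P" "\<forall>x y. (x, y) \<in> ?N \<longrightarrow> x < z \<and> z < y" by auto
      note N = this
      obtain X Y where XY: "(X, Y) \<in> ?N" and largest: "\<forall>x y. (x, y) \<in> ?N \<longrightarrow> X \<le> x \<and> y \<le> Y"
        by (rule largest_arc[OF N(1) ne N(2)]) (rule that)
      then have P: "(X, Y) \<in> P" "a < X" "X < z" "z < Y" "Y < b" by auto
      \<comment> \<open>An arc over the left end of the largest arc would be larger still.\<close>
      obtain x y where p: "(x, y) \<in> P" "a < x" "x < X" "X < y" "y < b" using mid[of X] P by auto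
      have "Y \<le> y" using noncrossing[OF p(1) P(1)] p by linarith
      then have "(x, y) \<in> ?N" using p P by auto
      then show ?thesis using largest p by fastforce
    qed
  qed
qed

section \<open>The binary tree of arcs\<close>

definition mid :: "real \<Rightarrow> real \<Rightarrow> real" where
  "mid a b = (SOME c. a < c \<and> c < b \<and> (a, c) \<in> P \<and> (c, b) \<in> P)"

lemma mid: assumes "(a, b) \<in> P" shows "a < mid a b" "mid a b < b" "(a, mid a b) \<in> P" "(mid a b, b) \<in> P"
  using someI_ex[OF midpoint_exists[OF assms]] unfolding mid_def by blast+

text \<open>Words are addresses in the binary tree, read from the root: False descends to the left
  half, True to the right half.\<close>

fun sub :: "bool list \<Rightarrow> real \<Rightarrow> real \<Rightarrow> real \<times> real" where
  "sub [] a b = (a, b)"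
| "sub (False # w) a b = sub w a (mid a b)"
| "sub (True # w) a b = sub w (mid a b) b"

lemma sub: assumes "(a, b) \<in> P"
  shows "sub w a b \<in> P \<and> a \<le> fst (sub w a b) \<and> fst (sub w a b) < snd (sub w a b) \<and> snd (sub w a b) \<le> b"
  using assms
proof (induction w arbitrary: a b)
  case Nil
  then show ?case using dom[OF Nil] by simp
next
  case (Cons h w)
  show ?case
    using Cons.IH[OF mid(3)[OF Cons.prems]] Cons.IH[OF mid(4)[OF Cons.prems]] mid(1,2)[OF Cons.prems] by (cases h) auto
qed

lemma sub_append: "sub (w @ v) a b = sub v (fst (sub w a b)) (snd (sub w a b))"
  by (induction w a b rule: sub.induct) simp_all

text \<open>Some smallest arc of the tree contains the given arc, after translation under the root.
  The given arc is contained in neither half, so it passes over the midpoint, and since it crosses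
  neither half its ends are those of the tree arc.\<close>

lemma arc_in_tree:
  assumes r: "(r, r + t) \<in> P" and xy: "(x, y) \<in> P"
  shows "\<exists>w k. x = fst (sub w r (r + t)) + of_int k * t \<and> y = snd (sub w r (r + t)) + of_int k * t"
proof -
  \<comment> \<open>The translate whose left end lies in [r, r + t), below the root loop.\<close>
  define k where "k = \<lfloor>(x - r) / t\<rfloor>"
  define x0 where "x0 = x - of_int k * t"
  define y0 where "y0 = y - of_int k * t"
  have p: "(x0, y0) \<in> P" using translate[OF xy, of "- k"] unfolding x0_def y0_def by simp
  have "of_int k \<le> (x - r) / t" "(x - r) / t < of_int k + 1" unfolding k_def by linarith+
  then have x0: "r \<le> x0" "x0 < r + t" using t_pos unfolding x0_def by (auto simp: field_simps)
  then have y0: "y0 \<le> r + t" using noncrossing[OF r p] dom[OF p] by fastforce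
  have lt: "x0 < y0" using dom[OF p] by simp
  let ?N = "{(a, b). (\<exists>w. (a, b) = sub w r (r + t)) \<and> a \<le> x0 \<and> y0 \<le> b}"
  have N: "?N \<subseteq> P" using sub[OF r] by auto
  have "(r, r + t) \<in> ?N" using x0 y0 by (auto intro!: exI[of _ "[]"])
  then have ne: "?N \<noteq> {}" by blast
  obtain A B where AB: "(A, B) \<in> ?N" and least: "\<forall>a b. (a, b) \<in> ?N \<longrightarrow> a \<le> A \<and> B \<le> b"
    by (rule smallest_arc[OF N ne lt]) (blast, rule that)
  then obtain w where w: "(A, B) = sub w r (r + t)" and in1: "A \<le> x0" "y0 \<le> B" by auto
  have P: "(A, B) \<in> P" using sub[OF r, of w] w by simp
  note m = mid[OF P]
  have c: "(A, mid A B) = sub (w @ [False]) r (r + t)" "(mid A B, B) = sub (w @ [True]) r (r + t)"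
    unfolding sub_append w[symmetric] by simp_all
  have no1: "mid A B < y0"
  proof (rule ccontr)
    assume "\<not> mid A B < y0"
    then have "(A, mid A B) \<in> ?N" using in1 by (intro CollectI case_prodI conjI exI[of _ "w @ [False]"] c(1)) auto
    then show False using least m by fastforce
  qed
  have no2: "x0 < mid A B"
  proof (rule ccontr)
    assume "\<not> x0 < mid A B"
    then have "(mid A B, B) \<in> ?N" using in1 by (intro CollectI case_prodI conjI exI[of _ "w @ [True]"] c(2)) auto
    then show False using least m by fastforce
  qed
  have "x0 = A" "y0 = B"
    using noncrossing[OF p m(4)] noncrossing[OF m(3) p] no1 no2 in1 by linarith+
  then show ?thesis unfolding x0_def y0_def using w by (intro exI[of _ w] exI[of _ k]) (metis add_diff_cancel_left' diff_add_cancel fst_conv snd_conv)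
qed

text \<open>Left ends of all translated tree arcs, indexed by words and integers. The index set is
  the same for any two systems, as \<open>dense_order_extension\<close> requires.\<close>

definition lend :: "real \<Rightarrow> bool list \<times> int \<Rightarrow> real" where
  "lend r wk = fst (sub (fst wk) r (r + t)) + of_int (snd wk) * t"

end

section \<open>Comparison of two arc systems\<close>

locale two_arc_systems = A: arc_system t P + B: arc_system t Q for t P Q
begin

text \<open>In both systems the left half precedes the right half, so the first differing letter
  decides, and a word that has ended stands at the leftmost position. The comparison depends on the
  words alone.\<close>

lemma sub_order:
  assumes "(a, b) \<in> P" "(c, d) \<in> Q"
  shows "fst (A.sub w a b) \<le> fst (A.sub v a b) \<longleftrightarrow> fst (B.sub w c d) \<le> fst (B.sub v c d)"
  using assms
proof (induction w arbitrary: v a b c d)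
  case Nil
  then show ?case using A.sub[OF Nil(1), of v] B.sub[OF Nil(2), of v] by simp
next
  case (Cons h w)
  note m = A.mid[OF Cons.prems(1)] and n = B.mid[OF Cons.prems(2)]
  show ?case
  proof (cases v)
    case Nil
    show ?thesis
    proof (cases h)
      case True
      then show ?thesis using Nil A.sub[OF m(4), of w] B.sub[OF n(4), of w] m n by simp
    next
      case False
      then show ?thesis using Nil Cons.IH[OF m(3) n(3), of "[]"] by simp
    qed
  next
    case v: (Cons h' v')
    show ?thesis
      using v Cons.IH[OF m(3) n(3), of v'] Cons.IH[OF m(4) n(4), of v'] A.sub[OF m(4), of w] B.sub[OF n(4), of w]
        A.sub[OF m(3), of w] B.sub[OF n(3), of w] A.sub[OF m(4), of v'] B.sub[OF n(4), of v']
        A.sub[OF m(3), of v'] B.sub[OF n(3), of v']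
      by (cases h; cases h') auto
  qed
qed

text \<open>The right end of a left half is the left end of the adjacent right half; only words that
  always turn right keep the end of the root. The same v serves both systems, so left ends alone
  control all endpoints.\<close>

lemma sub_right_end:
  "snd (A.sub w a b) = b \<and> snd (B.sub w c d) = d \<or>
    (\<exists>v. snd (A.sub w a b) = fst (A.sub v a b) \<and> snd (B.sub w c d) = fst (B.sub v c d))"
proof (induction w arbitrary: a b c d)
  case (Cons h w)
  show ?case
  proof (cases h)
    case True
    from Cons[of "A.mid a b" b "B.mid c d" d] show ?thesis
    proof (elim disjE exE)
      fix v assume "snd (A.sub w (A.mid a b) b) = fst (A.sub v (A.mid a b) b) \<and>
        snd (B.sub w (B.mid c d) d) = fst (B.sub v (B.mid c d) d)"
      then show ?thesis using True by (intro disjI2 exI[of _ "True # v"]) simp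
    qed (use True in simp)
  next
    case False
    from Cons[of a "A.mid a b" c "B.mid c d"] show ?thesis
    proof (elim disjE exE)
      assume "snd (A.sub w a (A.mid a b)) = A.mid a b \<and> snd (B.sub w c (B.mid c d)) = B.mid c d"
      then show ?thesis using False by (intro disjI2 exI[of _ "[True]"]) simp
    next
      fix v assume "snd (A.sub w a (A.mid a b)) = fst (A.sub v a (A.mid a b)) \<and>
        snd (B.sub w c (B.mid c d)) = fst (B.sub v c (B.mid c d))"
      then show ?thesis using False by (intro disjI2 exI[of _ "False # v"]) simp
    qed
  qed
qed simp

end

lemma (in arc_system) lend_dense:
  assumes r: "(r, r + t) \<in> P" and "a < b" shows "\<exists>i. a < lend r i \<and> lend r i < b"
proof -
  \<comment> \<open>The system is paired with itself in order to use \<open>sub_right_end\<close>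
    for it alone.\<close>
  interpret S: two_arc_systems t P P by (intro two_arc_systems.intro arc_system_axioms)
  obtain x y where xy: "(x, y) \<in> P" "a < x \<and> x < b \<or> a < y \<and> y < b" using endpoints_dense[OF assms(2)] by blast
  obtain w k where wk: "x = fst (sub w r (r + t)) + of_int k * t" "y = snd (sub w r (r + t)) + of_int k * t"
    using arc_in_tree[OF r xy(1)] by blast
  have "x = lend r (w, k)" using wk unfolding lend_def by simp
  moreover have "\<exists>i. y = lend r i"
    using S.sub_right_end[of w r "r + t" r "r + t"]
  proof (elim disjE exE)
    assume "snd (sub w r (r + t)) = r + t \<and> snd (sub w r (r + t)) = r + t"
    then have "y = lend r ([], k + 1)" using wk unfolding lend_def by (simp add: algebra_simps)
    then show ?thesis by blast
  next
    fix v assume "snd (sub w r (r + t)) = fst (sub v r (r + t)) \<and> snd (sub w r (r + t)) = fst (sub v r (r + t))"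
    then have "y = lend r (v, k)" using wk unfolding lend_def by simp
    then show ?thesis by blast
  qed
  ultimately show ?thesis using xy(2) by metis
qed

text \<open>Left ends with translation index k lie in [r + k t, r + (k + 1) t), so their order is
  lexicographic.\<close>

lemma (in arc_system) lend_le_iff:
  assumes r: "(r, r + t) \<in> P"
  shows "lend r (w, k) \<le> lend r (v, l) \<longleftrightarrow> k < l \<or> k = l \<and> fst (sub w r (r + t)) \<le> fst (sub v r (r + t))"
proof -
  have b: "r \<le> fst (sub w r (r + t))" "fst (sub w r (r + t)) < r + t" for w using sub[OF r, of w] by linarith+
  consider "k < l" | "k = l" | "l < k" by linarith
  then show ?thesis
  proof cases
    case 1
    then have "of_int k * t + t \<le> of_int l * t"
      using t_pos mult_right_mono[of "of_int (k + 1)" "of_int l" t] by (simp add: algebra_simps)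
    then show ?thesis using 1 b[of w] b[of v] unfolding lend_def by simp
  next
    case 3
    then have "of_int l * t + t \<le> of_int k * t"
      using t_pos mult_right_mono[of "of_int (l + 1)" "of_int k" t] by (simp add: algebra_simps)
    then show ?thesis using 3 b[of w] b[of v] unfolding lend_def by simp
  qed (simp add: lend_def)
qed

theorem (in two_arc_systems) arc_systems_equivalent:
  "\<exists>g. strict_mono g \<and> surj g \<and> (\<forall>x. g (x + t) = g x + t) \<and>
    (\<forall>(x, y)\<in>P. (g x, g y) \<in> Q) \<and> (\<forall>(x, y)\<in>Q. \<exists>(v, w)\<in>P. g v = x \<and> g w = y)"
proof -
  obtain r s where r: "(r, r + t) \<in> P" and s: "(s, s + t) \<in> Q" using A.loop_exists B.loop_exists by blast
  have ord: "A.lend r i \<le> A.lend r j \<longleftrightarrow> B.lend s i \<le> B.lend s j" for i j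
    using A.lend_le_iff[OF r, of "fst i" "snd i" "fst j" "snd j"] B.lend_le_iff[OF s, of "fst i" "snd i" "fst j" "snd j"]
      sub_order[OF r s, of "fst i" "fst j"] by simp
  obtain g where g: "strict_mono g" "surj g" and gf: "\<And>i. g (A.lend r i) = B.lend s i"
    using dense_order_extension[OF ord A.lend_dense[OF r] B.lend_dense[OF s]] by blast
  have shiftA: "A.lend r (w, k + 1) = A.lend r (w, k) + t" for w k unfolding A.lend_def by (simp add: algebra_simps)
  have shiftB: "B.lend s (w, k + 1) = B.lend s (w, k) + t" for w k unfolding B.lend_def by (simp add: algebra_simps)
  have lt: "g x < g y \<longleftrightarrow> x < y" for x y using g(1) by (rule strict_mono_less)
  \<comment> \<open>On left ends g commutes with the translation by construction. If it failed at x,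
    a left end would lie strictly between the two candidate values, and monotonicity would give a
    contradiction.\<close>
  have gt: "g (x + t) = g x + t" for x
  proof (rule ccontr)
    assume "g (x + t) \<noteq> g x + t"
    then consider "g (x + t) - t < g x" | "g x < g (x + t) - t" by linarith
    then show False
    proof cases
      case 1
      then obtain w k where i: "g (x + t) - t < B.lend s (w, k)" "B.lend s (w, k) < g x"
        using B.lend_dense[OF s, of "g (x + t) - t" "g x"] by auto
      then have "A.lend r (w, k) < x" using lt gf by metis
      then have "g (A.lend r (w, k + 1)) < g (x + t)" using lt shiftA by simp
      then show False using i gf shiftB by simp
    next
      case 2
      then obtain w k where i: "g x < B.lend s (w, k)" "B.lend s (w, k) < g (x + t) - t"
        using B.lend_dense[OF s, of "g x" "g (x + t) - t"] by auto
      then have "x < A.lend r (w, k)" using lt gf by metis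
      then have "g (x + t) < g (A.lend r (w, k + 1))" using lt shiftA by simp
      then show False using i gf shiftB by simp
    qed
  qed
  have tree: "g (fst (A.sub w r (r + t)) + of_int k * t) = fst (B.sub w s (s + t)) + of_int k * t"
    "g (snd (A.sub w r (r + t)) + of_int k * t) = snd (B.sub w s (s + t)) + of_int k * t" for w k
  proof -
    show "g (fst (A.sub w r (r + t)) + of_int k * t) = fst (B.sub w s (s + t)) + of_int k * t" for w
      using gf[of "(w, k)"] unfolding A.lend_def B.lend_def by simp
    note f = this
    show "g (snd (A.sub w r (r + t)) + of_int k * t) = snd (B.sub w s (s + t)) + of_int k * t"
      using sub_right_end[of w r "r + t" s "s + t"]
    proof (elim disjE exE)
      assume e: "snd (A.sub w r (r + t)) = r + t \<and> snd (B.sub w s (s + t)) = s + t"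
      show ?thesis using gf[of "([], k + 1)"] e unfolding A.lend_def B.lend_def by (simp add: algebra_simps)
    next
      fix v assume "snd (A.sub w r (r + t)) = fst (A.sub v r (r + t)) \<and> snd (B.sub w s (s + t)) = fst (B.sub v s (s + t))"
      then show ?thesis using f[of v] by simp
    qed
  qed
  have "(g x, g y) \<in> Q" if xy: "(x, y) \<in> P" for x y
  proof -
    obtain w k where wk: "x = fst (A.sub w r (r + t)) + of_int k * t" "y = snd (A.sub w r (r + t)) + of_int k * t"
      using A.arc_in_tree[OF r xy] by blast
    have "(fst (B.sub w s (s + t)), snd (B.sub w s (s + t))) \<in> Q" using B.sub[OF s, of w] by simp
    then show ?thesis unfolding wk tree by (rule B.translate)
  qed
  moreover have "\<exists>(v, w)\<in>P. g v = x \<and> g w = y" if xy: "(x, y) \<in> Q" for x y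
  proof -
    obtain w k where wk: "x = fst (B.sub w s (s + t)) + of_int k * t" "y = snd (B.sub w s (s + t)) + of_int k * t"
      using B.arc_in_tree[OF s xy] by blast
    have "(fst (A.sub w r (r + t)), snd (A.sub w r (r + t))) \<in> P" using A.sub[OF r, of w] by simp
    then have "(fst (A.sub w r (r + t)) + of_int k * t, snd (A.sub w r (r + t)) + of_int k * t) \<in> P" by (rule A.translate)
    then show ?thesis unfolding wk using tree by blast
  qed
  ultimately show ?thesis using g gt by blast
qed

section \<open>Orbit objects and clusters\<close>

text \<open>Subtraction modulo p in the natural numbers, as it occurs in the indices of circulant
  matrices.\<close>

lemma add_diff_mod: "j < p \<Longrightarrow> int ((i + (p - j)) mod p) = (int i - int j) mod int p"
proof -
  assume "j < p"
  then have "int ((i + (p - j)) mod p) = (int i - int j + int p) mod int p" by (simp add: zmod_int algebra_simps)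
  then show ?thesis by simp
qed

lemma tS_1: "tS p 1 h j = (h + j) mod p"
  by (simp add: tS_def)

sublocale gfpi \<subseteq> G: preadditive GG by (rule G_preadditive)
sublocale gfpi \<subseteq> S: stable_setup GG CG by (rule G_stable_setup)
sublocale gfpi \<subseteq> SD: preadditive "stable_cat GG CG" by (rule S.stable_preadditive)

context gfpi
begin

abbreviation "DD \<equiv> stable_cat GG CG"

lemma theta_pos: "0 < theta p" and p_theta: "real p * theta p = 2 * pi" and three_theta: "3 * theta p \<le> 2 * pi"
proof -
  show 0: "0 < theta p" using p0 unfolding theta_def by simp
  show 1: "real p * theta p = 2 * pi" using p0 unfolding theta_def by simp
  have "3 * theta p \<le> real p * theta p" using 0 p3 by (intro mult_right_mono) auto
  then show "3 * theta p \<le> 2 * pi" using 1 by simp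
qed

section \<open>Morphisms between orbit objects\<close>

abbreviation ept :: "real \<Rightarrow> real \<Rightarrow> nat \<Rightarrow> pt set" where
  "ept x y k \<equiv> Ept (x + real k * theta p) (y + real k * theta p)"

lemma SE_object:
  assumes "okp x y"
  shows SE_gobs: "SE p x y \<in> gobs u p" and SE_permob: "SE p x y = permob p (GX p [Ept x y]) (tS p 1)"
    and SE_perm_ok: "perm_ok p (GX p [Ept x y]) (tS p 1)" and SE_fst: "fst (SE p x y :: 'r gob) = GX p [Ept x y]"
    and SE_nth: "k < p \<Longrightarrow> GX p [Ept x y] ! k = ept x y k" and SE_length: "length (GX p [Ept x y]) = p"
    and SE_Xpi: "pts (GX p [Ept x y])" and ept_Xpi: "ept x y k \<in> Xpi"
proof -
  have X: "set [Ept x y] \<subseteq> Xpi" using Ept_Xpi[OF assms] by simp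
  show "SE p x y \<in> gobs u p" unfolding SE_def by (rule Sob_gobs[OF X])
  show "SE p x y = permob p (GX p [Ept x y]) (tS p 1)" unfolding SE_def using Sob_permob[OF X p0] by simp
  show "perm_ok p (GX p [Ept x y]) (tS p 1)" using Sob_perm_ok[OF X p0] by simp
  show "fst (SE p x y :: 'r gob) = GX p [Ept x y]" unfolding SE_def by (rule Sob_fst[OF X])
  show "length (GX p [Ept x y]) = p" by simp
  show "pts (GX p [Ept x y])" by (rule GX_Xpi[OF X])
  show "ept x y k \<in> Xpi" using assms unfolding okp_def by (intro Ept_Xpi) (simp add: okp_def)
  assume "k < p"
  then show "GX p [Ept x y] ! k = ept x y k" using GX_nth[of k p 0 "[Ept x y]"] by (simp add: rot_Ept)
qed

text \<open>Equivariance makes the matrix circulant, so a morphism of orbit objects is determined by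
  its first column; the computations below take place there.\<close>

lemma SE_coef:
  assumes "okp x y" "okp a b" and f: "f \<in> hom GG (SE p x y) (SE p a b)" and i: "i < p" and j: "j < p"
  shows "coef f i j = coef f ((i + (p - j)) mod p) 0"
proof -
  let ?k = "(i + (p - j)) mod p"
  have h: "und f \<in> homF u (GX p [Ept x y]) (GX p [Ept a b])"
    using G_homD(5)[OF f] unfolding SE_fst[OF assms(1)] SE_fst[OF assms(2)] .
  have "eqv u p (permob p (GX p [Ept x y]) (tS p 1)) (permob p (GX p [Ept a b]) (tS p 1)) (und f)"
    using f unfolding G_hom_iff SE_permob[OF assms(1)] SE_permob[OF assms(2)] by blast
  then have "\<forall>h<p. \<forall>i<p. \<forall>j<p. coef f ((h + i) mod p) ((h + j) mod p) = coef f i j"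
    unfolding eqv_permob_iff[OF SE_perm_ok[OF assms(1)] SE_perm_ok[OF assms(2)] h] tS_1 G_homD(8)[OF f] by simp
  moreover have "?k < p" using p0 by simp
  ultimately have "coef f ((j + ?k) mod p) ((j + 0) mod p) = coef f ?k 0" using j p0 by blast
  moreover have "(j + ?k) mod p = i"
  proof -
    have "(j + ?k) mod p = (j + (i + (p - j))) mod p" by (simp add: mod_simps)
    then show ?thesis using i j by simp
  qed
  ultimately show ?thesis using j by simp
qed

definition circ :: "real \<Rightarrow> real \<Rightarrow> real \<Rightarrow> real \<Rightarrow> (nat \<Rightarrow> 'r) \<Rightarrow> 'r gmor" where
  "circ x y a b c = lift_mor (SE p x y) (SE p a b)
    (fmat (GX p [Ept x y]) (GX p [Ept a b]) (\<lambda>i j. c ((i + (p - j)) mod p)))"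

lemma circ:
  assumes "okp x y" "okp a b"
  shows circ_hom: "circ x y a b c \<in> hom GG (SE p x y) (SE p a b)"
    and coef_circ: "k < p \<Longrightarrow> coef (circ x y a b c) k 0 = c k"
proof -
  let ?f = "fmat (GX p [Ept x y]) (GX p [Ept a b]) (\<lambda>i j. c ((i + (p - j)) mod p))"
  have f: "?f \<in> homF u (GX p [Ept x y]) (GX p [Ept a b])" by (rule fmat_hom[OF SE_Xpi[OF assms(1)] SE_Xpi[OF assms(2)]])
  have m: "((h + i) mod p + (p - (h + j) mod p)) mod p = (i + (p - j)) mod p" if "j < p" for h i j
  proof -
    have "(int (h + i) mod int p - int (h + j) mod int p) mod int p = (int i - int j) mod int p"
      unfolding mod_diff_eq by simp
    then have "int (((h + i) mod p + (p - (h + j) mod p)) mod p) = int ((i + (p - j)) mod p)"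
      unfolding add_diff_mod[OF that] by (subst add_diff_mod) (use p0 in \<open>simp_all add: zmod_int\<close>)
    then show ?thesis by linarith
  qed
  have "eqv u p (SE p x y) (SE p a b) ?f"
    unfolding SE_permob[OF assms(1)] SE_permob[OF assms(2)]
      eqv_permob_iff[OF SE_perm_ok[OF assms(1)] SE_perm_ok[OF assms(2)] f] tS_1 fmat_sel
    using p0 m by simp
  then show "circ x y a b c \<in> hom GG (SE p x y) (SE p a b)"
    unfolding circ_def by (rule G_homI[OF SE_gobs[OF assms(1)] SE_gobs[OF assms(2)]])
  show "k < p \<Longrightarrow> coef (circ x y a b c) k 0 = c k" unfolding circ_def using p0 by simp
qed

lemma G_coef_pls:
  assumes "f \<in> hom GG A B" "g \<in> hom GG A B" shows "coef (pls GG g f) i j = coef g i j + coef f i j"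
  using und_pls[OF assms] G_homD(8)[OF G.plus_hom[OF assms(2,1)]] G_homD(8)[OF assms(1)] G_homD(8)[OF assms(2)]
  by (metis coef_pls)

lemma G_coef_idn: "A \<in> gobs u p \<Longrightarrow> coef (idn GG A) i j = (if i = j \<and> i < length (fst A) then 1 else 0)"
  using und_idn[of A] G_homD(8)[OF G.id_hom, of A] coef_idn[of u "fst A"] by simp

lemma G_coef_zro: "A \<in> gobs u p \<Longrightarrow> B \<in> gobs u p \<Longrightarrow> coef (zro GG A B) i j = 0"
  using und_zro[of A B] G_homD(8)[OF G.zero_hom, of A B] coef_zro[of u "fst A" "fst B"] by simp

lemma G_coef_neg: assumes f: "f \<in> hom GG A B" shows "coef (G.neg f) i j = - coef f i j"
  using G_coef_pls[OF G.neg_hom[OF f] f, of i j] G.plus_neg[OF f] G_coef_zro[OF G_homD(1,2)[OF f], of i j]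
  by (simp add: eq_neg_iff_add_eq_0 add.commute)

text \<open>Composition of circulants is the cyclic convolution of their first columns, twisted by
  the cocycle of the rotated points.\<close>

lemma coef_SE_cmp:
  assumes o: "okp x y" "okp a b" "okp c d" and f: "f \<in> hom GG (SE p x y) (SE p a b)"
    and g: "g \<in> hom GG (SE p a b) (SE p c d)" and k: "k < p"
  shows "coef (cmp GG g f) k 0 =
    (\<Sum>j<p. coef g ((k + (p - j)) mod p) 0 * coef f j 0 * u ^ nc (Ept x y) (ept a b j) (ept c d k))"
proof -
  have uf: "und f \<in> homF u (GX p [Ept x y]) (GX p [Ept a b])"
    using G_homD(5)[OF f] unfolding SE_fst[OF o(1)] SE_fst[OF o(2)] .
  have ug: "und g \<in> homF u (GX p [Ept a b]) (GX p [Ept c d])"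
    using G_homD(5)[OF g] unfolding SE_fst[OF o(3)] SE_fst[OF o(2)] .
  have "coef (cmp GG g f) k 0 = coef (cmpF u (und g) (und f)) k 0"
    using und_cmp[OF f g] G_homD(8)[OF G.comp_hom[OF f g]] by simp
  also have "\<dots> = (\<Sum>j<p. coef g k j * coef f j 0 * u ^ nc (GX p [Ept x y] ! 0) (GX p [Ept a b] ! j) (GX p [Ept c d] ! k))"
    using coef_cmp[OF uf ug, of k 0] k p0 unfolding G_homD(8)[OF f] G_homD(8)[OF g] by simp
  also have "\<dots> = (\<Sum>j<p. coef g ((k + (p - j)) mod p) 0 * coef f j 0 * u ^ nc (Ept x y) (ept a b j) (ept c d k))"
  proof (rule sum.cong)
    fix j assume "j \<in> {..<p}"
    then have j: "j < p" by simp
    show "coef g k j * coef f j 0 * u ^ nc (GX p [Ept x y] ! 0) (GX p [Ept a b] ! j) (GX p [Ept c d] ! k) =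
        coef g ((k + (p - j)) mod p) 0 * coef f j 0 * u ^ nc (Ept x y) (ept a b j) (ept c d k)"
      unfolding SE_coef[OF o(2,3) g k j] SE_nth[OF o(1) p0] SE_nth[OF o(2) j] SE_nth[OF o(3) k] by simp
  qed simp
  finally show ?thesis .
qed

lemma SE_eqI:
  assumes o: "okp x y" "okp a b" and f: "f \<in> hom GG (SE p x y) (SE p a b)" and g: "g \<in> hom GG (SE p x y) (SE p a b)"
    and eq: "\<And>k. k < p \<Longrightarrow> coef f k 0 = coef g k 0"
  shows "f = g"
proof (rule G_eqI[OF f g], rule Fpi_eqI[OF G_homD(5)[OF f] G_homD(5)[OF g]])
  fix i j assume "i < length (fst (SE p a b :: 'r gob))" "j < length (fst (SE p x y :: 'r gob))"
  then have ij: "i < p" "j < p" unfolding SE_fst[OF o(1)] SE_fst[OF o(2)] by simp_all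
  show "coef (und f) i j = coef (und g) i j"
    unfolding G_homD(8)[OF f] G_homD(8)[OF g] SE_coef[OF o f ij] SE_coef[OF o g ij] by (rule eq) (use p0 in simp)
qed

lemma ept_translate:
  assumes "okp x y" shows "ept x y ((h + k) mod p) = hmpt (tau p h) (ept x y k)"
proof -
  have "ept x y k = hmpt (tau p k) (Ept x y)" for k
    using rot_tau[OF Ept_Xpi[OF assms], of p k] by (simp add: rot_Ept)
  then show ?thesis using hmpt_tau[OF p0 Ept_Xpi[OF assms]] by metis
qed

text \<open>Both the exponent nu and the entries of a circulant are invariant under simultaneous
  rotation, so the first column decides.\<close>

lemma SE_stably_zero_iff:
  assumes o: "okp x y" "okp a b" and f: "f \<in> hom GG (SE p x y) (SE p a b)"
  shows "S.sz f \<longleftrightarrow> (\<forall>k<p. u ^ nu (Ept x y) (ept a b k) dvd coef f k 0)"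
proof -
  have "u ^ nu (ept x y j) (ept a b i) dvd coef f i j"
    if d: "\<forall>k<p. u ^ nu (Ept x y) (ept a b k) dvd coef f k 0" and ij: "i < p" "j < p" for i j
  proof -
    let ?k = "(i + (p - j)) mod p"
    have k: "?k < p" using p0 by simp
    have "(j + ?k) mod p = (j + (i + (p - j))) mod p" by (simp add: mod_simps)
    then have jk: "(j + ?k) mod p = i" using ij by simp
    have "ept x y j = hmpt (tau p j) (Ept x y)" using ept_translate[OF o(1), of j 0] ij by simp
    moreover have "ept a b i = hmpt (tau p j) (ept a b ?k)" using ept_translate[OF o(2), of j ?k] jk by simp
    ultimately have "nu (ept x y j) (ept a b i) = nu (Ept x y) (ept a b ?k)"
      using hmpt_mu(3)[OF lift_map_tau Ept_Xpi[OF o(1)] ept_Xpi[OF o(2)]] by metis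
    then show ?thesis using d k SE_coef[OF o f ij] by metis
  qed
  moreover have "u ^ nu (Ept x y) (ept a b k) dvd coef f k 0"
    if "\<forall>i<p. \<forall>j<p. u ^ nu (ept x y j) (ept a b i) dvd coef f i j" "k < p" for k
    using that(1)[rule_format, OF that(2) p0] by simp
  ultimately have "(\<forall>i<p. \<forall>j<p. u ^ nu (ept x y j) (ept a b i) dvd coef f i j) \<longleftrightarrow>
      (\<forall>k<p. u ^ nu (Ept x y) (ept a b k) dvd coef f k 0)" by blast
  then show ?thesis
    unfolding stably_zero_G_iff[OF f] SE_fst[OF o(1)] SE_fst[OF o(2)]
      SE_length[OF o(1)] SE_length[OF o(2)] by (simp add: SE_nth[OF o(1)] SE_nth[OF o(2)])
qed

lemma SE_cls_eq_iff:
  assumes o: "okp x y" "okp a b" and f: "f \<in> hom GG (SE p x y) (SE p a b)" and g: "g \<in> hom GG (SE p x y) (SE p a b)"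
  shows "S.cls f = S.cls g \<longleftrightarrow> (\<forall>k<p. u ^ nu (Ept x y) (ept a b k) dvd coef f k 0 - coef g k 0)"
  unfolding S.cls_eq_iff[OF f g] SE_stably_zero_iff[OF o G.plus_hom[OF f G.neg_hom[OF g]]]
    G_coef_pls[OF G.neg_hom[OF g] f] G_coef_neg[OF g] by simp

lemma nc_sym: "X \<in> Xpi \<Longrightarrow> Y \<in> Xpi \<Longrightarrow> nc X Y X = nc Y X Y"
  using nc_cocycle[of X Y X Y] nc_left[of X Y] nc_right[of X Y] by simp

text \<open>The circulants with a single coefficient 1, at m and at -m, are mutually inverse, as the
  exponent of u in their composites is 0.\<close>

lemma SE_isomorphicI:
  assumes o: "okp x y" "okp a b" and m: "m < p" and nc: "nc (Ept x y) (ept a b m) (Ept x y) = 0"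
  shows "isomorphic GG (SE p x y) (SE p a b)"
proof -
  define m' where "m' = (p - m) mod p"
  have m': "m' < p" using p0 unfolding m'_def by simp
  let ?f = "circ x y a b (\<lambda>k. if k = m then 1 else 0)" and ?g = "circ a b x y (\<lambda>k. if k = m' then 1 else 0)"
  note f = circ_hom[OF o, of "\<lambda>k. if k = m then 1 else 0"] and g = circ_hom[OF o(2,1), of "\<lambda>k. if k = m' then 1 else 0"]
  have kj: "(k + (p - j)) mod p = l \<longleftrightarrow> k = (l + j) mod p" if "k < p" "j < p" "l < p" for k j l
  proof -
    have "(j + (k + (p - j)) mod p) mod p = k" using that by (simp add: mod_simps)
    moreover have "((l + j) mod p + (p - j)) mod p = l"
    proof -
      have "int (((l + j) mod p + (p - j)) mod p) = (int (l + j) - int j) mod int p"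
        unfolding add_diff_mod[OF that(2)] by (simp only: zmod_int mod_diff_left_eq)
      then show ?thesis using that(3) by simp
    qed
    ultimately show ?thesis by (metis add.commute)
  qed
  have mm: "(m' + m) mod p = 0" "(m + m') mod p = 0" using m unfolding m'_def by (simp_all add: mod_simps)
  have "cmp GG ?g ?f = idn GG (SE p x y)"
  proof (rule SE_eqI[OF o(1,1) G.comp_hom[OF f g] G.id_hom])
    show "SE p x y \<in> obs GG" using SE_gobs[OF o(1)] by simp
    fix k assume k: "k < p"
    have "coef (cmp GG ?g ?f) k 0 = coef ?g ((k + (p - m)) mod p) 0 * coef ?f m 0 * u ^ nc (Ept x y) (ept a b m) (ept x y k)"
      unfolding coef_SE_cmp[OF o o(1) f g k] by (rule sum_single[OF m]) (simp add: coef_circ[OF o])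
    also have "\<dots> = (if k = 0 then 1 else 0)"
      using k m m' mm nc kj[OF k m m'] p0 by (simp add: coef_circ[OF o] coef_circ[OF o(2,1)])
    finally show "coef (cmp GG ?g ?f) k 0 = coef (idn GG (SE p x y)) k 0"
      unfolding G_coef_idn[OF SE_gobs[OF o(1)]] SE_fst[OF o(1)] using p0 by simp
  qed
  moreover have "cmp GG ?f ?g = idn GG (SE p a b)"
  proof (rule SE_eqI[OF o(2,2) G.comp_hom[OF g f] G.id_hom])
    show "SE p a b \<in> obs GG" using SE_gobs[OF o(2)] by simp
    fix k assume k: "k < p"
    have "nc (Ept a b) (ept x y m') (Ept a b) = nc (ept a b m) (Ept x y) (ept a b m)"
    proof -
      have "ept a b m = hmpt (tau p m) (Ept a b)" using ept_translate[OF o(2), of m 0] m by simp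
      moreover have "Ept x y = hmpt (tau p m) (ept x y m')" using ept_translate[OF o(1), of m m'] mm by simp
      ultimately show ?thesis using hmpt_nc[OF lift_map_tau Ept_Xpi[OF o(2)] ept_Xpi[OF o(1)] Ept_Xpi[OF o(2)]] by metis
    qed
    then have nc': "nc (Ept a b) (ept x y m') (Ept a b) = 0"
      using nc nc_sym[OF Ept_Xpi[OF o(1)] ept_Xpi[OF o(2)]] by simp
    have "coef (cmp GG ?f ?g) k 0 = coef ?f ((k + (p - m')) mod p) 0 * coef ?g m' 0 * u ^ nc (Ept a b) (ept x y m') (ept a b k)"
      unfolding coef_SE_cmp[OF o(2) o g f k] by (rule sum_single[OF m']) (simp add: coef_circ[OF o(2,1)])
    also have "\<dots> = (if k = 0 then 1 else 0)"
      using k m m' mm nc' kj[OF k m' m] p0 by (simp add: coef_circ[OF o] coef_circ[OF o(2,1)])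
    finally show "coef (cmp GG ?f ?g) k 0 = coef (idn GG (SE p a b)) k 0"
      unfolding G_coef_idn[OF SE_gobs[OF o(2)]] SE_fst[OF o(2)] using p0 by simp
  qed
  ultimately show ?thesis by (rule G.isomorphicI[OF f g])
qed

text \<open>Since nu of the point with itself is 1, a composite that is stably the identity has
  leading coefficient 1 modulo u, and one of its summands is free of u.\<close>

lemma SE_isomorphicD:
  assumes o: "okp x y" "okp a b" and nu: "nu (Ept x y) (Ept x y) = 1" and iso: "isomorphic DD (SE p x y) (SE p a b)"
  shows "\<exists>m<p. nc (Ept x y) (ept a b m) (Ept x y) = 0"
proof -
  obtain F F' where F: "F \<in> hom DD (SE p x y) (SE p a b)" and F': "F' \<in> hom DD (SE p a b) (SE p x y)"
    and FF: "cmp DD F' F = idn DD (SE p x y)" using iso by (rule SD.isomorphicE) (rule that)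
  obtain f where f: "f \<in> hom GG (SE p x y) (SE p a b)" "F = S.cls f" using F by (rule S.stable_homE) (rule that)
  obtain g where g: "g \<in> hom GG (SE p a b) (SE p x y)" "F' = S.cls g" using F' by (rule S.stable_homE) (rule that)
  have I: "idn GG (SE p x y) \<in> hom GG (SE p x y) (SE p x y)" by (rule G.id_hom) (use SE_gobs[OF o(1)] in simp)
  have "S.cls (cmp GG g f) = S.cls (idn GG (SE p x y))"
    using FF unfolding f(2) g(2) S.stable_cmp[OF f(1) g(1)] S.stable_idn .
  then have "u dvd coef (cmp GG g f) 0 0 - coef (idn GG (SE p x y)) 0 0"
    unfolding SE_cls_eq_iff[OF o(1,1) G.comp_hom[OF f(1) g(1)] I] using p0 nu by fastforce
  then obtain z where "coef (cmp GG g f) 0 0 - 1 = u * z"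
    using p0 unfolding G_coef_idn[OF SE_gobs[OF o(1)]] SE_fst[OF o(1)] dvd_def by auto
  then have "coef (cmp GG g f) 0 0 = 1 + u * z" by (simp add: algebra_simps)
  then have "(\<Sum>j<p. coef g ((0 + (p - j)) mod p) 0 * coef f j 0 * u ^ nc (Ept x y) (ept a b j) (ept x y 0)) = 1 + u * z"
    unfolding coef_SE_cmp[OF o o(1) f(1) g(1) p0] .
  from nc_zero_if_unit_sum[OF _ this] show ?thesis by auto
qed

end

text \<open>
  Some basic morphism E(x,y) \<rightarrow> E(a,b) is stably nonzero when a translate by 2 pi of the pair (a,b),
  or of its flip (b,a + 2 pi), interleaves with (x,y).
\<close>

definition lk :: "real \<Rightarrow> real \<Rightarrow> real \<Rightarrow> real \<Rightarrow> bool" where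
  "lk x y a b \<longleftrightarrow> x \<le> a \<and> a < y \<and> y \<le> b \<and> b < x + 2 * pi \<or> x \<le> b \<and> b < y \<and> y \<le> a + 2 * pi \<and> a < x"

text \<open>Equality of coordinates up to the isomorphism of E(a,b) with its flip E(b,a+2
  pi).\<close>

definition same :: "real \<Rightarrow> real \<Rightarrow> real \<Rightarrow> real \<Rightarrow> bool" where
  "same x y a b \<longleftrightarrow> x = a \<and> y = b \<or> x = b \<and> y = a + 2 * pi"

lemma ex_int_parity: "(\<exists>i::int. Q i) \<longleftrightarrow> (\<exists>n. Q (2 * n) \<or> Q (2 * n + 1))"
  by (metis evenE oddE)

lemma zz_parity: "zz a b (2 * n) = a + 2 * pi * of_int n" "zz a b (2 * n + 1) = b + 2 * pi * of_int n"
  "zz a b (2 * n + 1 + 1) = a + 2 * pi * of_int n + 2 * pi"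
proof -
  show "zz a b (2 * n) = a + 2 * pi * of_int n" "zz a b (2 * n + 1) = b + 2 * pi * of_int n" unfolding zz_def by simp_all
  have "zz a b (2 * n + 2) = zz a b (2 * n) + 2 * pi" by (rule zz_add_2)
  then show "zz a b (2 * n + 1 + 1) = a + 2 * pi * of_int n + 2 * pi" unfolding zz_def by (simp add: algebra_simps)
qed

text \<open>Even indices yield the pair (a,b) and odd ones its flip, each up to a translation by 2
  pi.\<close>

lemma ex_zz_lk:
  "(\<exists>i. x \<le> zz a b i \<and> zz a b i < y \<and> y \<le> zz a b (i + 1) \<and> zz a b (i + 1) < x + 2 * pi) \<longleftrightarrow>
    (\<exists>n. lk x y (a + 2 * pi * of_int n) (b + 2 * pi * of_int n))"
  by (subst ex_int_parity, unfold zz_parity lk_def, rule ex_cong1) auto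

lemma ex_zz_same:
  "(\<exists>i. x = zz a b i \<and> y = zz a b (i + 1)) \<longleftrightarrow> (\<exists>n. same x y (a + 2 * pi * of_int n) (b + 2 * pi * of_int n))"
  by (subst ex_int_parity, unfold zz_parity same_def, rule ex_cong1) auto

context gfpi
begin

abbreviation tr :: "int \<Rightarrow> real \<Rightarrow> real" where "tr s x \<equiv> x + of_int s * theta p"

text \<open>Every integer multiple of theta is a rotation by k < p followed by a translation by 2 pi
  n, so the maps \<open>tr s\<close> account for both the group and the periodicity of
  points.\<close>

lemma tr_period: "tr (int k + int p * n) x = x + real k * theta p + 2 * pi * of_int n"
proof -
  have "real p * theta p * of_int n = 2 * pi * of_int n" unfolding p_theta ..
  then have h: "real p * of_int n * theta p = 2 * pi * of_int n" by (simp only: mult_ac)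
  have "real_of_int (int k + int p * n) = real k + real p * of_int n" by simp
  then show ?thesis unfolding \<open>real_of_int (int k + int p * n) = real k + real p * of_int n\<close> distrib_right h
    by (simp only: add.assoc)
qed

lemma tr_cases: obtains d where "of_int s * theta p = d" "theta p \<le> d \<or> d = 0 \<or> d \<le> - theta p"
proof -
  consider "1 \<le> s" | "s = 0" | "s \<le> -1" by linarith
  then have "theta p \<le> of_int s * theta p \<or> of_int s * theta p = 0 \<or> of_int s * theta p \<le> - theta p"
  proof cases
    case 1
    then have "1 * theta p \<le> of_int s * theta p" using theta_pos by (intro mult_right_mono) auto
    then show ?thesis by simp
  next
    case 3
    then have "of_int s * theta p \<le> of_int (-1) * theta p" using theta_pos by (intro mult_right_mono) linarith+
    then show ?thesis by simp
  qed simp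
  then show ?thesis by (rule that[OF refl])
qed

lemma tr_okp: "okp a b \<Longrightarrow> okp (tr s a) (tr s b)"
  unfolding okp_def by simp

lemma nu_ept:
  assumes "okp x y" "okp a b"
  shows "nu (Ept x y) (ept a b k) = (if \<exists>n. lk x y (tr (int k + int p * n) a) (tr (int k + int p * n) b) then 1 else 0)"
proof -
  have o: "okp (a + real k * theta p) (b + real k * theta p)" using assms(2) unfolding okp_def by simp
  show ?thesis unfolding nu_Ept_iff[OF assms(1) o] ex_zz_lk tr_period ..
qed

lemma nu_self: assumes "x < y" "y < x + 2 * pi" shows "nu (Ept x y) (Ept x y) = 1"
proof -
  have o: "okp x y" using assms unfolding okp_def by simp
  have "lk x y (tr (int 0 + int p * 0) x) (tr (int 0 + int p * 0) y)" using assms unfolding lk_def by simp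
  then show ?thesis using nu_ept[OF o o, of 0] by (metis add.right_neutral mult_zero_left of_nat_0)
qed

lemma int_residue: obtains k n where "k < p" "s = int k + int p * n"
  using that[of "nat (s mod int p)" "s div int p"] p0 by (simp add: nat_less_iff)

lemma hom_trivial_iff:
  assumes o: "okp x y" "okp a b"
  shows "hom DD (SE p x y) (SE p a b) = {zro DD (SE p x y) (SE p a b)} \<longleftrightarrow> (\<forall>s. \<not> lk x y (tr s a) (tr s b))"
proof -
  note g = SE_gobs[OF o(1)] SE_gobs[OF o(2)]
  have Z: "zro GG (SE p x y) (SE p a b) \<in> hom GG (SE p x y) (SE p a b)" using g by (intro G.zero_hom) simp_all
  show ?thesis
  proof
    assume h: "hom DD (SE p x y) (SE p a b) = {zro DD (SE p x y) (SE p a b)}"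
    show "\<forall>s. \<not> lk x y (tr s a) (tr s b)"
    proof (intro allI notI)
      fix s assume lk: "lk x y (tr s a) (tr s b)"
      obtain k n where k: "k < p" "s = int k + int p * n" by (rule int_residue)
      have nu: "nu (Ept x y) (ept a b k) = 1" unfolding nu_ept[OF o] using lk k(2) by auto
      \<comment> \<open>With all coefficients equal to 1, the map is stably nonzero as soon as one
        exponent nu is 1.\<close>
      note c = circ_hom[OF o, of "\<lambda>_. 1"]
      have "S.cls (circ x y a b (\<lambda>_. 1)) = S.cls (zro GG (SE p x y) (SE p a b))"
        using S.cls_hom[OF c] h unfolding S.stable_zro by simp
      then have "S.sz (circ x y a b (\<lambda>_. 1))" unfolding S.cls_zero_iff[OF c] .
      then have "u ^ 1 dvd 1" using SE_stably_zero_iff[OF o c] k(1) nu coef_circ[OF o k(1)] by metis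
      then show False using u_nonunit by simp
    qed
  next
    assume no: "\<forall>s. \<not> lk x y (tr s a) (tr s b)"
    have "F = zro DD (SE p x y) (SE p a b)" if F: "F \<in> hom DD (SE p x y) (SE p a b)" for F
    proof -
      obtain f where f: "f \<in> hom GG (SE p x y) (SE p a b)" "F = S.cls f" using F by (rule S.stable_homE) (rule that)
      have "nu (Ept x y) (ept a b k) = 0" for k
        unfolding nu_ept[OF o] by (rule if_not_P) (use no in blast)
      then have "S.sz f" unfolding SE_stably_zero_iff[OF o f(1)] by simp
      then show ?thesis unfolding f(2) S.stable_zro S.cls_zero_iff[OF f(1)] .
    qed
    then show "hom DD (SE p x y) (SE p a b) = {zro DD (SE p x y) (SE p a b)}"
      using S.cls_hom[OF Z] unfolding S.stable_zro by blast
  qed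
qed

text \<open>The flip is the shift by one in the sequence of endpoints; the degrees 1 and -1 of the
  two basic morphisms cancel.\<close>

lemma nc_flip: assumes o: "okp a b" shows "nc (Ept b (a + 2 * pi)) (Ept a b) (Ept b (a + 2 * pi)) = 0"
proof -
  have o': "okp b (a + 2 * pi)" using o unfolding okp_def by simp
  have z: "zz a b 1 = b" "zz a b (1 + 1) = a + 2 * pi" using zz_add_2[of a b 0] by simp_all
  have "dg (zz a b 1) (zz a b (1 + 1)) (zz a b 0) (zz a b (0 + 1)) = dg a b a b + 1 - 0" by (rule dg_shift[OF o])
  moreover have "dg (zz a b 0) (zz a b (0 + 1)) (zz a b 1) (zz a b (1 + 1)) = dg a b a b + 0 - 1" by (rule dg_shift[OF o])
  ultimately have "int (nc (Ept b (a + 2 * pi)) (Ept a b) (Ept b (a + 2 * pi))) = 0"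
    unfolding nc_Ept[OF o' o o'] z by (simp add: dg_self[OF o] dg_self[OF o'])
  then show ?thesis by simp
qed

lemma nc_zero_iff:
  assumes o: "okp x y" "okp a b"
  shows "nc (Ept x y) (ept a b k) (Ept x y) = 0 \<longleftrightarrow> (\<exists>n. same x y (tr (int k + int p * n) a) (tr (int k + int p * n) b))"
proof
  have o': "okp (a + real k * theta p) (b + real k * theta p)" using o(2) unfolding okp_def by simp
  {
    assume "nc (Ept x y) (ept a b k) (Ept x y) = 0"
    from nc_zero_coord[OF o(1) o' this]
    show "\<exists>n. same x y (tr (int k + int p * n) a) (tr (int k + int p * n) b)"
      unfolding ex_zz_same tr_period .
  next
    assume "\<exists>n. same x y (tr (int k + int p * n) a) (tr (int k + int p * n) b)"
    then obtain n where s: "same x y (tr (int k + int p * n) a) (tr (int k + int p * n) b)" by blast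
    have e: "ept a b k = Ept (tr (int k + int p * n) a) (tr (int k + int p * n) b)"
      unfolding tr_period by (rule Ept_periodic[symmetric])
    have oo: "okp (tr (int k + int p * n) a) (tr (int k + int p * n) b)" by (rule tr_okp[OF o(2)])
    from s show "nc (Ept x y) (ept a b k) (Ept x y) = 0"
      unfolding e same_def using nc_flip[OF oo] nc_left[OF Ept_Xpi[OF oo] Ept_Xpi[OF oo]] by auto
  }
qed

lemma SE_isomorphic_if_same:
  assumes o: "okp x y" "okp a b" and s: "same x y (tr s a) (tr s b)"
  shows "isomorphic DD (SE p x y) (SE p a b)"
proof -
  obtain k n where k: "k < p" "s = int k + int p * n" by (rule int_residue)
  have "nc (Ept x y) (ept a b k) (Ept x y) = 0" unfolding nc_zero_iff[OF o] using s k(2) by blast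
  then show ?thesis by (intro S.stable_isomorphic SE_isomorphicI[OF o k(1)])
qed

lemma same_if_SE_isomorphic:
  assumes xy: "x < y" "y < x + 2 * pi" and o: "okp a b" and iso: "isomorphic DD (SE p x y) (SE p a b)"
  shows "\<exists>s. same x y (tr s a) (tr s b)"
proof -
  have o1: "okp x y" using xy unfolding okp_def by simp
  obtain m where "m < p" "nc (Ept x y) (ept a b m) (Ept x y) = 0"
    using SE_isomorphicD[OF o1 o nu_self[OF xy] iso] by blast
  then show ?thesis unfolding nc_zero_iff[OF o1 o] by blast
qed

lemma u_prime: assumes "u dvd a * b" shows "u dvd a \<or> u dvd b"
proof (rule ccontr)
  assume "\<not> ?thesis"
  then have "a dvd 1" "b dvd 1" using dvr unfolding dvr_uniformizer_def by blast+
  then have "a * b dvd 1" using mult_dvd_mono[of a 1 b 1] by simp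
  then show False using assms u_nonunit dvd_trans by blast
qed

text \<open>Oddness of p enters here. If a translate by s theta identified (x,y) with its own flip,
  adding the two equations would give 2 s + p = 0.\<close>

lemma nc_self_zero:
  assumes xy: "x < y" "y < x + 2 * pi" and j: "j < p" and nc: "nc (Ept x y) (ept x y j) (Ept x y) = 0"
  shows "j = 0"
proof -
  have o: "okp x y" using xy unfolding okp_def by simp
  obtain n where s: "same x y (tr (int j + int p * n) x) (tr (int j + int p * n) y)" using nc unfolding nc_zero_iff[OF o o] by blast
  let ?s = "int j + int p * n"
  have t: "theta p \<noteq> 0" using theta_pos by simp
  from s consider "tr ?s x = x" | "x = tr ?s y" "y = tr ?s x + 2 * pi" unfolding same_def by auto
  then show ?thesis
  proof cases
    case 1
    then have "real_of_int ?s * theta p = 0" by linarith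
    then have "?s = 0" using t mult_eq_0_iff of_int_eq_0_iff by blast
    then have "int p dvd int j" by (metis add_eq_0_iff dvd_minus_iff dvd_triv_left)
    then show ?thesis using j by (auto dest: dvd_imp_le)
  next
    case 2
    then have "(of_int (2 * ?s) + real p) * theta p = 0" using p_theta by (simp add: algebra_simps)
    then have "of_int (2 * ?s + int p) = (0::real)" using t by simp
    then have "2 * ?s + int p = 0" by linarith
    then show ?thesis using p_odd by (metis even_add even_of_nat even_zero dvd_triv_left)
  qed
qed

lemma SE_nonzero:
  assumes xy: "x < y" "y < x + 2 * pi" shows "\<not> zero_object DD (SE p x y)"
proof
  assume z: "zero_object DD (SE p x y)"
  have o: "okp x y" using xy unfolding okp_def by simp
  have I: "idn GG (SE p x y) \<in> hom GG (SE p x y) (SE p x y)" by (rule G.id_hom) (use SE_gobs[OF o] in simp)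
  have "S.sz (idn GG (SE p x y))"
    using z unfolding zero_object_def S.stable_idn S.stable_zro S.cls_zero_iff[OF I] by simp
  then have "u ^ nu (Ept x y) (ept x y 0) dvd coef (idn GG (SE p x y)) 0 0"
    unfolding SE_stably_zero_iff[OF o o I] using p0 by blast
  then have "u dvd 1" using nu_self[OF xy] p0 unfolding G_coef_idn[OF SE_gobs[OF o]] SE_fst[OF o] by simp
  then show False using u_nonunit by simp
qed

lemma SE_zero:
  assumes "y = x \<or> y = x + 2 * pi" shows "zero_object DD (SE p x y)"
proof -
  let ?E = "SE p x y :: 'r gob"
  have o: "okp x y" using assms unfolding okp_def by auto
  have I: "idn GG ?E \<in> hom GG ?E ?E" by (rule G.id_hom) (use SE_gobs[OF o] in simp)
  have "bdpt (Ept x y)" using assms unfolding bdpt_def by blast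
  then have "nu (Ept x y) (ept x y k) = 0" for k using nu_bdpt(2)[OF ept_Xpi[OF o]] by simp
  then have "S.sz (idn GG ?E)" unfolding SE_stably_zero_iff[OF o o I] by simp
  then show "zero_object DD ?E"
    unfolding zero_object_def S.stable_idn S.stable_zro S.cls_zero_iff[OF I] using SE_gobs[OF o] by simp
qed

text \<open>Modulo stably zero maps an endomorphism has at most two coordinates, at 0 and at k1.
  Modulo u the first one is compatible with squares by \<open>nc_self_zero\<close>, so for an
  idempotent it is 0 or 1, and if it is 0 then the idempotent vanishes. Of two complementary
  idempotents one has first coordinate 0.\<close>

lemma SE_indecomposable:
  assumes xy: "x < y" "y < x + 2 * pi" and k1: "k1 < p" "k1 \<noteq> 0"
    and nu: "\<And>j. j < p \<Longrightarrow> j \<noteq> 0 \<Longrightarrow> j \<noteq> k1 \<Longrightarrow> nu (Ept x y) (ept x y j) = 0"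
  shows "indecomposable DD (SE p x y)"
proof (rule SD.indecomposableI)
  have o: "okp x y" using xy unfolding okp_def by simp
  let ?A = "SE p x y :: 'r gob"
  show "?A \<in> obs DD" using SE_gobs[OF o] by simp
  show "\<not> zero_object DD ?A" by (rule SE_nonzero[OF xy])
  have I: "idn GG ?A \<in> hom GG ?A ?A" by (rule G.id_hom) (use SE_gobs[OF o] in simp)
  have nu0: "nu (Ept x y) (ept x y 0) = 1" using nu_self[OF xy] by simp
  have X: "ept x y j \<in> Xpi" for j by (rule ept_Xpi[OF o])
  have cmp00: "u dvd coef (cmp GG f f) 0 0 - coef f 0 0 * coef f 0 0" if f: "f \<in> hom GG ?A ?A" for f
  proof -
    have "u dvd (\<Sum>j\<in>{..<p} - {0}. coef f ((0 + (p - j)) mod p) 0 * coef f j 0 * u ^ nc (Ept x y) (ept x y j) (ept x y 0))"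
    proof (rule dvd_sum)
      fix j assume "j \<in> {..<p} - {0}"
      then have "nc (Ept x y) (ept x y j) (ept x y 0) \<noteq> 0" using nc_self_zero[OF xy, of j] by auto
      then show "u dvd coef f ((0 + (p - j)) mod p) 0 * coef f j 0 * u ^ nc (Ept x y) (ept x y j) (ept x y 0)"
        by (intro dvd_mult dvd_power) simp
    qed
    moreover have "coef (cmp GG f f) 0 0 = coef f 0 0 * coef f 0 0 +
        (\<Sum>j\<in>{..<p} - {0}. coef f ((0 + (p - j)) mod p) 0 * coef f j 0 * u ^ nc (Ept x y) (ept x y j) (ept x y 0))"
      unfolding coef_SE_cmp[OF o o o f f p0] using p0 nc_left[OF X[of 0] X[of 0]] by (subst sum.remove[of _ 0]) auto
    ultimately show ?thesis by simp
  qed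
  have zero: "F = zro DD ?A ?A" if f: "f \<in> hom GG ?A ?A" "F = S.cls f" and FF: "cmp DD F F = F" and f0: "u dvd coef f 0 0" for f F
  proof -
    have ff: "S.cls (cmp GG f f) = S.cls f" using FF unfolding f(2) S.stable_cmp[OF f(1) f(1)] .
    have dv: "u ^ nu (Ept x y) (ept x y k) dvd coef (cmp GG f f) k 0 - coef f k 0" if "k < p" for k
      using ff that unfolding SE_cls_eq_iff[OF o o G.comp_hom[OF f(1) f(1)] f(1)] by blast
    have "u ^ nu (Ept x y) (ept x y k) dvd coef f k 0" if k: "k < p" for k
    proof (cases "nu (Ept x y) (ept x y k) = 0 \<or> k = 0")
      case True
      then show ?thesis using f0 nu0 by auto
    next
      case False
      then have kk: "k = k1" using nu[OF k] by blast
      have nuk: "nu (Ept x y) (ept x y k) = 1" using False unfolding nu_ept[OF o o] by (auto split: if_splits)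
      \<comment> \<open>In the square of f at k1 the terms j = 0 and j = k1 contain the leading
        coefficient of f. For the other j the intermediate point has nu = 0, and
        \<open>nu_triangle\<close> forces a positive power of u.\<close>
      have "u dvd (\<Sum>j<p. coef f ((k + (p - j)) mod p) 0 * coef f j 0 * u ^ nc (Ept x y) (ept x y j) (ept x y k))"
      proof (rule dvd_sum)
        fix j assume "j \<in> {..<p}"
        then have j: "j < p" by simp
        consider "j = 0" | "j = k" | "j \<noteq> 0" "j \<noteq> k" by blast
        then show "u dvd coef f ((k + (p - j)) mod p) 0 * coef f j 0 * u ^ nc (Ept x y) (ept x y j) (ept x y k)"
        proof cases
          case 1
          then show ?thesis using f0 by simp
        next
          case 2
          then show ?thesis using f0 k by simp
        next
          case 3
          have "nu (Ept x y) (ept x y j) = 0" using nu[OF j] 3 kk by blast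
          then have "nc (Ept x y) (ept x y j) (ept x y k) \<noteq> 0"
            using nu_triangle[OF Ept_Xpi[OF o] X[of j] X[of k]] nuk by simp
          then show ?thesis by (intro dvd_mult dvd_power) simp
        qed
      qed
      then have "u dvd coef (cmp GG f f) k 0" unfolding coef_SE_cmp[OF o o o f(1) f(1) k] .
      then show ?thesis using dv[OF k] nuk dvd_diff[of u "coef (cmp GG f f) k 0" "coef (cmp GG f f) k 0 - coef f k 0"] by simp
    qed
    then show ?thesis unfolding f(2) S.stable_zro S.cls_zero_iff[OF f(1)] SE_stably_zero_iff[OF o o f(1)] by blast
  qed
  fix e e' assume e: "e \<in> hom DD ?A ?A" and e': "e' \<in> hom DD ?A ?A" and ee: "cmp DD e e = e" and ee': "cmp DD e' e' = e'"
    and sum: "pls DD e e' = idn DD ?A"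
  obtain f where f: "f \<in> hom GG ?A ?A" "e = S.cls f" using e by (rule S.stable_homE) (rule that)
  obtain g where g: "g \<in> hom GG ?A ?A" "e' = S.cls g" using e' by (rule S.stable_homE) (rule that)
  have "S.cls (cmp GG f f) = S.cls f" using ee unfolding f(2) S.stable_cmp[OF f(1) f(1)] .
  then have "u ^ nu (Ept x y) (ept x y 0) dvd coef (cmp GG f f) 0 0 - coef f 0 0"
    unfolding SE_cls_eq_iff[OF o o G.comp_hom[OF f(1) f(1)] f(1)] using p0 by blast
  then have "u dvd coef (cmp GG f f) 0 0 - coef f 0 0" unfolding nu0 by simp
  from dvd_diff[OF this cmp00[OF f(1)]]
  have "u dvd (coef (cmp GG f f) 0 0 - coef f 0 0) - (coef (cmp GG f f) 0 0 - coef f 0 0 * coef f 0 0)" .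
  then have "u dvd coef f 0 0 * (coef f 0 0 - 1)" by (simp add: algebra_simps)
  then consider "u dvd coef f 0 0" | "u dvd coef f 0 0 - 1" using u_prime by blast
  then show "e = zro DD ?A ?A \<or> e' = zro DD ?A ?A"
  proof cases
    case 1
    then show ?thesis using zero[OF f ee] by blast
  next
    case 2
    have "S.cls (pls GG f g) = S.cls (idn GG ?A)" using sum unfolding f(2) g(2) S.stable_pls[OF g(1) f(1)] S.stable_idn .
    then have "u ^ nu (Ept x y) (ept x y 0) dvd coef (pls GG f g) 0 0 - coef (idn GG ?A) 0 0"
      unfolding SE_cls_eq_iff[OF o o G.plus_hom[OF f(1) g(1)] I] using p0 by blast
    then have "u dvd coef f 0 0 + coef g 0 0 - 1"
      using nu0 p0 unfolding G_coef_pls[OF g(1) f(1)] G_coef_idn[OF SE_gobs[OF o]] SE_fst[OF o] by simp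
    then have "u dvd (coef f 0 0 + coef g 0 0 - 1) - (coef f 0 0 - 1)" using 2 by (rule dvd_diff)
    then have "u dvd coef g 0 0" by simp
    then show ?thesis using zero[OF g ee'] by blast
  qed
qed

text \<open>An arc of length at most theta interleaves with a nontrivial translate of itself only if
  its length is theta and the translation is by -theta, which is the rotation with index p -
  1.\<close>

lemma nu_ept_short:
  assumes xy: "x < y" "y \<le> x + theta p" and j: "j < p" "j \<noteq> 0" and d: "y < x + theta p \<or> j \<noteq> p - 1"
  shows "nu (Ept x y) (ept x y j) = 0"
proof -
  have o: "okp x y" using xy theta_pos three_theta unfolding okp_def by simp
  have no: "\<not> lk x y (tr s x) (tr s y)" if s: "s = int j + int p * n" for s n
  proof -
    have jj: "s \<noteq> 0"
    proof
      assume "s = 0"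
      then have "int p dvd int j" using s by (metis add_eq_0_iff dvd_minus_iff dvd_triv_left)
      then show False using j by (simp add: nat_dvd_not_less)
    qed
    have "s \<noteq> -1" if "j \<noteq> p - 1"
    proof
      assume "s = -1"
      then have "int (j + 1) = int p * (- n)" using s by simp
      then have "int p dvd int (j + 1)" by (metis dvd_triv_left)
      then have "p dvd j + 1" unfolding int_dvd_int_iff .
      then have "p \<le> j + 1" by (rule dvd_imp_le) simp
      then show False using j that by simp
    qed
    then consider "1 \<le> s" | "s = -1" "y < x + theta p" | "s \<le> -2" using jj d by linarith
    then show ?thesis
    proof cases
      case 1
      then have le: "theta p \<le> of_int s * theta p" using theta_pos by simp
      obtain d where "of_int s * theta p = d" by blast
      then show ?thesis using le xy theta_pos unfolding lk_def by auto
    next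
      case 2
      then show ?thesis using xy theta_pos unfolding lk_def by auto
    next
      case 3
      then have "of_int s * theta p \<le> of_int (-2) * theta p" using theta_pos by (intro mult_right_mono) linarith+
      then show ?thesis using xy theta_pos unfolding lk_def by auto
    qed
  qed
  then show ?thesis unfolding nu_ept[OF o o] by simp
qed

lemma SE_indecomposable_short:
  assumes "x < y" "y \<le> x + theta p" shows "indecomposable DD (SE p x y)"
  using assms theta_pos three_theta p3
  by (intro SE_indecomposable[of _ _ "p - 1"] nu_ept_short) auto

end

section \<open>Rigid objects\<close>

locale gfpi_residue = gfpi u CF p for u :: "'r::idom" and CF p +
  fixes res :: "'r \<Rightarrow> 'k::field"
  assumes res: "residue_map u res"
begin

lemma res_add: "res (a + b) = res a + res b" and res_mult: "res (a * b) = res a * res b" and res_1: "res 1 = 1"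
  and res_0_iff: "res a = 0 \<longleftrightarrow> u dvd a" and res_surj: "\<exists>a. res a = c"
  using res unfolding residue_map_def surj_def by metis+

lemma res_diff: "res (a - b) = res a - res b"
  using res_add[of "a - b" b] by simp

lemma res_eq_iff: "res a = res b \<longleftrightarrow> u dvd a - b"
  using res_0_iff[of "a - b"] by (simp add: res_diff)

text \<open>For length below theta all nontrivial rotations have nu = 0, so a stable endomorphism is
  determined by the residue of its leading coefficient.\<close>

lemma rigid_SE:
  assumes xy: "x < y" "y < x + theta p" shows "rigid TYPE('k) u p CF (SE p x y)"
proof -
  let ?A = "SE p x y :: 'r gob"
  have y2: "y < x + 2 * pi" using xy theta_pos three_theta by simp
  have o: "okp x y" using xy y2 unfolding okp_def by simp
  \<comment> \<open>A section of the residue map as a map of sets; \<Phi> is still a ring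
    homomorphism because stable classes depend on residues only.\<close>
  define lft where "lft c = (SOME a. res a = c)" for c
  have lft: "res (lft c) = c" for c unfolding lft_def by (rule someI_ex[OF res_surj])
  define ci where "ci c = circ x y x y (\<lambda>k. if k = 0 then lft c else 0)" for c
  define \<Phi> where "\<Phi> c = S.cls (ci c)" for c
  have ci: "ci c \<in> hom GG ?A ?A" for c unfolding ci_def by (rule circ_hom[OF o o])
  have ci_coef: "coef (ci c) k 0 = (if k = 0 then lft c else 0)" if "k < p" for c k
    unfolding ci_def by (rule coef_circ[OF o o that])
  have eq: "S.cls f = S.cls g \<longleftrightarrow> res (coef f 0 0) = res (coef g 0 0)" if f: "f \<in> hom GG ?A ?A" and g: "g \<in> hom GG ?A ?A" for f g
  proof -
    have "u ^ nu (Ept x y) (ept x y k) dvd coef f k 0 - coef g k 0" if "k < p" "k \<noteq> 0" for k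
      using nu_ept_short[OF xy(1) less_imp_le[OF xy(2)] that] xy(2) by simp
    then have "S.cls f = S.cls g \<longleftrightarrow> u ^ nu (Ept x y) (ept x y 0) dvd coef f 0 0 - coef g 0 0"
      unfolding SE_cls_eq_iff[OF o o f g] using p0 by metis
    then show ?thesis using nu_self[OF xy(1) y2] unfolding res_eq_iff by simp
  qed
  have I: "idn GG ?A \<in> hom GG ?A ?A" by (rule G.id_hom) (use SE_gobs[OF o] in simp)
  have "inj \<Phi>" unfolding inj_def \<Phi>_def eq[OF ci ci] using p0 by (simp add: ci_coef lft)
  moreover have "\<Phi> ` UNIV = hom DD ?A ?A"
  proof (rule set_eqI, rule iffI)
    fix F assume "F \<in> hom DD ?A ?A"
    then obtain f where f: "f \<in> hom GG ?A ?A" "F = S.cls f" by (rule S.stable_homE) (rule that)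
    have "F = \<Phi> (res (coef f 0 0))" unfolding \<Phi>_def f(2) eq[OF f(1) ci] using p0 by (simp add: ci_coef lft)
    then show "F \<in> \<Phi> ` UNIV" by blast
  qed (use S.cls_hom[OF ci] in \<open>auto simp: \<Phi>_def\<close>)
  ultimately have "bij_betw \<Phi> UNIV (hom DD ?A ?A)" unfolding bij_betw_def by blast
  moreover have "\<Phi> 1 = idn DD ?A" unfolding \<Phi>_def S.stable_idn eq[OF ci I]
    using p0 by (simp add: ci_coef lft G_coef_idn[OF SE_gobs[OF o]] SE_fst[OF o] res_1)
  moreover have "\<Phi> (a + b) = pls DD (\<Phi> a) (\<Phi> b)" for a b
    unfolding \<Phi>_def S.stable_pls[OF ci ci] eq[OF ci G.plus_hom[OF ci ci]] G_coef_pls[OF ci ci]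
    using p0 by (simp add: ci_coef lft res_add)
  moreover have "\<Phi> (a * b) = cmp DD (\<Phi> a) (\<Phi> b)" for a b
  proof -
    have "coef (cmp GG (ci a) (ci b)) 0 0 =
        coef (ci a) ((0 + (p - 0)) mod p) 0 * coef (ci b) 0 0 * u ^ nc (Ept x y) (ept x y 0) (ept x y 0)"
      unfolding coef_SE_cmp[OF o o o ci ci p0] by (rule sum_single[OF p0]) (simp add: ci_coef)
    then have "coef (cmp GG (ci a) (ci b)) 0 0 = lft a * lft b"
      using p0 nc_left[OF Ept_Xpi[OF o] Ept_Xpi[OF o]] by (simp add: ci_coef)
    then show ?thesis unfolding \<Phi>_def S.stable_cmp[OF ci ci] eq[OF ci G.comp_hom[OF ci ci]]
      using p0 by (simp add: ci_coef lft res_mult)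
  qed
  ultimately show ?thesis
    unfolding rigid_def Let_def CpiG_def using SE_indecomposable_short[OF xy(1) less_imp_le[OF xy(2)]] by blast
qed

text \<open>For theta \<le> y - x \<le> 2 pi - theta the rotation by -theta, with index p - 1,
  interleaves with (x,y). The endomorphism with coefficient 1 there and 0 elsewhere is stably
  nonzero, but u divides the leading coefficient of each of its composites, so it has no left
  inverse and the endomorphism ring is not a field. Lengths above 2 pi - theta belong to flips of
  short arcs.\<close>

lemma rigid_range:
  assumes A: "rigid TYPE('k) u p CF A" and o: "okp x y" and iso: "isomorphic DD A (SE p x y)"
  shows "x < y \<and> y < x + 2 * pi \<and> (y < x + theta p \<or> x + 2 * pi - theta p < y)"
proof (rule ccontr)
  assume neg: "\<not> ?thesis"
  let ?E = "SE p x y :: 'r gob"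
  obtain \<Phi> :: "'k \<Rightarrow> _" where bij: "bij_betw \<Phi> UNIV (hom DD A A)" and \<Phi>1: "\<Phi> 1 = idn DD A"
    and \<Phi>p: "\<And>a b. \<Phi> (a + b) = pls DD (\<Phi> a) (\<Phi> b)" and \<Phi>m: "\<And>a b. \<Phi> (a * b) = cmp DD (\<Phi> a) (\<Phi> b)"
    using A unfolding rigid_def Let_def CpiG_def by blast
  have nz: "\<not> zero_object DD A" using A unfolding rigid_def Let_def CpiG_def indecomposable_def by blast
  have I: "idn GG ?E \<in> hom GG ?E ?E" by (rule G.id_hom) (use SE_gobs[OF o] in simp)
  show False
  proof (cases "x < y \<and> y < x + 2 * pi")
    case False
    then have "y = x \<or> y = x + 2 * pi" using o unfolding okp_def by auto
    then have "zero_object DD ?E" by (rule SE_zero)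
    then show False using nz SD.zero_object_iso[OF SD.isomorphic_sym[OF iso]] by blast
  next
    case True
    then have xy: "x < y" "y < x + 2 * pi" and mid: "x + theta p \<le> y" "y \<le> x + 2 * pi - theta p" using neg by auto
    let ?k = "p - 1"
    have k: "?k < p" "?k \<noteq> 0" using p3 by auto
    have s: "int ?k + int p * (- 1) = - 1" using p3 by simp
    have "lk x y (tr (int ?k + int p * (-1)) x) (tr (int ?k + int p * (-1)) y)"
      unfolding s using xy mid theta_pos unfolding lk_def by simp
    then have nu: "nu (Ept x y) (ept x y ?k) = 1" unfolding nu_ept[OF o o] by (rule if_P[OF exI])
    let ?f = "circ x y x y (\<lambda>k. if k = ?k then 1 else 0)"
    have f: "?f \<in> hom GG ?E ?E" by (rule circ_hom[OF o o])
    have fc: "coef ?f k 0 = (if k = ?k then 1 else 0)" if "k < p" for k by (rule coef_circ[OF o o that])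
    have nsz: "\<not> S.sz ?f"
    proof
      assume "S.sz ?f"
      then have "u ^ nu (Ept x y) (ept x y ?k) dvd coef ?f ?k 0" unfolding SE_stably_zero_iff[OF o o f] using k by blast
      then show False using u_nonunit nu fc[OF k(1)] by simp
    qed
    let ?F = "S.cls ?f"
    have F: "?F \<in> hom DD ?E ?E" by (rule S.cls_hom[OF f])
    obtain a b where a: "a \<in> hom DD A ?E" and b: "b \<in> hom DD ?E A" and ba: "cmp DD b a = idn DD A" and ab: "cmp DD a b = idn DD ?E"
      using iso by (rule SD.isomorphicE) (rule that)
    define F' where "F' = cmp DD b (cmp DD ?F a)"
    have F': "F' \<in> hom DD A A" unfolding F'_def by (rule SD.comp_hom[OF SD.comp_hom[OF a F] b])
    have E: "?E \<in> obs DD" and Ao: "A \<in> obs DD" using SD.isomorphic_obs[OF iso] by auto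
    have aF': "cmp DD (cmp DD a F') b = ?F"
    proof -
      have "cmp DD a F' = cmp DD ?F a"
        unfolding F'_def SD.comp_assoc[OF SD.comp_hom[OF a F] b a] ab by (rule SD.id_left[OF SD.comp_hom[OF a F]])
      then show ?thesis using SD.comp_assoc[OF b a F] ab SD.id_right[OF F] by simp
    qed
    have "F' \<noteq> \<Phi> 0"
    proof
      assume 0: "F' = \<Phi> 0"
      have "\<Phi> 0 \<in> hom DD A A" using bij by (auto simp: bij_betw_def)
      moreover have "pls DD (\<Phi> 0) (\<Phi> 0) = \<Phi> 0" using \<Phi>p[of 0 0] by simp
      ultimately have "F' = zro DD A A" using SD.plus_cancel_zero[of "\<Phi> 0" A A "\<Phi> 0"] unfolding 0 by blast
      then have "cmp DD a F' = zro DD A ?E" using SD.zero_comp[OF a Ao] by simp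
      then have "?F = zro DD ?E ?E" using aF' SD.comp_zero[OF b E] by simp
      then show False using nsz unfolding S.stable_zro S.cls_zero_iff[OF f] by blast
    qed
    moreover have "F' \<in> range \<Phi>" using F' bij_betw_imp_surj_on[OF bij] by simp
    then obtain c where c: "F' = \<Phi> c" by (rule imageE)
    ultimately have "c \<noteq> 0" by blast
    define H where "H = \<Phi> (1 / c)"
    have H: "H \<in> hom DD A A" unfolding H_def using bij by (auto simp: bij_betw_def)
    have HF: "cmp DD H F' = idn DD A" unfolding H_def c using \<Phi>m[of "1 / c" c] \<Phi>1 \<open>c \<noteq> 0\<close> by simp
    define M where "M = cmp DD (cmp DD a H) b"
    have aH: "cmp DD a H \<in> hom DD A ?E" by (rule SD.comp_hom[OF H a])
    have M: "M \<in> hom DD ?E ?E" unfolding M_def by (rule SD.comp_hom[OF b aH])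
    have "cmp DD M ?F = idn DD ?E"
    proof -
      have aF: "cmp DD a F' \<in> hom DD A ?E" by (rule SD.comp_hom[OF F' a])
      have "cmp DD M ?F = cmp DD (cmp DD a H) (cmp DD (cmp DD b (cmp DD a F')) b)"
        using aF' SD.comp_assoc[OF SD.comp_hom[OF b aF] b aH] SD.comp_assoc[OF b aF b] unfolding M_def by simp
      also have "cmp DD b (cmp DD a F') = F'" using SD.comp_assoc[OF F' a b] ba SD.id_left[OF F'] by simp
      also have "cmp DD (cmp DD a H) (cmp DD F' b) = cmp DD (cmp DD a (cmp DD H F')) b"
        using SD.comp_assoc[OF b F' aH] SD.comp_assoc[OF F' H a] by simp
      finally show ?thesis unfolding HF SD.id_right[OF a] ab .
    qed
    moreover obtain g where g: "g \<in> hom GG ?E ?E" "M = S.cls g" using M by (rule S.stable_homE) (rule that)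
    ultimately have "S.cls (cmp GG g ?f) = S.cls (idn GG ?E)" using S.stable_cmp[OF f g(1)] unfolding S.stable_idn by simp
    then have "u ^ nu (Ept x y) (ept x y 0) dvd coef (cmp GG g ?f) 0 0 - coef (idn GG ?E) 0 0"
      unfolding SE_cls_eq_iff[OF o o G.comp_hom[OF f g(1)] I] using p0 by blast
    then have d: "u dvd coef (cmp GG g ?f) 0 0 - 1"
      using nu_self[OF xy] p0 unfolding G_coef_idn[OF SE_gobs[OF o]] SE_fst[OF o] by simp
    have "u dvd coef (cmp GG g ?f) 0 0"
      unfolding coef_SE_cmp[OF o o o f g(1) p0]
    proof (rule dvd_sum)
      fix j assume "j \<in> {..<p}"
      then have j: "j < p" by simp
      show "u dvd coef g ((0 + (p - j)) mod p) 0 * coef ?f j 0 * u ^ nc (Ept x y) (ept x y j) (ept x y 0)"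
      proof (cases "j = 0")
        case True
        then show ?thesis using fc[OF p0] k by simp
      next
        case False
        then have "nc (Ept x y) (ept x y j) (ept x y 0) \<noteq> 0" using nc_self_zero[OF xy j] by auto
        then show ?thesis by (intro dvd_mult dvd_power) simp
      qed
    qed
    then have "u dvd coef (cmp GG g ?f) 0 0 - (coef (cmp GG g ?f) 0 0 - 1)" using d by (rule dvd_diff)
    then show False using u_nonunit by simp
  qed
qed

end

section \<open>Crossing and compatibility\<close>

definition cross :: "real \<Rightarrow> real \<Rightarrow> real \<Rightarrow> real \<Rightarrow> bool" where
  "cross x y a b \<longleftrightarrow> x < a \<and> a < y \<and> y < b \<or> a < x \<and> x < b \<and> b < y"

definition sq :: "real \<Rightarrow> nat \<Rightarrow> real" where
  "sq c n = c * inverse (real (Suc n))"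

lemma sq: "0 < c \<Longrightarrow> 0 < sq c n" "0 < c \<Longrightarrow> sq c n \<le> c"
  unfolding sq_def by (simp_all add: divide_simps)

lemma sq_tendsto: "sq c \<longlonglongrightarrow> 0"
  unfolding sq_def[abs_def] using tendsto_mult_left[OF LIMSEQ_inverse_real_of_nat, of c] by simp

lemma minus_sq_tendsto: "(\<lambda>n. y - sq c n) \<longlonglongrightarrow> y"
  using tendsto_diff[OF tendsto_const sq_tendsto, of y c] by simp

lemma shift_iterate:
  fixes g :: "real \<Rightarrow> real"
  assumes "\<And>x. g (x + t) = g x + t" shows "g (x + real n * t) = g x + real n * t"
proof (induction n)
  case (Suc n)
  have e: "z + real (Suc n) * t = z + real n * t + t" for z by (simp add: algebra_simps)
  show ?case unfolding e assms Suc ..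
qed simp

text \<open>\<open>ar_topology\<close> applies \<open>topology\<close> to such a predicate, and its
  open sets can be read off only once the axioms of a topology are verified.\<close>

lemma quotient_istopology:
  "istopology (\<lambda>U. U \<subseteq> f ` S \<and> openin (top_of_set S) {d \<in> S. f d \<in> U})"
  unfolding istopology_def
proof (intro conjI allI impI)
  fix U V assume U: "U \<subseteq> f ` S \<and> openin (top_of_set S) {d \<in> S. f d \<in> U}" and V: "V \<subseteq> f ` S \<and> openin (top_of_set S) {d \<in> S. f d \<in> V}"
  have e: "{d \<in> S. f d \<in> U \<inter> V} = {d \<in> S. f d \<in> U} \<inter> {d \<in> S. f d \<in> V}" by blast
  show "openin (top_of_set S) {d \<in> S. f d \<in> U \<inter> V}"
    unfolding e by (rule openin_Int[OF U[THEN conjunct2] V[THEN conjunct2]])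
  show "U \<inter> V \<subseteq> f ` S" using U by blast
next
  fix K assume K: "\<forall>U\<in>K. U \<subseteq> f ` S \<and> openin (top_of_set S) {d \<in> S. f d \<in> U}"
  have "{d \<in> S. f d \<in> \<Union>K} = \<Union>((\<lambda>U. {d \<in> S. f d \<in> U}) ` K)" by blast
  moreover have "openin (top_of_set S) (\<Union>((\<lambda>U. {d \<in> S. f d \<in> U}) ` K))" by (rule openin_Union) (use K in blast)
  ultimately show "openin (top_of_set S) {d \<in> S. f d \<in> \<Union>K}" by (rule ssubst)
  show "\<Union>K \<subseteq> f ` S" using K by blast
qed

context gfpi_residue
begin

lemma short_okp: "x < y \<Longrightarrow> y \<le> x + theta p \<Longrightarrow> okp x y"
  using theta_pos three_theta unfolding okp_def by simp

text \<open>By \<open>rigid_range\<close> the limit length is not strictly between theta and 2 pi -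
  theta, and indecomposability excludes the lengths 0 and 2 pi. A long arc is replaced by its
  flip.\<close>

lemma almost_rigidD:
  assumes A: "almost_rigid TYPE('k) u p CF A"
  obtains x y where "x < y" "y \<le> x + theta p" "isomorphic DD A (SE p x y)"
proof -
  obtain Ys where Ys: "\<And>n. rigid TYPE('k) u p CF (Ys n)" "converges u p CF Ys A" and ind: "indecomposable DD A"
    using A unfolding almost_rigid_def CpiG_def by blast
  obtain xs ys x y where o: "\<And>n. okp (xs n) (ys n)" and iso: "\<And>n. isomorphic DD (Ys n) (SE p (xs n) (ys n))"
    and oxy: "okp x y" and Axy: "isomorphic DD A (SE p x y)" and lim: "xs \<longlonglongrightarrow> x" "ys \<longlonglongrightarrow> y"
    using Ys(2) unfolding converges_def CpiG_def okp_def by blast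
  have range: "ys n - xs n < theta p \<or> 2 * pi - theta p < ys n - xs n" for n
    using rigid_range[OF Ys(1) o iso, of n] by linarith
  have d: "(\<lambda>n. ys n - xs n) \<longlonglongrightarrow> y - x" by (rule tendsto_diff[OF lim(2,1)])
  have "\<not> (theta p < y - x \<and> y - x < 2 * pi - theta p)"
  proof
    assume "theta p < y - x \<and> y - x < 2 * pi - theta p"
    then have "\<forall>\<^sub>F n in sequentially. theta p < ys n - xs n \<and> ys n - xs n < 2 * pi - theta p"
      using order_tendstoD[OF d] eventually_conj by blast
    then obtain n where "theta p < ys n - xs n" "ys n - xs n < 2 * pi - theta p"
      using eventually_happens'[OF sequentially_bot] by blast
    then show False using range[of n] by linarith
  qed
  moreover have "y \<noteq> x" "y \<noteq> x + 2 * pi"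
    using ind SE_zero[of y x] SD.zero_object_iso[OF SD.isomorphic_sym[OF Axy]] unfolding indecomposable_def by blast+
  ultimately consider "x < y" "y \<le> x + theta p" | "y < x + 2 * pi" "x + 2 * pi \<le> y + theta p"
    using oxy unfolding okp_def by linarith
  then show ?thesis
  proof cases
    case 1
    then show ?thesis using that Axy by blast
  next
    case 2
    have "same y (x + 2 * pi) (tr 0 x) (tr 0 y)" unfolding same_def by simp
    then have "isomorphic DD (SE p y (x + 2 * pi)) (SE p x y)" by (rule SE_isomorphic_if_same[OF short_okp[OF 2] oxy])
    then show ?thesis using that[OF 2] SD.isomorphic_trans[OF Axy SD.isomorphic_sym] by blast
  qed
qed

lemma SE_refl: "okp x y \<Longrightarrow> isomorphic DD (SE p x y) (SE p x y)"
  using SE_gobs by (intro SD.isomorphic_refl) simp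

lemma almost_rigid_SE:
  assumes xy: "x < y" "y \<le> x + theta p" shows "almost_rigid TYPE('k) u p CF (SE p x y)"
proof -
  \<comment> \<open>Moving the right end by at most half the length keeps the approximating arcs
    nondegenerate and shorter than theta.\<close>
  define ys where "ys n = y - sq ((y - x) / 2) n" for n
  have ys: "x < ys n" "ys n < x + theta p" for n
    using sq[of "(y - x) / 2" n] xy unfolding ys_def by (simp_all add: field_simps)
  have o: "okp x (ys n)" for n by (rule short_okp[OF ys(1) less_imp_le[OF ys(2)]])
  have R: "rigid TYPE('k) u p CF (SE p x (ys n))" for n by (rule rigid_SE[OF ys])
  have "converges u p CF (\<lambda>n. SE p x (ys n)) (SE p x y)"
    unfolding converges_def CpiG_def
    by (rule exI[of _ "\<lambda>_. x"], rule exI[of _ ys], rule exI[of _ x], rule exI[of _ y])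
      (use o short_okp[OF xy] SE_refl minus_sq_tendsto in \<open>auto simp: okp_def ys_def[abs_def]\<close>)
  then show ?thesis
    unfolding almost_rigid_def CpiG_def
    by (intro conjI SE_indecomposable_short[OF xy] exI[of _ "\<lambda>n. SE p x (ys n)"] allI R)
qed

lemma compatible_iso:
  assumes c: "compatible u p CF X Y" and X: "isomorphic DD X X'" and Y: "isomorphic DD Y Y'"
  shows "compatible u p CF X' Y'"
proof -
  obtain Ys where Ys: "converges u p CF Ys Y" "\<And>n. hom DD X (Ys n) = {zro DD X (Ys n)}"
    using c unfolding compatible_def CpiG_def by blast
  have "converges u p CF Ys Y'"
    using Ys(1) SD.isomorphic_trans[OF SD.isomorphic_sym[OF Y]] unfolding converges_def CpiG_def by blast
  moreover have "hom DD X' (Ys n) = {zro DD X' (Ys n)}" for n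
  proof (rule SD.hom_trivial_iso[OF X _ Ys(2)])
    show "isomorphic DD (Ys n) (Ys n)"
      using Ys(1) SD.isomorphic_obs SD.isomorphic_refl unfolding converges_def CpiG_def by blast
  qed
  ultimately show ?thesis unfolding compatible_def CpiG_def by blast
qed

text \<open>Strict interleaving is an open condition under which nonzero maps exist, so it would
  persist along a sequence converging to the second object. The coordinates to which the sequence
  converges may be those of a flip, up to translation.\<close>

lemma not_cross_if_compatible:
  assumes xy: "x < y" "y \<le> x + theta p" and xy': "x' < y'" "y' \<le> x' + theta p"
    and c: "compatible u p CF (SE p x y) (SE p x' y')"
  shows "\<not> cross x y (tr t x') (tr t y')"
proof
  assume cr: "cross x y (tr t x') (tr t y')"
  obtain Ys where Ys: "converges u p CF Ys (SE p x' y')" "\<And>n. hom DD (SE p x y) (Ys n) = {zro DD (SE p x y) (Ys n)}"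
    using c unfolding compatible_def CpiG_def by blast
  obtain xs ys a b where o: "\<And>n. okp (xs n) (ys n)" and iso: "\<And>n. isomorphic DD (Ys n) (SE p (xs n) (ys n))"
    and oab: "okp a b" and ab: "isomorphic DD (SE p x' y') (SE p a b)" and lim: "xs \<longlonglongrightarrow> a" "ys \<longlonglongrightarrow> b"
    using Ys(1) unfolding converges_def CpiG_def okp_def by blast
  have oxy: "okp x y" by (rule short_okp[OF xy])
  have no: "\<not> lk x y (tr v (xs n)) (tr v (ys n))" for n v
    using SD.hom_trivial_iso[OF SE_refl[OF oxy] iso Ys(2)] unfolding hom_trivial_iff[OF oxy o] by blast
  have "y' < x' + 2 * pi" using xy' theta_pos three_theta by linarith
  then obtain s where s: "same x' y' (tr s a) (tr s b)" using same_if_SE_isomorphic[OF xy'(1) _ oab ab] by blast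
  \<comment> \<open>The strict version of \<open>lk\<close>, which is stable under small changes of
    a and b.\<close>
  define q where "q v \<longleftrightarrow> x < tr v a \<and> tr v a < y \<and> y < tr v b \<and> tr v b < x + 2 * pi \<or>
    x < tr v b \<and> tr v b < y \<and> y < tr v a + 2 * pi \<and> tr v a < x" for v
  have ts: "tr t (tr s z) = tr (t + s) z" "tr (t + s + int p) z = tr (t + s) z + 2 * pi" for z
    using p_theta by (simp_all add: algebra_simps)
  have "\<exists>v. q v"
  proof -
    obtain \<alpha> \<beta> where e: "tr (t + s) a = \<alpha>" "tr (t + s) b = \<beta>" by blast
    have t2: "2 * theta p < 2 * pi" using theta_pos three_theta by linarith
    from s consider "x' = tr s a" "y' = tr s b" | "x' = tr s b" "y' = tr s a + 2 * pi" unfolding same_def by auto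
    then show ?thesis
    proof cases
      case 1
      have "tr t x' = \<alpha>" "tr t y' = \<beta>" unfolding 1 ts e by simp_all
      then have "cross x y \<alpha> \<beta>" "\<beta> \<le> \<alpha> + theta p" using cr xy' by auto
      then have "q (t + s)" using xy t2 theta_pos unfolding cross_def q_def e by auto
      then show ?thesis by blast
    next
      case 2
      have y': "tr t y' = tr t (tr s a) + 2 * pi" unfolding 2 by simp
      have "tr t x' = \<beta>" "tr t y' = \<alpha> + 2 * pi" unfolding y' 2(1) ts e by simp_all
      then have "cross x y \<beta> (\<alpha> + 2 * pi)" "\<alpha> + 2 * pi \<le> \<beta> + theta p" using cr xy' by auto
      \<comment> \<open>For a flipped limit the two kinds of crossing are seen by different
        translates: the second kind needs a further 2 pi, that is, p more steps of theta.\<close>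
      then have "q (t + s) \<or> q (t + s + int p)" using xy t2 theta_pos unfolding cross_def q_def ts(2) e by auto
      then show ?thesis by blast
    qed
  qed
  then obtain v where v: "q v" by blast
  have l: "(\<lambda>n. tr v (xs n)) \<longlonglongrightarrow> tr v a" "(\<lambda>n. tr v (ys n)) \<longlonglongrightarrow> tr v b" "(\<lambda>n. tr v (xs n) + 2 * pi) \<longlonglongrightarrow> tr v a + 2 * pi"
    by (intro tendsto_add tendsto_const lim)+
  have "\<forall>\<^sub>F n in sequentially. lk x y (tr v (xs n)) (tr v (ys n))"
    using v unfolding q_def
  proof (elim disjE conjE)
    assume h: "x < tr v a" "tr v a < y" "y < tr v b" "tr v b < x + 2 * pi"
    show ?thesis
      using order_tendstoD(1)[OF l(1) h(1)] order_tendstoD(2)[OF l(1) h(2)] order_tendstoD(1)[OF l(2) h(3)] order_tendstoD(2)[OF l(2) h(4)]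
      by eventually_elim (simp add: lk_def)
  next
    assume h: "x < tr v b" "tr v b < y" "y < tr v a + 2 * pi" "tr v a < x"
    show ?thesis
      using order_tendstoD(1)[OF l(2) h(1)] order_tendstoD(2)[OF l(2) h(2)] order_tendstoD(1)[OF l(3) h(3)] order_tendstoD(2)[OF l(1) h(4)]
      by eventually_elim (simp add: lk_def)
  qed
  then show False using no eventually_happens'[OF sequentially_bot] by blast
qed

text \<open>The positions of an approximating pair used below: inside the arc and short of its right
  end, around the arc and starting to its left, or between the arc and its next translate.\<close>

lemma not_lk:
  assumes xy: "x < y" "y \<le> x + theta p"
    and ab: "x \<le> a \<and> a \<le> b \<and> b < y \<or> a < x \<and> y \<le> b \<and> y \<le> a + theta p \<and> b < x + theta p \<or> y \<le> a \<and> a \<le> b \<and> b < x + theta p"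
  shows "\<not> lk x y (tr t a) (tr t b)"
proof -
  obtain d where d: "of_int t * theta p = d" "theta p \<le> d \<or> d = 0 \<or> d \<le> - theta p" by (rule tr_cases)
  from d(2) show ?thesis unfolding lk_def d(1) using xy ab theta_pos by (elim disjE) auto
qed

lemma compatibleI:
  assumes xy: "okp x y" and o: "\<And>n. okp (xs n) (ys n)" "okp x' y'"
    and lim: "xs \<longlonglongrightarrow> tr s x'" "ys \<longlonglongrightarrow> tr s y'" and no: "\<And>n t. \<not> lk x y (tr t (xs n)) (tr t (ys n))"
  shows "compatible u p CF (SE p x y) (SE p x' y')"
proof -
  have "same (tr s x') (tr s y') (tr s x') (tr s y')" unfolding same_def by simp
  then have iso: "isomorphic DD (SE p x' y') (SE p (tr s x') (tr s y'))"
    by (intro SD.isomorphic_sym[OF SE_isomorphic_if_same[OF tr_okp[OF o(2)] o(2)]])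
  have "converges u p CF (\<lambda>n. SE p (xs n) (ys n)) (SE p x' y')"
    unfolding converges_def CpiG_def
    by (rule exI[of _ xs], rule exI[of _ ys], rule exI[of _ "tr s x'"], rule exI[of _ "tr s y'"])
      (use o lim iso SE_refl in \<open>auto simp: okp_def\<close>)
  then show ?thesis
    unfolding compatible_def CpiG_def using hom_trivial_iff[OF xy o(1)] no by blast
qed

text \<open>Arcs with a common endpoint may admit nonzero maps, while compatibility asks for
  approximations that admit none. The approximation depends on the position of the translate (a,b)
  with x \<le> a < x + theta: the right end is shrunk, or the arc is pushed to the left, or it is
  kept.\<close>

lemma compatible_if_not_cross:
  assumes xy: "x < y" "y \<le> x + theta p" and xy': "x' < y'" "y' \<le> x' + theta p"
    and ne: "\<And>s. \<not> (x = tr s x' \<and> y = tr s y')" and nc: "\<And>s. \<not> cross x y (tr s x') (tr s y')"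
  shows "compatible u p CF (SE p x y) (SE p x' y')"
proof -
  define s where "s = \<lceil>(x - x') / theta p\<rceil>"
  define a where "a = tr s x'"
  define b where "b = tr s y'"
  have "(x - x') / theta p \<le> of_int s" "of_int s < (x - x') / theta p + 1" unfolding s_def by linarith+
  then have a: "x \<le> a" "a < x + theta p" using theta_pos unfolding a_def by (simp_all add: field_simps)
  have ab: "a < b" "b \<le> a + theta p" using xy' unfolding a_def b_def by simp_all
  have N0: "\<not> cross x y a b" using nc[of s] unfolding a_def b_def .
  have N1: "\<not> cross x y (a - theta p) (b - theta p)" using nc[of "s - 1"] unfolding a_def b_def by (simp add: algebra_simps)
  have E: "\<not> (x = a \<and> y = b)" using ne[of s] unfolding a_def b_def .
  note o = short_okp[OF xy] short_okp[OF xy']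
  have t: "theta p \<le> 2 * pi" using theta_pos three_theta by linarith
  have shrink: ?thesis if h: "\<And>c. a \<le> c \<Longrightarrow> c < b \<Longrightarrow> x \<le> a \<and> a \<le> c \<and> c < y \<or> y \<le> a \<and> a \<le> c \<and> c < x + theta p"
  proof (rule compatibleI[OF o(1) _ o(2), of "\<lambda>_. a" "\<lambda>n. b - sq (b - a) n" s])
    have sq: "a \<le> b - sq (b - a) n" "b - sq (b - a) n < b" for n using sq[of "b - a" n] ab by simp_all
    show "okp a (b - sq (b - a) n)" for n using sq[of n] ab t unfolding okp_def by linarith
    show "(\<lambda>_. a) \<longlonglongrightarrow> tr s x'" "(\<lambda>n. b - sq (b - a) n) \<longlonglongrightarrow> tr s y'"
      using minus_sq_tendsto unfolding a_def b_def by simp_all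
    show "\<not> lk x y (tr v a) (tr v (b - sq (b - a) n))" for n v
      by (rule not_lk[OF xy]) (use h[OF sq] in blast)
  qed
  consider "a < y" "b \<le> y" | "a < y" "y < b" | "y \<le> a" "b \<le> x + theta p" | "y \<le> a" "x + theta p < b" by linarith
  then show ?thesis
  proof cases
    case 1
    then show ?thesis using a by (intro shrink) auto
  next
    case 2
    then have ax: "a = x" using N0 a unfolding cross_def by auto
    \<comment> \<open>The arcs share the left end and (a,b) is longer. Pushing it left by at most b
      - y makes it start before x and still reach y.\<close>
    show ?thesis
    proof (rule compatibleI[OF o(1) _ o(2), of "\<lambda>n. a - sq (b - y) n" "\<lambda>n. b - sq (b - y) n" s])
      have sq: "0 < sq (b - y) n" "sq (b - y) n \<le> b - y" for n using sq[of "b - y" n] 2 by simp_all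
      show "okp (a - sq (b - y) n) (b - sq (b - y) n)" for n using ab t unfolding okp_def by linarith
      show "(\<lambda>n. a - sq (b - y) n) \<longlonglongrightarrow> tr s x'" "(\<lambda>n. b - sq (b - y) n) \<longlonglongrightarrow> tr s y'"
        using minus_sq_tendsto unfolding a_def b_def by simp_all
      show "\<not> lk x y (tr v (a - sq (b - y) n)) (tr v (b - sq (b - y) n))" for n v
        by (rule not_lk[OF xy]) (use sq[of n] ab ax in linarith)
    qed
  next
    case 3
    then show ?thesis by (intro shrink) auto
  next
    case 4
    \<comment> \<open>The translate by -theta now contains the arc (x,y) and starts strictly before
      it, so the constant sequence serves.\<close>
    then have y: "y \<le> b - theta p" using N1 a unfolding cross_def by auto
    show ?thesis
    proof (rule compatibleI[OF o(1) _ o(2), of "\<lambda>_. a - theta p" "\<lambda>_. b - theta p" "s - 1"])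
      show "okp (a - theta p) (b - theta p)" using ab t unfolding okp_def by linarith
      show "(\<lambda>_. a - theta p) \<longlonglongrightarrow> tr (s - 1) x'" "(\<lambda>_. b - theta p) \<longlonglongrightarrow> tr (s - 1) y'"
        unfolding a_def b_def by (simp_all add: algebra_simps)
      show "\<not> lk x y (tr v (a - theta p)) (tr v (b - theta p))" for v
        by (rule not_lk[OF xy]) (use 4 y a ab in linarith)
    qed
  qed
qed

text \<open>The flip of an arc of length at most theta has length at least 2 pi - theta, which
  exceeds theta, so only translates remain.\<close>

lemma translate_if_isomorphic:
  assumes xy: "x < y" "y \<le> x + theta p" and xy': "x' < y'" "y' \<le> x' + theta p"
    and iso: "isomorphic DD (SE p x y) (SE p x' y')"
  shows "\<exists>s. x = tr s x' \<and> y = tr s y'"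
proof -
  have "y < x + 2 * pi" using xy theta_pos three_theta by linarith
  then obtain s where "same x y (tr s x') (tr s y')" using same_if_SE_isomorphic[OF xy(1) _ short_okp[OF xy'] iso] by blast
  then show ?thesis using xy xy' theta_pos three_theta unfolding same_def by auto
qed

lemma SE_translate: assumes "okp x y" shows "isomorphic DD (SE p x y) (SE p (tr s x) (tr s y))"
  by (rule SD.isomorphic_sym, rule SE_isomorphic_if_same[OF tr_okp[OF assms] assms, of s s]) (simp add: same_def)

section \<open>Clusters as arc systems\<close>

definition arcs :: "'r gob set \<Rightarrow> (real \<times> real) set" where
  "arcs L = {(x, y). x < y \<and> y \<le> x + theta p \<and> (\<exists>A\<in>L. isomorphic DD A (SE p x y))}"

lemma arcs_iff: "(x, y) \<in> arcs L \<longleftrightarrow> x < y \<and> y \<le> x + theta p \<and> (\<exists>A\<in>L. isomorphic DD A (SE p x y))"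
  unfolding arcs_def by simp

lemma cluster_arcE:
  assumes "cluster TYPE('k) u p CF L" "A \<in> L"
  obtains x y where "(x, y) \<in> arcs L" "isomorphic DD A (SE p x y)"
proof -
  have "almost_rigid TYPE('k) u p CF A" using assms unfolding cluster_def compatible_family_def by blast
  then obtain x y where "x < y" "y \<le> x + theta p" "isomorphic DD A (SE p x y)" by (rule almost_rigidD)
  then show ?thesis using that[of x y] assms(2) unfolding arcs_iff by blast
qed

lemma cluster_noncrossing:
  assumes c: "cluster TYPE('k) u p CF L" and a: "(x, y) \<in> arcs L" and a': "(x', y') \<in> arcs L"
  shows "\<not> cross x y (tr s x') (tr s y')"
proof -
  obtain A where A: "x < y" "y \<le> x + theta p" "A \<in> L" "isomorphic DD A (SE p x y)" using a unfolding arcs_iff by blast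
  obtain B where B: "x' < y'" "y' \<le> x' + theta p" "B \<in> L" "isomorphic DD B (SE p x' y')" using a' unfolding arcs_iff by blast
  show ?thesis
  proof (cases "A = B")
    case False
    then have "compatible u p CF A B" using c A(3) B(3) unfolding cluster_def compatible_family_def pairwise_def by blast
    then have "compatible u p CF (SE p x y) (SE p x' y')" by (rule compatible_iso[OF _ A(4) B(4)])
    then show ?thesis by (rule not_cross_if_compatible[OF A(1,2) B(1,2)])
  next
    \<comment> \<open>Compatibility is imposed on distinct members only; two arcs of the same member
      are translates, and an arc of length at most theta crosses none of its translates.\<close>
    case True
    then have "isomorphic DD (SE p x y) (SE p x' y')" using SD.isomorphic_trans[OF SD.isomorphic_sym[OF A(4)] B(4)[folded True]] by blast
    then obtain t where t: "x = tr t x'" "y = tr t y'" using translate_if_isomorphic[OF A(1,2) B(1,2)] by blast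
    define r where "r = s - t"
    have e: "tr s x' = tr r x" "tr s y' = tr r y" unfolding t r_def by (simp_all add: algebra_simps)
    obtain d where d: "of_int r * theta p = d" "theta p \<le> d \<or> d = 0 \<or> d \<le> - theta p" by (rule tr_cases)
    from d(2) show ?thesis unfolding e cross_def d(1) using A(1,2) theta_pos by (elim disjE) auto
  qed
qed

text \<open>Otherwise SE(x,y) could be added to the cluster. Compatibility with each member is shown
  in both orders, as \<open>pairwise\<close> asks for both.\<close>

lemma cluster_maximal:
  assumes c: "cluster TYPE('k) u p CF L" and xy: "x < y" "y \<le> x + theta p"
    and nc: "\<And>x' y'. (x', y') \<in> arcs L \<Longrightarrow> \<not> cross x y x' y'"
  shows "(x, y) \<in> arcs L"
proof (rule ccontr)
  assume no: "(x, y) \<notin> arcs L"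
  note o = short_okp[OF xy]
  let ?E = "SE p x y :: 'r gob"
  have fam: "compatible_family TYPE('k) u p CF L"
    and max: "\<And>M. compatible_family TYPE('k) u p CF M \<Longrightarrow> L \<subseteq> M \<Longrightarrow> M = L" using c unfolding cluster_def by blast+
  have B: "compatible u p CF ?E B \<and> compatible u p CF B ?E \<and> \<not> isomorphic DD ?E B \<and> \<not> isomorphic DD B ?E" if BL: "B \<in> L" for B
  proof -
    obtain x' y' where a: "(x', y') \<in> arcs L" and iso: "isomorphic DD B (SE p x' y')" by (rule cluster_arcE[OF c BL])
    have xy': "x' < y'" "y' \<le> x' + theta p" using a unfolding arcs_iff by blast+
    have tra: "(tr s x', tr s y') \<in> arcs L" for s
      using xy' BL SD.isomorphic_trans[OF iso SE_translate[OF short_okp[OF xy']]] unfolding arcs_iff by auto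
    have ne: "\<not> (x = tr s x' \<and> y = tr s y')" for s using tra[of s] no by blast
    have ne': "\<not> (x' = tr s x \<and> y' = tr s y)" for s
    proof
      assume "x' = tr s x \<and> y' = tr s y"
      then have "x = tr (- s) x' \<and> y = tr (- s) y'" by simp
      then show False using ne by blast
    qed
    have cr: "\<not> cross x y (tr s x') (tr s y')" for s by (rule nc[OF tra])
    have cr': "\<not> cross x' y' (tr s x) (tr s y)" for s
      using cr[of "- s"] unfolding cross_def by auto
    have "compatible u p CF ?E B"
      by (rule compatible_iso[OF compatible_if_not_cross[OF xy xy' ne cr] SE_refl[OF o] SD.isomorphic_sym[OF iso]])
    moreover have "compatible u p CF B ?E"
      by (rule compatible_iso[OF compatible_if_not_cross[OF xy' xy ne' cr'] SD.isomorphic_sym[OF iso] SE_refl[OF o]])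
    moreover have "\<not> isomorphic DD B ?E" using no xy BL unfolding arcs_iff by blast
    ultimately show ?thesis using SD.isomorphic_sym by blast
  qed
  have "compatible_family TYPE('k) u p CF (insert ?E L)"
    using fam B almost_rigid_SE[OF xy] unfolding compatible_family_def pairwise_insert CpiG_def by blast
  then have "?E \<in> L" using max[of "insert ?E L"] by blast
  then show False using no xy SE_refl[OF o] unfolding arcs_iff by blast
qed

lemma openin_ar_topology:
  "openin (ar_topology u p CF) U \<longleftrightarrow> U \<subseteq> ar_class u p CF ` ar_domain p \<and>
    openin (top_of_set (ar_domain p)) {d \<in> ar_domain p. ar_class u p CF d \<in> U}"
  unfolding ar_topology_def topology_inverse'[OF quotient_istopology] ..

text \<open>Discreteness in the quotient isolates the class of an arc; what remains is to separate
  the arc from its own translates.\<close>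

lemma cluster_discrete:
  assumes c: "cluster TYPE('k) u p CF L" and a: "(x, y) \<in> arcs L"
  shows "\<exists>e>0. \<forall>(x', y')\<in>arcs L. \<bar>x' - x\<bar> < e \<longrightarrow> \<bar>y' - y\<bar> < e \<longrightarrow> (x', y') = (x, y)"
proof -
  have cls: "\<exists>A\<in>L. ar_class u p CF (v, w) = iso_class DD A" if vw: "(v, w) \<in> arcs L" for v w
  proof -
    obtain A where A: "A \<in> L" "isomorphic DD A (SE p v w)" using vw unfolding arcs_iff by blast
    then have "iso_class DD (SE p v w) = iso_class DD A"
      using SD.iso_class_eq_iff SD.isomorphic_obs[OF A(2)] SD.isomorphic_sym by blast
    then show ?thesis using A(1) unfolding ar_class_def CpiG_def by auto
  qed
  have dom: "(v, w) \<in> ar_domain p" if "(v, w) \<in> arcs L" for v w using that unfolding arcs_iff ar_domain_def by simp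
  let ?C = "iso_class DD ` L"
  obtain A where A: "A \<in> L" "ar_class u p CF (x, y) = iso_class DD A" using cls[OF a] by blast
  have "subtopology (ar_topology u p CF) ?C = discrete_topology ?C" using c unfolding cluster_def CpiG_def by blast
  then have "openin (subtopology (ar_topology u p CF) ?C) {iso_class DD A}" using A(1) by simp
  then obtain T where T: "openin (ar_topology u p CF) T" "{iso_class DD A} = T \<inter> ?C" unfolding openin_subtopology by blast
  have "openin (top_of_set (ar_domain p)) {d \<in> ar_domain p. ar_class u p CF d \<in> T}"
    using T(1) unfolding openin_ar_topology by blast
  moreover have "(x, y) \<in> {d \<in> ar_domain p. ar_class u p CF d \<in> T}" using dom[OF a] A(2) T(2) by blast
  ultimately obtain e where e: "0 < e" "ball (x, y) e \<inter> ar_domain p \<subseteq> {d \<in> ar_domain p. ar_class u p CF d \<in> T}"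
    unfolding openin_contains_ball by blast
  \<comment> \<open>The bound e / 2 on both coordinates keeps the pair in the ball of radius e, and
    the bound theta excludes the nontrivial translates.\<close>
  have "(x', y') = (x, y)" if a': "(x', y') \<in> arcs L" and close: "\<bar>x' - x\<bar> < min (e / 2) (theta p)" "\<bar>y' - y\<bar> < min (e / 2) (theta p)" for x' y'
  proof -
    have "dist (x, y) (x', y') \<le> \<bar>x - x'\<bar> + \<bar>y - y'\<bar>"
      unfolding dist_Pair_Pair dist_real_def by (simp add: sqrt_sum_squares_le_sum_abs)
    then have "(x', y') \<in> ball (x, y) e" using close by (simp add: abs_minus_commute)
    then have "ar_class u p CF (x', y') \<in> T" using e(2) dom[OF a'] by blast
    then have "ar_class u p CF (x', y') = iso_class DD A" using cls[OF a'] T(2) by blast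
    then have eq: "iso_class DD (SE p x' y') = iso_class DD (SE p x y)" using A(2) unfolding ar_class_def CpiG_def by simp
    have xy: "x < y" "y \<le> x + theta p" and xy': "x' < y'" "y' \<le> x' + theta p" using a a' unfolding arcs_iff by blast+
    have "isomorphic DD (SE p x' y') (SE p x y)"
      using eq SD.iso_class_eq_iff SE_gobs[OF short_okp[OF xy]] SE_gobs[OF short_okp[OF xy']] by simp
    then obtain s where s: "x' = tr s x" "y' = tr s y" using translate_if_isomorphic[OF xy' xy] by blast
    have "\<bar>of_int s\<bar> * theta p < 1 * theta p" using close(1) theta_pos unfolding s by (simp add: abs_mult)
    then have "\<bar>of_int s :: real\<bar> < 1" using theta_pos by simp
    then have "s = 0" by linarith
    then show ?thesis using s by simp
  qed
  then show ?thesis using e(1) theta_pos by (intro exI[of _ "min (e / 2) (theta p)"]) auto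
qed

lemma cluster_arc_system: assumes c: "cluster TYPE('k) u p CF L" shows "arc_system (theta p) (arcs L)"
proof
  show "0 < theta p" by (rule theta_pos)
  fix x y
  show "(x, y) \<in> arcs L \<Longrightarrow> x < y \<and> y \<le> x + theta p" unfolding arcs_iff by blast
  show "(x + of_int k * theta p, y + of_int k * theta p) \<in> arcs L" if a: "(x, y) \<in> arcs L" for k
  proof -
    obtain A where A: "x < y" "y \<le> x + theta p" "A \<in> L" "isomorphic DD A (SE p x y)" using a unfolding arcs_iff by blast
    then show ?thesis using SD.isomorphic_trans[OF A(4) SE_translate[OF short_okp[OF A(1,2)], of k]] unfolding arcs_iff by auto
  qed
  show "\<not> (x < x' \<and> x' < y \<and> y < y')" if "(x, y) \<in> arcs L" "(x', y') \<in> arcs L" for x' y'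
    using cluster_noncrossing[OF c that, of 0] unfolding cross_def by simp
  show "(x, y) \<in> arcs L" if "x < y" "y \<le> x + theta p"
    "\<And>x' y'. (x', y') \<in> arcs L \<Longrightarrow> \<not> (x < x' \<and> x' < y \<and> y < y') \<and> \<not> (x' < x \<and> x < y' \<and> y' < y)"
    by (rule cluster_maximal[OF c that(1,2)]) (use that(3) in \<open>unfold cross_def, blast\<close>)
  show "\<exists>e>0. \<forall>(x', y')\<in>arcs L. \<bar>x' - x\<bar> < e \<longrightarrow> \<bar>y' - y\<bar> < e \<longrightarrow> (x', y') = (x, y)" if "(x, y) \<in> arcs L"
    by (rule cluster_discrete[OF c that])
qed

theorem clusters_equivalent:
  assumes L: "cluster TYPE('k) u p CF L" and L': "cluster TYPE('k) u p CF L'"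
  shows "\<exists>g F0 F1. circle_homeo_lift p g \<and> strictly_triangulated_automorphism GG CG TT F0 F1 \<and>
    induced_by u p CF g F0 F1 \<and> (\<forall>A\<in>L. \<exists>B\<in>L'. isomorphic DD (F0 A) B) \<and> (\<forall>B\<in>L'. \<exists>A\<in>L. isomorphic DD (F0 A) B)"
proof -
  interpret X: two_arc_systems "theta p" "arcs L" "arcs L'"
    by (intro two_arc_systems.intro cluster_arc_system L L')
  obtain g where g: "strict_mono g" "surj g" and gt': "\<forall>x. g (x + theta p) = g x + theta p"
    and PQ': "\<forall>(x, y)\<in>arcs L. (g x, g y) \<in> arcs L'"
    and QP': "\<forall>(x, y)\<in>arcs L'. \<exists>(v, w)\<in>arcs L. g v = x \<and> g w = y"
    using X.arc_systems_equivalent by (elim exE conjE)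
  have gt: "g (x + theta p) = g x + theta p" for x using gt' by blast
  have PQ: "(x, y) \<in> arcs L \<Longrightarrow> (g x, g y) \<in> arcs L'" for x y using bspec[OF PQ', of "(x, y)"] by simp
  have QP: "(x, y) \<in> arcs L' \<Longrightarrow> \<exists>(v, w)\<in>arcs L. g v = x \<and> g w = y" for x y using bspec[OF QP', of "(x, y)"] by simp
  define h where "h = inv g"
  have inj: "inj g" using g(1) by (rule strict_mono_imp_inj_on)
  have hg: "h (g x) = x" for x unfolding h_def using inj by simp
  have gh: "g (h x) = x" for x unfolding h_def using g(2) by (simp add: surj_f_inv_f)
  have lt: "g x < g y \<longleftrightarrow> x < y" for x y using g(1) by (rule strict_mono_less)
  have h: "strict_mono h" unfolding strict_mono_def using lt gh by metis
  have ht: "h (x + theta p) = h x + theta p" for x using gt[of "h x"] gh hg by metis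
  \<comment> \<open>Iterating the step theta p times yields the period 2 pi of a lifted circle
    map.\<close>
  note gn = shift_iterate[of g, OF gt] and hn = shift_iterate[of h, OF ht]
  have lift: "lift_map g" "lift_map h" using g(1) h gn[of _ p] hn[of _ p] p_theta unfolding lift_map_def by simp_all
  interpret Y: gaut u CF p g h by unfold_locales (use lift hg gh gt ht in auto)
  have "continuous_on UNIV g" by (rule continuous_onI_mono) (use g in \<open>auto simp: strict_mono_less_eq\<close>)
  moreover have "continuous_on UNIV h"
  proof (rule continuous_onI_mono)
    have "surj h" using hg by (metis surjI)
    then show "open (range h)" by simp
  qed (use h in \<open>auto simp: strict_mono_less_eq\<close>)
  ultimately have "homeomorphism UNIV UNIV g h" by (intro homeomorphismI) (auto simp: hg gh)
  then have "circle_homeo_lift p g" unfolding circle_homeo_lift_def using gt by blast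
  moreover have img: "isomorphic DD (Y.A0 A) (SE p (g x) (g y))" if "(x, y) \<in> arcs L" "isomorphic DD A (SE p x y)" for A x y
  proof -
    have "okp x y" using that(1) short_okp unfolding arcs_iff by blast
    then show ?thesis using Y.A0_stable_isomorphic[of A "SE p x y"] that(2) Y.A0_SE unfolding CpiG_def by simp
  qed
  have "\<exists>B\<in>L'. isomorphic DD (Y.A0 A) B" if A: "A \<in> L" for A
  proof -
    obtain x y where a: "(x, y) \<in> arcs L" "isomorphic DD A (SE p x y)" by (rule cluster_arcE[OF L A])
    obtain B where B: "B \<in> L'" "isomorphic DD B (SE p (g x) (g y))" using PQ[OF a(1)] unfolding arcs_iff by blast
    then show ?thesis using SD.isomorphic_trans[OF img[OF a] SD.isomorphic_sym[OF B(2)]] by blast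
  qed
  moreover have "\<exists>A\<in>L. isomorphic DD (Y.A0 A) B" if B: "B \<in> L'" for B
  proof -
    obtain x y where b: "(x, y) \<in> arcs L'" "isomorphic DD B (SE p x y)" by (rule cluster_arcE[OF L' B])
    obtain v w where a: "(v, w) \<in> arcs L" "g v = x" "g w = y" using QP[OF b(1)] by blast
    obtain A where A: "A \<in> L" "isomorphic DD A (SE p v w)" using a(1) unfolding arcs_iff by blast
    then show ?thesis using SD.isomorphic_trans[OF img[OF a(1) A(2)]] SD.isomorphic_sym[OF b(2)] a by blast
  qed
  ultimately show ?thesis using Y.A_induced by blast
qed

end

text \<open>One suspension serves all pairs of clusters. The condition on the characteristic of K
  makes p a unit of R, which the averages over the group require.\<close>

theorem corollary3p5p4:
  fixes p :: nat and u :: "'r::idom" and res :: "'r \<Rightarrow> 'k::field"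
    and CF :: "('r fmor \<times> 'r fmor) set"
  assumes "prime p" and "odd p"
    and "dvr_uniformizer u" and "residue_map u res"
    and "CHAR('k) \<noteq> p" and "card {z :: 'k. z ^ p = 1} = p"
    and "Fpi_frobenius u CF"
  shows "\<exists>T. suspension (FpiG u p) (conflG u p CF) T \<and> normalized p T \<and>
    (\<forall>L L'. cluster TYPE('k) u p CF L \<and> cluster TYPE('k) u p CF L' \<longrightarrow>
      (\<exists>g F0 F1. circle_homeo_lift p g \<and>
        strictly_triangulated_automorphism (FpiG u p) (conflG u p CF) T F0 F1 \<and>
        induced_by u p CF g F0 F1 \<and>
        (\<forall>A\<in>L. \<exists>B\<in>L'. isomorphic (CpiG u p CF) (F0 A) B) \<and>
        (\<forall>B\<in>L'. \<exists>A\<in>L. isomorphic (CpiG u p CF) (F0 A) B)))"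
proof -
  have r: "res 1 = 1" "\<And>a b. res (a + b) = res a + res b" "\<And>a. res a = 0 \<longleftrightarrow> u dvd a"
    using assms(4) unfolding residue_map_def by blast+
  have "res (of_nat n) = of_nat n" for n
    by (induction n) (use r(1,2) r(3)[of 0] in simp_all)
  \<comment> \<open>The image of p in K is nonzero, so u does not divide p, and in a discrete
    valuation ring this makes p a unit.\<close>
  moreover have "(of_nat p :: 'k) \<noteq> 0"
  proof
    assume "(of_nat p :: 'k) = 0"
    then have "CHAR('k) dvd p" by (simp add: of_nat_eq_0_iff_char_dvd)
    then have "CHAR('k) = 1" using assms(1,5) by (metis prime_nat_iff)
    then show False by simp
  qed
  ultimately have "\<not> u dvd of_nat p" using r(3)[of "of_nat p"] by simp
  then have unit: "(of_nat p :: 'r) dvd 1" using assms(3) unfolding dvr_uniformizer_def by blast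
  have p3: "3 \<le> p" using prime_ge_2_nat[OF assms(1)] assms(2) by (cases "p = 2") auto
  interpret gfpi_residue u CF p res
    by unfold_locales (use assms unit p3 in auto)
  show ?thesis
    using TT_suspension TT_normalized clusters_equivalent unfolding CpiG_def by blast
qed

end
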